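(* Let $T>0$, let $\{\Omega_t\}_{t\in[0,T]}$ be nonempty, open, bounded subsets of $\mathbb{R}^N$ with Lipschitz boundary, $\mathcal{O}:=\bigcup_{t\in(0,T)}\{t\}\times\Omega_t$, $\Gamma:=\bigcup_{t\in(0,T)}\{t\}\times\partial\Omega_t$, $f\in L^2(\mathcal{O})$, $u_0\in H^1_0(\Omega_0)$, $u_1\in L^2(\Omega_0)$. Let $\Phi:[0,T]\times\overline{\Omega_0}\to\mathbb{R}^N$, $\Psi:\overline{\mathcal{O}}\to\overline{\Omega_0}$ be of class $C^{1,1}$ with $\Phi(t,\Omega_0)=\Omega_t$, $\Psi(t,\Omega_t)=\Omega_0$, $\Phi(t,\Psi(t,x))=x$ on $\overline{\mathcal{O}}$, $\Psi(t,\Phi(t,y))=y$ on $[0,T]\times\overline{\Omega_0}$, $\Phi(0,y)=y$. Then $u$ is a weak solution of $$\ddot u-\Delta u=f\ \text{in }\mathcal{O},\quad u=0\ \text{on }\Gamma,\quad u(0)=u_0,\ \dot u(0)=u_1$$ if and only if $v(t,y):=u(t,\Phi(t,y))$ is a weak solution of $$\ddot v-\operatorname{div}(B\nabla v)+a\cdot\nabla v-2b\cdot\nabla\dot v=g\ \text{in }(0,T)\times\Omega_0,\quad v=0\ \text{on }(0,T)\times\partial\Omega_0,\quad v(0)=v_0,\ \dot v(0)=v_1,$$ where $B(t,y):=D\Psi(t,\Phi(t,y))D\Psi(t,\Phi(t,y))^T-\dot\Psi(t,\Phi(t,y))\otimes\dot\Psi(t,\Phi(t,y))$, $b(t,y):=-\dot\Psi(t,\Phi(t,y))$,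 $a(t,y):=-\{B(t,y)^T\nabla\det D\Phi(t,y)+\partial_t[b(t,y)\det D\Phi(t,y)]\}\det D\Psi(t,\Phi(t,y))$, $g(t,y):=f(t,\Phi(t,y))$, $v_0:=u_0$, $v_1:=u_1+\dot\Phi(0,\cdot)\cdot\nabla u_0$.
   Context: Dots are time derivatives, $D$ spatial Jacobian, $\nabla$ spatial gradient; $v\in L^p(0,T;X_t)$ means $v(t)\in X_t$ for a.e. $t$ and $\|v(t)\|_{X_t}\in L^p(0,T)$; functions on $\overline{\mathcal{O}}$ are extended by $0$ outside. Weak solution of the $u$-problem: $u:\overline{\mathcal{O}}\to\mathbb{R}$ with (i) $u\in L^2(0,T;H^1_0(\Omega_t))$, $\dot u\in L^2(0,T;L^2(\Omega_t))$; (ii) $u|_{[0,T]\times\Omega_0}\in C^0([0,T];L^2(\Omega_0))$ and $\dot u|_{[0,\delta]\times\Omega'}\in C^0([0,\delta];H^{-1}(\Omega'))$ for every $\delta>0$ and open $\Omega'\subseteq\Omega_0$ with $[0,\delta]\times\Omega'\subseteq\mathcal{O}$, with $u(0)=u_0$, $\dot u(0)=u_1$; (iii) $-\int_0^T\langle\dot u,\dot\eta\rangle_{L^2(\Omega_t)}\mathrm{d}t+\int_0^T\langle\nabla u,\nabla\eta\rangle_{L^2(\Omega_t)}\mathrm{d}t=\int_0^T\langle f,\eta\rangle_{L^2(\Omega_t)}\mathrm{d}t$ for all $\eta\in L^2(0,T;H^1_0(\Omega_t))$ with $\dot\eta\in L^2(0,T;L^2(\Omega_t))$, $\eta(0)=\eta(T)=0$.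 Weak solution of the $v$-problem: $v$ with (i) $v\in L^2(0,T;H^1_0(\Omega_0))$, $\dot v\in L^2(0,T;L^2(\Omega_0))$; (ii) $v\in C^0([0,T];L^2(\Omega_0))$, $v(0)=v_0$, $\dot v\in C^0([0,T];H^{-1}(\Omega_0))$, $\dot v(0)=v_1$; (iii) $-\int_0^T\langle\dot v,\dot\xi\rangle+\int_0^T\langle B\nabla v,\nabla\xi\rangle+\int_0^T\langle a\cdot\nabla v,\xi\rangle+2\int_0^T\langle\dot v,\operatorname{div}(b\xi)\rangle=\int_0^T\langle g,\xi\rangle$ (all $L^2(\Omega_0)$ products integrated in time) for every $\xi\in L^2(0,T;H^1_0(\Omega_0))\cap H^1_0(0,T;L^2(\Omega_0))$.
   Formalization: In the definition of weak solution of the u-problem, the condition [0,δ]×Ω'⊆𝒪 is read with 𝒪 taken over the closed interval t∈[0,T]; with t∈(0,T) it never holds for nonempty Ω', and the condition u̇(0)=u_1 would be void. *)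

theory Defs
  imports "HOL-Analysis.Analysis"
begin

text \<open>Functions are total; a function on a set S is read through its extension by 0
  (all integrals carry the indicator of S).\<close>

definition L2 :: "'a::euclidean_space set \<Rightarrow> ('a \<Rightarrow> real) \<Rightarrow> bool" where
  "L2 S w \<longleftrightarrow> (\<lambda>x. indicator S x * w x) \<in> borel_measurable lebesgue \<and>
                integrable lebesgue (\<lambda>x. (indicator S x * w x)\<^sup>2)"

definition l2ip :: "'a::euclidean_space set \<Rightarrow> ('a \<Rightarrow> real) \<Rightarrow> ('a \<Rightarrow> real) \<Rightarrow> real" where
  "l2ip S w z = (\<integral>x. indicator S x * w x * z x \<partial>lebesgue)"

definition l2norm :: "'a::euclidean_space set \<Rightarrow> ('a \<Rightarrow> real) \<Rightarrow> real" where
  "l2norm S w = sqrt (\<integral>x. indicator S x * (w x)\<^sup>2 \<partial>lebesgue)"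

definition pd :: "('a::euclidean_space \<Rightarrow> real) \<Rightarrow> 'a \<Rightarrow> 'a \<Rightarrow> real" where
  "pd f e x = frechet_derivative f (at x) e"

definition test_fun :: "'a::euclidean_space set \<Rightarrow> ('a \<Rightarrow> real) \<Rightarrow> bool" where
  "test_fun S \<phi> \<longleftrightarrow> (\<forall>x. \<phi> differentiable (at x)) \<and>
     (\<forall>e. continuous_on UNIV (pd \<phi> e)) \<and>
     compact (closure {x. \<phi> x \<noteq> 0}) \<and> closure {x. \<phi> x \<noteq> 0} \<subseteq> S"

definition weak_dir_deriv :: "'a::euclidean_space set \<Rightarrow> ('a \<Rightarrow> real) \<Rightarrow> 'a \<Rightarrow> ('a \<Rightarrow> real) \<Rightarrow> bool" where
  "weak_dir_deriv S w e h \<longleftrightarrow> (\<forall>\<phi>. test_fun S \<phi> \<longrightarrow>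
      (\<integral>x. indicator S x * w x * pd \<phi> e x \<partial>lebesgue) = - (\<integral>x. indicator S x * h x * \<phi> x \<partial>lebesgue))"

definition cgrad :: "(real^'n \<Rightarrow> real) \<Rightarrow> real^'n \<Rightarrow> real^'n" where
  "cgrad \<phi> x = (\<chi> i. pd \<phi> (axis i 1) x)"

definition is_wgrad :: "(real^'n) set \<Rightarrow> (real^'n \<Rightarrow> real) \<Rightarrow> (real^'n \<Rightarrow> real^'n) \<Rightarrow> bool" where
  "is_wgrad S w G \<longleftrightarrow> (\<forall>i. L2 S (\<lambda>x. G x $ i) \<and> weak_dir_deriv S w (axis i 1) (\<lambda>x. G x $ i))"

definition wgrad :: "(real^'n) set \<Rightarrow> (real^'n \<Rightarrow> real) \<Rightarrow> real^'n \<Rightarrow> real^'n" where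
  "wgrad S w = (SOME G. is_wgrad S w G)"

definition H1 :: "(real^'n) set \<Rightarrow> (real^'n \<Rightarrow> real) \<Rightarrow> bool" where
  "H1 S w \<longleftrightarrow> L2 S w \<and> (\<exists>G. is_wgrad S w G)"

definition H1norm :: "(real^'n) set \<Rightarrow> (real^'n \<Rightarrow> real) \<Rightarrow> real" where
  "H1norm S w = sqrt ((l2norm S w)\<^sup>2 + (\<Sum>i\<in>UNIV. (l2norm S (\<lambda>x. wgrad S w x $ i))\<^sup>2))"

definition H10 :: "(real^'n) set \<Rightarrow> (real^'n \<Rightarrow> real) \<Rightarrow> bool" where
  "H10 S w \<longleftrightarrow> H1 S w \<and> (\<exists>\<phi>::nat \<Rightarrow> real^'n \<Rightarrow> real. (\<forall>k. test_fun S (\<phi> k)) \<and>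
       (\<lambda>k. H1norm S (\<lambda>x. \<phi> k x - w x)) \<longlonglongrightarrow> 0)"

definition wdiv :: "(real^'n) set \<Rightarrow> (real^'n \<Rightarrow> real^'n) \<Rightarrow> real^'n \<Rightarrow> real" where
  "wdiv S F = (SOME h. L2 S h \<and> (\<forall>\<phi>. test_fun S \<phi> \<longrightarrow>
      (\<integral>x. indicator S x * (F x \<bullet> cgrad \<phi> x) \<partial>lebesgue) = - (\<integral>x. indicator S x * h x * \<phi> x \<partial>lebesgue)))"

definition slice :: "(real \<times> 'b \<Rightarrow> real) \<Rightarrow> real \<Rightarrow> 'b \<Rightarrow> real" where
  "slice u t = (\<lambda>x. u (t, x))"

definition tdomain :: "real \<Rightarrow> (real \<Rightarrow> (real^'n) set) \<Rightarrow> (real \<times> (real^'n)) set" where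
  "tdomain T \<Omega> = {(t, x). t \<in> {0<..<T} \<and> x \<in> \<Omega> t}"

definition tdomain_cl :: "real \<Rightarrow> (real \<Rightarrow> (real^'n) set) \<Rightarrow> (real \<times> (real^'n)) set" where
  "tdomain_cl T \<Omega> = {(t, x). t \<in> {0..T} \<and> x \<in> \<Omega> t}"

definition L2_H10 :: "real \<Rightarrow> (real \<Rightarrow> (real^'n) set) \<Rightarrow> (real \<times> (real^'n) \<Rightarrow> real) \<Rightarrow> bool" where
  "L2_H10 T \<Omega> u \<longleftrightarrow> L2 (tdomain T \<Omega>) u \<and>
     (AE t in lebesgue. t \<in> {0<..<T} \<longrightarrow> H10 (\<Omega> t) (slice u t)) \<and>
     L2 {0<..<T} (\<lambda>t. H1norm (\<Omega> t) (slice u t))"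

definition L2_L2 :: "real \<Rightarrow> (real \<Rightarrow> (real^'n) set) \<Rightarrow> (real \<times> (real^'n) \<Rightarrow> real) \<Rightarrow> bool" where
  "L2_L2 T \<Omega> w \<longleftrightarrow> L2 (tdomain T \<Omega>) w \<and>
     (AE t in lebesgue. t \<in> {0<..<T} \<longrightarrow> L2 (\<Omega> t) (slice w t)) \<and>
     L2 {0<..<T} (\<lambda>t. l2norm (\<Omega> t) (slice w t))"

definition is_tderiv :: "real \<Rightarrow> (real \<Rightarrow> (real^'n) set) \<Rightarrow> (real \<times> (real^'n) \<Rightarrow> real) \<Rightarrow> (real \<times> (real^'n) \<Rightarrow> real) \<Rightarrow> bool" where
  "is_tderiv T \<Omega> u w \<longleftrightarrow> weak_dir_deriv (tdomain T \<Omega>) u (1, 0) w \<and> L2_L2 T \<Omega> w"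

definition tderiv :: "real \<Rightarrow> (real \<Rightarrow> (real^'n) set) \<Rightarrow> (real \<times> (real^'n) \<Rightarrow> real) \<Rightarrow> real \<times> (real^'n) \<Rightarrow> real" where
  "tderiv T \<Omega> u = (SOME w. is_tderiv T \<Omega> u w)"

definition L2_cont :: "real \<Rightarrow> (real^'n) set \<Rightarrow> (real \<times> (real^'n) \<Rightarrow> real) \<Rightarrow> (real^'n \<Rightarrow> real) \<Rightarrow> bool" where
  "L2_cont T S u u0 \<longleftrightarrow> (\<exists>U :: real \<Rightarrow> real^'n \<Rightarrow> real.
      (\<forall>t\<in>{0..T}. L2 S (U t)) \<and>
      (\<forall>t\<in>{0..T}. ((\<lambda>s. l2norm S (\<lambda>x. U s x - U t x)) \<longlongrightarrow> 0) (at t within {0..T})) \<and>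
      (AE t in lebesgue. t \<in> {0..T} \<longrightarrow> (AE x in lebesgue. x \<in> S \<longrightarrow> U t x = u (t, x))) \<and>
      (AE x in lebesgue. x \<in> S \<longrightarrow> U 0 x = u0 x))"

text \<open>Restriction of w to [0,delta] x S lies in C^0([0,delta];H^{-1}(S)) with value w1 at 0.
  Elements of H^{-1}(S) are represented by their action on test functions (dense in H^1_0(S)),
  bounded w.r.t. the H^1 norm.\<close>
definition Hm1_cont :: "real \<Rightarrow> (real^'n) set \<Rightarrow> (real \<times> (real^'n) \<Rightarrow> real) \<Rightarrow> (real^'n \<Rightarrow> real) \<Rightarrow> bool" where
  "Hm1_cont \<delta> S w w1 \<longleftrightarrow> (\<exists>lf :: real \<Rightarrow> (real^'n \<Rightarrow> real) \<Rightarrow> real.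
      (\<forall>t\<in>{0..\<delta>}. \<exists>C. \<forall>\<phi>. test_fun S \<phi> \<longrightarrow> \<bar>lf t \<phi>\<bar> \<le> C * H1norm S \<phi>) \<and>
      (\<forall>t\<in>{0..\<delta>}. \<forall>\<epsilon>>0. \<exists>d>0. \<forall>s\<in>{0..\<delta>}. \<bar>s - t\<bar> < d \<longrightarrow>
          (\<forall>\<phi>. test_fun S \<phi> \<longrightarrow> \<bar>lf s \<phi> - lf t \<phi>\<bar> \<le> \<epsilon> * H1norm S \<phi>)) \<and>
      (AE t in lebesgue. t \<in> {0..\<delta>} \<longrightarrow> (\<forall>\<phi>. test_fun S \<phi> \<longrightarrow> lf t \<phi> = l2ip S (slice w t) \<phi>)) \<and>
      (\<forall>\<phi>. test_fun S \<phi> \<longrightarrow> lf 0 \<phi> = l2ip S w1 \<phi>))"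

definition vanish_ends :: "real \<Rightarrow> (real \<Rightarrow> (real^'n) set) \<Rightarrow> (real \<times> (real^'n) \<Rightarrow> real) \<Rightarrow> bool" where
  "vanish_ends T \<Omega> \<eta> \<longleftrightarrow> (\<forall>\<epsilon>>0. \<exists>d>0. AE t in lebesgue.
      t \<in> {0<..<d} \<union> {T - d<..<T} \<longrightarrow> l2norm (\<Omega> t) (slice \<eta> t) < \<epsilon>)"

definition admissible :: "real \<Rightarrow> (real \<Rightarrow> (real^'n) set) \<Rightarrow> (real \<times> (real^'n) \<Rightarrow> real) \<Rightarrow> bool" where
  "admissible T \<Omega> \<eta> \<longleftrightarrow> L2_H10 T \<Omega> \<eta> \<and> (\<exists>w. is_tderiv T \<Omega> \<eta> w) \<and> vanish_ends T \<Omega> \<eta>"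

definition tint :: "real \<Rightarrow> (real \<Rightarrow> real) \<Rightarrow> real" where
  "tint T F = (\<integral>t. indicator {0<..<T} t * F t \<partial>lebesgue)"

definition wsol_u :: "real \<Rightarrow> (real \<Rightarrow> (real^'n) set) \<Rightarrow> (real \<times> (real^'n) \<Rightarrow> real)
    \<Rightarrow> (real^'n \<Rightarrow> real) \<Rightarrow> (real^'n \<Rightarrow> real) \<Rightarrow> (real \<times> (real^'n) \<Rightarrow> real) \<Rightarrow> bool" where
  "wsol_u T \<Omega> f u0 u1 u \<longleftrightarrow>
     L2_H10 T \<Omega> u \<and> (\<exists>w. is_tderiv T \<Omega> u w) \<and>
     L2_cont T (\<Omega> 0) u u0 \<and>
     (\<forall>\<delta> \<Omega>'. \<delta> > 0 \<longrightarrow> open \<Omega>' \<longrightarrow> \<Omega>' \<subseteq> \<Omega> 0 \<longrightarrow> {0..\<delta>} \<times> \<Omega>' \<subseteq> tdomain_cl T \<Omega> \<longrightarrow>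
        Hm1_cont \<delta> \<Omega>' (tderiv T \<Omega> u) u1) \<and>
     (\<forall>\<eta>. admissible T \<Omega> \<eta> \<longrightarrow>
        - tint T (\<lambda>t. l2ip (\<Omega> t) (slice (tderiv T \<Omega> u) t) (slice (tderiv T \<Omega> \<eta>) t))
        + tint T (\<lambda>t. \<integral>x. indicator (\<Omega> t) x *
              (wgrad (\<Omega> t) (slice u t) x \<bullet> wgrad (\<Omega> t) (slice \<eta> t) x) \<partial>lebesgue)
        = tint T (\<lambda>t. l2ip (\<Omega> t) (slice f t) (slice \<eta> t)))"

definition wsol_v :: "real \<Rightarrow> (real^'n) set \<Rightarrow> (real \<times> (real^'n) \<Rightarrow> real^'n^'n)
    \<Rightarrow> (real \<times> (real^'n) \<Rightarrow> real^'n) \<Rightarrow> (real \<times> (real^'n) \<Rightarrow> real^'n) \<Rightarrow> (real \<times> (real^'n) \<Rightarrow> real)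
    \<Rightarrow> (real^'n \<Rightarrow> real) \<Rightarrow> (real^'n \<Rightarrow> real) \<Rightarrow> (real \<times> (real^'n) \<Rightarrow> real) \<Rightarrow> bool" where
  "wsol_v T \<Omega>0 B a b g v0 v1 v \<longleftrightarrow>
     L2_H10 T (\<lambda>_. \<Omega>0) v \<and> (\<exists>w. is_tderiv T (\<lambda>_. \<Omega>0) v w) \<and>
     L2_cont T \<Omega>0 v v0 \<and>
     Hm1_cont T \<Omega>0 (tderiv T (\<lambda>_. \<Omega>0) v) v1 \<and>
     (\<forall>\<xi>. admissible T (\<lambda>_. \<Omega>0) \<xi> \<longrightarrow>
        - tint T (\<lambda>t. l2ip \<Omega>0 (slice (tderiv T (\<lambda>_. \<Omega>0) v) t) (slice (tderiv T (\<lambda>_. \<Omega>0) \<xi>) t))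
        + tint T (\<lambda>t. \<integral>y. indicator \<Omega>0 y *
              ((B (t, y) *v wgrad \<Omega>0 (slice v t) y) \<bullet> wgrad \<Omega>0 (slice \<xi> t) y) \<partial>lebesgue)
        + tint T (\<lambda>t. \<integral>y. indicator \<Omega>0 y *
              ((a (t, y) \<bullet> wgrad \<Omega>0 (slice v t) y) * \<xi> (t, y)) \<partial>lebesgue)
        + 2 * tint T (\<lambda>t. l2ip \<Omega>0 (slice (tderiv T (\<lambda>_. \<Omega>0) v) t)
                           (wdiv \<Omega>0 (\<lambda>y. \<xi> (t, y) *\<^sub>R b (t, y))))
        = tint T (\<lambda>t. l2ip \<Omega>0 (slice g t) (slice \<xi> t)))"

definition lipschitz_boundary :: "(real^'n) set \<Rightarrow> bool" where
  "lipschitz_boundary \<Omega> \<longleftrightarrow> (\<forall>p\<in>frontier \<Omega>. \<exists>r>0. \<exists>R::real^'n^'n. \<exists>k. \<exists>\<gamma>::real^'n \<Rightarrow> real. \<exists>L.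
      orthogonal_matrix R \<and>
      (\<forall>x y. \<bar>\<gamma> x - \<gamma> y\<bar> \<le> L * norm (x - y)) \<and>
      (\<forall>x. \<gamma> x = \<gamma> (\<chi> i. if i = k then 0 else x $ i)) \<and>
      (\<forall>x\<in>ball p r. x \<in> \<Omega> \<longleftrightarrow> (R *v x) $ k < \<gamma> (R *v x)))"

definition C11_on :: "(real \<times> (real^'n)) set \<Rightarrow> (real \<times> (real^'n) \<Rightarrow> real^'n) \<Rightarrow> bool" where
  "C11_on S F \<longleftrightarrow> (\<forall>z\<in>S. F differentiable (at z within S)) \<and>
     (\<exists>L. \<forall>z\<in>S. \<forall>z'\<in>S. onorm (\<lambda>h. frechet_derivative F (at z within S) h
                                   - frechet_derivative F (at z' within S) h) \<le> L * dist z z')"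

definition tdot :: "(real \<times> (real^'n)) set \<Rightarrow> (real \<times> (real^'n) \<Rightarrow> real^'n) \<Rightarrow> real \<times> (real^'n) \<Rightarrow> real^'n" where
  "tdot S F z = frechet_derivative F (at z within S) (1, 0)"

definition Dx :: "(real \<times> (real^'n)) set \<Rightarrow> (real \<times> (real^'n) \<Rightarrow> real^'n) \<Rightarrow> real \<times> (real^'n) \<Rightarrow> real^'n^'n" where
  "Dx S F z = matrix (\<lambda>h. frechet_derivative F (at z within S) (0, h))"

definition outer :: "real^'n \<Rightarrow> real^'n \<Rightarrow> real^'n^'n" where
  "outer p q = (\<chi> i j. p $ i * q $ j)"

definition domPhi :: "real \<Rightarrow> (real \<Rightarrow> (real^'n) set) \<Rightarrow> (real \<times> (real^'n)) set" where
  "domPhi T \<Omega> = {0..T} \<times> closure (\<Omega> 0)"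

definition domPsi :: "real \<Rightarrow> (real \<Rightarrow> (real^'n) set) \<Rightarrow> (real \<times> (real^'n)) set" where
  "domPsi T \<Omega> = closure (tdomain T \<Omega>)"

definition coefB where
  "coefB T \<Omega> \<Phi> \<Psi> z = (let x = (fst z, \<Phi> z); M = Dx (domPsi T \<Omega>) \<Psi> x; p = tdot (domPsi T \<Omega>) \<Psi> x
      in M ** transpose M - outer p p)"

definition coefb where
  "coefb T \<Omega> \<Phi> \<Psi> z = - tdot (domPsi T \<Omega>) \<Psi> (fst z, \<Phi> z)"

definition detDPhi where
  "detDPhi T \<Omega> \<Phi> z = det (Dx (domPhi T \<Omega>) \<Phi> z)"

text \<open>a = -(B^T grad det D Phi + d/dt[b det D Phi]) det D Psi(t, Phi(t,y)); the derivatives of the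
  Lipschitz functions involved are the classical ones (existing a.e. by Rademacher).\<close>
definition coefa where
  "coefa T \<Omega> \<Phi> \<Psi> z =
     (det (Dx (domPsi T \<Omega>) \<Psi> (fst z, \<Phi> z))) *\<^sub>R (- (transpose (coefB T \<Omega> \<Phi> \<Psi> z) *v
           (\<chi> i. frechet_derivative (detDPhi T \<Omega> \<Phi>) (at z) (0, axis i 1))
         + frechet_derivative (\<lambda>w. detDPhi T \<Omega> \<Phi> w *\<^sub>R coefb T \<Omega> \<Phi> \<Psi> w) (at z) (1, 0)))"

end

theory Submission
  imports Defs
begin

text \<open>Composition with the flow is an isomorphism of the energy spaces, so it remains to match the weak
equations and the initial values. Tested with \<open>w \<circ> \<Psi>\<close> and with \<open>det (D\<Phi>) * w\<close>, the two weak forms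
differ, by Euler's identity for the Jacobian, by commutators of time and space derivatives, and these
vanish if \<open>w\<close> vanishes at both ends of the time interval. The initial values are compared through the
limits at time zero of the pairings with transported test functions; the correction of the initial
velocity is the contribution of the convective part \<open>- b \<bullet> \<nabla>v\<close> of the pulled back time derivative.\<close>

notation (ASCII)
 iff (infixr "<->" 25) and tendsto (infixr "--->" 55) and LIMSEQ ("((_)/ ----> (_))" [60, 60] 60)
 and scaleR (infixr "*R" 75) and inner (infix "<.>" 70)

hide_fact (open) Henstock_Kurzweil_Integration.integrable_add Henstock_Kurzweil_Integration.integrable_diff
 Henstock_Kurzweil_Integration.integrable_bound Henstock_Kurzweil_Integration.integrable_sum Henstock_Kurzweil_Integration.integral_add
 Henstock_Kurzweil_Integration.integral_cong Henstock_Kurzweil_Integration.integral_diff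
 Henstock_Kurzweil_Integration.integral_sum

abbreviation ev_seq (binder "EV " 10) where "EV k. P k == eventually P sequentially"

abbreviation lint :: "('a::euclidean_space => 'b::{banach, second_countable_topology}) => 'b" (binder "LINT " 60) where
 "LINT x. f x == integral\<^sup>L lebesgue f"

abbreviation leb :: "'a::euclidean_space set => 'a measure" where "leb S == lebesgue_on S"

definition sq_integrable :: "'a measure => ('a => real) => bool" where
 "sq_integrable M f <-> f : borel_measurable M & integrable M (%x. (f x)^2)"

abbreviation int_on :: "'a::euclidean_space set => ('a => real) => real" where "int_on S f == integral\<^sup>L (leb S) f"

abbreviation L1_on :: "'a::euclidean_space set => ('a => real) => bool" where "L1_on S f == integrable (leb S) f"

abbreviation L2_on :: "'a::euclidean_space set => ('a => real) => bool" where "L2_on S f == sq_integrable (leb S) f"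

abbreviation ip :: "'a::euclidean_space set => ('a => real) => ('a => real) => real" where "ip S f g == int_on S (%x. f x * g x)"

abbreviation sqnorm :: "'a::euclidean_space set => ('a => real) => real" where "sqnorm S f == int_on S (%x. (f x)^2)"

abbreviation (input) sect :: "('b * 'c => 'd) => 'b => 'c => 'd" where "sect f t == %x. f (t, x)"

lemma L2_measurable: "sq_integrable M f ==> f : borel_measurable M"
 and L2_square_integrable: "sq_integrable M f ==> integrable M (%x. (f x)^2)" by (auto simp: sq_integrable_def)

lemma L2_zero [simp]: "sq_integrable M (%x. 0)" by (simp add: sq_integrable_def)

lemma L2_mult:
 assumes "sq_integrable M f" "sq_integrable M g"
 shows "integrable M (%x. f x * g x)"
proof (rule integrable_bound)
 show "integrable M (%x. (f x)^2 + (g x)^2)" "(%x. f x * g x) : borel_measurable M" using assms by (auto simp: sq_integrable_def)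
 have "abs (a * b) <= a^2 + b^2" for a b :: real
  using sum_squares_bound[of "abs a" "abs b"] mult_nonneg_nonneg[of "abs a" "abs b"]
  unfolding abs_mult power2_abs by linarith
 thus "AE x in M. norm (f x * g x) <= norm ((f x)^2 + (g x)^2)" by auto
qed

lemma L2_bound:
 assumes "sq_integrable M f" "g : borel_measurable M" "AE x in M. abs (g x) <= C * abs (f x)"
 shows "sq_integrable M g"
proof -
 have "integrable M (%x. (g x)^2)"
 proof (rule integrable_bound)
  show "integrable M (%x. C^2 * (f x)^2)" using assms by (auto simp: sq_integrable_def)
  show "AE x in M. norm ((g x)^2) <= norm (C^2 * (f x)^2)" using assms(3)
  proof eventually_elim
   case (elim x)
   from power_mono[OF this, of 2] show ?case by (simp add: power_mult_distrib)
  qed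
 qed (use assms in measurable)
 with assms show ?thesis by (simp add: sq_integrable_def)
qed

lemma L2_cmult: "sq_integrable M f ==> sq_integrable M (%x. c * f x)"
 by (rule L2_bound[where C = "abs c"]) (auto simp: sq_integrable_def abs_mult)

lemma L2_bounded_mult:
 assumes "sq_integrable M f" "g : borel_measurable M" "AE x in M. abs (g x) <= C"
 shows "sq_integrable M (%x. g x * f x)"
proof (rule L2_bound[OF assms(1)])
 show "AE x in M. abs (g x * f x) <= C * abs (f x)"
  using assms(3) by eventually_elim (simp add: abs_mult mult_right_mono)
qed (use assms in "auto simp: sq_integrable_def")

lemma L2_add: "sq_integrable M f ==> sq_integrable M g ==> sq_integrable M (%x. f x + g x)"
 using L2_mult[of M f g] by (auto simp: sq_integrable_def power2_sum mult.assoc)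

lemma L2_minus: "sq_integrable M f ==> sq_integrable M (%x. - f x)" using L2_cmult[of M f "-1"] by simp

lemma L2_diff: "sq_integrable M f ==> sq_integrable M g ==> sq_integrable M (%x. f x - g x)"
 using L2_add[OF _ L2_minus, of M f g] by simp

lemma L2_sum: "(!!i. i:I ==> sq_integrable M (f i)) ==> sq_integrable M (%x. SUM i:I. f i x)"
 by (induction I rule: infinite_finite_induct) (auto intro: L2_add)

lemma (in finite_measure) L2_const: "sq_integrable M (%x. c)" by (simp add: sq_integrable_def)

lemma (in finite_measure) L2_imp_integrable: "sq_integrable M f ==> integrable M f"
 using L2_mult[of M f "%_. 1"] L2_const[of 1] by simp

lemma (in finite_measure) L2_bounded: "f : borel_measurable M ==> AE x in M. abs (f x) <= C ==> sq_integrable M f"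
 using L2_bounded_mult[OF L2_const[of 1]] by simp

lemma Cauchy_Schwarz_integral:
 assumes "sq_integrable M f" "sq_integrable M g"
 shows "(LINT x|M. f x * g x)^2 <= (LINT x|M. (f x)^2) * (LINT x|M. (g x)^2)"
proof -
 note [measurable] = assms[THEN L2_measurable]
 have "ennreal ((LINT x|M. abs (f x * g x))^2) = (nn_integral M (%x. ennreal (abs (f x)) * ennreal (abs (g x))))^2"
  using L2_mult[OF assms] by (simp add: nn_integral_eq_integral ennreal_power ennreal_mult'[symmetric] abs_mult[symmetric])
 also have "... <= (nn_integral M (%x. ennreal (abs (f x))^2)) * (nn_integral M (%x. ennreal (abs (g x))^2))"
  by (rule Cauchy_Schwarz_nn_integral) measurable
 also have "... = ennreal ((LINT x|M. (f x)^2) * (LINT x|M. (g x)^2))" using assms[THEN L2_square_integrable]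
  by (simp add: nn_integral_eq_integral ennreal_power ennreal_mult)
 finally have "(LINT x|M. abs (f x * g x))^2 <= (LINT x|M. (f x)^2) * (LINT x|M. (g x)^2)"
  by (subst (asm) ennreal_le_iff) auto
 moreover have "(LINT x|M. f x * g x)^2 <= (LINT x|M. abs (f x * g x))^2"
  unfolding abs_le_square_iff[symmetric] using integral_abs_bound[of M "%x. f x * g x"] by simp
 ultimately show ?thesis by linarith
qed

lemma Cauchy_Schwarz_integral_sqrt:
 assumes "sq_integrable M f" "sq_integrable M g"
 shows "abs (LINT x|M. f x * g x) <= sqrt (LINT x|M. (f x)^2) * sqrt (LINT x|M. (g x)^2)"
 using real_sqrt_le_mono[OF Cauchy_Schwarz_integral[OF assms]] by (simp add: real_sqrt_mult)

lemma integral_square_add_le: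
 assumes "sq_integrable M f" "sq_integrable M g"
 shows "(LINT x|M. (f x + g x)^2) <= 2 * (LINT x|M. (f x)^2) + 2 * (LINT x|M. (g x)^2)"
proof -
 note squares = assms[THEN L2_square_integrable]
 have "(LINT x|M. (f x + g x)^2) <= (LINT x|M. 2 * (f x)^2 + 2 * (g x)^2)"
 proof (rule integral_mono)
  show "(f x + g x)^2 <= 2 * (f x)^2 + 2 * (g x)^2" for x
   using zero_le_power2[of "f x - g x"] by (simp add: power2_diff power2_sum)
 qed (use squares L2_square_integrable[OF L2_add[OF assms]] in simp_all)
 thus ?thesis using squares by simp
qed

definition L2_tendsto :: "'a measure => (nat => 'a => real) => ('a => real) => bool" where
 "L2_tendsto M F f <-> (%k. LINT x|M. (F k x - f x)^2) ----> 0"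

lemma L2_strong_imp_weak_tendsto:
 assumes f: "eventually (%t. sq_integrable M (f t)) F" "sq_integrable M f0"
  and lim: "((%t. LINT x|M. (f t x - f0 x)^2) ---> 0) F" and g: "sq_integrable M g"
 shows "((%t. LINT x|M. f t x * g x) ---> (LINT x|M. f0 x * g x)) F"
proof (rule LIM_zero_cancel, rule Lim_null_comparison)
 show "eventually (%t. norm ((LINT x|M. f t x * g x) - (LINT x|M. f0 x * g x)) <=
   sqrt (LINT x|M. (f t x - f0 x)^2) * sqrt (LINT x|M. (g x)^2)) F" using f(1)
 proof eventually_elim
  case (elim t)
  have "(LINT x|M. f t x * g x) - (LINT x|M. f0 x * g x) = (LINT x|M. (f t x - f0 x) * g x)"
   using L2_mult[OF elim g] L2_mult[OF f(2) g] by (simp add: left_diff_distrib)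
  thus ?case using Cauchy_Schwarz_integral_sqrt[OF L2_diff[OF elim f(2)] g] by simp
 qed
 show "((%t. sqrt (LINT x|M. (f t x - f0 x)^2) * sqrt (LINT x|M. (g x)^2)) ---> 0) F"
  using tendsto_mult_left_zero[OF tendsto_real_sqrt[OF lim, simplified]] .
qed

lemma L2_tendsto_integral_mult:
 assumes F: "!!k. sq_integrable M (F k)" and f: "sq_integrable M f" and g: "sq_integrable M g" and lim: "L2_tendsto M F f"
 shows "(%k. LINT x|M. F k x * g x) ----> (LINT x|M. f x * g x)"
 by (rule L2_strong_imp_weak_tendsto[OF always_eventually f lim[unfolded L2_tendsto_def] g]) (simp add: F)

text \<open>Scheffe's lemma for \<open>F k * abs (F k)\<close>, whose absolute value is \<open>(F k)\<^sup>2\<close>.\<close>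

lemma L2_tendsto_if_AE_tendsto:
 assumes F: "!!k. sq_integrable M (F k)" and f: "sq_integrable M f"
  and pointwise: "AE x in M. (%k. F k x) ----> f x"
  and norms: "!!k. (LINT x|M. (F k x)^2) <= (LINT x|M. (f x)^2)"
 shows "L2_tendsto M F f"
proof -
 define sgn_sq where "sgn_sq r = r * abs r" for r :: real
 have norm_sgn_sq: "norm (sgn_sq r) = r^2" for r
  by (simp add: sgn_sq_def abs_mult power2_eq_square)
 have sgn_sq_integrable: "integrable M (%x. sgn_sq (g x))" if g: "sq_integrable M g" for g
 proof (rule integrable_bound[OF L2_square_integrable[OF g]])
  show "(%x. sgn_sq (g x)) : borel_measurable M"
   unfolding sgn_sq_def using L2_measurable[OF g] by measurable
 qed (simp add: norm_sgn_sq[unfolded real_norm_def])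
 note diff_integrable = integrable_diff[OF sgn_sq_integrable[OF F]
   sgn_sq_integrable[OF f]]
 have "(%k. nn_integral M (%x. norm (sgn_sq (F k x) - sgn_sq (f x)))) ----> 0"
 proof (rule Scheffe_lemma1[OF sgn_sq_integrable[OF F] sgn_sq_integrable[OF f]])
  show "AE x in M. (%k. sgn_sq (F k x)) ----> sgn_sq (f x)"
   using pointwise unfolding sgn_sq_def by eventually_elim (intro tendsto_intros)
  show "limsup (%k. nn_integral M (%x. norm (sgn_sq (F k x)))) <= nn_integral M (%x. norm (sgn_sq (f x)))"
   unfolding norm_sgn_sq using norms L2_square_integrable[OF F] L2_square_integrable[OF f]
   by (intro Limsup_bounded always_eventually) (simp add: nn_integral_eq_integral ennreal_leI)
 qed
 hence "(%k. LINT x|M. abs (sgn_sq (F k x) - sgn_sq (f x))) ----> 0"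
  using diff_integrable by (simp add: nn_integral_eq_integral ennreal_tendsto_0_iff)
 hence lim: "(%k. 2 * (LINT x|M. abs (sgn_sq (F k x) - sgn_sq (f x)))) ----> 0"
  by (rule tendsto_mult_right_zero)
 have square_diff_le: "(a - b)^2 <= 2 * abs (sgn_sq a - sgn_sq b)" for a b
 proof (cases "0 <= a <-> 0 <= b")
  case True
  hence "abs (sgn_sq a - sgn_sq b) = abs (a - b) * abs (a + b)" "abs (a - b) <= abs (a + b)"
   by (auto simp: sgn_sq_def abs_mult[symmetric] algebra_simps)
  with mult_left_mono[of "abs (a - b)" "abs (a + b)" "abs (a - b)"] show ?thesis
   by (simp add: power2_eq_square abs_mult_self_eq)
 next
  case False
  hence "abs (sgn_sq a - sgn_sq b) = a^2 + b^2" by (auto simp: sgn_sq_def power2_eq_square)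
  with sum_squares_bound[of a "- b"] show ?thesis by (simp add: power2_diff)
 qed
 have "(LINT x|M. (F k x - f x)^2) <= (LINT x|M. 2 * abs (sgn_sq (F k x) - sgn_sq (f x)))" for k
  using L2_square_integrable[OF L2_diff[OF F f]] diff_integrable square_diff_le
  by (intro integral_mono) auto
 thus ?thesis
  unfolding L2_tendsto_def by (intro tendsto_sandwich[OF _ _ tendsto_const lim]) auto
qed

lemma lebesgue_cong_AE:
 fixes f g :: "'a::euclidean_space => real"
 assumes ae: "AE x in lebesgue. f x = g x"
 shows "f : borel_measurable lebesgue <-> g : borel_measurable lebesgue"
  and "integrable lebesgue f <-> integrable lebesgue g"
  and "(LINT x. f x) = (LINT x. g x)"
proof -
 have ae': "AE x in lebesgue. g x = f x" using ae by (rule eventually_mono) (rule sym)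
 show meas: "f : borel_measurable lebesgue <-> g : borel_measurable lebesgue"
  using borel_measurable_AE[OF _ ae] borel_measurable_AE[OF _ ae'] by blast
 show int: "integrable lebesgue f <-> integrable lebesgue g"
  using meas integrable_cong_AE[OF _ _ ae] borel_measurable_integrable by blast
 show "(LINT x. f x) = (LINT x. g x)"
  using int integral_cong_AE[OF _ _ ae] by (metis borel_measurable_integrable not_integrable_integral_eq)
qed

lemma lebesgue_open [simp, intro]: "open S ==> S : sets lebesgue"
 by auto

lemma lebesgue_compact: "compact K ==> K : sets lebesgue"
 by (simp add: lmeasurable_compact fmeasurableD)

context
 fixes S :: "'a::euclidean_space set" assumes S: "S : sets lebesgue"
begin

lemma int_indicator: "(LINT x. indicator S x * f x) = int_on S f"
 using S by (simp add: integral_restrict_space)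

lemma L1_indicator: "integrable lebesgue (%x. indicator S x * f x) <-> L1_on S f"
 using S by (simp add: integrable_restrict_space)

lemma measurable_indicator_iff:
 "(%x. indicator S x * f x :: real) : borel_measurable lebesgue <-> f : borel_measurable (leb S)"
 using S by (simp add: borel_measurable_restrict_space_iff)

lemma AE_on_iff: "(AE x in leb S. P x) <-> (AE x in lebesgue. x : S --> P x)"
 using S by (simp add: AE_restrict_space_iff)

lemma
 fixes f g :: "'a => real"
 assumes ae: "AE x in leb S. f x = g x"
 shows measurable_on_cong_AE: "f : borel_measurable (leb S) <-> g : borel_measurable (leb S)"
  and L1_on_cong_AE: "L1_on S f <-> L1_on S g"
  and int_on_cong_AE: "int_on S f = int_on S g"
  and L2_on_cong_AE: "L2_on S f <-> L2_on S g"
proof -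
 have "AE x in lebesgue. indicator S x * f x = indicator S x * g x"
  "AE x in lebesgue. indicator S x * (f x)^2 = indicator S x * (g x)^2"
  using ae by (auto simp: AE_on_iff indicator_def elim: eventually_mono)
 note cong = this[THEN lebesgue_cong_AE(1)] this[THEN lebesgue_cong_AE(2)] this[THEN lebesgue_cong_AE(3)]
 show "f : borel_measurable (leb S) <-> g : borel_measurable (leb S)"
  "L1_on S f <-> L1_on S g" "int_on S f = int_on S g" "L2_on S f <-> L2_on S g"
  using cong unfolding sq_integrable_def
  by (simp_all only: measurable_indicator_iff L1_indicator int_indicator)
qed

lemma L2_iff: "L2 S w <-> L2_on S w"
proof -
 have "(%x. (indicator S x * w x)^2) = (%x. indicator S x * (w x)^2)"
  by (auto simp: indicator_def)
 thus ?thesis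
  unfolding L2_def sq_integrable_def by (simp only: measurable_indicator_iff L1_indicator)
qed

lemma l2norm_eq: "l2norm S w = sqrt (sqnorm S w)"
 by (simp add: l2norm_def int_indicator)

lemma l2ip_eq: "l2ip S w z = ip S w z"
 by (simp add: l2ip_def int_indicator[symmetric] mult.assoc)

lemma weak_dir_deriv_iff:
 "weak_dir_deriv S w e h <->
  (ALL phi. test_fun S phi --> ip S w (pd phi e) = - ip S h phi)"
 by (simp add: weak_dir_deriv_def int_indicator[symmetric] mult.assoc)

lemma finite_measure_lebesgue_on_bounded: "bounded S ==> finite_measure (leb S)"
 using S bounded_set_imp_lmeasurable finite_measure_lebesgue_on by blast

lemma L1_on_if_L2_on: "bounded S ==> L2_on S w ==> L1_on S w"
 by (rule finite_measure.L2_imp_integrable[OF finite_measure_lebesgue_on_bounded])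

lemma L1_on_subset:
 assumes "K : sets lebesgue" "K <= S" "L1_on S f"
 shows "L1_on K f"
proof -
 have "integrable lebesgue (%x. indicator K x * (indicator S x * f x))"
  using assms integrable_mult_indicator[of K lebesgue "%x. indicator S x * f x"]
  by (simp add: L1_indicator)
 also have "(%x. indicator K x * (indicator S x * f x)) = (%x. indicator K x * f x)"
  using assms by (auto simp: indicator_def fun_eq_iff)
 finally show ?thesis using assms by (simp add: integrable_restrict_space)
qed

lemma L2_on_subset: "K : sets lebesgue ==> K <= S ==> L2_on S f ==> L2_on K f"
 unfolding sq_integrable_def by (blast intro: L1_on_subset measurable_restrict_mono)

lemma int_on_superset:
 assumes "K : sets lebesgue" "K <= S" "!!x. x:S ==> x ~: K ==> g x = 0"
 shows "int_on K g = int_on S g"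
proof -
 have "(%x. indicator K x * g x) = (%x. indicator S x * g x)"
  using assms by (auto simp: indicator_def fun_eq_iff)
 thus ?thesis using S assms(1) by (simp add: integral_restrict_space)
qed

end

lemma int_on_mono_set:
 assumes "S : sets lebesgue" "K : sets lebesgue" "K <= S" "L1_on S f" "!!x. 0 <= f x"
 shows "int_on K f <= int_on S f"
 unfolding int_indicator[OF assms(1), symmetric] int_indicator[OF assms(2), symmetric]
 using assms L1_on_subset[OF assms(1-4)]
 by (intro integral_mono) (auto simp: L1_indicator[symmetric] indicator_def)

lemma int_on_UNIV:
 assumes "S : sets lebesgue" "!!x. x ~: S ==> g x = 0"
 shows "int_on S g = (LINT x. g x)"
 using int_on_superset[of UNIV S g] assms by (simp add: lebesgue_on_UNIV_eq)

lemma L2_on_indicator: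
 assumes "S : sets lebesgue" "L2_on S w"
 shows "sq_integrable lebesgue (%x. indicator S x * w x)"
 using assms L2_iff[OF assms(1), of w] by (auto simp: L2_def sq_integrable_def)

lemma L1_on_if_integrable: "integrable lebesgue f ==> S : sets lebesgue ==> L1_on S f"
 using L1_on_subset[of UNIV S f] by (simp add: lebesgue_on_UNIV_eq)

lemma L2_on_if_sq_integrable:
 "sq_integrable lebesgue f ==> S : sets lebesgue ==> L2_on S f"
 using L2_on_subset[of UNIV S f] by (simp add: lebesgue_on_UNIV_eq)

text \<open>Fubini's theorem for the completed measure; the library states it only for \<open>lborel\<close>.\<close>

lemma AE_lebesgue_Pair:
 assumes "AE z in lebesgue. P z"
 shows "AE x in lebesgue. AE y in lebesgue. P (x, y)"
proof -
 have "AE z in lborel \<Otimes>\<^sub>M lborel. P z"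
  unfolding lborel_prod using assms by (simp only: AE_completion_iff)
 hence "AE x in lborel. AE y in lborel. P (x, y)" by (rule lborel_pair.AE_pair)
 thus ?thesis by (simp add: AE_completion_iff)
qed

lemma lebesgue_borel_version:
 fixes h :: "'a::euclidean_space => real"
 assumes "h : borel_measurable lebesgue"
 obtains h' where "h' : borel_measurable borel" "AE z in lebesgue. h z = h' z"
 using completion_ex_borel_measurable_real[OF assms] by (auto simp: AE_completion_iff)

lemma lebesgue_if_borel [measurable_dest]:
 "f : borel_measurable borel ==> f : borel_measurable lebesgue"
 by (simp add: measurable_completion)

lemma borel_section:
 fixes h :: "'a::euclidean_space \<times> 'b::euclidean_space => real"
 assumes "h : borel_measurable borel"
 shows "(sect h x) : borel_measurable borel"
 using assms by (rule measurable_compose[rotated])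
  (auto intro: borel_measurable_continuous_onI continuous_intros)

lemma lebesgue_section_measurable:
 fixes h :: "'a::euclidean_space \<times> 'b::euclidean_space => real"
 assumes "h : borel_measurable lebesgue"
 shows "AE x in lebesgue. (sect h x) : borel_measurable lebesgue"
proof -
 obtain h' where h': "h' : borel_measurable borel" "AE z in lebesgue. h z = h' z"
  using lebesgue_borel_version[OF assms] .
 from AE_lebesgue_Pair[OF h'(2)] show ?thesis
  by eventually_elim (simp only: lebesgue_cong_AE(1) lebesgue_if_borel[OF borel_section[OF h'(1)]])
qed

lemma
 fixes h :: "'a::euclidean_space \<times> 'b::euclidean_space => real"
 assumes h: "integrable lebesgue h"
 shows lebesgue_Fubini_section: "AE x in lebesgue. integrable lebesgue (sect h x)"
  and lebesgue_Fubini_integrable: "integrable lebesgue (%x. LINT y. h (x, y))"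
  and lebesgue_Fubini: "(LINT x. (LINT y. h (x, y))) = (LINT z. h z)"
proof -
 obtain h' where h': "h' : borel_measurable borel" and ae: "AE z in lebesgue. h z = h' z"
  using lebesgue_borel_version[OF borel_measurable_integrable[OF h]] .
 have h'_integrable: "integrable (lborel \<Otimes>\<^sub>M lborel) h'"
  using h h' by (simp add: lebesgue_cong_AE(2)[OF ae] integrable_completion lborel_prod)
 note inner_integrable = lborel_pair.integrable_fst'[OF h'_integrable]
 have sections: "AE x in lebesgue. (integrable lebesgue (sect h x) <-> integrable lborel (sect h' x)) &
   (LINT y. h (x, y)) = (LINT y|lborel. h' (x, y))"
  using AE_lebesgue_Pair[OF ae]
 proof eventually_elim
  case (elim x)
  show ?case using borel_section[OF h']
   by (simp add: lebesgue_cong_AE(2,3)[OF elim] integrable_completion integral_completion)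
 qed
 hence ae_inner: "AE x in lebesgue. (LINT y. h (x, y)) = (LINT y|lborel. h' (x, y))"
  by eventually_elim simp
 show "AE x in lebesgue. integrable lebesgue (sect h x)"
  using sections lborel_pair.AE_integrable_fst'[OF h'_integrable, THEN AE_completion]
  by eventually_elim simp
 show "integrable lebesgue (%x. LINT y. h (x, y))"
  unfolding lebesgue_cong_AE(2)[OF ae_inner]
  using inner_integrable by (subst integrable_completion) auto
 have "(LINT x. (LINT y. h (x, y))) = (LINT x|lborel. (LINT y|lborel. h' (x, y)))"
  unfolding lebesgue_cong_AE(3)[OF ae_inner]
  using inner_integrable by (subst integral_completion) auto
 also have "... = (LINT z|lborel. h' z)"
  using lborel_pair.integral_fst'[OF h'_integrable] by (simp add: lborel_prod)
 also have "... = (LINT z. h z)"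
  unfolding lebesgue_cong_AE(3)[OF ae] using h' by (simp add: integral_completion)
 finally show "(LINT x. (LINT y. h (x, y))) = (LINT z. h z)" .
qed

lemma lebesgue_Tonelli_integrable:
 fixes h :: "'a::euclidean_space \<times> 'b::euclidean_space => real"
 assumes h: "h : borel_measurable lebesgue"
  and sections: "AE x in lebesgue. integrable lebesgue (sect h x)"
  and bound: "AE x in lebesgue. (LINT y. abs (h (x, y))) <= c x"
  and c: "integrable lebesgue c"
 shows "integrable lebesgue h"
proof -
 obtain h' where h': "h' : borel_measurable borel" and ae: "AE z in lebesgue. h z = h' z"
  using lebesgue_borel_version[OF h] .
 have "nn_integral lborel (%z. ennreal (norm (h' z))) = nn_integral lborel (%x. nn_integral lborel (%y. ennreal (norm (h' (x, y)))))"
  by (subst lborel_prod[symmetric], subst lborel.nn_integral_fst) (use h' in "auto simp: lborel_prod")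
 also have "... = nn_integral lebesgue (%x. nn_integral lebesgue (%y. ennreal (norm (h' (x, y)))))"
  by (simp add: nn_integral_completion)
 also have "... <= nn_integral lebesgue (%x. ennreal (abs (c x)))"
 proof (rule nn_integral_mono_AE)
  show "AE x in lebesgue. (nn_integral lebesgue (%y. ennreal (norm (h' (x, y))))) <= ennreal (abs (c x))"
   using AE_lebesgue_Pair[OF ae] sections bound
  proof eventually_elim
   case (elim x)
   have "nn_integral lebesgue (%y. ennreal (norm (h' (x, y)))) = nn_integral lebesgue (%y. ennreal (norm (h (x, y))))"
    using elim(1) by (intro nn_integral_cong_AE) auto
   also have "... = ennreal (LINT y. norm (h (x, y)))" using elim(2) by (intro nn_integral_eq_integral) auto
   finally show ?case using elim(3) by (simp add: ennreal_leI)
  qed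
 qed
 also have "... < \<infinity>" using c by (subst nn_integral_eq_integral) auto
 finally have "integrable lborel h'" using h' by (intro integrableI_bounded) auto
 thus ?thesis unfolding lebesgue_cong_AE(2)[OF ae] using h' by (simp add: integrable_completion)
qed

definition C1 :: "('a :: euclidean_space => real) => bool" where
 "C1 phi <-> (ALL x. phi differentiable (at x)) & (ALL e. continuous_on UNIV (pd phi e))"

lemma test_fun_iff: "test_fun S phi <-> C1 phi & compact (closure {x. phi x ~= 0}) & closure {x. phi x ~= 0} <= S"
 by (auto simp: test_fun_def C1_def)

lemma test_fun_C1: "test_fun S phi ==> C1 phi" by (simp add: test_fun_iff)

lemma C1_has_derivative: "C1 phi ==> (phi has_derivative (%h. pd phi h x)) (at x)"
 unfolding C1_def pd_def using frechet_derivative_works by blast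

lemma pd_eqI: "(phi has_derivative D) (at x) ==> pd phi e x = D e" unfolding pd_def using frechet_derivative_at by metis

lemma C1I:
 assumes "!!x. (phi has_derivative (%h. D x h)) (at x)" "!!e. continuous_on UNIV (%x. D x e)"
 shows "C1 phi"
proof -
 have "pd phi e = (%x. D x e)" for e using pd_eqI[OF assms(1)] by auto
 thus ?thesis unfolding C1_def using assms(2) differentiableI[OF assms(1)] by simp
qed

lemma C1_continuous_pd: "C1 phi ==> continuous_on UNIV (pd phi e)" by (simp add: C1_def)

lemma C1_continuous: "C1 phi ==> continuous_on UNIV phi"
 using C1_has_derivative by (meson continuous_at_imp_continuous_on has_derivative_continuous)

lemma pd_mult: "C1 phi ==> C1 psi ==> pd (%x. phi x * psi x) e x = phi x * pd psi e x + pd phi e x * psi x"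
 by (rule pd_eqI[OF has_derivative_mult[OF C1_has_derivative C1_has_derivative]])

lemma C1_mult: "C1 phi ==> C1 psi ==> C1 (%x. phi x * psi x)"
 by (rule C1I[OF has_derivative_mult[OF C1_has_derivative C1_has_derivative]])
 (auto intro!: continuous_on_add continuous_on_mult continuous_on_diff continuous_on_const dest: C1_continuous_pd C1_continuous)

lemma pd_diff: "C1 phi ==> C1 psi ==> pd (%x. phi x - psi x) e x = pd phi e x - pd psi e x"
 by (rule pd_eqI[OF has_derivative_diff[OF C1_has_derivative C1_has_derivative]])

lemma C1_diff: "C1 phi ==> C1 psi ==> C1 (%x. phi x - psi x)"
 by (rule C1I[OF has_derivative_diff[OF C1_has_derivative C1_has_derivative]])
 (auto intro!: continuous_on_add continuous_on_mult continuous_on_diff continuous_on_const dest: C1_continuous_pd C1_continuous)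

lemma C1_const: "C1 (%x. c)" by (rule C1I[OF has_derivative_const]) auto

lemma linear_pd: "C1 phi ==> linear (%e. pd phi e x)" using C1_has_derivative has_derivative_linear by blast

lemma pd_add_dir: "C1 phi ==> pd phi (a + b) x = pd phi a x + pd phi b x" using linear_add[OF linear_pd] by blast

lemma pd_scale_dir: "C1 phi ==> pd phi (c *R a) x = c * pd phi a x" using linear_scale[OF linear_pd] by (metis real_scaleR_def)

lemma pd_basis_expand: "C1 phi ==> pd phi h x = (SUM b:Basis. (h <.> b) * pd phi b x)"
proof -
 assume C: "C1 phi"
 have "pd phi h x = pd phi (SUM b:Basis. (h <.> b) *R b) x" by (simp add: euclidean_representation)
 also have "... = (SUM b:Basis. pd phi ((h <.> b) *R b) x)" using linear_sum[OF linear_pd[OF C], of "%b. (h <.> b) *R b" Basis] .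
 finally show ?thesis by (simp add: pd_scale_dir[OF C])
qed

definition Cc :: "('a :: euclidean_space => real) => bool" where "Cc g <-> continuous_on UNIV g & compact (closure {x. g x ~= 0})"

lemma CcI: "continuous_on UNIV g ==> compact K ==> (!!x. x ~: K ==> g x = 0) ==> Cc g"
proof -
 assume a: "continuous_on UNIV g" "compact K" "!!x. x ~: K ==> g x = 0"
 have "closure {x. g x ~= 0} <= K" using a by (intro closure_minimal compact_imp_closed) auto
 thus ?thesis using a compact_Int_closed[of K "closure {x. g x ~= 0}"] by (simp add: Cc_def Int_absorb1)
qed

lemma test_funI:
 assumes "C1 phi" "compact K" "K <= S" "!!x. x ~: K ==> phi x = 0"
 shows "test_fun S phi"
proof -
 have "closure {x. phi x ~= 0} <= K" using assms by (intro closure_minimal compact_imp_closed) auto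
 moreover have "Cc phi" using assms C1_continuous CcI by blast
 ultimately show ?thesis using assms(1, 3) unfolding test_fun_iff Cc_def by blast
qed

lemma test_fun_supportE:
 assumes "test_fun S phi"
 obtains K where "compact K" "K <= S" "!!x. x ~: K ==> phi x = 0" "!!x e. x ~: K ==> pd phi e x = 0"
proof
 let ?K = "closure {x. phi x ~= 0}"
 show "compact ?K" "?K <= S" using assms by (auto simp: test_fun_iff)
 show "x ~: ?K ==> phi x = 0" for x using closure_subset[of "{x. phi x ~= 0}"] by auto
 show "pd phi e x = 0" if "x ~: ?K" for x e
 proof -
  have "((%x. 0) has_derivative (%h. 0)) (at x)" by (rule has_derivative_const)
  hence "(phi has_derivative (%h. 0)) (at x)" by (rule has_derivative_transform_within_open[of _ _ _ _ "- ?K"])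
   (use that closure_subset[of "{x. phi x ~= 0}"] in "auto simp: open_Compl")
  thus ?thesis by (rule pd_eqI)
 qed
qed

lemma test_fun_mono: "test_fun S phi ==> S <= S' ==> test_fun S' phi" by (auto simp: test_fun_iff)

lemma test_fun_mult_C1:
 assumes "test_fun S phi" "C1 psi" shows "test_fun S (%x. phi x * psi x)"
proof -
 obtain K where K: "compact K" "K <= S" "!!x. x ~: K ==> phi x = 0" using test_fun_supportE[OF assms(1)] by metis
 show ?thesis by (rule test_funI[OF C1_mult[OF test_fun_C1[OF assms(1)] assms(2)] K(1, 2)]) (simp add: K(3))
qed

lemma test_fun_Cc: "test_fun S phi ==> Cc phi" and pd_test_fun_Cc: "test_fun S phi ==> Cc (pd phi e)"
proof -
 assume t: "test_fun S phi"
 obtain K where K: "compact K" "!!x. x ~: K ==> phi x = 0" "!!x e. x ~: K ==> pd phi e x = 0"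
  using test_fun_supportE[OF t] by metis
 show "Cc phi" "Cc (pd phi e)"
  using K C1_continuous[OF test_fun_C1[OF t]] C1_continuous_pd[OF test_fun_C1[OF t]] by (auto intro: CcI[of _ K])
qed

lemma Cc_supportE:
 assumes "Cc g"
 obtains r where "r > 0" "!!x. norm x > r ==> g x = 0"
proof -
 have "bounded {x. g x ~= 0}" using assms bounded_subset[OF compact_imp_bounded closure_subset] unfolding Cc_def by blast
 then obtain r where "r > 0" "!!x. g x ~= 0 ==> norm x <= r" by (auto simp: bounded_pos)
 thus ?thesis using that[of r] by force
qed

lemma Cc_boundE:
 assumes "Cc g" obtains C where "C > 0" "!!x. abs (g x) <= C"
proof -
 obtain r where r: "r > 0" "!!x. norm x > r ==> g x = 0" using Cc_supportE[OF assms] by blast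
 have "compact (g ` cball 0 r)" using assms by (intro compact_continuous_image) (auto simp: Cc_def intro: continuous_on_subset)
 then obtain C where C: "C > 0" "!!x. x : cball 0 r ==> abs (g x) <= C" by (force simp: bounded_pos dest: compact_imp_bounded)
 have "abs (g x) <= C" for x using C r by (cases "norm x <= r") (auto simp: order_le_less)
 with C that show ?thesis by blast
qed

lemma Cc_borel[measurable_dest]: "Cc g ==> g : borel_measurable borel" by (simp add: Cc_def borel_measurable_continuous_onI)

lemma Cc_integrable:
 assumes "Cc g" shows "integrable lebesgue g"
proof -
 obtain r where r: "r > 0" "!!x. norm x > r ==> g x = 0" using Cc_supportE[OF assms] by blast
 obtain C where C: "C > 0" "!!x. abs (g x) <= C" using Cc_boundE[OF assms] by blast
 have [measurable]: "g : borel_measurable borel" using assms by measurable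
 have "integrable lebesgue (%x. C * indicator (cball 0 r) x)"
  by (intro integrable_mult_right integrable_real_indicator) (use emeasure_bounded_finite[OF
   bounded_cball] in "auto simp: less_top")
 thus ?thesis
 proof (rule integrable_bound)
  show "AE x in lebesgue. norm (g x) <= norm (C * indicator (cball 0 r) x)"
   using C r(2) by (intro AE_I2) (force simp: indicator_def not_le)
 qed measurable
qed

lemma Cc_square: "Cc g ==> Cc (%x. (g x)^2)" by (auto simp: Cc_def intro!: continuous_intros)

lemma Cc_sq_integrable: "Cc g ==> sq_integrable lebesgue g"
 using Cc_integrable[OF Cc_square, of g] Cc_integrable[of g] by (simp add: sq_integrable_def)

lemma Cc_L2_on: "Cc g ==> S : sets lebesgue ==> L2_on S g" by (rule L2_on_if_sq_integrable[OF Cc_sq_integrable])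

lemma test_fun_L2_on: "test_fun S phi ==> A : sets lebesgue ==> L2_on A phi"
 and pd_test_fun_L2_on: "test_fun S phi ==> A : sets lebesgue ==> L2_on A (pd phi e)"
 by (auto intro: Cc_L2_on test_fun_Cc pd_test_fun_Cc)

lemma Cc_uniformly_continuousE:
 assumes "Cc g" "e > 0"
 obtains d where "d > 0" "!!x y. norm (x - y) < d ==> abs (g x - g y) < e"
proof -
 obtain r where r: "r > 0" "!!x. norm x > r ==> g x = 0" using Cc_supportE[OF assms(1)] by blast
 have "uniformly_continuous_on (cball 0 (r + 1)) g"
  using assms by (intro compact_uniformly_continuous) (auto simp: Cc_def intro: continuous_on_subset)
 then obtain d where d: "d > 0" "!!x y. x : cball 0 (r + 1) ==> y : cball 0 (r + 1) ==> dist y x < d ==> dist (g y) (g x) < e"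
  using assms(2) unfolding uniformly_continuous_on_def by metis
 show ?thesis
 proof
  show "min d 1 > 0" using d by simp
  fix x y :: 'a assume xy: "norm (x - y) < min d 1"
  show "abs (g x - g y) < e"
  proof (cases "norm x <= r \<or> norm y <= r")
   case True
   have "norm x <= norm y + norm (x - y)" "norm y <= norm x + norm (x - y)"
    using norm_triangle_sub[of x y] norm_triangle_sub[of y x] by (auto simp: norm_minus_commute)
   with True xy have "norm x <= r + 1" "norm y <= r + 1" by auto
   thus ?thesis using d(2)[of y x] xy by (auto simp: dist_norm)
  next
   case False
   thus ?thesis using r assms(2) by simp
  qed
 qed
qed

lemma C1_mvt:
 assumes "C1 phi"
 obtains t where "0 < t" "t < 1" "phi (z + h) - phi z = pd phi h (z + t *R h)"
proof -
 have "((%s. phi (z + s *R h)) has_real_derivative pd phi h (z + s *R h)) (at s)" for s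
 proof -
  have "((%s. z + s *R h) has_derivative (%r. r *R h)) (at s)" by (auto intro!: derivative_eq_intros)
  from has_derivative_compose[OF this C1_has_derivative[OF assms]]
  have "((%s. phi (z + s *R h)) has_derivative (%r. pd phi (r *R h) (z + s *R h))) (at s)" .
  thus ?thesis unfolding has_field_derivative_def by (simp add: pd_scale_dir[OF assms] mult.commute[of _ "pd phi h _"])
 qed
 from MVT2[of 0 1 "%s. phi (z + s *R h)" "%s. pd phi h (z + s *R h)", OF _ this] that
 show ?thesis by auto
qed

lemma test_fun_uniform_derivE:
 assumes k: "test_fun UNIV k" and "e > 0"
 obtains d where "d > 0" "!!z h. norm h < d ==> abs (k (z + h) - k z - pd k h z) <= e * norm h"
proof -
 have C: "C1 k" using k by (rule test_fun_C1)
 let ?n = "real DIM('a)"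
 have e': "e / ?n > 0" using assms by simp
 have "ALL b:Basis. EX d > 0. ALL x y. norm (x - y) < d --> abs (pd k b x - pd k b y) < e / ?n"
  using Cc_uniformly_continuousE[OF pd_test_fun_Cc[OF k] e'] by metis
 then obtain d where d: "!!b. b:Basis ==> d b > 0"
  "!!b x y. b:Basis ==> norm (x - y) < d b ==> abs (pd k b x - pd k b y) < e / ?n" by metis
 show ?thesis
 proof
  show "Min (d ` Basis) > 0" using d by simp
  fix z h :: 'a assume h: "norm h < Min (d ` Basis)"
  obtain t where t: "0 < t" "t < 1" "k (z + h) - k z = pd k h (z + t *R h)" using C1_mvt[OF C] by blast
  have "abs (k (z + h) - k z - pd k h z) = abs (SUM b:Basis. (h <.> b) * (pd k b (z + t *R h) - pd k b z))"
   unfolding t(3) by (subst(1 2) pd_basis_expand[OF C]) (simp add: sum_subtractf algebra_simps)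
  also have "... <= (SUM b:Basis. abs ((h <.> b) * (pd k b (z + t *R h) - pd k b z)))" by (rule sum_abs)
  also have "... <= (SUM b : (Basis :: 'a set). norm h * (e / ?n))"
  proof (rule sum_mono)
   fix b :: 'a assume b: "b:Basis"
   have "norm (z + t *R h - z) < d b"
   proof -
    have "norm (z + t *R h - z) <= norm h" using t by (simp add: mult_left_le_one_le)
    also have "... < d b" using h b by auto
    finally show ?thesis .
   qed
   hence "abs (pd k b (z + t *R h) - pd k b z) <= e / ?n" using d(2)[OF b] by (simp add: less_imp_le)
   thus "abs ((h <.> b) * (pd k b (z + t *R h) - pd k b z)) <= norm h * (e / ?n)"
    unfolding abs_mult using Basis_le_norm[OF b] by (intro mult_mono) auto
  qed
  also have "... = e * norm h" by simp
  finally show "abs (k (z + h) - k z - pd k h z) <= e * norm h" .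
 qed
qed

lemma
 fixes w :: "'a => real"
 assumes w: "integrable M w" and g: "g : borel_measurable M" and bound: "!!x. abs (g x) <= C"
 shows integrable_mult_bounded: "integrable M (%x. w x * g x)"
  and abs_integral_mult_le: "abs (LINT x|M. w x * g x) <= (LINT x|M. abs (w x)) * C"
proof -
 have le: "abs (w x * g x) <= abs (w x) * C" for x unfolding abs_mult using bound by (intro mult_left_mono) auto
 show integrable: "integrable M (%x. w x * g x)" by (rule integrable_bound[of M "%x. abs (w x) * C"])
   (use w g le in "auto intro: order_trans[OF _ abs_ge_self]")
 have "abs (LINT x|M. w x * g x) <= (LINT x|M. abs (w x * g x))" by (rule integral_abs_bound)
 also have "... <= (LINT x|M. abs (w x) * C)" using w integrable le by (intro integral_mono) auto
 finally show "abs (LINT x|M. w x * g x) <= (LINT x|M. abs (w x)) * C" by simp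
qed

definition conv :: "('a :: euclidean_space => real) => ('a => real) => 'a => real" where "conv w k x = (LINT y. w y * k (y - x))"

lemma Cc_shifted_borel:
 assumes "Cc k" shows "(%y. k (y - x)) : borel_measurable lebesgue"
proof -
 have "continuous_on UNIV (%y. k (y - x))"
  by (rule continuous_on_compose2[of UNIV k]) (use assms in "auto simp: Cc_def intro!: continuous_intros")
 thus ?thesis by (intro lebesgue_if_borel borel_measurable_continuous_onI)
qed

lemma conv_integrable:
 assumes "integrable lebesgue w" "Cc k"
 shows "integrable lebesgue (%y. w y * k (y - x))"
proof -
 obtain C where "!!x. abs (k x) <= C" using Cc_boundE[OF assms(2)] by blast
 thus ?thesis by (intro integrable_mult_bounded assms Cc_shifted_borel)
qed

lemma continuous_conv:
 assumes w: "integrable lebesgue w" and k: "Cc k"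
 shows "continuous_on UNIV (conv w k)" unfolding continuous_on_iff
proof clarify
 fix x :: 'a and e :: real assume e: "e > 0"
 define I where "I = (LINT y. abs (w y))"
 have I: "I >= 0" by (simp add: I_def)
 with e obtain d where d: "d > 0" "!!x y. norm (x - y) < d ==> abs (k x - k y) < e / (I + 1)"
  using Cc_uniformly_continuousE[OF k, of "e / (I + 1)"] by auto
 have "dist (conv w k x') (conv w k x) < e" if "dist x' x < d" for x'
 proof -
  have "conv w k x' - conv w k x = (LINT y. w y * (k (y - x') - k (y - x)))"
   unfolding conv_def right_diff_distrib using conv_integrable[OF w k] by simp
  also have "abs (...) <= I * (e / (I + 1))" unfolding I_def
  proof (rule abs_integral_mult_le[OF w])
   show "abs (k (y - x') - k (y - x)) <= e / ((LINT y. abs (w y)) + 1)" for y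
    using d(2)[of "y - x'" "y - x"] that by (simp add: I_def dist_norm norm_minus_commute less_imp_le)
  qed (intro borel_measurable_diff Cc_shifted_borel k)
  also have "... < e" using e I by (simp add: field_simps)
  finally show ?thesis by (simp add: dist_real_def)
 qed
 with d show "EX d > 0. ALL x':UNIV. dist x' x < d --> dist (conv w k x') (conv w k x) < e" by auto
qed

lemma conv_has_derivative:
 assumes w: "integrable lebesgue w" and k: "test_fun UNIV k"
 shows "(conv w k has_derivative (%h. - conv w (pd k h) x)) (at x)"
proof -
 note C = test_fun_C1[OF k]
 note [simp] = conv_integrable[OF w test_fun_Cc[OF k]] conv_integrable[OF w pd_test_fun_Cc[OF k]]
 define I where "I = (LINT y. abs (w y))"
 have I: "I >= 0" by (simp add: I_def)
 have "linear (%h. - conv w (pd k h) x)"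
  by (rule linearI) (simp_all add: conv_def pd_add_dir[OF C] pd_scale_dir[OF C] distrib_left mult.left_commute)
 hence linear: "bounded_linear (%h. - conv w (pd k h) x)" by (rule linear_conv_bounded_linear[THEN iffD1])
 have "EX d > 0. ALL x'. norm (x' - x) < d -->
   norm (conv w k x' - conv w k x - - conv w (pd k (x' - x)) x) <= e * norm (x' - x)" if e: "e > 0" for e
 proof -
  obtain d where d: "d > 0" "!!z h. norm h < d ==> abs (k (z + h) - k z - pd k h z) <= e / (I + 1) * norm h"
   using test_fun_uniform_derivE[OF k, of "e / (I + 1)"] I e by auto
  have "abs (conv w k x' - conv w k x - - conv w (pd k (x' - x)) x) <= e * norm (x' - x)" if "norm (x' - x) < d" for x'
  proof -
   let ?r = "%y. k (y - x') - k (y - x) + pd k (x' - x) (y - x)"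
   have neg: "pd k (x' - x) z = - pd k (x - x') z" for z using pd_scale_dir[OF C, of "-1" "x - x'" z] by simp
   have "conv w k x' - conv w k x - - conv w (pd k (x' - x)) x = (LINT y. w y * ?r y)"
    unfolding conv_def by (simp add: algebra_simps)
   also have "abs (...) <= I * (e / (I + 1) * norm (x' - x))" unfolding I_def
   proof (rule abs_integral_mult_le[OF w])
    show "abs (?r y) <= e / ((LINT y. abs (w y)) + 1) * norm (x' - x)" for y
     using d(2)[of "x - x'" "y - x"] that unfolding neg by (simp add: I_def norm_minus_commute)
   qed (intro borel_measurable_add borel_measurable_diff Cc_shifted_borel test_fun_Cc[OF k] pd_test_fun_Cc[OF k])
   also have "... <= e * norm (x' - x)"
    using mult_right_mono[of "I * (e / (I + 1))" e "norm (x' - x)"] e I by (simp add: field_simps)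
   finally show ?thesis .
  qed
  with d(1) show ?thesis by auto
 qed
 with linear show ?thesis unfolding has_derivative_at_alt by blast
qed

lemma pd_conv: "integrable lebesgue w ==> test_fun UNIV k ==> pd (conv w k) e x = - conv w (pd k e) x"
 by (rule pd_eqI[OF conv_has_derivative])

lemma C1_conv: "integrable lebesgue w ==> test_fun UNIV k ==> C1 (conv w k)"
 by (rule C1I[OF conv_has_derivative]) (auto intro!: continuous_intros continuous_conv pd_test_fun_Cc)

lemma integral_translate:
 fixes g :: "'a :: euclidean_space => real"
 assumes "g : borel_measurable borel"
 shows "(LINT x. g (x + h)) = (LINT x. g x)"
proof -
 have "(LINT x|lborel. g x) = (LINT x | distr lborel borel ((+) h). g x)" by (simp add: lborel_distr_plus)
 also have "... = (LINT x|lborel. g (h + x))" using assms by (subst integral_distr) auto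
 finally show ?thesis using assms by (simp add: integral_completion add.commute)
qed

lemma pos_part_power_deriv: "((%s :: real. (max 0 s)^(n + 2)) has_real_derivative real (n + 2) * (max 0 s)^(n + 1)) (at s)"
proof -
 consider "s > 0" | "s < 0" | "s = 0" by linarith
 thus ?thesis
 proof cases
  assume s: "s > 0"
  have "((%s :: real. s^(n + 2)) has_real_derivative real (n + 2) * s^(n + 1)) (at s)" using DERIV_pow[of "n + 2" s] by simp
  hence "((%s :: real. (max 0 s)^(n + 2)) has_real_derivative real (n + 2) * s^(n + 1)) (at s)"
   by (rule has_field_derivative_transform_within_open[of _ _ _ "{0<..}"]) (use s in auto)
  thus ?thesis using s by (simp add: max_def)
 next
  assume s: "s < 0"
  have "((%s :: real. 0) has_real_derivative 0) (at s)" by simp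
  hence "((%s :: real. (max 0 s)^(n + 2)) has_real_derivative 0) (at s)"
   by (rule has_field_derivative_transform_within_open[of _ _ _ "{..<0}"]) (use s in auto)
  thus ?thesis using s by (simp add: max_def)
 next
  assume s: "s = 0"
  have "isCont (%z :: real. (max 0 z)^(n + 1)) 0" by (intro continuous_intros)
  moreover have "(max 0 z)^(n + 2) = (max 0 z)^(n + 1) * z" for z :: real by (cases "z <= 0") (auto simp: max_def)
  ultimately show ?thesis unfolding s CARAT_DERIV by (intro exI[of _ "%z. (max 0 z)^(n + 1)"]) simp
 qed
qed

text \<open>The kernel is supported in the unit cube with corner \<open>0\<close>, so that differentiation of
 integrals along cubes applies to it; its exponent makes it twice continuously differentiable.\<close>

definition bump_core :: "'a :: euclidean_space => real" where
 "bump_core x = 1 / 4 - (x - (1 / 2) *R One) <.> (x - (1 / 2) *R One)"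

definition bump :: "'a :: euclidean_space => real" where "bump x = (max 0 (bump_core x))^3"

lemma bump_core_deriv: "(bump_core has_derivative (%h. - 2 * ((x - (1 / 2) *R One) <.> h))) (at x)"
 unfolding bump_core_def[abs_def] by (auto intro!: derivative_eq_intros simp: inner_commute)

lemma continuous_bump_core: "continuous_on S bump_core" unfolding bump_core_def[abs_def] by (intro continuous_intros)

lemma bump_has_derivative: "(bump has_derivative (%h. - 6 * (max 0 (bump_core x))^2 * ((x - (1 / 2) *R One) <.> h))) (at x)"
proof -
 have "((%s. max 0 s^3) has_real_derivative 3 * (max 0 (bump_core x))^2) (at (bump_core x))"
  using pos_part_power_deriv[of 1 "bump_core x"] by (simp add: numeral_eq_Suc)
 from DERIV_compose_FDERIV[OF this bump_core_deriv]
 show ?thesis by (simp add: bump_def[abs_def] algebra_simps)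
qed

lemma pd_bump: "pd bump e x = - 6 * (max 0 (bump_core x))^2 * ((x - (1 / 2) *R One) <.> e)"
 by (rule pd_eqI[OF bump_has_derivative])

lemma C1_bump: "C1 bump" by (rule C1I[OF bump_has_derivative]) (intro continuous_intros continuous_bump_core)

lemma pd_bump_has_derivative: "(pd bump e has_derivative (%h. 24 * max 0 (bump_core x) * ((x - (1 / 2) *R One) <.>
   h) * ((x - (1 / 2) *R One) <.> e) - 6 * (max 0 (bump_core x))^2 * (h <.> e))) (at x)"
proof -
 have "((%s. (max 0 s)^2) has_real_derivative 2 * (max 0 (bump_core x))) (at (bump_core x))"
  using pos_part_power_deriv[of 0 "bump_core x"] by (simp add: numeral_eq_Suc)
 from DERIV_compose_FDERIV[OF this bump_core_deriv]
 have 1: "((%x. (max 0 (bump_core x))^2) has_derivative (%h. (- 2 * ((x - (1 / 2) *R One)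
   <.> h)) * (2 * max 0 (bump_core x)))) (at x)" .
 have "((%x. - 6 * (max 0 (bump_core x))^2 * ((x - (1 / 2) *R One) <.> e))
   has_derivative (%h. - 6 * (max 0 (bump_core x))^2 * (h <.> e) + (- 6 * ((- 2 * ((x - (1
   / 2) *R One) <.> h)) * (2 * max 0 (bump_core x)))) * ((x - (1 / 2) *R One) <.> e))) (at x)"
  by (rule has_derivative_mult[OF has_derivative_mult_right[OF 1]]) (auto intro!: derivative_eq_intros)
 thus ?thesis unfolding pd_bump[abs_def] by (simp add: algebra_simps)
qed

lemma C1_pd_bump: "C1 (pd bump e)" by (rule C1I[OF pd_bump_has_derivative]) (intro continuous_intros continuous_bump_core)

lemma pd_bump_commute: "pd (pd bump e) h x = pd (pd bump h) e x" by (simp add: pd_eqI[OF pd_bump_has_derivative] inner_commute)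

lemma bump_core_pos_cbox: "bump_core x > 0 ==> x : cbox 0 One"
proof -
 assume "bump_core x > 0"
 hence "(norm (x - (1 / 2) *R One))^2 < (1 / 2)^2" by (simp add: bump_core_def power2_norm_eq_inner power_divide)
 hence n: "norm (x - (1 / 2) *R One) < 1 / 2" by (rule power_less_imp_less_base) simp
 show ?thesis unfolding mem_box
 proof (intro ballI)
  fix i :: 'a assume i: "i:Basis"
  have "abs ((x - (1 / 2) *R One) <.> i) < 1 / 2" using Basis_le_norm[OF i] n by (rule le_less_trans)
  hence "abs (x <.> i - 1 / 2) < 1 / 2" using i by (simp add: inner_diff_left)
  hence "0 <= x <.> i" "x <.> i <= 1" by linarith+
  thus "0 <.> i <= x <.> i & x <.> i <= One <.> i" using i by simp
 qed
qed

lemma bump_outside: "x ~: cbox 0 One ==> bump x = 0" "x ~: cbox 0 One ==> pd bump e x = 0"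
 using bump_core_pos_cbox[of x] by (cases "bump_core x > 0"; auto simp: bump_def pd_bump max_absorb1)+

lemma bump_nonneg: "0 <= bump x" and bump_le_1: "bump x <= 1"
proof -
 show "0 <= bump x" by (simp add: bump_def)
 have "bump_core x <= 1" unfolding bump_core_def using inner_ge_zero[of "x - (1 / 2) *R One"] by linarith
 thus "bump x <= 1" unfolding bump_def by (intro power_le_one) auto
qed

definition bump_mass :: "'a :: euclidean_space itself => real" where "bump_mass _ = (LINT x. bump (x :: 'a))"

lemma bump_Cc: "Cc bump" by (rule CcI[of _ "cbox 0 One"]) (auto simp: bump_outside C1_continuous C1_bump)

lemma bump_mass_pos: "bump_mass TYPE('a :: euclidean_space) > 0"
proof (rule ccontr)
 assume "~?thesis"
 moreover have "bump_mass TYPE('a) >= 0" by (simp add: bump_mass_def bump_nonneg)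
 ultimately have "(LINT x. bump (x :: 'a)) = 0" by (simp add: bump_mass_def)
 hence "AE x in lebesgue. bump (x :: 'a) = 0"
  using Cc_integrable[OF bump_Cc] by (subst (asm) integral_nonneg_eq_0_iff_AE) (auto simp: bump_nonneg)
 then obtain N where "negligible N" "{x :: 'a. bump x ~= 0} <= N" unfolding eventually_ae_filter_negligible by auto
 moreover have "{x :: 'a. bump x ~= 0} = {x. bump_core x > 0}" by (auto simp: bump_def max_def)
 ultimately have "negligible {x :: 'a. bump_core x > 0}" using negligible_subset by auto
 moreover have "open {x :: 'a. bump_core x > 0}" using continuous_bump_core by (intro open_Collect_less) auto
 moreover have "(1 / 2) *R One : {x :: 'a. bump_core x > 0}" by (simp add: bump_core_def)
 ultimately show False using open_not_negligible by blast
qed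

definition mollifier :: "real => 'a :: euclidean_space => real" where
 "mollifier eps z = bump (z /\<^sub>R eps) / (eps^DIM('a) * bump_mass TYPE('a))"

lemma mollifier_nonneg: "eps > 0 ==> 0 <= mollifier eps z"
 using bump_mass_pos[where 'a = 'a] by (simp add: mollifier_def bump_nonneg)

lemma mollifier_le: "eps > 0 ==> mollifier eps (z :: 'a :: euclidean_space) <= 1 / (eps^DIM('a) * bump_mass TYPE('a))"
 unfolding mollifier_def using bump_mass_pos[where 'a = 'a] bump_le_1 by (intro divide_right_mono) auto

lemma scale_cbox_iff: "eps > 0 ==> z /\<^sub>R eps : cbox 0 One <-> z : cbox 0 (eps *R One)" by (auto simp: mem_box field_simps)

lemma mollifier_outside: "eps > 0 ==> z ~: cbox 0 (eps *R One) ==> mollifier eps z = 0"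
 using scale_cbox_iff[of eps z] bump_outside(1)[of "z /\<^sub>R eps"] by (simp add: mollifier_def)

lemma scaled_has_derivative:
 assumes "C1 phi" shows "((%z. phi (z /\<^sub>R eps) / c) has_derivative (%h. pd phi h (z /\<^sub>R eps) / (eps * c))) (at z)"
proof -
 have "((%z. z /\<^sub>R eps) has_derivative (%h. h /\<^sub>R eps)) (at z)" by (auto intro!: derivative_eq_intros)
 from has_derivative_compose[OF this C1_has_derivative[OF assms]]
 have "((%z. phi (z /\<^sub>R eps) / c) has_derivative (%h. pd phi (h /\<^sub>R eps) (z /\<^sub>R eps) / c)) (at z)"
  by (rule bounded_linear.has_derivative[OF bounded_linear_divide])
 thus ?thesis by (simp add: pd_scale_dir[OF assms] divide_inverse mult_ac)
qed

lemma C1_scaled: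
 assumes "C1 phi" shows "C1 (%z. phi (z /\<^sub>R eps) / c)"
proof (rule C1I[OF scaled_has_derivative[OF assms]])
 fix e
 have "continuous_on UNIV (%z. pd phi e (z /\<^sub>R eps))"
  by (rule continuous_on_compose2[OF C1_continuous_pd[OF assms]]) (auto intro!: continuous_intros)
 thus "continuous_on UNIV (%z. pd phi e (z /\<^sub>R eps) / (eps * c))" unfolding divide_inverse by (intro continuous_intros)
qed

lemma pd_mollifier: "pd (mollifier eps) e z = pd bump e (z /\<^sub>R eps) / (eps * (eps^DIM('a) * bump_mass TYPE('a)))"
 for z :: "'a :: euclidean_space" unfolding mollifier_def[abs_def] by (rule pd_eqI[OF scaled_has_derivative[OF C1_bump]])

lemma C1_mollifier: "C1 (mollifier eps)" unfolding mollifier_def[abs_def] by (rule C1_scaled[OF C1_bump])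

lemma C1_pd_mollifier: "C1 (pd (mollifier eps) e)" unfolding pd_mollifier[abs_def] by (rule C1_scaled[OF C1_pd_bump])

lemma pd_mollifier_commute: "pd (pd (mollifier eps) e) h z = pd (pd (mollifier eps) h) e z"
 unfolding pd_mollifier[abs_def] pd_eqI[OF scaled_has_derivative[OF C1_pd_bump]] pd_bump_commute[of e h] ..

lemma test_fun_mollifier: "eps > 0 ==> test_fun UNIV (mollifier eps)"
 by (rule test_funI[OF C1_mollifier, of "cbox 0 (eps *R One)"]) (auto simp: mollifier_outside)

lemma test_fun_pd_mollifier: "eps > 0 ==> test_fun UNIV (pd (mollifier eps) e)"
 by (rule test_funI[OF C1_pd_mollifier, of "cbox 0 (eps *R One)"]) (auto simp: pd_mollifier bump_outside scale_cbox_iff)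

lemma shifted_has_derivative:
 assumes "C1 phi" shows "((%y. phi (y - x)) has_derivative (%h. pd phi h (y - x))) (at y)"
proof -
 have "((%y. y - x) has_derivative (%h. h)) (at y)" by (auto intro!: derivative_eq_intros)
 from has_derivative_compose[OF this C1_has_derivative[OF assms]] show ?thesis .
qed

lemma C1_shifted:
 assumes "C1 phi" shows "C1 (%y. phi (y - x))" by (rule C1I[OF shifted_has_derivative[OF assms]])
 (rule continuous_on_compose2[OF C1_continuous_pd[OF assms]], auto intro!: continuous_intros)

lemma pd_shifted: "C1 phi ==> pd (%y. phi (y - x)) e y = pd phi e (y - x)" by (rule pd_eqI[OF shifted_has_derivative])

lemma test_fun_shifted_mollifier:
 assumes "eps > 0" "cbox x (x + eps *R One) <= S"
 shows "test_fun S (%y. mollifier eps (y - x))"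
proof (rule test_funI[OF C1_shifted[OF C1_mollifier] compact_cbox assms(2)])
 fix y assume "y ~: cbox x (x + eps *R One)"
 hence "y - x ~: cbox 0 (eps *R One)" by (auto simp: mem_box inner_diff_left inner_add_left algebra_simps)
 thus "mollifier eps (y - x) = 0" using assms(1) by (rule mollifier_outside[rotated])
qed

lemma integral_mollifier:
 assumes "eps > 0"
 shows "(LINT z. mollifier eps (z :: 'a :: euclidean_space)) = 1"
proof -
 have b: "(bump :: 'a => real) : borel_measurable borel" by (rule Cc_borel[OF bump_Cc])
 have m: "(%z :: 'a. bump (z /\<^sub>R eps)) : borel_measurable borel" using b by measurable
 have "(LINT z|lborel. bump ((z :: 'a) /\<^sub>R eps)) = (LINT z | density (distr lborel borel (%x.
   0 + eps *R x)) (%_. abs eps^DIM('a)). bump ((z :: 'a) /\<^sub>R eps))"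
  using assms by (subst(1) lborel_affine[of eps "0 :: 'a"]) auto
 also have "... = eps^DIM('a) * (LINT x|lborel. bump (x :: 'a))"
  using m assms b by (subst integral_density) (auto simp: integral_distr)
 finally show ?thesis using assms bump_mass_pos[where 'a = 'a] b m by (simp add: mollifier_def bump_mass_def integral_completion)
qed

lemma integral_shifted_mollifier:
 assumes "eps > 0"
 shows "(LINT y. mollifier eps (y - (x :: 'a :: euclidean_space))) = 1"
 using integral_translate[OF Cc_borel[OF test_fun_Cc[OF test_fun_mollifier[OF assms]]], of "-x"]
  integral_mollifier[OF assms, where 'a = 'a] by simp

lemma one_over_Suc_tendsto_0: "(%k. 1 / real (Suc k)) ----> 0" using LIMSEQ_inverse_real_of_nat by (simp add: inverse_eq_divide)

lemma one_over_Suc_at_right_0: "filterlim (%k. 1 / real (Suc k)) (at_right 0) sequentially"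
 by (simp add: filterlim_at one_over_Suc_tendsto_0 del: of_nat_Suc)

lemma AE_average_tendsto:
 fixes w :: "'a::euclidean_space => real"
 assumes "!!a b. w integrable_on cbox a b"
 shows "AE x in lebesgue. ((%h. integral (cbox x (x + h *R One)) w / h^DIM('a)) ---> w x) (at_right 0)"
proof -
 obtain N where N: "negligible N" "!!x e. x ~: N ==> 0 < e ==> EX d > 0. ALL h. 0 < h & h < d -->
   norm (integral (cbox x (x + h *R One)) w /\<^sub>R h^DIM('a) - w x) < e"
  using integrable_ccontinuous_explicit[OF assms] by metis
 have "AE x in lebesgue. x ~: N" using N(1) unfolding negligible_iff_null_sets by (rule AE_not_in)
 thus ?thesis
 proof eventually_elim
  case (elim x)
  show ?case
  proof (rule tendstoI)
   fix e :: real assume "e > 0"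
   from N(2)[OF elim this] show "eventually (%h. dist (integral (cbox x (x + h *R One)) w / h^DIM('a)) (w x) < e) (at_right 0)"
    by (auto simp: eventually_at_right_field dist_real_def divide_inverse_commute)
  qed
 qed
qed

lemma AE_Lebesgue_point:
 fixes w :: "'a::euclidean_space => real"
 assumes w: "integrable lebesgue w"
 shows "AE x in lebesgue. ((%h. int_on (cbox x (x + h *R One)) (%y. abs (w y - w x)) / h^DIM('a)) ---> 0) (at_right 0)"
proof -
 let ?avg = "%g x h. int_on (cbox x (x + h *R One)) g / h^DIM('a)"
 interpret finite_measure "leb (cbox a b)" for a b :: 'a by (rule finite_measure_lebesgue_on_bounded) auto
 have w_int: "L1_on (cbox a b) (%y. abs (w y - q))" for a b q using L1_on_if_integrable[OF w] by auto
 have "AE x in lebesgue. (?avg (%y. abs (w y - q)) x ---> abs (w x - q)) (at_right 0)" for q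
  using AE_average_tendsto[OF integrable_on_lebesgue_on[OF w_int], of q] by (simp add: lebesgue_integral_eq_integral[OF w_int])
 hence "AE x in lebesgue. ALL q : \<rat>. (?avg (%y. abs (w y - q)) x ---> abs (w x - q)) (at_right 0)"
  by (simp add: AE_ball_countable countable_rat)
 thus ?thesis
 proof eventually_elim
  case (elim x)
  have "eventually (%h. ?avg (%y. abs (w y - w x)) x h < e) (at_right 0)" if e: "e > 0" for e
  proof -
   obtain q where q: "q : \<rat>" "w x < q" "q < w x + e / 2" using Rats_dense_in_real[of "w x" "w x + e / 2"] e by auto
   have "eventually (%h. ?avg (%y. abs (w y - q)) x h < e / 2) (at_right 0)"
    using elim q by (intro order_tendstoD[where y = "abs (w x - q)"]) auto
   thus ?thesis using eventually_at_right_less[of 0]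
   proof eventually_elim
    case (elim h)
    let ?Q = "cbox x (x + h *R One)"
    have "int_on ?Q (%y. abs (w y - w x)) <= int_on ?Q (%y. abs (w y - q) + (q - w x))"
     using w_int q by (intro integral_mono integrable_add) auto
    also have "... = int_on ?Q (%y. abs (w y - q)) + (q - w x) * h^DIM('a)" using w_int elim(2)
     by (simp add: measure_restrict_space measure_completion measure_lborel_cbox_eq inner_add_left)
    finally have "?avg (%y. abs (w y - w x)) x h <= ?avg (%y. abs (w y - q)) x h + (q - w x)"
     using elim(2) by (simp add: field_simps)
    thus ?case using elim(1) q(3) by linarith
   qed
  qed
  moreover have "eventually (%h. 0 <= ?avg (%y. abs (w y - w x)) x h) (at_right 0)"
   using eventually_at_right_less[of 0] by eventually_elim simp
  ultimately show ?case by (intro order_tendstoI) (auto elim: eventually_mono)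
 qed
qed

lemma conv_mollifier_diff_le:
 fixes w :: "'a::euclidean_space => real"
 assumes w: "integrable lebesgue w" and h: "0 < h"
 shows "abs (conv w (mollifier h) x - w x) <=
  int_on (cbox x (x + h *R One)) (%y. abs (w y - w x)) / h^DIM('a) / bump_mass TYPE('a)"
proof -
 let ?Q = "cbox x (x + h *R One)" and ?c = "1 / (h^DIM('a) * bump_mass TYPE('a))"
 note Cc_mollifier = test_fun_Cc[OF test_fun_mollifier[OF h]]
 have shifted: "integrable lebesgue (%y. mollifier h (y - x))"
  using Cc_integrable[OF test_fun_Cc[OF test_fun_shifted_mollifier[OF h subset_UNIV]]] .
 have outside: "mollifier h (y - x) = 0" if "y ~: ?Q" for y
  using that by (intro mollifier_outside[OF h]) (auto simp: mem_box inner_diff_left inner_add_left algebra_simps)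
 have "L1_on ?Q w" by (rule L1_on_if_integrable[OF w]) simp
 hence w_int: "L1_on ?Q (%y. abs (w y - w x))" by (intro integrable_abs integrable_diff finite_measure.integrable_const
   finite_measure_lebesgue_on_bounded) auto
 have product: "integrable lebesgue (%y. (w y - w x) * mollifier h (y - x))"
  using conv_integrable[OF w Cc_mollifier, of x] shifted by (simp add: left_diff_distrib)
 have "conv w (mollifier h) x - w x = (LINT y. w y * mollifier h (y - x)) -
   w x * (LINT y. mollifier h (y - x))" unfolding conv_def integral_shifted_mollifier[OF h] by simp
 also have "... = (LINT y. (w y - w x) * mollifier h (y - x))"
  using conv_integrable[OF w Cc_mollifier, of x] shifted by (simp add: left_diff_distrib)
 also have "... = ip ?Q (%y. w y - w x) (%y. mollifier h (y - x))" using outside by (intro int_on_UNIV[symmetric]) auto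
 also have "abs (...) <= ip ?Q (%y. abs (w y - w x)) (%y. ?c)"
 proof (rule order_trans[OF integral_abs_bound integral_mono])
  show "L1_on ?Q (%y. abs ((w y - w x) * mollifier h (y - x)))" by (intro integrable_abs L1_on_if_integrable product) auto
  show "abs ((w y - w x) * mollifier h (y - x)) <= abs (w y - w x) * ?c" for y
   unfolding abs_mult using mollifier_le[OF h, of "y - x"] mollifier_nonneg[OF h, of "y - x"] by (intro mult_left_mono) auto
 qed (use w_int in auto)
 finally show ?thesis by simp
qed

lemma AE_conv_mollifier_tendsto:
 fixes w :: "'a::euclidean_space => real"
 assumes w: "integrable lebesgue w"
 shows "AE x in lebesgue. (%k. conv w (mollifier (1 / Suc k)) x) ----> w x" using AE_Lebesgue_point[OF w]
proof eventually_elim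
 case (elim x)
 let ?avg = "%h. int_on (cbox x (x + h *R One)) (%y. abs (w y - w x)) / h^DIM('a)"
 have lim: "(%k. ?avg (1 / real (Suc k)) / bump_mass TYPE('a)) ----> 0"
  by (rule tendsto_divide_zero[OF filterlim_compose[OF elim one_over_Suc_at_right_0]])
 show ?case
 proof (rule LIM_zero_cancel, rule Lim_null_comparison[OF always_eventually lim], rule allI)
  fix k
  show "norm (conv w (mollifier (1 / Suc k)) x - w x) <= ?avg (1 / real (Suc k)) / bump_mass TYPE('a)"
   using conv_mollifier_diff_le[OF w, of "1 / Suc k" x] by simp
 qed
qed

lemma conv_mollifier_square_le:
 fixes w :: "'a::euclidean_space => real"
 assumes w: "sq_integrable lebesgue w" and eps: "eps > 0"
 shows "integrable lebesgue (%y. (w y)^2 * mollifier eps (y - x))"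
  and "(conv w (mollifier eps) x)^2 <= (LINT y. (w y)^2 * mollifier eps (y - x))"
proof -
 let ?k = "%y. mollifier eps (y - x)"
 note k = test_fun_Cc[OF test_fun_shifted_mollifier[OF eps subset_UNIV]]
 have [measurable]: "w : borel_measurable lebesgue" "?k : borel_measurable lebesgue"
  by (rule L2_measurable[OF w], rule Cc_shifted_borel[OF test_fun_Cc[OF test_fun_mollifier[OF eps]]])
 have root: "(sqrt (?k y))^2 = ?k y" for y by (simp add: mollifier_nonneg[OF eps])
 show weighted: "integrable lebesgue (%y. (w y)^2 * ?k y)"
 proof (rule integrable_mult_bounded)
  show "abs (?k y) <= 1 / (eps^DIM('a) * bump_mass TYPE('a))" for y
   using mollifier_le[OF eps, of "y - x"] mollifier_nonneg[OF eps, of "y - x"] by simp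
 qed (use w in "auto simp: sq_integrable_def")
 have "(LINT y. (w y * sqrt (?k y)) * sqrt (?k y))^2 <=
   (LINT y. (w y * sqrt (?k y))^2) * (LINT y. (sqrt (?k y))^2)" using weighted Cc_integrable[OF k]
  by (intro Cauchy_Schwarz_integral) (simp_all add: sq_integrable_def power_mult_distrib root)
 thus "(conv w (mollifier eps) x)^2 <= (LINT y. (w y)^2 * ?k y)" using integral_shifted_mollifier[OF eps, of x]
  by (simp add: conv_def power_mult_distrib root mult.assoc mollifier_nonneg[OF eps])
qed

lemma nn_integral_reflected_mollifier:
 assumes eps: "eps > 0"
 shows "nn_integral lborel (%x. ennreal (mollifier eps ((y :: 'a::euclidean_space) - x))) = 1"
proof -
 note k = test_fun_Cc[OF test_fun_mollifier[OF eps, where 'a = 'a]]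
 have "nn_integral lborel (%x. ennreal (mollifier eps (y - x))) =
   nn_integral (distr lborel borel (%x. y - x)) (%x. ennreal (mollifier eps x))"
  using Cc_borel[OF k] by (subst nn_integral_distr) auto
 also have "distr lborel borel (%x. y - x) = (lborel :: 'a measure)" using lborel_affine[of "-1" y] by (simp add: density_1)
 also have "nn_integral lborel (%x. ennreal (mollifier eps (x::'a))) = nn_integral lebesgue (%x. ennreal (mollifier eps (x::'a)))"
  by (simp add: nn_integral_completion)
 also have "... = 1" using Cc_integrable[OF k] integral_mollifier[OF eps, where 'a = 'a]
  by (subst nn_integral_eq_integral) (auto simp: mollifier_nonneg[OF eps])
 finally show ?thesis .
qed

lemma conv_mollifier_contraction:
 fixes w :: "'a::euclidean_space => real"
 assumes w: "integrable lebesgue w" "sq_integrable lebesgue w" and eps: "eps > 0"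
 shows "sq_integrable lebesgue (conv w (mollifier eps))" and "(LINT x. (conv w (mollifier eps) x)^2) <= (LINT x. (w x)^2)"
proof -
 let ?c = "conv w (mollifier eps)"
 obtain v where v: "v : borel_measurable borel" "AE x in lebesgue. w x = v x"
  using lebesgue_borel_version[OF L2_measurable[OF w(2)]] .
 have pointwise: "ennreal ((?c x)^2) <= nn_integral lborel (%y. ennreal ((v y)^2) * ennreal (mollifier eps (y - x)))" for x
 proof -
  have "ennreal ((?c x)^2) <= ennreal (LINT y. (w y)^2 * mollifier eps (y - x))"
   by (rule ennreal_leI[OF conv_mollifier_square_le(2)[OF w(2) eps]])
  also have "... = nn_integral lebesgue (%y. ennreal ((w y)^2 * mollifier eps (y - x)))"
   using conv_mollifier_square_le(1)[OF w(2) eps]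
   by (intro nn_integral_eq_integral[symmetric]) (auto intro!: AE_I2 mult_nonneg_nonneg mollifier_nonneg[OF eps])
  also have "... = nn_integral lebesgue (%y. ennreal ((v y)^2) * ennreal (mollifier eps (y - x)))"
   using v(2) by (intro nn_integral_cong_AE, eventually_elim)
    (simp only: ennreal_mult[OF zero_le_power2 mollifier_nonneg[OF eps]])
  finally show ?thesis by (simp add: nn_integral_completion)
 qed
 have "continuous_on UNIV (%p :: 'a * 'a. mollifier eps (snd p - fst p))"
  by (rule continuous_on_compose2[OF C1_continuous[OF C1_mollifier]]) (auto intro!: continuous_intros)
 note this[THEN borel_measurable_continuous_onI, measurable]
 have [measurable]: "(%p :: 'a * 'a. v (snd p)) : borel_measurable borel"
  by (rule measurable_compose[OF borel_measurable_continuous_onI v(1)]) (intro continuous_intros)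
 have joint: "(%(x, y). ennreal ((v y)^2) * ennreal (mollifier eps (y - x)))
   : borel_measurable (lborel \<Otimes>\<^sub>M (lborel :: 'a measure))" unfolding lborel_prod case_prod_unfold by measurable
 have "(%x. y - x) : borel_measurable borel" for y :: 'a by measurable
 hence reflected: "(%x. mollifier eps (y - x)) : borel_measurable borel" for y :: 'a
  using measurable_compose[OF _ borel_measurable_continuous_onI[OF C1_continuous[OF C1_mollifier]]] by blast
 have "nn_integral lborel (%x. ennreal ((?c x)^2)) <=
   (nn_integral lborel (%x. nn_integral lborel (%y. ennreal ((v y)^2) * ennreal (mollifier eps (y - x)))))"
  using pointwise by (intro nn_integral_mono)
 also have "... = nn_integral lborel (%y. nn_integral lborel (%x. ennreal ((v y)^2) * ennreal (mollifier eps (y - x))))"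
  by (rule lborel_pair.Fubini'[OF joint, symmetric])
 also have "... = nn_integral lebesgue (%y. ennreal ((v y)^2))"
  using reflected by (simp add: nn_integral_cmult nn_integral_reflected_mollifier[OF eps] nn_integral_completion)
 also have "... = nn_integral lebesgue (%y. ennreal ((w y)^2))" using v(2) by (intro nn_integral_cong_AE) auto
 also have "... = ennreal (LINT y. (w y)^2)" using w(2) by (intro nn_integral_eq_integral) (auto simp: sq_integrable_def)
 finally have le: "nn_integral lebesgue (%x. ennreal ((?c x)^2)) <= ennreal (LINT y. (w y)^2)"
  by (simp add: nn_integral_completion)
 have measurable: "?c : borel_measurable lebesgue"
  by (intro lebesgue_if_borel borel_measurable_continuous_onI continuous_conv w test_fun_Cc[OF test_fun_mollifier] eps)
 hence square: "integrable lebesgue (%x. (?c x)^2)" using le by (intro integrableI_bounded) (auto intro: le_less_trans)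
 with measurable show "sq_integrable lebesgue ?c" by (simp add: sq_integrable_def)
 from le square show "(LINT x. (?c x)^2) <= (LINT x. (w x)^2)" by (simp add: nn_integral_eq_integral)
qed

definition mollify :: "'a::euclidean_space set => ('a => real) => nat => 'a => real" where
 "mollify S w k = conv (%y. indicator S y * w y) (mollifier (1 / Suc k))"

lemma AE_mollify_tendsto:
 assumes "S : sets lebesgue" "L1_on S w"
 shows "AE x in lebesgue. (%k. mollify S w k x) ----> indicator S x * w x"
 unfolding mollify_def using assms by (intro AE_conv_mollifier_tendsto) (simp add: L1_indicator)

lemma C1_mollify:
 assumes "S : sets lebesgue" "L1_on S w"
 shows "C1 (mollify S w k)" unfolding mollify_def using assms by (intro C1_conv test_fun_mollifier) (auto simp: L1_indicator)

lemma mollify_eq: "S : sets lebesgue ==> mollify S w k x = ip S w (%y. mollifier (1 / Suc k) (y - x))"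
 by (simp add: mollify_def conv_def int_indicator[symmetric] mult.assoc)

lemma pd_mollify_eq:
 assumes "S : sets lebesgue" "L1_on S w"
 shows "pd (mollify S w k) e x = - ip S w (%y. pd (%y. mollifier (1 / Suc k) (y - x)) e y)"
 using assms by (simp add: mollify_def pd_conv test_fun_mollifier L1_indicator conv_def
  pd_shifted[OF C1_mollifier] int_indicator[symmetric] mult.assoc)

lemma mollify_L2_tendsto_UNIV:
 assumes "S : sets lebesgue" "bounded S" "L2_on S w"
 shows "sq_integrable lebesgue (mollify S w k)" "L2_tendsto lebesgue (mollify S w) (%x. indicator S x * w x)"
proof -
 have i: "integrable lebesgue (%x. indicator S x * w x)" using L1_on_if_L2_on[OF assms] assms(1) by (simp add: L1_indicator)
 note s = L2_on_indicator[OF assms(1,3)]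
 show "sq_integrable lebesgue (mollify S w k)" unfolding mollify_def by (intro conv_mollifier_contraction i s) auto
 show "L2_tendsto lebesgue (mollify S w) (%x. indicator S x * w x)" unfolding mollify_def[abs_def]
  by (intro L2_tendsto_if_AE_tendsto conv_mollifier_contraction AE_conv_mollifier_tendsto i s) auto
qed

lemma mollify_L2_tendsto:
 assumes S: "S : sets lebesgue" "bounded S" and K: "K : sets lebesgue" "K <= S" and w: "L2_on S w"
 shows "L2_on K (mollify S w k)" "L2_tendsto (leb K) (mollify S w) w"
proof -
 note mollify = mollify_L2_tendsto_UNIV[OF S w]
 show "L2_on K (mollify S w k)" by (rule L2_on_if_sq_integrable[OF mollify(1) K(1)])
 have "sqnorm K (%x. mollify S w k x - w x) <= (LINT x. (mollify S w k x - indicator S x * w x)^2)" for k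
 proof -
  have "sqnorm K (%x. mollify S w k x - w x) = sqnorm K (%x. mollify S w k x - indicator S x * w x)"
   using K by (intro integral_cong) (auto simp: space_restrict_space)
  also have "... <= sqnorm UNIV (%x. mollify S w k x - indicator S x * w x)"
   using L2_square_integrable[OF L2_diff[OF mollify(1) L2_on_indicator[OF S(1) w]]] K(1)
   by (intro int_on_mono_set) (auto simp: lebesgue_on_UNIV_eq)
  finally show ?thesis by (simp add: lebesgue_on_UNIV_eq)
 qed
 thus "L2_tendsto (leb K) (mollify S w) w" unfolding L2_tendsto_def
  by (intro tendsto_sandwich[OF _ _ tendsto_const mollify(2)[unfolded L2_tendsto_def]]) auto
qed

lemma eventually_one_over_Suc_less: "r > 0 ==> EV k. 1 / real (Suc k) * c < r"
 using tendsto_mult_left_zero[OF one_over_Suc_tendsto_0, of c] by (rule order_tendstoD)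

lemma compact_in_open_margin:
 fixes K :: "'a :: euclidean_space set"
 assumes "compact K" "K <= S" "open S"
 obtains r where "r > 0" "!!x y. x : K ==> dist x y < r ==> y : S"
proof (cases "K = {}")
 case True
 thus ?thesis using that[of 1] by auto
next
 case False
 have "EX r > 0. ALL x : K. ALL y : - S. r <= dist x y" by (intro separate_compact_closed assms) (use assms in auto)
 thus ?thesis using that by force
qed

lemma norm_le_in_cube:
 fixes x y :: "'a :: euclidean_space"
 assumes "h >= 0" "y : cbox x (x + h *R One)"
 shows "norm (y - x) <= h * norm (One :: 'a)"
proof -
 have "norm (y - x) <= norm (h *R (One :: 'a))"
  using assms by (intro norm_le_componentwise) (auto simp: mem_box inner_diff_left inner_add_left abs_if)
 thus ?thesis using assms(1) by simp
qed

lemma compact_cube_margin: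
 fixes K :: "'a::euclidean_space set"
 assumes K: "compact K" "K <= S" and S: "open S"
 shows "EV k. ALL x:K. cbox x (x + (1 / Suc k) *R One) <= S"
proof -
 obtain r where r: "r > 0" "!!x y. x : K ==> dist x y < r ==> y : S" using compact_in_open_margin[OF assms] by blast
 from eventually_one_over_Suc_less[OF r(1), of "norm (One :: 'a)"] show ?thesis
 proof eventually_elim
  case (elim k)
  have "y : S" if "x : K" "y : cbox x (x + (1 / Suc k) *R One)" for x y
   using norm_le_in_cube[OF _ that(2)] elim by (intro r(2)[OF that(1)]) (simp add: dist_norm norm_minus_commute)
  thus ?case by blast
 qed
qed

lemma AE_zero_if_orthogonal_test_fun:
 fixes w :: "'a::euclidean_space => real"
 assumes S: "open S" and w: "L1_on S w" and orthogonal: "!!phi. test_fun S phi ==> ip S w phi = 0"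
 shows "AE x in leb S. w x = 0" unfolding AE_on_iff[OF lebesgue_open[OF S]] using AE_mollify_tendsto[OF lebesgue_open[OF S] w]
proof eventually_elim
 case (elim x)
 show ?case
 proof
  assume x: "x : S"
  have "EV k. mollify S w k x = 0" using compact_cube_margin[of "{x}", OF _ _ S]
  proof (rule eventually_mono)
   fix k assume "ALL x : {x}. cbox x (x + (1 / Suc k) *R One) <= S"
   hence t: "test_fun S (%y. mollifier (1 / Suc k) (y - x))" by (intro test_fun_shifted_mollifier) auto
   have "mollify S w k x = (LINT y. indicator S y * (w y * mollifier (1 / Suc k) (y - x)))"
    by (simp add: mollify_def conv_def mult.assoc)
   thus "mollify S w k x = 0" using orthogonal[OF t] by (simp add: int_indicator S)
  qed (use x in auto)
  from LIMSEQ_unique[OF elim tendsto_eventually[OF this]] x show "w x = 0" by simp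
 qed
qed

lemma pd_mollify:
 assumes S: "S : sets lebesgue" "L1_on S w" and d: "weak_dir_deriv S w e h" and cube: "cbox x (x + (1 / Suc k) *R One) <= S"
 shows "pd (mollify S w k) e x = mollify S h k x"
proof -
 have "test_fun S (%y. mollifier (1 / Suc k) (y - x))" by (rule test_fun_shifted_mollifier[OF _ cube]) simp
 thus ?thesis using d by (simp add: pd_mollify_eq[OF S] mollify_eq[OF S(1)] weak_dir_deriv_iff[OF S(1)])
qed

lemma eventually_pd_mollify:
 assumes S: "open S" "L1_on S w" and d: "weak_dir_deriv S w e h" and K: "compact K" "K <= S"
 shows "EV k. ALL x:K. pd (mollify S w k) e x = mollify S h k x"
 using compact_cube_margin[OF K S(1)] by eventually_elim (use pd_mollify[OF lebesgue_open[OF S(1)] S(2) d] in blast)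

lemma pd_mollify_L2_tendsto:
 assumes S: "open S" "bounded S" and w: "L2_on S w" "L2_on S h" and d: "weak_dir_deriv S w e h" and K: "compact K" "K <= S"
 shows "L2_tendsto (leb K) (%k. pd (mollify S w k) e) h" unfolding L2_tendsto_def
proof (rule Lim_transform_eventually)
 note Sm = lebesgue_open[OF S(1)]
 show "(%k. sqnorm K (%x. mollify S h k x - h x)) ----> 0"
  using mollify_L2_tendsto(2)[OF Sm S(2) lebesgue_compact[OF K(1)] K(2) w(2)] by (simp add: L2_tendsto_def)
 show "EV k. sqnorm K (%x. mollify S h k x - h x) = sqnorm K (%x. pd (mollify S w k) e x - h x)"
  using eventually_pd_mollify[OF S(1) L1_on_if_L2_on[OF Sm S(2) w(1)] d K]
  by eventually_elim (intro integral_cong, auto simp: space_restrict_space)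
qed

lemma Cc_translate:
 assumes "Cc g" shows "Cc (%x. g (x + a))"
proof (rule CcI)
 have g: "continuous_on UNIV g" "compact (closure {x. g x ~= 0})" using assms by (auto simp: Cc_def)
 show "continuous_on UNIV (%x. g (x + a))" by (rule continuous_on_compose2[OF g(1)]) (auto intro!: continuous_intros)
 show "compact ((%x. x - a) ` closure {x. g x ~= 0})" using g(2) by (rule compact_translation_subtract)
 show "g (x + a) = 0" if "x ~: (%x. x - a) ` closure {x. g x ~= 0}" for x
  using that closure_subset[of "{x. g x ~= 0}"] by (force intro: image_eqI[of _ _ "x + a"])
qed

lemma Cc_mult: "continuous_on UNIV f ==> Cc g ==> Cc (%x. f x * g x)" by (rule CcI[of _ "closure {x. g x ~= 0}"])
  (use closure_subset[of "{x. g x ~= 0}"] in "auto simp: Cc_def intro!: continuous_intros")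

lemma bilipschitz_inverseE:
 fixes F :: "real => real"
 assumes lower: "!!x y. x <= y ==> y - x <= F y - F x" and cont: "continuous_on UNIV F"
 obtains G where "G : borel_measurable borel" "!!y. F (G y) = y" "!!x. G (F x) = x"
proof -
 have "EX x. F x = y" for y
 proof -
  define M where "M = abs (y - F 0) + 1"
  have M: "M > 0" "M >= y - F 0" "M >= F 0 - y" by (auto simp: M_def)
  hence "F (- M) <= y" "y <= F M" using lower[of "-M" 0] lower[of 0 M] by auto
  thus ?thesis using IVT'[of F "-M" y M] cont M(1) by (auto intro: continuous_on_subset)
 qed
 hence FG: "F (inv F y) = y" for y by (metis f_inv_into_f rangeI)
 have less: "F x < F y" if "x < y" for x y using lower[of x y] that by simp
 have "inj F" by (rule linorder_injI) (metis less less_irrefl)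
 hence GF: "inv F (F x) = x" for x by (rule inv_f_f)
 have "mono (inv F)" by (rule monoI) (metis FG less linorder_not_less)
 from that[OF borel_measurable_mono[OF this] FG GF] show ?thesis .
qed

text \<open>The inverse of a bi-Lipschitz function \<open>F\<close> transports Lebesgue measure to an absolutely
 continuous measure, whose Radon--Nikodym density is the derivative of \<open>F\<close>.\<close>

lemma bilipschitz_density:
 assumes lower: "!!x y. x <= y ==> y - x <= F y - F x" and upper: "!!x y. x <= y ==> F y - F x <= C * (y - x)"
 shows "EX g : borel_measurable lborel.
  ALL a b. a <= b --> (\<integral>\<^sup>+x \<in> {a<..b}. g x \<partial>lborel) = ennreal (F b - F a)"
proof -
 have lip: "abs (F y - F x) <= C * abs (y - x)" for x y
  using upper[of x y] upper[of y x] lower[of x y] lower[of y x] by (cases "x <= y") auto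
 have "C >= 0" using lip[of 1 0] by simp
 hence "continuous_on UNIV F"
  by (intro lipschitz_on_continuous_on[of C] lipschitz_onI) (auto simp: dist_real_def lip abs_minus_commute)
 then obtain G where G: "G : borel_measurable borel" "!!y. F (G y) = y" "!!x. G (F x) = x"
  using bilipschitz_inverseE[OF lower] by blast
 have le_iff: "F x <= F y <-> x <= y" for x y using lower[of x y] lower[of y x] by (cases "x <= y") auto
 define mu where "mu = distr lborel borel G"
 have mu_interval: "emeasure mu {a<..b} = ennreal (F b - F a)" if "a <= b" for a b
 proof -
  have "G -` {a<..b} = {F a<..F b}" using le_iff G(2) by (auto simp: not_le[symmetric]) (metis G(2) le_iff)+
  thus ?thesis unfolding mu_def using G(1) that le_iff by (subst emeasure_distr) auto
 qed
 have "absolutely_continuous lborel mu" unfolding absolutely_continuous_def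
 proof
  fix N assume N: "N : null_sets (lborel :: real measure)"
  have "negligible N" using N by (simp add: negligible_iff_null_sets null_sets_completionI)
  hence "negligible (F ` N)"
   by (rule negligible_locally_Lipschitz_image[OF order_refl]) (use lip in "auto intro!: exI[of _ UNIV] exI[of _ C]")
  moreover have "F ` N = G -` N" using G(2,3) by (auto simp: image_iff) metis
  ultimately have "G -` N : null_sets lebesgue" by (simp add: negligible_iff_null_sets)
  moreover have "G -` N : sets lborel" using measurable_sets[OF G(1), of N] N by (simp add: null_sets_def)
  ultimately have "emeasure lborel (G -` N) = 0" using emeasure_completion[of "G -` N" lborel] by auto
  thus "N : null_sets mu" unfolding mu_def using N emeasure_distr[of G lborel borel N] G(1) by (auto simp: null_sets_def)
 qed
 moreover have "sets mu = sets lborel" by (simp add: mu_def)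
 ultimately obtain g where g: "g : borel_measurable lborel" "density lborel g = mu"
  using sigma_finite_measure.Radon_Nikodym[OF sigma_finite_lborel] by blast
 have "(\<integral>\<^sup>+x \<in> {a<..b}. g x \<partial>lborel) = ennreal (F b - F a)" if "a <= b" for a b
  using mu_interval[OF that] g(1) unfolding g(2)[symmetric] by (subst (asm) emeasure_density) auto
 with g(1) show ?thesis by blast
qed

lemma bilipschitz_integral:
 fixes F :: "real => real"
 assumes lower: "!!x y. x <= y ==> y - x <= F y - F x" and upper: "!!x y. x <= y ==> F y - F x <= C * (y - x)"
 shows "EX r. ALL a b. a <= b --> (r has_integral (F b - F a)) {a..b}"
proof -
 obtain g where g: "g : borel_measurable lborel"
  "ALL a b. a <= b --> (\<integral>\<^sup>+x \<in> {a<..b}. g x \<partial>lborel) = ennreal (F b - F a)"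
  using bilipschitz_density[OF assms] by blast
 define r where "r x = enn2real (g x)" for x
 have [measurable]: "r : borel_measurable borel" using g(1) unfolding r_def by measurable
 have "AE x in lborel. g x * indicator {- real n<..real n} x ~= \<infinity>" for n
  using g(2)[rule_format, of "- real n" "real n"] g(1) by (intro nn_integral_PInf_AE) auto
 hence "AE x in lborel. ALL n. g x * indicator {- real n<..real n} x ~= \<infinity>" by (simp add: AE_all_countable)
 hence finite: "AE x in lborel. g x ~= \<infinity>"
 proof eventually_elim
  case (elim x)
  obtain n where "abs x < real n" using reals_Archimedean2 by blast
  hence "x : {- real n<..real n}" by auto
  thus ?case using elim[rule_format, of n] by simp
 qed
 have "(r has_integral (F b - F a)) {a..b}" if ab: "a <= b" for a b
 proof -
  have "(nn_integral lborel (%x. ennreal (r x * indicator {a<..b} x))) = ennreal (F b - F a)"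
   unfolding g(2)[rule_format, OF ab, symmetric] using finite
   by (intro nn_integral_cong_AE) (auto simp: r_def indicator_def ennreal_enn2real_if)
  hence "((%x. r x * indicator {a<..b} x) has_integral (F b - F a)) UNIV"
  proof (intro nn_integral_has_integral)
   show "(%x. r x * indicator {a<..b} x) : borel_measurable borel" by measurable
   show "0 <= r x * indicator {a<..b} x" for x by (simp add: r_def)
   show "0 <= F b - F a" using lower[OF ab] ab by simp
  qed
  hence "((%x. if x : {a<..b} then r x else 0) has_integral (F b - F a)) UNIV" by (rule has_integral_eq[rotated]) auto
  hence "(r has_integral (F b - F a)) {a<..b}" by (subst (asm) has_integral_restrict_UNIV)
  thus ?thesis by (subst (asm) has_integral_spike_set_eq[of _ "{a..b}"]) (auto intro: negligible_subset[of "{a}"])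
 qed
 thus ?thesis by blast
qed

lemma AE_right_derivative_lipschitz_real:
 fixes f :: "real => real"
 assumes lip: "!!x y. abs (f x - f y) <= L * abs (x - y)"
 shows "AE x in lborel. EX D. ((%h. (f (x + h) - f x) / h) ---> D) (at_right 0)"
proof -
 define F where "F x = f x + (L + 1) * x" for x
 have "y - x <= F y - F x" "F y - F x <= (2 * L + 1) * (y - x)" if "x <= y" for x y
  using lip[of y x] that by (auto simp: F_def algebra_simps abs_le_iff)
 from bilipschitz_integral[OF this] obtain r where r: "(r has_integral (F b - F a)) {a..b}" if "a <= b" for a b by blast
 have "r integrable_on cbox a b" for a b using r[of a b] by (cases "a <= b") (auto intro: has_integral_integrable)
 note AE_average_tendsto[OF this, unfolded AE_completion_iff]
 thus ?thesis
 proof eventually_elim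
  case (elim x)
  have "eventually (%h. integral (cbox x (x + h *R One)) r / h^DIM(real) - (L + 1) = (f (x + h) - f x) / h) (at_right 0)"
   using eventually_at_right_less[of 0]
  proof eventually_elim
   case (elim h)
   hence "integral {x..x + h} r = F (x + h) - F x" by (intro integral_unique[OF r]) simp
   thus ?case using elim by (simp add: F_def field_simps)
  qed
  from Lim_transform_eventually[OF tendsto_diff[OF elim tendsto_const] this] show ?case by blast
 qed
qed

definition diff_quot :: "('a::euclidean_space => real) => 'a => 'a => real => real" where
 "diff_quot f e x h = (f (x + h *R e) - f x) / h"

definition dir_deriv :: "('a::euclidean_space => real) => 'a => 'a => real" where
 "dir_deriv f e x = lim (%k. diff_quot f e x (1 / Suc k))"

locale lipschitz_fun =
 fixes f :: "'a::euclidean_space => real" and L :: real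
 assumes lip: "abs (f x - f y) <= L * norm (x - y)"
begin

lemma const_nonneg: "0 <= L"
proof -
 obtain b :: 'a where b: "b:Basis" using nonempty_Basis by blast
 show ?thesis using lip[of b 0] b by (simp add: order_trans[OF abs_ge_zero])
qed

lemma continuous: "continuous_on S f"
 by (rule lipschitz_on_continuous_on[of L]) (auto intro!: lipschitz_onI simp: dist_norm lip const_nonneg)

lemma continuous_comp: "continuous_on S g ==> continuous_on S (%x. f (g x))"
 by (rule continuous_on_compose2[OF continuous[of UNIV]]) auto

end

lemma test_fun_lipschitzE:
 assumes "test_fun S phi" obtains L where "lipschitz_fun phi L"
proof -
 note C = test_fun_C1[OF assms]
 have "ALL b. EX M > 0. ALL x. abs (pd phi b x) <= M" using Cc_boundE[OF pd_test_fun_Cc[OF assms]] by metis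
 then obtain M where M: "!!b. M b > 0" "!!b x. abs (pd phi b x) <= M b" by metis
 have "lipschitz_fun phi (sum M Basis)"
 proof
  fix x y
  obtain t where t: "phi (y + (x - y)) - phi y = pd phi (x - y) (y + t *R (x - y))" using C1_mvt[OF C] by blast
  have "abs (pd phi (x - y) (y + t *R (x - y))) <= (SUM b:Basis. norm (x - y) * M b)"
   by (subst pd_basis_expand[OF C], rule order_trans[OF sum_abs], rule sum_mono)
    (auto simp: abs_mult intro!: mult_mono M Basis_le_norm)
  with t show "abs (phi x - phi y) <= sum M Basis * norm (x - y)" by (simp add: sum_distrib_right mult.commute)
 qed
 thus ?thesis by (rule that)
qed

context lipschitz_fun begin

lemma diff_quot_bound: "abs (diff_quot f e x h) <= L * norm e"
proof (cases "h = 0")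
 case True
 thus ?thesis by (simp add: diff_quot_def const_nonneg)
next
 case False
 have "abs (f (x + h *R e) - f x) <= L * (abs h * norm e)" using lip[of "x + h *R e" x] by simp
 thus ?thesis using False by (simp add: diff_quot_def divide_simps algebra_simps)
qed

lemma diff_quot_borel: "(%x. diff_quot f e x h) : borel_measurable borel" unfolding diff_quot_def divide_inverse
 by (intro borel_measurable_continuous_onI continuous_intros continuous_comp)

lemma AE_dir_deriv_tendsto: "AE x in lebesgue. (%k. diff_quot f e x (1 / Suc k)) ----> dir_deriv f e x"
proof -
 define A where "A x <-> convergent (%k. diff_quot f e x (1 / Suc k))" for x
 have [measurable]: "(%x. diff_quot f e x h) : borel_measurable borel" for h by (rule diff_quot_borel)
 have "Measurable.pred borel A" unfolding A_def[abs_def] Cauchy_convergent_iff[symmetric] pred_def by measurable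
 hence A: "{x. A x} : sets borel" by (simp add: pred_def)
 have "AE s in lborel. A (x + s *R e)" for x
 proof -
  have "abs (f (x + s *R e) - f (x + t *R e)) <= (L * norm e) * abs (s - t)" for s t
   using lip[of "x + s *R e" "x + t *R e"] by (simp add: scaleR_diff_left[symmetric] mult_ac)
  from AE_right_derivative_lipschitz_real[OF this] show ?thesis
  proof eventually_elim
   case (elim s)
   then obtain D where "((%h. (f (x + (s + h) *R e) - f (x + s *R e)) / h) ---> D) (at_right 0)" by blast
   from filterlim_compose[OF this one_over_Suc_at_right_0]
   show ?case unfolding A_def diff_quot_def convergent_def by (auto simp: scaleR_add_left add.assoc)
  qed
 qed
 hence "AE x in lborel. AE s in lborel. A (x + s *R e)" by simp
 moreover have "{p : space ((lborel :: 'a measure) \<Otimes>\<^sub>M (lborel :: real measure)). A (fst p + snd p *R e)}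
   : sets ((lborel :: 'a measure) \<Otimes>\<^sub>M lborel)"
 proof -
  have "(%p :: 'a * real. fst p + snd p *R e) : borel_measurable borel"
   by (intro borel_measurable_continuous_onI continuous_intros)
  from measurable_sets[OF this A] show ?thesis unfolding lborel_prod by (simp add: vimage_def)
 qed
 ultimately have "AE s in lborel. AE x in lborel. A (x + s *R e)" using lborel_pair.AE_commute[of "%x s. A (x + s *R e)"] by simp
 hence "EX s. AE x in lborel. A (x + s *R e)" by (rule eventually_happens'[rotated]) (simp add: ae_filter_eq_bot_iff)
 then obtain s where "AE x in lborel. A (s *R e + x)" by (auto simp: add.commute)
 hence "AE x in distr lborel borel ((+) (s *R e)). A x" using A by (subst AE_distr_iff) auto
 hence "AE x in lebesgue. A x" unfolding lborel_distr_plus by (rule AE_completion)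
 thus ?thesis by eventually_elim (simp add: A_def dir_deriv_def convergent_LIMSEQ_iff)
qed

lemma dir_deriv_lebesgue: "dir_deriv f e : borel_measurable lebesgue" unfolding dir_deriv_def[abs_def]
 by (intro lebesgue_if_borel borel_measurable_lim_metric diff_quot_borel)

lemma AE_dir_deriv_bound: "AE x in lebesgue. abs (dir_deriv f e x) <= L * norm e" using AE_dir_deriv_tendsto[of e]
proof eventually_elim
 case (elim x)
 from tendsto_rabs[OF this] show ?case by (rule LIMSEQ_le_const2) (use diff_quot_bound in blast)
qed

lemma integrable_dir_deriv_mult:
 assumes "integrable lebesgue g" shows "integrable lebesgue (%x. dir_deriv f e x * g x)"
proof (rule integrable_bound)
 show "integrable lebesgue (%x. (L * norm e) * g x)" using assms by simp
 show "(%x. dir_deriv f e x * g x) : borel_measurable lebesgue"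
  using dir_deriv_lebesgue borel_measurable_integrable[OF assms] by measurable
 show "AE x in lebesgue. norm (dir_deriv f e x * g x) <= norm (L * norm e * g x)" using AE_dir_deriv_bound[of e]
  by eventually_elim (simp add: abs_mult mult_right_mono const_nonneg)
qed

lemma integral_diff_quot_mult:
 assumes phi: "Cc phi"
 shows "(LINT x. diff_quot f e x h * phi x) = (LINT x. f x * diff_quot phi (- e) x h)"
proof -
 have shifted: "Cc (%x. f x * phi (x - h *R e))" using Cc_mult[OF continuous Cc_translate[OF phi, of "- (h *R e)"]] by simp
 have "Cc (%x. f (x + h *R e) * phi x)" by (intro Cc_mult continuous_comp phi continuous_intros)
 note int = Cc_integrable[OF shifted] Cc_integrable[OF this] Cc_integrable[OF Cc_mult[OF continuous phi]]
 have "(LINT x. diff_quot f e x h * phi x) = ((LINT x. f (x + h *R e) * phi x) - (LINT x. f x * phi x)) / h"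
  using int by (simp add: diff_quot_def left_diff_distrib)
 also have "(LINT x. f (x + h *R e) * phi x) = (LINT x. f x * phi (x - h *R e))"
  using integral_translate[OF Cc_borel[OF shifted], of "h *R e"] by simp
 also have "((LINT x. f x * phi (x - h *R e)) - (LINT x. f x * phi x)) / h =
   (LINT x. f x * diff_quot phi (- e) x h)" using int by (simp add: diff_quot_def right_diff_distrib)
 finally show ?thesis .
qed

lemma diff_quot_test_fun_tendsto:
 assumes phi: "test_fun UNIV phi"
 shows "(%k. LINT x. f x * diff_quot phi e x (1 / Suc k)) ----> (LINT x. f x * pd phi e x)"
proof -
 note C = test_fun_C1[OF phi]
 obtain r where r: "r > 0" "!!x. norm x > r ==> phi x = 0" using Cc_supportE[OF test_fun_Cc[OF phi]] by blast
 obtain M where "lipschitz_fun phi M" using test_fun_lipschitzE[OF phi] .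
 then interpret phi: lipschitz_fun phi M .
 define B where "B = cball (0 :: 'a) (r + norm e)"
 have bound: "abs (diff_quot phi e x h) <= indicator B x * (M * norm e)" if h: "0 < h" "h <= 1" for x h
 proof (cases "x : B")
  case True
  thus ?thesis using phi.diff_quot_bound[of e x h] by simp
 next
  case False
  have "norm (h *R e) <= norm e" using h by (simp add: mult_left_le_one_le)
  moreover have "norm x <= norm (x + h *R e) + norm (h *R e)" using norm_triangle_ineq4[of "x + h *R e" "h *R e"] by simp
  moreover have "norm x > r + norm e" using False by (simp add: B_def)
  ultimately have "norm x > r" "norm (x + h *R e) > r" using norm_ge_zero[of e] by linarith+
  thus ?thesis using r(2) False by (simp add: diff_quot_def)
 qed
 have dominating: "integrable lebesgue (%x. indicator B x * (abs (f x) * (M * norm e)))"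
 proof -
  have "integrable lborel (%x. indicator B x *R (abs (f x) * (M * norm e)))"
   unfolding B_def by (intro borel_integrable_compact continuous_intros continuous) auto
  thus ?thesis by (subst integrable_completion) (auto dest: borel_measurable_integrable)
 qed
 show ?thesis
 proof (rule integral_dominated_convergence[OF _ _ dominating])
  show "AE x in lebesgue. (%k. f x * diff_quot phi e x (1 / Suc k)) ----> f x * pd phi e x"
  proof (intro AE_I2 tendsto_intros)
   fix x
   have "((%s. x + s *R e) has_derivative (%s. s *R e)) (at 0)" by (auto intro!: derivative_eq_intros)
   from has_derivative_compose[OF this C1_has_derivative[OF C]]
   have "((%s. phi (x + s *R e)) has_real_derivative pd phi e x) (at 0)"
    by (simp add: has_field_derivative_def pd_scale_dir[OF C] mult.commute[of _ "pd phi e _"])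
   hence "(diff_quot phi e x ---> pd phi e x) (at 0)" by (simp add: DERIV_def diff_quot_def[abs_def])
   from filterlim_compose[OF this one_over_Suc_at_right_0[THEN filterlim_mono[OF _ at_le order_refl]]]
   show "(%k. diff_quot phi e x (1 / Suc k)) ----> pd phi e x" by simp
  qed
  show "AE x in lebesgue. norm (f x * diff_quot phi e x (1 / Suc k)) <= indicator B x * (abs (f x) * (M * norm e))" for k
   using mult_left_mono[OF bound[of "1 / Suc k"] abs_ge_zero] by (intro AE_I2) (simp add: abs_mult mult.left_commute)
 qed (intro lebesgue_if_borel borel_measurable_times phi.diff_quot_borel
   borel_measurable_continuous_onI[OF continuous] Cc_borel[OF pd_test_fun_Cc[OF phi]])+
qed

lemma dir_deriv_weak:
 assumes phi: "test_fun UNIV phi"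
 shows "(LINT x. f x * pd phi e x) = - (LINT x. dir_deriv f e x * phi x)"
proof -
 note Cc_phi = test_fun_Cc[OF phi]
 have "(%k. LINT x. diff_quot f e x (1 / Suc k) * phi x) ----> (LINT x. dir_deriv f e x * phi x)"
 proof (rule integral_dominated_convergence[where w = "%x. (L * norm e) * abs (phi x)"])
  have [measurable]: "phi : borel_measurable lebesgue" using Cc_borel[OF Cc_phi] by measurable
  show "(%x. dir_deriv f e x * phi x) : borel_measurable lebesgue" using dir_deriv_lebesgue by measurable
  show "(%x. diff_quot f e x (1 / Suc k) * phi x) : borel_measurable lebesgue" for k
   using lebesgue_if_borel[OF diff_quot_borel] by measurable
  show "integrable lebesgue (%x. (L * norm e) * abs (phi x))" using Cc_integrable[OF Cc_phi] by simp
  show "AE x in lebesgue. (%k. diff_quot f e x (1 / Suc k) * phi x) ----> dir_deriv f e x * phi x"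
   using AE_dir_deriv_tendsto[of e] by eventually_elim (intro tendsto_intros)
  show "AE x in lebesgue. norm (diff_quot f e x (1 / Suc k) * phi x) <= L * norm e * abs (phi x)" for k
   using diff_quot_bound by (intro AE_I2) (simp add: abs_mult mult_right_mono)
 qed
 from LIMSEQ_unique[OF this[unfolded integral_diff_quot_mult[OF Cc_phi]] diff_quot_test_fun_tendsto[OF phi]]
 show ?thesis using pd_scale_dir[OF test_fun_C1[OF phi], of "-1" e] by simp
qed

lemma AE_dir_deriv_linear: "AE x in lebesgue. dir_deriv f e x = (SUM b:Basis. (e <.> b) * dir_deriv f b x)"
proof -
 define w where "w x = dir_deriv f e x - (SUM b:Basis. (e <.> b) * dir_deriv f b x)" for x
 have "AE x in lebesgue. x : ball 0 (real n) --> w x = 0" for n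
 proof -
  let ?S = "ball (0 :: 'a) (real n)"
  have L1: "L1_on ?S (dir_deriv f b)" for b using integrable_dir_deriv_mult[of "indicator ?S" b] emeasure_bounded_finite[of ?S]
   by (simp add: L1_indicator[symmetric] mult.commute less_top integrable_real_indicator)
  have "AE x in leb ?S. w x = 0"
  proof (rule AE_zero_if_orthogonal_test_fun)
   show "L1_on ?S w" unfolding w_def by (intro integrable_diff integrable_sum integrable_mult_right L1)
   fix phi :: "'a => real" assume phi: "test_fun ?S phi"
   hence phi_UNIV: "test_fun UNIV phi" by (rule test_fun_mono) simp
   obtain K where "K <= ?S" "!!x. x ~: K ==> phi x = 0" using test_fun_supportE[OF phi] by metis
   hence "phi x = 0" if "x ~: ?S" for x using that by blast
   hence "ip ?S w phi = (LINT x. w x * phi x)" by (intro int_on_UNIV) simp_all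
   also have "... = (LINT x. dir_deriv f e x * phi x) - (SUM b:Basis. (e <.> b) * (LINT x. dir_deriv f b x * phi x))"
    using integrable_dir_deriv_mult[OF Cc_integrable[OF test_fun_Cc[OF phi]]]
    by (simp add: w_def left_diff_distrib sum_distrib_right mult.assoc integral_sum)
   also have "... = - (LINT x. f x * pd phi e x) + (SUM b:Basis. (e <.> b) * (LINT x. f x * pd phi b x))"
    unfolding dir_deriv_weak[OF phi_UNIV] by (simp add: sum_negf)
   also have "(SUM b:Basis. (e <.> b) * (LINT x. f x * pd phi b x)) = (LINT x. (SUM b:Basis. (e <.> b) * (f x * pd phi b x)))"
    using Cc_integrable[OF Cc_mult[OF continuous pd_test_fun_Cc[OF phi]]] by (subst integral_sum) auto
   also have "... = (LINT x. f x * pd phi e x)"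
    by (subst (2) pd_basis_expand[OF test_fun_C1[OF phi]]) (simp add: sum_distrib_left mult_ac)
   finally show "ip ?S w phi = 0" by simp
  qed simp
  thus ?thesis by (simp add: AE_on_iff)
 qed
 hence "AE x in lebesgue. ALL n. x : ball 0 (real n) --> w x = 0" unfolding AE_all_countable by blast
 thus ?thesis
 proof eventually_elim
  case (elim x)
  obtain n where "norm x < real n" using reals_Archimedean2 by blast
  thus ?case using elim by (auto simp: w_def)
 qed
qed

text \<open>By the Lipschitz bound, difference quotients along the steps \<open>1 / Suc k\<close> in finitely many
 directions control the increments of \<open>f\<close> in all directions.\<close>

lemma has_derivative_if_dense_dir_derivs:
 assumes dense: "!!X. open X ==> X ~= {} ==> EX d:D. d : X"
  and lim: "!!d. d : D ==> (%k. diff_quot f d x (1 / Suc k)) ----> G <.> d"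
 shows "(f has_derivative (%h. G <.> h)) (at x)" unfolding has_derivative_at_alt
proof (intro conjI allI impI)
 show "bounded_linear (%h. G <.> h)" by (rule bounded_linear_inner_right)
 fix eps :: real assume eps: "eps > 0"
 define M where "M = 3 * (L + norm G) + 1"
 define c where "c = min 1 (eps / M)"
 have M: "M > 0" by (simp add: M_def add_nonneg_pos const_nonneg)
 with eps have c: "0 < c" "c <= 1" "M * c <= eps" by (auto simp: c_def min_def field_simps)
 have "sphere (0 :: 'a) 1 <= (UN d:D. ball d c)"
 proof
  fix u :: 'a
  obtain d where "d : D" "d : ball u c" using dense[of "ball u c"] c by auto
  thus "u : (UN d:D. ball d c)" by (auto simp: dist_commute)
 qed
 then obtain D' where D': "D' <= D" "finite D'" "sphere (0 :: 'a) 1 <= (UN d:D'. ball d c)"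
  using compactE_image[OF compact_sphere, of D "%d. ball d c" "0 :: 'a" 1] by auto
 have "EV k. ALL d:D'. abs (diff_quot f d x (1 / Suc k) - G <.> d) < c"
  using D' tendstoD[OF lim c(1)] by (intro eventually_ball_finite) (auto simp: dist_real_def)
 then obtain K where K: "!!k d. k >= K ==> d : D' ==> abs (diff_quot f d x (1 / Suc k) - G <.> d) < c"
  unfolding eventually_sequentially by blast
 define s0 where "s0 = min c (1 / Suc K)"
 have "norm (f y - f x - G <.> (y - x)) <= eps * norm (y - x)" if y: "norm (y - x) < s0" for y
 proof (cases "y = x")
  case False
  define h where "h = norm (y - x)"
  have h: "0 < h" "h < c" "h < 1 / Suc K" using False y by (auto simp: h_def s0_def)
  define u where "u = (y - x) /\<^sub>R h"
  have u: "norm u = 1" "y = x + h *R u" using h by (auto simp: u_def h_def)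
  then obtain d where d: "d : D'" "norm (u - d) < c" using D'(3) by (auto simp: dist_norm norm_minus_commute)
  define k where "k = nat \<lfloor>1 / h\<rfloor>"
  have k: "real k <= 1 / h" "1 / h < real (Suc k)" using h(1) by (simp_all add: k_def) linarith
  define s where "s = 1 / real (Suc k)"
  have s: "0 < s" "s <= h" using k(2) h(1) by (auto simp: s_def field_simps)
  have "h * real k <= 1" using k(1) h(1) by (simp add: field_simps)
  hence "h <= s + h * s" by (simp add: s_def field_simps)
  hence hs: "h - s <= h * c" using s h mult_left_mono[of s c h] by linarith
  have "real (Suc K) < 1 / h" using h(1,3) by (simp add: field_simps)
  hence "K <= k" using k(2) by simp
  have "norm (h *R u - s *R d) = norm (h *R (u - d) + (h - s) *R d)" by (simp add: algebra_simps)
  also have "... <= h * norm (u - d) + (h - s) * norm d" using norm_triangle_ineq[of "h *R (u - d)" "(h - s) *R d"] h s by simp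
  also have "... <= h * c + (h * c) * 2"
  proof (intro add_mono mult_mono hs)
   show "norm d <= 2" using norm_triangle_ineq4[of u "u - d"] u(1) d(2) c(2) by simp
  qed (use h c d in auto)
  finally have dist: "norm (h *R u - s *R d) <= 3 * c * h" by simp
  have "abs (f y - f (x + s *R d)) <= L * (3 * c * h)"
   using lip[of y "x + s *R d"] mult_left_mono[OF dist const_nonneg] by (simp add: u(2))
  moreover have "abs (f (x + s *R d) - f x - s * (G <.> d)) <= c * h"
  proof -
   have "f (x + s *R d) - f x - s * (G <.> d) = s * (diff_quot f d x s - G <.> d)"
    using s(1) by (simp add: diff_quot_def field_simps)
   also have "abs (...) <= h * c"
    unfolding abs_mult using s K[OF \<open>K <= k\<close> d(1)] less_imp_le[OF order_less_le_trans[OF s(1,2)]]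
    by (intro mult_mono) (simp_all add: s_def)
   finally show ?thesis by (simp add: mult.commute)
  qed
  moreover have "abs (s * (G <.> d) - G <.> (y - x)) <= norm G * (3 * c * h)"
   using Cauchy_Schwarz_ineq2[of G "s *R d - h *R u"] mult_left_mono[OF dist norm_ge_zero[of G]]
   by (simp add: u(2) inner_diff_right norm_minus_commute)
  ultimately have "abs (f y - f x - G <.> (y - x)) <= L * (3 * c * h) + c * h + norm G * (3 * c * h)" by linarith
  also have "... = M * c * h" by (simp add: M_def algebra_simps)
  also have "... <= eps * h" using c(3) h(1) by (intro mult_right_mono) auto
  finally show ?thesis by (simp add: h_def)
 qed simp
 moreover have "s0 > 0" using c by (simp add: s0_def)
 ultimately show "EX d > 0. ALL y. norm (y - x) < d --> norm (f y - f x - G <.> (y - x)) <= eps * norm (y - x)" by blast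
qed

theorem Rademacher: "AE x in lebesgue. f differentiable (at x) & (ALL e. pd f e x = (SUM b:Basis. (e <.> b) * dir_deriv f b x))"
proof -
 obtain D :: "'a set" where D: "countable D" "!!X. open X ==> X ~= {} ==> EX d:D. d : X" using countable_dense_exists by metis
 have "AE x in lebesgue. (%k. diff_quot f e x (1 / Suc k)) ----> (SUM b:Basis. (e <.> b) * dir_deriv f b x)" for e
  using AE_dir_deriv_tendsto[of e] AE_dir_deriv_linear[of e] by eventually_elim simp
 hence "AE x in lebesgue. ALL e:D. (%k. diff_quot f e x (1 / Suc k)) ----> (SUM b:Basis. (e <.> b) * dir_deriv f b x)"
  by (simp add: AE_ball_countable[OF D(1)])
 thus ?thesis
 proof eventually_elim
  case (elim x)
  define G where "G = (SUM b:Basis. dir_deriv f b x *R b)"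
  have G: "G <.> e = (SUM b:Basis. (e <.> b) * dir_deriv f b x)" for e
   unfolding G_def inner_sum_left by (intro sum.cong) (auto simp: inner_commute)
  have "(f has_derivative (%h. G <.> h)) (at x)"
   by (rule has_derivative_if_dense_dir_derivs[OF D(2)]) (use elim in "auto simp: G")
  thus ?case using pd_eqI[of f "%h. G <.> h" x] by (auto intro: differentiableI simp: G)
 qed
qed

lemma AE_differentiable: "AE x in lebesgue. f differentiable (at x)" using Rademacher by eventually_elim simp

lemma AE_pd_eq_dir_deriv: "AE x in lebesgue. pd f e x = dir_deriv f e x"
 using Rademacher AE_dir_deriv_linear[of e] by eventually_elim simp

lemma pd_lebesgue: "pd f e : borel_measurable lebesgue"
 using dir_deriv_lebesgue lebesgue_cong_AE(1)[OF AE_pd_eq_dir_deriv] by blast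

lemma AE_pd_bound: "AE x in lebesgue. abs (pd f e x) <= L * norm e"
 using AE_pd_eq_dir_deriv[of e] AE_dir_deriv_bound[of e] by eventually_elim simp

lemma pd_weak:
 assumes "test_fun UNIV phi"
 shows "(LINT x. f x * pd phi e x) = - (LINT x. pd f e x * phi x)"
proof -
 have "AE x in lebesgue. pd f e x * phi x = dir_deriv f e x * phi x" using AE_pd_eq_dir_deriv[of e] by eventually_elim simp
 from lebesgue_cong_AE(3)[OF this] dir_deriv_weak[OF assms, of e] show ?thesis by simp
qed

end

lemma integral_pd_test_fun:
 assumes "test_fun UNIV phi" shows "(LINT x. pd phi e x) = 0"
proof -
 interpret one: lipschitz_fun "%_. 1 :: real" 0 by unfold_locales simp
 have "pd (%_ :: 'a. 1) e x = 0" for x by (rule pd_eqI[OF has_derivative_const])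
 thus ?thesis using one.pd_weak[OF assms, of e] by simp
qed

lemma integration_by_parts:
 assumes phi: "test_fun S phi" and psi: "C1 psi"
 shows "(LINT x. psi x * pd phi e x) = - (LINT x. pd psi e x * phi x)"
proof -
 have product: "test_fun UNIV (%x. phi x * psi x)" using test_fun_mult_C1[OF phi psi] by (rule test_fun_mono) simp
 note int = Cc_integrable[OF Cc_mult[OF C1_continuous[OF psi] pd_test_fun_Cc[OF phi]]]
  Cc_integrable[OF Cc_mult[OF C1_continuous_pd[OF psi] test_fun_Cc[OF phi]]]
 have "0 = (LINT x. pd (%x. phi x * psi x) e x)" by (simp add: integral_pd_test_fun[OF product])
 also have "... = (LINT x. pd psi e x * phi x + psi x * pd phi e x)"
  using pd_mult[OF test_fun_C1[OF phi] psi] by (simp add: mult.commute)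
 also have "... = (LINT x. pd psi e x * phi x) + (LINT x. psi x * pd phi e x)" using int by simp
 finally show ?thesis by simp
qed

lemma L2_tendsto_le:
 assumes "!!k. (LINT x|M. (G k x - g x)^2) <= C k" "C ----> 0"
 shows "L2_tendsto M G g" unfolding L2_tendsto_def
 by (rule tendsto_sandwich[OF _ _ tendsto_const assms(2)]) (simp_all add: assms(1))

lemma L2_tendsto_bounded_mult:
 assumes F: "!!k. sq_integrable M (F k)" "sq_integrable M f" "L2_tendsto M F f"
  and m: "m : borel_measurable M" "AE x in M. abs (m x) <= C"
 shows "L2_tendsto M (%k x. m x * F k x) (%x. m x * f x)"
proof (rule L2_tendsto_le)
 fix k
 note diff = L2_diff[OF F(1) F(2), of k]
 have "(LINT x|M. (m x * F k x - m x * f x)^2) <= (LINT x|M. C^2 * (F k x - f x)^2)"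
 proof (rule integral_mono_AE)
  show "integrable M (%x. (m x * F k x - m x * f x)^2)"
   using L2_square_integrable[OF L2_bounded_mult[OF diff m]] by (simp add: right_diff_distrib)
  show "AE x in M. (m x * F k x - m x * f x)^2 <= C^2 * (F k x - f x)^2" using m(2)
  proof eventually_elim
   case (elim x)
   from power_mono[OF this, of 2] show ?case by (simp add: right_diff_distrib[symmetric] power_mult_distrib mult_right_mono)
  qed
 qed (use L2_square_integrable[OF diff] in simp)
 thus "(LINT x|M. (m x * F k x - m x * f x)^2) <= C^2 * (LINT x|M. (F k x - f x)^2)" by simp
next
 show "(%k. C^2 * (LINT x|M. (F k x - f x)^2)) ----> 0" using F(3) unfolding L2_tendsto_def by (rule tendsto_mult_right_zero)
qed

lemma L2_tendsto_add:
 assumes F: "!!k. sq_integrable M (F k)" "sq_integrable M f" "L2_tendsto M F f"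
  and G: "!!k. sq_integrable M (G k)" "sq_integrable M g" "L2_tendsto M G g"
 shows "L2_tendsto M (%k x. F k x + G k x) (%x. f x + g x)"
proof (rule L2_tendsto_le)
 show "(LINT x|M. (F k x + G k x - (f x + g x))^2) <= 2 * (LINT x|M. (F k x - f x)^2) + 2 * (LINT x|M. (G k x - g x)^2)" for k
  using integral_square_add_le[OF L2_diff[OF F(1,2)] L2_diff[OF G(1,2)], of k k] by (simp add: algebra_simps)
 show "(%k. 2 * (LINT x|M. (F k x - f x)^2) + 2 * (LINT x|M. (G k x - g x)^2)) ----> 0"
  using F(3) G(3) unfolding L2_tendsto_def by (auto intro!: tendsto_eq_intros)
qed

lemma L2_tendsto_sum:
 assumes "!!i k. i : I ==> sq_integrable M (F i k)" "!!i. i : I ==> sq_integrable M (f i)"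
  "!!i. i : I ==> L2_tendsto M (F i) (f i)"
 shows "L2_tendsto M (%k x. SUM i:I. F i k x) (%x. SUM i:I. f i x)" using assms
proof (induction I rule: infinite_finite_induct)
 case (insert i I)
 thus ?case by (simp add: L2_tendsto_add L2_sum)
qed (simp_all add: L2_tendsto_def)

lemma L2_on_continuous:
 assumes g: "continuous_on (closure S) g" and S: "bounded S" "S : sets lebesgue"
 shows "L2_on S g"
proof -
 have closure: "compact (closure S)" using S(1) by simp
 from compact_imp_bounded[OF compact_continuous_image[OF g this]]
 obtain C where C: "!!x. x : closure S ==> abs (g x) <= C" by (auto simp: bounded_iff)
 have "g : borel_measurable (leb (closure S))"
  using g closure by (intro continuous_imp_measurable_on_sets_lebesgue lebesgue_compact)
 hence "g : borel_measurable (leb S)" using closure_subset by (rule measurable_restrict_mono)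
 moreover have "AE x in leb S. abs (g x) <= C" using C closure_subset[of S] by (auto simp: AE_on_iff[OF S(2)])
 ultimately show ?thesis by (rule finite_measure.L2_bounded[OF finite_measure_lebesgue_on_bounded[OF S(2,1)]])
qed

lemma L2_on_C1:
 assumes "C1 psi" "bounded S" "S : sets lebesgue"
 shows "L2_on S psi" "L2_on S (pd psi e)"
 using assms continuous_on_subset[OF C1_continuous] continuous_on_subset[OF C1_continuous_pd] by (auto intro!: L2_on_continuous)

lemma AE_eq_if_pairing_eq:
 assumes S: "open S" "bounded S" and f: "L2_on S f" and g: "L2_on S g" and eq: "!!phi. test_fun S phi ==> ip S f phi = ip S g phi"
 shows "AE x in leb S. f x = g x"
proof -
 note Sm = lebesgue_open[OF S(1)]
 have "AE x in leb S. f x - g x = 0"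
 proof (rule AE_zero_if_orthogonal_test_fun[OF S(1)])
  show "L1_on S (%x. f x - g x)" by (intro L1_on_if_L2_on Sm S(2) L2_diff f g)
  fix phi assume phi: "test_fun S phi"
  note phi_L2 = test_fun_L2_on[OF phi Sm]
  show "ip S (%x. f x - g x) phi = 0" using L2_mult[OF f phi_L2] L2_mult[OF g phi_L2] eq[OF phi] by (simp add: left_diff_distrib)
 qed
 thus ?thesis by eventually_elim simp
qed

lemma weak_deriv_unique:
 assumes S: "open S" "bounded S" and h: "L2_on S h" "L2_on S h'" and d: "weak_dir_deriv S w e h" "weak_dir_deriv S w e h'"
 shows "AE x in leb S. h x = h' x" using d unfolding weak_dir_deriv_iff[OF lebesgue_open[OF S(1)]]
 by (intro AE_eq_if_pairing_eq[OF S h]) (metis neg_equal_iff_equal)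

lemma weak_deriv_cong_AE:
 assumes S: "S : sets lebesgue" and d: "weak_dir_deriv S w e h" and ae: "AE x in leb S. w x = w' x" "AE x in leb S. h x = h' x"
 shows "weak_dir_deriv S w' e h'"
proof -
 have "ip S f phi = ip S f' phi" if "AE x in leb S. f x = f' x" for f f' phi
  by (rule int_on_cong_AE[OF S]) (use that in eventually_elim, simp)
 from this[OF ae(1)] this[OF ae(2)] d show ?thesis unfolding weak_dir_deriv_iff[OF S] by simp
qed

lemma weak_deriv_subset:
 assumes S: "S : sets lebesgue" "S' : sets lebesgue" "S' <= S" and d: "weak_dir_deriv S w e h"
 shows "weak_dir_deriv S' w e h" unfolding weak_dir_deriv_iff[OF S(2)]
proof (intro allI impI)
 fix phi assume phi: "test_fun S' phi"
 obtain K where K: "K <= S'" "!!x. x ~: K ==> phi x = 0" "!!x e. x ~: K ==> pd phi e x = 0"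
  using test_fun_supportE[OF phi] by metis
 have "ip S' f g = ip S f g" if "!!x. x ~: K ==> g x = 0" for f g :: "'a => real"
  by (rule int_on_superset[OF S]) (use K(1) that in auto)
 thus "ip S' w (pd phi e) = - ip S' h phi" using d test_fun_mono[OF phi S(3)] K(2,3) unfolding weak_dir_deriv_iff[OF S(1)] by simp
qed

lemma weak_deriv_diff:
 assumes S: "S : sets lebesgue" and s: "L2_on S w" "L2_on S h" "L2_on S w'" "L2_on S h'"
 and d: "weak_dir_deriv S w e h" "weak_dir_deriv S w' e h'"
 shows "weak_dir_deriv S (%x. w x - w' x) e (%x. h x - h' x)" unfolding weak_dir_deriv_iff[OF S]
proof (intro allI impI)
 fix phi assume t: "test_fun S phi"
 note p = test_fun_L2_on[OF t S] and q = Cc_L2_on[OF pd_test_fun_Cc[OF t, of e] S]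
 show "ip S (%x. w x - w' x) (pd phi e) = - (ip S (%x. h x - h' x) phi)"
  using d t L2_mult[OF s(1) q] L2_mult[OF s(3) q] L2_mult[OF s(2) p] L2_mult[OF s(4) p]
  unfolding weak_dir_deriv_iff[OF S] by (simp add: left_diff_distrib)
qed

lemma C1_weak_deriv:
 assumes S: "S : sets lebesgue" and psi: "C1 psi"
 shows "weak_dir_deriv S psi e (pd psi e)"
proof -
 have "weak_dir_deriv UNIV psi e (pd psi e)" using integration_by_parts[OF _ psi] by (simp add: weak_dir_deriv_def)
 thus ?thesis by (rule weak_deriv_subset[rotated 3]) (use S in auto)
qed

lemma weak_deriv_lipschitz_mult_C1:
 assumes m: "lipschitz_fun m L" and psi: "C1 psi" and S: "S : sets lebesgue"
 shows "weak_dir_deriv S (%x. m x * psi x) e (%x. m x * pd psi e x + pd m e x * psi x)"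
proof -
 interpret m: lipschitz_fun m L by (rule m)
 have "weak_dir_deriv UNIV (%x. m x * psi x) e (%x. m x * pd psi e x + pd m e x * psi x)" unfolding weak_dir_deriv_def
 proof (intro allI impI)
  fix phi :: "'a => real" assume phi: "test_fun UNIV phi"
  note C = test_fun_C1[OF phi]
  note prod = test_fun_mult_C1[OF phi psi]
  have int: "integrable lebesgue (%x. m x * psi x * pd phi e x)" "integrable lebesgue (%x. m x * pd psi e x * phi x)"
   by (intro Cc_integrable Cc_mult[OF _ pd_test_fun_Cc[OF phi]] Cc_mult[OF _ test_fun_Cc[OF phi]]
    continuous_on_mult m.continuous C1_continuous C1_continuous_pd psi)+
  have int': "integrable lebesgue (%x. pd m e x * (phi x * psi x))"
  proof (rule integrable_bound)
   show "integrable lebesgue (%x. (L * norm e) * (phi x * psi x))" using Cc_integrable[OF test_fun_Cc[OF prod]] by simp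
   show "AE x in lebesgue. norm (pd m e x * (phi x * psi x)) <= norm (L * norm e * (phi x * psi x))"
    using m.AE_pd_bound[of e] by eventually_elim (simp add: abs_mult mult_right_mono m.const_nonneg)
  qed (use m.pd_lebesgue Cc_integrable[OF test_fun_Cc[OF prod]] in measurable)
  have "(LINT x. m x * pd (%x. phi x * psi x) e x) = (LINT x. m x * psi x * pd phi e x + m x * pd psi e x * phi x)"
   by (intro integral_cong) (simp_all add: pd_mult[OF C psi] algebra_simps)
  hence "(LINT x. m x * psi x * pd phi e x) = - (LINT x. m x * pd psi e x * phi x) -
    (LINT x. pd m e x * (phi x * psi x))" using m.pd_weak[OF prod, of e] int by simp
  also have "... = - (LINT x. (m x * pd psi e x + pd m e x * psi x) * phi x)"
   using integral_add[OF int(2) int'] by (simp add: algebra_simps)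
  finally show "(LINT x. indicator UNIV x * (m x * psi x) * pd phi e x) =
    - (LINT x. indicator UNIV x * (m x * pd psi e x + pd m e x * psi x) * phi x)" by simp
 qed
 thus ?thesis by (rule weak_deriv_subset[rotated 3]) (use S in auto)
qed

lemma weak_deriv_limit:
 assumes S: "S : sets lebesgue" and d: "!!k. weak_dir_deriv S (W k) e (H k)"
  and L2: "!!K k. compact K ==> K <= S ==> L2_on K (W k)" "!!K k. compact K ==> K <= S ==> L2_on K (H k)"
   "L2_on S w" "L2_on S h" and lim: "!!K. compact K ==> K <= S ==> L2_tendsto (leb K) W w"
   "!!K. compact K ==> K <= S ==> L2_tendsto (leb K) H h"
 shows "weak_dir_deriv S w e h" unfolding weak_dir_deriv_iff[OF S]
proof (intro allI impI)
 fix phi assume phi: "test_fun S phi"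
 obtain K where K: "compact K" "K <= S" and zero: "!!x. x ~: K ==> phi x = 0" "!!x e. x ~: K ==> pd phi e x = 0"
  using test_fun_supportE[OF phi] by metis
 note Km = lebesgue_compact[OF K(1)]
 have onK: "ip S f g = ip K f g" if "!!x. x ~: K ==> g x = 0" for g f :: "'a => real"
  by (rule int_on_superset[OF S Km K(2), symmetric]) (use that in simp)
 note phi_L2 = test_fun_L2_on[OF phi Km] pd_test_fun_L2_on[OF phi Km]
 have "(%k. ip K (W k) (pd phi e)) ----> ip K w (pd phi e)"
  by (intro L2_tendsto_integral_mult L2(1) lim(1) K phi_L2 L2_on_subset[OF S Km K(2) L2(3)])
 moreover have "(%k. - ip K (H k) phi) ----> - ip K h phi"
  by (intro tendsto_minus L2_tendsto_integral_mult L2(2) lim(2) K phi_L2 L2_on_subset[OF S Km K(2) L2(4)])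
 moreover have "ip K (W k) (pd phi e) = - ip K (H k) phi" for k
  using d[of k, unfolded weak_dir_deriv_iff[OF S], rule_format, OF phi]
  by (simp add: onK[of "pd phi e", OF zero(2)] onK[of phi, OF zero(1)])
 ultimately have "ip K w (pd phi e) = - ip K h phi" using LIMSEQ_unique by simp
 thus "ip S w (pd phi e) = - ip S h phi" by (simp add: onK zero)
qed

lemma (in lipschitz_fun) bounded_on:
 assumes "bounded S" obtains C where "C > 0" "!!x. x : S ==> abs (f x) <= C"
proof -
 obtain r where r: "r > 0" "!!x. x : S ==> norm x <= r" using assms by (auto simp: bounded_pos)
 have "abs (f x) <= abs (f 0) + L * r + 1" if "x : S" for x
  using lip[of x 0] mult_left_mono[OF r(2)[OF that] const_nonneg] by auto
 moreover have "abs (f 0) + L * r + 1 > 0" using const_nonneg r(1) by (simp add: add_nonneg_pos)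
 ultimately show ?thesis using that by blast
qed

lemma (in lipschitz_fun) AE_on_pd_bound: "S : sets lebesgue ==> AE x in leb S. abs (pd f e x) <= L * norm e"
 using AE_pd_bound[of e] by (auto simp: AE_on_iff elim: eventually_mono)

lemma (in lipschitz_fun) measurable_on: "f : borel_measurable (leb S)" "pd f e : borel_measurable (leb S)"
 by (intro measurable_restrict_space1 pd_lebesgue lebesgue_if_borel borel_measurable_continuous_onI continuous)+

lemma (in lipschitz_fun) L2_on_mult:
 assumes "S : sets lebesgue" "bounded S" "L2_on S w"
 shows "L2_on S (%x. f x * w x)" "L2_on S (%x. pd f e x * w x)"
proof -
 obtain C where "!!x. x : S ==> abs (f x) <= C" using bounded_on[OF assms(2)] by blast
 thus "L2_on S (%x. f x * w x)" using assms by (intro L2_bounded_mult[OF _ measurable_on(1)]) (auto simp: AE_on_iff)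
 show "L2_on S (%x. pd f e x * w x)" by (rule L2_bounded_mult[OF assms(3) measurable_on(2) AE_on_pd_bound[OF assms(1)]])
qed

lemma (in lipschitz_fun) L2_tendsto_mult:
 assumes S: "S : sets lebesgue" "bounded S" and F: "!!k. L2_on S (F k)" "L2_on S w" "L2_tendsto (leb S) F w"
 shows "L2_tendsto (leb S) (%k x. f x * F k x) (%x. f x * w x)"
  and "L2_tendsto (leb S) (%k x. pd f e x * F k x) (%x. pd f e x * w x)"
proof -
 obtain C where "!!x. x : S ==> abs (f x) <= C" using bounded_on[OF S(2)] by blast
 thus "L2_tendsto (leb S) (%k x. f x * F k x) (%x. f x * w x)"
  by (intro L2_tendsto_bounded_mult[OF F measurable_on(1)]) (auto simp: AE_on_iff[OF S(1)])
 show "L2_tendsto (leb S) (%k x. pd f e x * F k x) (%x. pd f e x * w x)"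
  by (rule L2_tendsto_bounded_mult[OF F measurable_on(2) AE_on_pd_bound[OF S(1)]])
qed

lemma weak_deriv_lipschitz_mult:
 assumes S: "open S" "bounded S" and m: "lipschitz_fun m L" and w: "L2_on S w" "L2_on S h" and d: "weak_dir_deriv S w e h"
 shows "weak_dir_deriv S (%x. m x * w x) e (%x. m x * h x + pd m e x * w x)"
proof (rule weak_deriv_limit)
 interpret m: lipschitz_fun m L by (rule m)
 let ?W = "mollify S w"
 note Sm = lebesgue_open[OF S(1)]
 show "S : sets lebesgue" by (rule Sm)
 have C: "C1 (?W k)" for k by (rule C1_mollify[OF Sm L1_on_if_L2_on[OF Sm S(2) w(1)]])
 show "weak_dir_deriv S (%x. m x * ?W k x) e (%x. m x * pd (?W k) e x + pd m e x * ?W k x)" for k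
  by (rule weak_deriv_lipschitz_mult_C1[OF m C Sm])
 show "L2_on S (%x. m x * w x)" "L2_on S (%x. m x * h x + pd m e x * w x)" by (intro L2_add m.L2_on_mult Sm S w)+
 fix K assume K: "compact K" "K <= S"
 note Kb = compact_imp_bounded[OF K(1)] and Km = lebesgue_compact[OF K(1)]
 note wK = L2_on_subset[OF Sm Km K(2) w(1)] L2_on_subset[OF Sm Km K(2) w(2)] L2_on_C1[OF C Kb Km]
 note lim = mollify_L2_tendsto(2)[OF Sm S(2) Km K(2) w(1)] pd_mollify_L2_tendsto[OF S w d K]
 show "L2_on K (%x. m x * ?W k x)" "L2_on K (%x. m x * pd (?W k) e x + pd m e x * ?W k x)" for k
  by (intro L2_add m.L2_on_mult Km Kb wK)+
 show "L2_tendsto (leb K) (%k x. m x * ?W k x) (%x. m x * w x)" by (rule m.L2_tendsto_mult[OF Km Kb wK(3) wK(1) lim(1)])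
 show "L2_tendsto (leb K) (%k x. m x * pd (?W k) e x + pd m e x * ?W k x) (%x. m x * h x + pd m e x * w x)"
  by (intro L2_tendsto_add m.L2_on_mult m.L2_tendsto_mult Km Kb wK lim)
qed

lemma is_wgrad_iff:
 assumes "open S"
 shows "is_wgrad S w G <-> (ALL i. L2_on S (%x. G x $ i) & weak_dir_deriv S w (axis i 1) (%x. G x $ i))"
 unfolding is_wgrad_def using assms by (simp add: L2_iff)

lemma is_wgrad_wgrad: "is_wgrad S w G ==> is_wgrad S w (wgrad S w)" using someI[of "is_wgrad S w"] by (simp add: wgrad_def)

lemma is_wgrad_unique:
 assumes S: "open S" "bounded S" and "is_wgrad S w G" "is_wgrad S w G'"
 shows "AE x in leb S. G x = G' x"
proof -
 have "AE x in leb S. G x $ i = G' x $ i" for i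
  using assms(3, 4) by (intro weak_deriv_unique[OF S, of _ _ w "axis i 1"]) (auto simp: is_wgrad_iff[OF S(1)])
 hence "AE x in leb S. ALL i. G x $ i = G' x $ i" unfolding AE_all_countable by blast
 thus ?thesis by eventually_elim (simp add: vec_eq_iff)
qed

lemma is_wgrad_cong_AE:
 assumes S: "open S" and G: "is_wgrad S w G" and ae: "AE x in leb S. w x = w' x" "AE x in leb S. G x = G' x"
 shows "is_wgrad S w' G'" unfolding is_wgrad_iff[OF S]
proof (intro allI conjI)
 fix i
 have G_ae: "AE x in leb S. G x $ i = G' x $ i" using ae(2) by eventually_elim simp
 show "L2_on S (%x. G' x $ i)" using G L2_on_cong_AE[OF lebesgue_open[OF S] G_ae] by (simp add: is_wgrad_iff[OF S])
 show "weak_dir_deriv S w' (axis i 1) (%x. G' x $ i)"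
  using G by (intro weak_deriv_cong_AE[OF lebesgue_open[OF S] _ ae(1) G_ae]) (simp add: is_wgrad_iff[OF S])
qed

definition H1_grad :: "(real^'n) set => (real^'n => real) => (real^'n => real^'n) => bool" where
 "H1_grad S w G <-> L2_on S w & is_wgrad S w G"

definition H1_dist ::
 "(real^'n) set => (real^'n => real) => (real^'n => real^'n) => (real^'n => real) => (real^'n => real^'n) => real" where
 "H1_dist S w G w' G' = sqnorm S (%x. w x - w' x) + (SUM i:UNIV. sqnorm S (%x. G x $ i - G' x $ i))"

definition H10_grad :: "(real^'n) set => (real^'n => real) => (real^'n => real^'n) => bool" where
 "H10_grad S w G <-> H1_grad S w G & (ALL eps > 0. EX phi. test_fun S phi & H1_dist S phi (cgrad phi) w G < eps)"

lemma H1_gradD: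
 assumes "open S" "H1_grad S w G"
 shows "L2_on S w" "!!i. L2_on S (%x. G x $ i)" "!!i. weak_dir_deriv S w (axis i 1) (%x. G x $ i)"
 using assms by (auto simp: H1_grad_def is_wgrad_iff)

lemma H10_grad_H1: "H10_grad S w G ==> H1_grad S w G" by (simp add: H10_grad_def)

lemma H1norm_square:
 assumes S: "open S" "bounded S" and H: "H1_grad S w G"
 shows "(H1norm S w)^2 = sqnorm S w + (SUM i:UNIV. sqnorm S (%x. G x $ i))"
proof -
 note Sm = lebesgue_open[OF S(1)]
 have G: "is_wgrad S w G" using H by (simp add: H1_grad_def)
 have "sqnorm S (%x. wgrad S w x $ i) = sqnorm S (%x. G x $ i)" for i
  by (rule int_on_cong_AE[OF Sm]) (use is_wgrad_unique[OF S is_wgrad_wgrad[OF G] G] in eventually_elim, simp)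
 thus ?thesis unfolding H1norm_def by (simp add: sum_nonneg l2norm_eq[OF Sm])
qed

lemma H1norm_nonneg: "H1norm S w >= 0" unfolding H1norm_def by (simp add: sum_nonneg)

lemma H1_grad_C1: "open S ==> bounded S ==> C1 psi ==> H1_grad S psi (cgrad psi)"
 by (simp add: H1_grad_def is_wgrad_iff cgrad_def L2_on_C1 C1_weak_deriv)

lemma H1_grad_diff:
 assumes S: "open S" and "H1_grad S w G" "H1_grad S w' G'"
 shows "H1_grad S (%x. w x - w' x) (%x. G x - G' x)" using H1_gradD[OF S assms(2)] H1_gradD[OF S assms(3)] S
 unfolding H1_grad_def is_wgrad_iff[OF S] by (auto intro!: L2_diff weak_deriv_diff)

lemma H1_dist_nonneg: "H1_dist S w G w' G' >= 0" by (simp add: H1_dist_def sum_nonneg)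

lemma H1_dist_triangle:
 assumes S: "open S" and H: "H1_grad S w G" "H1_grad S w' G'" "H1_grad S w'' G''"
 shows "H1_dist S w G w'' G'' <= 2 * H1_dist S w G w' G' + 2 * H1_dist S w' G' w'' G''"
proof -
 have t: "sqnorm S (%x. f x - h x) <= 2 * sqnorm S (%x. f x - g x) + 2 * sqnorm S (%x. g x - h x)"
  if "L2_on S f" "L2_on S g" "L2_on S h" for f g h
  using integral_square_add_le[OF L2_diff[OF that(1, 2)] L2_diff[OF that(2, 3)]] by simp
 have "(SUM i:UNIV. sqnorm S (%x. G x $ i - G'' x $ i)) <=
   ((SUM i:UNIV. 2 * sqnorm S (%x. G x $ i - G' x $ i) + 2 * sqnorm S (%x. G' x $ i - G'' x $ i)))"
  by (intro sum_mono t H1_gradD(2)[OF S H(1)] H1_gradD(2)[OF S H(2)] H1_gradD(2)[OF S H(3)])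
 thus ?thesis using t[OF H1_gradD(1)[OF S H(1)] H1_gradD(1)[OF S H(2)] H1_gradD(1)[OF S H(3)]]
  unfolding H1_dist_def by (simp add: sum.distrib sum_distrib_left)
qed

lemma H1_dist_tendsto_iff: "(%k. H1_dist S (F k) (D k) w G) ----> 0 <-> L2_tendsto (leb S) F w &
  (ALL i. L2_tendsto (leb S) (%k x. D k x $ i) (%x. G x $ i))"
proof
 assume lim: "(%k. H1_dist S (F k) (D k) w G) ----> 0"
 have "sqnorm S (%x. D k x $ i - G x $ i) <= H1_dist S (F k) (D k) w G" for k i
  using member_le_sum[of i UNIV "%i. sqnorm S (%x. D k x $ i - G x $ i)"] by (simp add: H1_dist_def add_increasing)
 moreover have "sqnorm S (%x. F k x - w x) <= H1_dist S (F k) (D k) w G" for k by (simp add: H1_dist_def sum_nonneg)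
 ultimately show "L2_tendsto (leb S) F w & (ALL i. L2_tendsto (leb S) (%k x. D k x $ i) (%x. G x $ i))"
  by (simp add: L2_tendsto_le[OF _ lim])
next
 assume "L2_tendsto (leb S) F w & (ALL i. L2_tendsto (leb S) (%k x. D k x $ i) (%x. G x $ i))"
 thus "(%k. H1_dist S (F k) (D k) w G) ----> 0" unfolding H1_dist_def L2_tendsto_def by (auto intro!: tendsto_eq_intros)
qed

lemma H10_grad_iff_seq: "H10_grad S w G <-> H1_grad S w G & (EX phi. (ALL k. test_fun S (phi k)) &
  (%k. H1_dist S (phi k) (cgrad (phi k)) w G) ----> 0)"
proof (intro iffI conjI)
 assume H: "H10_grad S w G"
 hence "ALL k. EX phi. test_fun S phi & H1_dist S phi (cgrad phi) w G < 1 / Suc k" unfolding H10_grad_def by simp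
 then obtain phi where phi: "!!k. test_fun S (phi k)" "!!k. H1_dist S (phi k) (cgrad (phi k)) w G < 1 / Suc k" by metis
 have "(%k. H1_dist S (phi k) (cgrad (phi k)) w G) ----> 0"
  by (rule tendsto_sandwich[OF _ _ tendsto_const one_over_Suc_tendsto_0])
   (auto intro!: always_eventually simp: H1_dist_nonneg less_imp_le[OF phi(2)] simp del: of_nat_Suc)
 with phi(1) show "EX phi. (ALL k. test_fun S (phi k)) & (%k. H1_dist S (phi k) (cgrad (phi k)) w G) ----> 0" by blast
next
 assume "H1_grad S w G & (EX phi. (ALL k. test_fun S (phi k)) & (%k. H1_dist S (phi k) (cgrad (phi k)) w G) ----> 0)"
 then obtain phi where H: "H1_grad S w G" and phi: "!!k. test_fun S (phi k)"
  and lim: "(%k. H1_dist S (phi k) (cgrad (phi k)) w G) ----> 0" by blast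
 show "H10_grad S w G" unfolding H10_grad_def
 proof (intro conjI H allI impI)
  fix eps :: real assume "eps > 0"
  from eventually_happens[OF order_tendstoD(2)[OF lim this]] phi
  show "EX phi. test_fun S phi & H1_dist S phi (cgrad phi) w G < eps" by auto
 qed
qed (simp add: H10_grad_def)

lemma H10_gradE:
 assumes "H10_grad S w G"
 obtains phi where "!!k. test_fun S (phi k)" "L2_tendsto (leb S) phi w"
  "!!i. L2_tendsto (leb S) (%k x. cgrad (phi k) x $ i) (%x. G x $ i)"
 using assms unfolding H10_grad_iff_seq H1_dist_tendsto_iff by blast

lemma H10_iff:
 assumes S: "open S" "bounded S"
 shows "H10 S w <-> (EX G. H10_grad S w G)" and "H10 S w ==> is_wgrad S w G ==> H10_grad S w G"
proof -
 have norm: "H1norm S (%x. phi x - w x) = sqrt (H1_dist S phi (cgrad phi) w G)" if "H1_grad S w G" "test_fun S phi" for phi G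
  using H1norm_square[OF S H1_grad_diff[OF S(1) H1_grad_C1[OF S test_fun_C1[OF that(2)]] that(1)]]
  by (intro real_sqrt_unique[symmetric] H1norm_nonneg) (simp add: H1_dist_def)
 have sqrt: "(%k. sqrt (X k)) ----> 0 <-> X ----> 0" if "!!k. X k >= 0" for X
  using tendsto_real_sqrt[of X 0 sequentially] tendsto_power[of "%k. sqrt (X k)" 0 sequentially 2] that by auto
 have iff: "(EX phi. (ALL k. test_fun S (phi k)) & (%k. H1norm S (%x. phi k x - w x)) ----> 0) <-> H10_grad S w G"
  if H: "H1_grad S w G" for G unfolding H10_grad_iff_seq using H by (simp add: norm[OF H] sqrt[OF H1_dist_nonneg] cong: conj_cong)
 have H1: "H1 S w <-> (EX G. H1_grad S w G)" "H1 S w ==> is_wgrad S w G ==> H1_grad S w G" for G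
  using S by (auto simp: H1_def H1_grad_def L2_iff)
 show "H10 S w <-> (EX G. H10_grad S w G)" unfolding H10_def H1(1) using iff H10_grad_H1 by blast
 show "H10 S w ==> is_wgrad S w G ==> H10_grad S w G" unfolding H10_def using iff H1(2) by blast
qed

lemma H10_grad_closed:
 assumes S: "open S" "bounded S" and H: "H1_grad S w G"
 and cl: "!!eps. eps > 0 ==> EX w' G'. H10_grad S w' G' & H1_dist S w' G' w G < eps"
 shows "H10_grad S w G" unfolding H10_grad_def
proof (intro conjI H allI impI)
 fix eps :: real assume e: "eps > 0"
 obtain w' G' where w': "H10_grad S w' G'" "H1_dist S w' G' w G < eps / 4" using cl[of "eps / 4"] e by auto
 obtain phi where phi: "test_fun S phi" "H1_dist S phi (cgrad phi) w' G' < eps / 4"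
  using w'(1) e unfolding H10_grad_def by (meson zero_less_divide_iff zero_less_numeral)
 have "H1_dist S phi (cgrad phi) w G < eps"
  using H1_dist_triangle[OF S(1) H1_grad_C1[OF S test_fun_C1[OF phi(1)]] H10_grad_H1[OF w'(1)] H] phi(2) w'(2) by simp
 with phi(1) show "EX phi. test_fun S phi & H1_dist S phi (cgrad phi) w G < eps" by blast
qed

lemma H10_grad_limit:
 assumes S: "open S" "bounded S" and H: "H1_grad S w G" and F: "!!k. H10_grad S (F k) (D k)"
  and lim: "L2_tendsto (leb S) F w" "!!i. L2_tendsto (leb S) (%k x. D k x $ i) (%x. G x $ i)"
 shows "H10_grad S w G"
proof (rule H10_grad_closed[OF S H])
 fix eps :: real assume eps: "eps > 0"
 have "(%k. H1_dist S (F k) (D k) w G) ----> 0" using lim by (simp add: H1_dist_tendsto_iff)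
 from eventually_happens[OF order_tendstoD(2)[OF this eps]] F
 show "EX w' G'. H10_grad S w' G' & H1_dist S w' G' w G < eps" by auto
qed

lemma H10_grad_test_fun: "open S ==> bounded S ==> test_fun S phi ==> H10_grad S phi (cgrad phi)"
 unfolding H10_grad_def using H1_grad_C1[OF _ _ test_fun_C1] by (auto simp: H1_dist_def intro!: exI[of _ phi])

lemma H10_grad_cong_AE:
 assumes S: "open S" "bounded S" and H: "H10_grad S w G" and ae: "AE x in leb S. w x = w' x" "AE x in leb S. G x = G' x"
 shows "H10_grad S w' G'"
proof (rule H10_grad_limit[OF S _ H])
 show "H1_grad S w' G'" using is_wgrad_cong_AE[OF S(1) _ ae] L2_on_cong_AE[OF lebesgue_open[OF S(1)] ae(1)] H10_grad_H1[OF H]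
  by (auto simp: H1_grad_def)
 have const: "L2_tendsto (leb S) (%_ :: nat. f) g" if "AE x in leb S. f x = g x" for f g
  unfolding L2_tendsto_def using that by (subst integral_eq_zero_AE) (auto elim: eventually_mono)
 show "L2_tendsto (leb S) (%_. w) w'" by (rule const[OF ae(1)])
 show "L2_tendsto (leb S) (%_ x. G x $ i) (%x. G' x $ i)" for i by (rule const) (use ae(2) in eventually_elim, simp)
qed

lemma H10_integration_by_parts:
 assumes S: "open S" "bounded S" and H: "H10_grad S w G" and Z: "H1_grad S z Z"
 shows "ip S w (%x. Z x $ i) = - ip S (%x. G x $ i) z"
proof -
 note Sm = lebesgue_open[OF S(1)]
 obtain phi where phi: "!!k. test_fun S (phi k)" and lim: "L2_tendsto (leb S) phi w"
  "!!i. L2_tendsto (leb S) (%k x. cgrad (phi k) x $ i) (%x. G x $ i)" using H10_gradE[OF H] by metis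
 note H1 = H1_gradD[OF S(1) H10_grad_H1[OF H]] and Z1 = H1_gradD[OF S(1) Z]
  and phi1 = H1_gradD[OF S(1) H1_grad_C1[OF S test_fun_C1[OF phi]]]
 have parts: "ip S (phi k) (%x. Z x $ i) = - ip S (%x. cgrad (phi k) x $ i) z" for k
  using Z1(3)[of i] phi[of k] unfolding weak_dir_deriv_iff[OF Sm] by (simp add: cgrad_def mult.commute)
 have "(%k. ip S (phi k) (%x. Z x $ i)) ----> ip S w (%x. Z x $ i)" by (intro L2_tendsto_integral_mult phi1 H1 Z1 lim)
 moreover have "(%k. - ip S (%x. cgrad (phi k) x $ i) z) ----> - ip S (%x. G x $ i) z"
  by (intro tendsto_minus L2_tendsto_integral_mult phi1 H1 Z1 lim)
 ultimately show ?thesis unfolding parts by (rule LIMSEQ_unique)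
qed

lemma mollify_zero:
 assumes "!!y. y : S ==> norm (y - x) <= (1 / Suc k) * norm (One :: 'a) ==> w y = 0"
 shows "mollify S w k (x :: 'a :: euclidean_space) = 0"
proof -
 have z: "indicator S y * w y * mollifier (1 / Suc k) (y - x) = 0" for y
 proof (cases "y : cbox x (x + (1 / Suc k) *R One)")
  case True
  thus ?thesis using assms[of y] norm_le_in_cube[of "1 / Suc k" y x] by (cases "y : S") auto
 next
  case False
  hence "y - x ~: cbox 0 ((1 / Suc k) *R One)" by (auto simp: mem_box inner_diff_left inner_add_left algebra_simps)
  thus ?thesis using mollifier_outside[of "1 / Suc k" "y - x"] by simp
 qed
 show ?thesis unfolding mollify_def conv_def z by simp
qed

lemma mollify_compact_support:
 assumes S: "open S" "bounded S" and w: "L2_on S w"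
  and K: "compact K" "K <= S" "!!x. x : S ==> x ~: K ==> w x = 0"
 obtains K' where "compact K'" "K' <= S" "K <= K'"
  "EV k. test_fun S (mollify S w k) & (ALL x. x ~: K' --> (ALL e. pd (mollify S w k) e x = 0))"
proof -
 obtain r where r: "r > 0" "!!x y. x : K ==> dist x y < r ==> y : S"
  using compact_in_open_margin[OF K(1,2) S(1)] by blast
 define K' where "K' = {x + y | x y. x : K & y : cball 0 (r / 2)}"
 have K': "compact K'" unfolding K'_def using K(1) by (intro compact_sums) auto
 have "K' <= S" using r by (force simp: K'_def dist_norm)
 moreover have "K <= K'" using r(1) by (force simp: K'_def)
 moreover have "EV k. test_fun S (mollify S w k) & (ALL x. x ~: K' --> (ALL e. pd (mollify S w k) e x = 0))"
  using eventually_one_over_Suc_less[OF half_gt_zero[OF r(1)], of "norm (One :: 'a)"]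
 proof eventually_elim
  case (elim k)
  have zero: "mollify S w k x = 0" if x: "x ~: K'" for x
  proof (rule mollify_zero)
   fix y assume y: "y : S" "norm (y - x) <= (1 / Suc k) * norm (One :: 'a)"
   have "norm (x - y) <= r / 2"
    using y(2) elim unfolding norm_minus_commute[of x] by (rule order_trans[OF _ less_imp_le])
   moreover have "x = y + (x - y)" by simp
   ultimately have "y ~: K" using x unfolding K'_def by fastforce
   thus "w y = 0" using K(3) y(1) by blast
  qed
  have "C1 (mollify S w k)" by (rule C1_mollify[OF lebesgue_open L1_on_if_L2_on[OF lebesgue_open]]) (use S w in auto)
  hence "test_fun S (mollify S w k)" using zero \<open>K' <= S\<close> by (intro test_funI[OF _ K']) auto
  moreover have "pd (mollify S w k) e x = 0" if "x ~: K'" for e x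
   by (rule pd_eqI[OF has_derivative_transform_within_open[OF has_derivative_const, of "- K'"]])
    (use that zero K' in "auto simp: open_Compl compact_imp_closed")
  ultimately show ?case by blast
 qed
 ultimately show ?thesis using that[OF K'] by blast
qed

lemma weak_deriv_zero_outside:
 assumes S: "open S" "bounded S" and K: "closed K" and h: "L2_on S h" and d: "weak_dir_deriv S w e h"
  and zero: "!!x. x : S ==> x ~: K ==> w x = 0"
 shows "AE x in leb S. x ~: K --> h x = 0"
proof -
 note Sm = lebesgue_open[OF S(1)]
 have o: "open (S - K)" using S(1) K by (rule open_Diff)
 have "AE x in leb (S - K). h x = 0"
 proof (rule weak_deriv_unique[OF o bounded_subset[OF S(2)]])
  show "weak_dir_deriv (S - K) w e h" by (rule weak_deriv_subset[OF Sm lebesgue_open[OF o] _ d]) auto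
  have "AE x in leb (S - K). 0 = w x" using zero by (auto simp: AE_on_iff o)
  from weak_deriv_cong_AE[OF lebesgue_open[OF o] C1_weak_deriv[OF lebesgue_open[OF o] C1_const[of 0]] this]
  show "weak_dir_deriv (S - K) w e (%_. 0)" by (simp add: pd_eqI[OF has_derivative_const])
 qed (use L2_on_subset[OF Sm lebesgue_open[OF o] _ h] in auto)
 thus ?thesis by (auto simp: AE_on_iff Sm o elim: eventually_mono)
qed

lemma H10_grad_compact_support:
 assumes S: "open S" "bounded S" and H: "H1_grad S w G" and K: "compact K" "K <= S" "!!x. x : S ==> x ~: K ==> w x = 0"
 shows "H10_grad S w G"
proof -
 note Sm = lebesgue_open[OF S(1)] and H1 = H1_gradD[OF S(1) H]
 let ?W = "mollify S w"
 obtain K' where K': "compact K'" "K' <= S" "K <= K'"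
  and test: "EV k. test_fun S (?W k) & (ALL x. x ~: K' --> (ALL e. pd (?W k) e x = 0))"
  using mollify_compact_support[OF S H1(1) K] by blast
 have bound: "EV k. sqnorm S (%x. pd (?W k) (axis i 1) x - G x $ i) <=
   sqnorm S (%x. mollify S (%x. G x $ i) k x - G x $ i)" for i
  using eventually_pd_mollify[OF S(1) L1_on_if_L2_on[OF Sm S(2) H1(1)] H1(3)[of i] K'(1,2)] test
 proof eventually_elim
  case (elim k)
  show ?case
  proof (rule integral_mono_AE)
   show "L1_on S (%x. (pd (?W k) (axis i 1) x - G x $ i)^2)"
    using elim by (intro L2_square_integrable L2_diff H1 Cc_L2_on[OF pd_test_fun_Cc] Sm) auto
   show "L1_on S (%x. (mollify S (%x. G x $ i) k x - G x $ i)^2)"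
    by (intro L2_square_integrable L2_diff H1 mollify_L2_tendsto[OF Sm S(2) Sm order_refl])
   have "AE x in leb S. x ~: K' --> G x $ i = 0"
    by (rule weak_deriv_zero_outside[OF S compact_imp_closed[OF K'(1)] H1(2,3)]) (use K(3) K'(3) in blast)
   thus "AE x in leb S. (pd (?W k) (axis i 1) x - G x $ i)^2 <= (mollify S (%x. G x $ i) k x - G x $ i)^2"
   proof eventually_elim
    case (elim x)
    thus ?case using \<open>ALL x:K'. _\<close> \<open>test_fun S (?W k) & _\<close> by (cases "x : K'") auto
   qed
  qed
 qed
 have "(%k. sqnorm S (%x. pd (?W k) (axis i 1) x - G x $ i)) ----> 0" for i
 proof (rule tendsto_sandwich[OF _ bound tendsto_const])
  show "(%k. sqnorm S (%x. mollify S (%x. G x $ i) k x - G x $ i)) ----> 0"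
   using mollify_L2_tendsto(2)[OF Sm S(2) Sm order_refl H1(2)[of i]] by (simp add: L2_tendsto_def)
 qed simp
 hence lim: "(%k. H1_dist S (?W k) (cgrad (?W k)) w G) ----> 0" using mollify_L2_tendsto(2)[OF Sm S(2) Sm order_refl H1(1)]
  unfolding H1_dist_tendsto_iff by (simp add: L2_tendsto_def cgrad_def)
 show ?thesis unfolding H10_grad_def
 proof (intro conjI H allI impI)
  fix eps :: real assume "eps > 0"
  from eventually_happens[OF eventually_conj[OF test order_tendstoD(2)[OF lim this]]]
  show "EX phi. test_fun S phi & H1_dist S phi (cgrad phi) w G < eps" by auto
 qed
qed

lemma H1_grad_lipschitz_mult:
 assumes S: "open S" "bounded S" and m: "lipschitz_fun m L" and H: "H1_grad S w G"
 shows "H1_grad S (%x. m x * w x) (%x. m x *R G x + w x *R cgrad m x)"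
proof -
 interpret lipschitz_fun m L by (rule m)
 note Sm = lebesgue_open[OF S(1)] and H1 = H1_gradD[OF S(1) H]
 show ?thesis unfolding H1_grad_def is_wgrad_iff[OF S(1)]
 proof (intro conjI allI)
  show "L2_on S (%x. m x * w x)" by (rule L2_on_mult[OF Sm S(2) H1(1)])
  fix i
  have eq: "(%x. (m x *R G x + w x *R cgrad m x) $ i) = (%x. m x * G x $ i + pd m (axis i 1) x * w x)"
   by (simp add: cgrad_def mult.commute)
  show "L2_on S (%x. (m x *R G x + w x *R cgrad m x) $ i)" unfolding eq by (intro L2_add L2_on_mult[OF Sm S(2)] H1)
  show "weak_dir_deriv S (%x. m x * w x) (axis i 1) (%x. (m x *R G x + w x *R cgrad m x) $ i)"
   unfolding eq by (rule weak_deriv_lipschitz_mult[OF S m H1])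
 qed
qed

lemma H10_grad_lipschitz_mult:
 assumes S: "open S" "bounded S" and m: "lipschitz_fun m L" and H: "H10_grad S w G"
 shows "H10_grad S (%x. m x * w x) (%x. m x *R G x + w x *R cgrad m x)"
proof -
 interpret lipschitz_fun m L by (rule m)
 note Sm = lebesgue_open[OF S(1)] and H1 = H10_grad_H1[OF H]
 note w = H1_gradD[OF S(1) H1]
 obtain phi where phi: "!!k. test_fun S (phi k)" and lim: "L2_tendsto (leb S) phi w"
  "!!i. L2_tendsto (leb S) (%k x. cgrad (phi k) x $ i) (%x. G x $ i)" using H10_gradE[OF H] by metis
 have phi1: "H1_grad S (phi k) (cgrad (phi k))" for k by (rule H1_grad_C1[OF S test_fun_C1[OF phi]])
 note phi_L2 = H1_gradD[OF S(1) phi1]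
 show ?thesis
 proof (rule H10_grad_limit[OF S H1_grad_lipschitz_mult[OF S m H1]])
  fix k
  obtain K where "compact K" "K <= S" "!!x. x ~: K ==> phi k x = 0" using test_fun_supportE[OF phi] by metis
  thus "H10_grad S (%x. m x * phi k x) (%x. m x *R cgrad (phi k) x + phi k x *R cgrad m x)"
   by (intro H10_grad_compact_support[OF S H1_grad_lipschitz_mult[OF S m phi1], of K]) auto
 next
  show "L2_tendsto (leb S) (%k x. m x * phi k x) (%x. m x * w x)" by (rule L2_tendsto_mult[OF Sm S(2) phi_L2(1) w(1) lim(1)])
  show "L2_tendsto (leb S) (%k x. (m x *R cgrad (phi k) x + phi k x *R cgrad m x) $ i)
    (%x. (m x *R G x + w x *R cgrad m x) $ i)" for i
   using L2_tendsto_add[OF L2_on_mult(1)[OF Sm S(2) phi_L2(2)] L2_on_mult(1)[OF Sm S(2) w(2)]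
     L2_tendsto_mult(1)[OF Sm S(2) phi_L2(2) w(2) lim(2)] L2_on_mult(2)[OF Sm S(2) phi_L2(1)]
     L2_on_mult(2)[OF Sm S(2) w(1)] L2_tendsto_mult(2)[OF Sm S(2) phi_L2(1) w(1) lim(1)], of i "axis i 1"]
   by (simp add: cgrad_def mult.commute)
 qed
qed

text \<open>The library proves the change of variables formula for index types of class
 \<open>wellorder\<close> only; every finite type is in bijection with such a type.\<close>

typedef (overloaded) 'n ordered_index = "{i :: nat. i < CARD('n::finite)}" by (rule exI[of _ 0]) simp

instantiation ordered_index :: (finite) linorder
begin

definition "x <= y <-> Rep_ordered_index x <= Rep_ordered_index y"

definition "x < y <-> Rep_ordered_index x < Rep_ordered_index y"

instance by standard (auto simp: less_eq_ordered_index_def less_ordered_index_def Rep_ordered_index_inject)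

end

instance ordered_index :: (finite) finite
proof
 have "(UNIV :: 'a ordered_index set) = Abs_ordered_index ` {i. i < CARD('a)}"
  by (rule type_definition.Abs_image[OF type_definition_ordered_index, symmetric])
 thus "finite (UNIV :: 'a ordered_index set)" by (metis finite_Collect_less_nat finite_imageI)
qed

instance ordered_index :: (finite) wellorder
proof
 fix P :: "'a ordered_index => bool" and a :: "'a ordered_index"
 assume step: "!!x. (!!y. y < x ==> P y) ==> P x"
 show "P a"
  by (induction a rule: measure_induct_rule[where f = Rep_ordered_index]) (auto intro: step simp: less_ordered_index_def)
qed

lemma ex_bij_ordered_index: "EX r :: 'n::finite ordered_index => 'n. bij r"
proof -
 have "bij_betw (Rep_ordered_index :: 'n ordered_index => nat) UNIV {i. i < CARD('n)}"
  using type_definition.Rep_range[OF type_definition_ordered_index]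
  by (auto simp: bij_betw_def inj_on_def Rep_ordered_index_inject)
 moreover obtain f :: "nat => 'n" where "bij_betw f {0..<CARD('n)} UNIV" using ex_bij_betw_nat_finite[of "UNIV :: 'n set"] by auto
 moreover have "{0..<CARD('n)} = {i. i < CARD('n)}" by auto
 ultimately show ?thesis using bij_betw_trans by metis
qed

lemma det_reindex:
 fixes A :: "real^'n::finite^'n" and r :: "'m::finite => 'n"
 assumes bij: "bij r"
 shows "det (\<chi> i j. A $ r i $ r j) = det A"
proof -
 let ?conj = "map_permutation UNIV r"
 have bij': "bij_betw r UNIV UNIV" "bij_betw (inv r) UNIV UNIV" using bij bij_imp_bij_inv by auto
 have inv: "inv r (r i) = i" "r (inv r j) = j" for i j using bij by (simp_all add: bij_is_inj bij_is_surj surj_f_inv_f)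
 have "det A = (SUM q | q permutes UNIV. of_int (sign q) * (PROD i:UNIV. A $ i $ q i))" by (simp add: det_def)
 also have "... = (SUM p | p permutes UNIV. of_int (sign (?conj p)) * (PROD i:UNIV. A $ i $ ?conj p i))"
  by (rule sum.reindex_bij_witness[where i = ?conj and j = "map_permutation UNIV (inv r)"])
   (auto simp: map_permutation_compose_inv[OF bij'(1)] map_permutation_compose_inv[OF bij'(2)] inv
    intro: map_permutation_permutes bij')
 also have "... = (SUM p | p permutes UNIV. of_int (sign p) * (PROD i:UNIV. A $ r i $ r (p i)))"
 proof (rule sum.cong[OF refl])
  fix p :: "'m => 'm" assume "p : {p. p permutes UNIV}"
  moreover have "(PROD i:UNIV. A $ i $ ?conj p i) = (PROD i:UNIV. A $ r i $ ?conj p (r i))"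
   using prod.reindex_bij_betw[OF bij'(1), of "%i. A $ i $ ?conj p i"] by simp
  ultimately show "of_int (sign (?conj p)) * (PROD i:UNIV. A $ i $ ?conj p i) =
    of_int (sign p) * (PROD i:UNIV. A $ r i $ r (p i))"
   by (simp add: sign_map_permutation map_permutation_apply bij_is_inj[OF bij])
 qed
 finally show ?thesis by (simp add: det_def)
qed

lemma bij_betw_axis_Basis: "bij_betw (%i. axis i 1) UNIV (Basis :: (real^'n) set)"
 by (auto simp: bij_betw_def inj_on_def axis_eq_axis Basis_vec_def)

lemma sum_Basis_vec: "(SUM b:Basis. f b) = (SUM j:UNIV. f (axis j 1 :: real^'n))"
 by (rule sum.reindex_bij_betw[OF bij_betw_axis_Basis, symmetric])

lemma prod_Basis_vec: "(PROD b:Basis. f b) = (PROD j:UNIV. f (axis j 1 :: real^'n))"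
 by (rule prod.reindex_bij_betw[OF bij_betw_axis_Basis, symmetric])

definition reindex :: "('m::finite => 'n::finite) => real^'n => real^'m" where "reindex r x = (\<chi> i. x $ r i)"

lemma linear_reindex: "linear (reindex r)" by (rule linearI) (auto simp: reindex_def vec_eq_iff)

lemma continuous_on_reindex: "continuous_on S (reindex r)"
 by (intro linear_continuous_on linear_conv_bounded_linear[THEN iffD1] linear_reindex)

lemma reindex_borel: "reindex r : borel_measurable borel" by (intro borel_measurable_continuous_onI continuous_on_reindex)

lemma reindex_inverse:
 assumes "bij r"
 shows "reindex r (reindex (inv r) x) = x" "reindex (inv r) (reindex r y) = y"
 using assms by (auto simp: reindex_def vec_eq_iff bij_is_inj bij_is_surj surj_f_inv_f)

lemma det_matrix_conj_reindex:
 assumes "bij r"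
 shows "det (matrix (%h. reindex r (L (reindex (inv r) h)))) = det (matrix L)"
proof -
 have "inv r i = j <-> i = r j" for i j using assms by (metis bij_inv_eq_iff)
 hence "reindex (inv r) (axis j 1) = axis (r j) 1" for j by (simp add: reindex_def axis_def vec_eq_iff)
 hence "matrix (%h. reindex r (L (reindex (inv r) h))) = (\<chi> i j. matrix L $ r i $ r j)" by (simp add: matrix_def reindex_def)
 thus ?thesis by (simp add: det_reindex[OF assms])
qed

lemma distr_reindex:
 assumes bij: "bij (r :: 'm::finite => 'n::finite)"
 shows "distr lborel borel (reindex r) = lborel"
proof (rule lborel_eqI[symmetric])
 fix l u :: "real^'m" assume le: "!!b. b:Basis ==> l <.> b <= u <.> b"
 have le': "l $ i <= u $ i" for i using le[of "axis i 1"] by (simp add: inner_axis)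
 let ?l = "reindex (inv r) l" and ?u = "reindex (inv r) u"
 have "reindex r -` box l u = box ?l ?u" using bij by (auto simp: mem_box_cart reindex_def) (metis bij_inv_eq_iff)+
 hence "emeasure (distr lborel borel (reindex r)) (box l u) = emeasure lborel (box ?l ?u)"
  by (simp add: emeasure_distr reindex_borel)
 also have "... = ennreal (PROD b:Basis. (?u - ?l) <.> b)"
  by (rule emeasure_lborel_box) (auto simp: Basis_vec_def inner_axis reindex_def le')
 also have "(PROD b:Basis. (?u - ?l) <.> b) = (PROD i:UNIV. (u - l) $ inv r i)"
  by (simp add: prod_Basis_vec inner_axis reindex_def)
 also have "... = (PROD b:Basis. (u - l) <.> b)"
  using prod.reindex_bij_betw[OF bij_imp_bij_inv[OF bij], of "%i. (u - l) $ i"] by (simp add: prod_Basis_vec inner_axis)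
 finally show "emeasure (distr lborel borel (reindex r)) (box l u) = ennreal (PROD b:Basis. (u - l) <.> b)" .
qed simp

lemma
 fixes F :: "'a::euclidean_space => 'b::euclidean_space" and f :: "'b => real"
 assumes F: "F : borel_measurable borel" "distr lborel borel F = lborel" and f: "integrable lebesgue f"
 shows integrable_lebesgue_comp: "integrable lebesgue (%x. f (F x))"
  and integral_lebesgue_comp: "(LINT x. f (F x)) = (LINT y. f y)"
proof -
 obtain f' where f': "f' : borel_measurable borel" "AE y in lebesgue. f y = f' y" using lebesgue_borel_version[of f] f by auto
 have comp: "(%x. f' (F x)) : borel_measurable borel" using F(1) f'(1) by (rule measurable_compose)
 have "AE y in distr lborel borel F. f y = f' y" using f'(2) unfolding F(2) AE_completion_iff .
 hence ae: "AE x in lebesgue. f (F x) = f' (F x)" using AE_distrD[of F lborel borel] F(1) by (simp add: AE_completion_iff)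
 note cong = lebesgue_cong_AE[OF f'(2)] lebesgue_cong_AE[OF ae]
 have "integrable (distr lborel borel F) f'" using f cong(2) f'(1) by (simp add: F(2) integrable_completion)
 thus "integrable lebesgue (%x. f (F x))" using cong(5) f'(1) comp by (simp add: integrable_distr_eq F(1) integrable_completion)
 have "(LINT x|lborel. f' (F x)) = (LINT y|lborel. f' y)" using integral_distr[OF _ f'(1), of F lborel] by (simp add: F)
 thus "(LINT x. f (F x)) = (LINT y. f y)" using cong(3,6) f'(1) comp by (simp add: integral_completion)
qed

lemma L1_on_reindex:
 fixes f :: "real^'m::finite => real"
 assumes bij: "bij (r :: 'm => 'n::finite)" and S: "open S" and f: "L1_on S f"
 shows "L1_on (reindex r -` S) (%x. f (reindex r x))" "int_on (reindex r -` S) (%x. f (reindex r x)) = int_on S f"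
proof -
 have "open (reindex r -` S)" using S continuous_on_reindex by (rule open_vimage)
 moreover have "indicator S (reindex r x) = (indicator (reindex r -` S) x :: real)" for x by (simp add: indicator_def)
 ultimately show "L1_on (reindex r -` S) (%x. f (reindex r x))" "int_on (reindex r -` S) (%x. f (reindex r x)) = int_on S f"
  using integrable_lebesgue_comp[OF reindex_borel distr_reindex[OF bij], of "%x. indicator S x * f x"]
   integral_lebesgue_comp[OF reindex_borel distr_reindex[OF bij], of "%x. indicator S x * f x"] S f
  by (simp_all add: L1_indicator int_indicator)
qed

lemma change_of_variables_wellorder:
 fixes f :: "real^'m::{finite, wellorder} => real" and g :: "real^'m::_ => real^'m::_"
 assumes S: "S : sets lebesgue" "g ` S : sets lebesgue"
  and deriv: "!!x. x : S ==> (g has_derivative g' x) (at x within S)" and inj: "inj_on g S" and f: "L1_on (g ` S) f"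
 shows "L1_on S (%x. abs (det (matrix (g' x))) * f (g x))" "ip S (%x. abs (det (matrix (g' x)))) (%x. f (g x)) = int_on (g ` S) f"
proof -
 let ?J = "%x. abs (det (matrix (g' x)))"
 let ?f = "%x. vec (f x) :: real^1"
 have f_abs: "f absolutely_integrable_on g ` S" using f S(2) by (simp add: set_integrable_def L1_indicator)
 hence "(%x. ?J x *R ?f (g x)) absolutely_integrable_on S & integral S (%x. ?J x *R ?f (g x)) = integral (g ` S) ?f"
  using has_absolute_integral_change_of_variables[OF S(1) deriv inj, of ?f "integral (g ` S) ?f"]
  by (simp add: absolutely_integrable_on_1_iff)
 hence Jf_abs: "(%x. ?J x * f (g x)) absolutely_integrable_on S"
  and integral: "integral S (%x. ?J x * f (g x)) = integral (g ` S) f"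
  by (simp_all add: absolutely_integrable_on_1_iff integral_on_1_eq)
 from Jf_abs show "L1_on S (%x. ?J x * f (g x))" using S(1) by (simp add: set_integrable_def L1_indicator)
 show "ip S ?J (%x. f (g x)) = int_on (g ` S) f"
  using set_lebesgue_integral_eq_integral(2)[OF f_abs] set_lebesgue_integral_eq_integral(2)[OF Jf_abs] integral S
  by (simp add: set_lebesgue_integral_def int_indicator)
qed

theorem change_of_variables:
 fixes f :: "real^'n => real" and g :: "real^'n => real^'n"
 assumes S: "open S" and deriv: "!!x. x : S ==> (g has_derivative g' x) (at x)" and inj: "inj_on g S" and f: "L1_on (g ` S) f"
 shows "L1_on S (%x. abs (det (matrix (g' x))) * f (g x))" "ip S (%x. abs (det (matrix (g' x)))) (%x. f (g x)) = int_on (g ` S) f"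
proof -
 obtain r :: "'n ordered_index => 'n" where bij: "bij r" using ex_bij_ordered_index by blast
 note bij_inv = bij_imp_bij_inv[OF bij]
 let ?Q = "reindex r :: real^'n => real^'n ordered_index" and ?P = "reindex (inv r) :: real^'n ordered_index => real^'n"
 note PQ = reindex_inverse[OF bij]
 let ?S = "?P -` S" and ?g = "%y. ?Q (g (?P y))" and ?g' = "%y h. ?Q (g' (?P y) (?P h))"
 let ?J = "%x. abs (det (matrix (g' x))) * f (g x)"
 have open_image: "open (g ` S)"
  using deriv by (intro invariance_of_domain[OF _ S inj]) (meson continuous_at_imp_continuous_on has_derivative_continuous)
 have open': "open ?S" "open (?P -` (g ` S))" by (intro open_vimage S open_image continuous_on_reindex)+
 have image: "?g ` ?S = ?P -` (g ` S)" using PQ by (auto simp: image_iff) (metis PQ vimageI2)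
 have deriv': "(?g has_derivative ?g' y) (at y within ?S)" if "y : ?S" for y
  using that has_derivative_compose[OF has_derivative_compose[OF linear_imp_has_derivative[OF linear_reindex] deriv]
    linear_imp_has_derivative[OF linear_reindex]] by (auto intro: has_derivative_at_withinI)
 have inj': "inj_on ?g ?S" using inj PQ unfolding inj_on_def by (metis vimageE)
 have "L1_on (?g ` ?S) (%y. f (?P y))" "int_on (?g ` ?S) (%y. f (?P y)) = int_on (g ` S) f"
  using L1_on_reindex[OF bij_inv open_image f] unfolding image by auto
 hence "L1_on ?S (%y. ?J (?P y))" "int_on ?S (%y. ?J (?P y)) = int_on (g ` S) f"
  using change_of_variables_wellorder[OF lebesgue_open[OF open'(1)] _ deriv' inj', of "%y. f (?P y)"] open'(2)
  by (simp_all add: image PQ det_matrix_conj_reindex[OF bij])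
 moreover have "?Q -` ?S = S" by (simp add: vimage_def PQ)
 ultimately show "L1_on S ?J" "int_on S ?J = int_on (g ` S) f"
  using L1_on_reindex[OF bij open'(1), of "%y. ?J (?P y)"] by (simp_all add: PQ)
qed

lemma test_fun_extend_zero:
 fixes phi :: "'a::euclidean_space => real"
 assumes A: "open A" and K: "compact K" "K <= A" "!!x. x ~: K ==> phi x = 0"
  and deriv: "!!x. x : A ==> (phi has_derivative D x) (at x)" and cont: "!!e. continuous_on A (%x. D x e)"
 shows "test_fun A phi"
proof -
 have open': "open (- K)" using K(1) by (simp add: open_Compl compact_imp_closed)
 have zero: "(phi has_derivative (%h. 0)) (at x)" if "x ~: K" for x
  by (rule has_derivative_transform_within_open[OF has_derivative_const[of 0] open']) (use that K(3) in auto)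
 let ?D = "%x e. if x : A then D x e else 0"
 have "(phi has_derivative ?D x) (at x)" for x using deriv[of x] zero[of x] K(2) by (cases "x : A") auto
 moreover have "continuous_on UNIV (%x. ?D x e)" for e
 proof -
  have "?D x e = 0" if "x : - K" for x using has_derivative_unique[OF deriv zero, of x] that by (auto simp: fun_eq_iff)
  hence "continuous_on (- K) (%x. ?D x e)" by (subst continuous_on_cong[OF refl, of _ _ "%_. 0"]) auto
  moreover have "continuous_on A (%x. ?D x e)" using cont[of e] by (simp cong: continuous_on_cong)
  ultimately have "continuous_on (A \<union> - K) (%x. ?D x e)" using A open' by (intro continuous_on_open_Un)
  moreover have "A \<union> - K = UNIV" using K(2) by auto
  ultimately show ?thesis by simp
 qed
 ultimately have "C1 phi" by (rule C1I)
 thus ?thesis using K by (intro test_funI) auto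
qed

lemma int_on_pd_test_fun:
 assumes S: "S : sets lebesgue" and phi: "test_fun S phi"
 shows "int_on S (pd phi e) = 0"
proof -
 obtain K where K: "K <= S" "!!x e. x ~: K ==> pd phi e x = 0" by (rule test_fun_supportE[OF phi]) blast
 have "integral\<^sup>L lebesgue (pd phi e) = int_on UNIV (pd phi e)" by (simp add: lebesgue_on_UNIV_eq)
 also have "... = int_on S (pd phi e)" using K by (intro int_on_superset[symmetric] S) auto
 finally show ?thesis using integral_pd_test_fun[OF test_fun_mono[OF phi]] by simp
qed

locale diffeo =
 fixes A B :: "'a::euclidean_space set" and F G :: "'a => 'a" and F' G' :: "'a => 'a => 'a"
 assumes open_dom: "open A" "open B" and bounded_dom: "bounded A" "bounded B"
  and F_in: "!!x. x : A ==> F x : B" and G_in: "!!y. y : B ==> G y : A"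
  and GF: "!!x. x : A ==> G (F x) = x" and FG: "!!y. y : B ==> F (G y) = y"
  and F_deriv: "!!x. x : A ==> (F has_derivative F' x) (at x)" and G_deriv: "!!y. y : B ==> (G has_derivative G' y) (at y)"
  and F'_cont: "!!e. continuous_on A (%x. F' x e)"
begin

lemma lebesgue_A: "A : sets lebesgue" and lebesgue_B: "B : sets lebesgue" using open_dom by auto

lemma continuous_F: "continuous_on A F" and continuous_G: "continuous_on B G"
 using F_deriv G_deriv by (meson continuous_at_imp_continuous_on has_derivative_continuous)+

lemma F_image: "F ` A = B" using F_in G_in FG by force

lemma AE_comp:
 assumes "AE y in leb B. P y"
 shows "AE x in leb A. P (F x)"
proof -
 obtain N where N: "negligible N" "{y. ~ (y : B --> P y)} <= N"
  using assms unfolding AE_on_iff[OF lebesgue_B] eventually_ae_filter_negligible by auto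
 have "G differentiable_on (N \<inter> B)"
  unfolding differentiable_on_def using G_deriv by (meson Int_iff differentiableI differentiable_at_withinI)
 hence "negligible (G ` (N \<inter> B))"
  using negligible_subset[OF N(1), of "N \<inter> B"] by (intro negligible_differentiable_image_negligible) auto
 moreover have "{x. ~ (x : A --> P (F x))} <= G ` (N \<inter> B)" using N(2) F_in GF by (force intro!: image_eqI[of _ G "F _"])
 ultimately show ?thesis unfolding AE_on_iff[OF lebesgue_A] eventually_ae_filter_negligible by blast
qed

lemma measurable_comp:
 fixes f :: "'a => real"
 assumes "f : borel_measurable (leb B)"
 shows "(%x. f (F x)) : borel_measurable (leb A)"
proof -
 obtain f' where f': "f' : borel_measurable borel" "AE y in lebesgue. indicator B y * f y = f' y"
  using assms lebesgue_borel_version by (metis measurable_indicator_iff[OF lebesgue_B])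
 have "AE y in leb B. f' y = f y" unfolding AE_on_iff[OF lebesgue_B] using f'(2) by eventually_elim (auto simp: indicator_def)
 hence ae: "AE x in leb A. f' (indicator A x *R F x) = f (F x)"
  using AE_comp by (fastforce simp: AE_on_iff[OF lebesgue_A] elim: eventually_mono)
 have "(%x. indicator A x *R F x) : borel_measurable borel"
  using open_dom continuous_F by (intro borel_measurable_continuous_on_indicator) auto
 hence "(%x. f' (indicator A x *R F x)) : borel_measurable (leb A)"
  by (intro measurable_restrict_space1 lebesgue_if_borel measurable_compose[OF _ f'(1)])
 thus ?thesis by (simp only: measurable_on_cong_AE[OF lebesgue_A ae])
qed

lemma measurable_F': "(%x. F' x e <.> b) : borel_measurable (leb A)"
 by (intro continuous_imp_measurable_on_sets_lebesgue lebesgue_A continuous_intros F'_cont)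

lemma comp_has_derivative:
 assumes "C1 psi" "x : A"
 shows "((%x. psi (F x)) has_derivative (%e. pd psi (F' x e) (F x))) (at x)"
 using has_derivative_compose[OF F_deriv[OF assms(2)] C1_has_derivative[OF assms(1)]] .

lemma continuous_pd_comp:
 assumes "C1 psi"
 shows "continuous_on A (%x. pd psi (F' x e) (F x))" unfolding pd_basis_expand[OF assms, of "F' _ e"]
 by (intro continuous_intros F'_cont continuous_on_compose2[OF C1_continuous_pd[OF assms] continuous_F]) auto

lemma test_fun_comp:
 assumes psi: "test_fun B psi"
 shows "test_fun A (%x. if x : A then psi (F x) else 0)" (is "test_fun A ?psi")
  "x : A ==> pd (%x. if x : A then psi (F x) else 0) e x = pd psi (F' x e) (F x)"
proof -
 obtain K where K: "compact K" "K <= B" "!!x. x ~: K ==> psi x = 0" using test_fun_supportE[OF psi] by metis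
 have image: "compact (G ` K)" "G ` K <= A"
  using K G_in continuous_on_subset[OF continuous_G K(2)] by (auto intro: compact_continuous_image)
 have zero: "?psi x = 0" if "x ~: G ` K" for x using that GF[of x] K(3)[of "F x"] by (metis image_eqI)
 have deriv: "(?psi has_derivative (%e. pd psi (F' x e) (F x))) (at x)" if "x : A" for x
  by (rule has_derivative_transform_within_open[OF comp_has_derivative[OF test_fun_C1[OF psi] that] open_dom(1) that]) auto
 show "test_fun A ?psi" by (rule test_fun_extend_zero[OF open_dom(1) image zero deriv continuous_pd_comp[OF test_fun_C1[OF psi]]])
 show "pd ?psi e x = pd psi (F' x e) (F x)" if "x : A" by (rule pd_eqI[OF deriv[OF that]])
qed

lemma test_fun_mult_comp:
 assumes phi: "test_fun A phi" and psi: "C1 psi"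
 shows "test_fun A (%x. phi x * psi (F x))"
  "x : A ==> pd (%x. phi x * psi (F x)) e x = phi x * pd psi (F' x e) (F x) + pd phi e x * psi (F x)"
proof -
 obtain K where K: "compact K" "K <= A" "!!x. x ~: K ==> phi x = 0" using test_fun_supportE[OF phi] by metis
 note phi' = test_fun_C1[OF phi]
 have deriv: "((%x. phi x * psi (F x)) has_derivative
   (%e. phi x * pd psi (F' x e) (F x) + pd phi e x * psi (F x))) (at x)" if "x : A" for x
  by (rule has_derivative_mult[OF C1_has_derivative[OF phi'] comp_has_derivative[OF psi that]])
 have "continuous_on A (%x. phi x * pd psi (F' x e) (F x) + pd phi e x * psi (F x))" for e
  by (intro continuous_intros continuous_on_subset[OF C1_continuous[OF phi']] continuous_pd_comp[OF psi]
   continuous_on_subset[OF C1_continuous_pd[OF phi']] continuous_on_compose2[OF C1_continuous[OF psi] continuous_F]) auto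
 thus "test_fun A (%x. phi x * psi (F x))" using K(3) by (intro test_fun_extend_zero[OF open_dom(1) K(1,2) _ deriv]) auto
 show "pd (%x. phi x * psi (F x)) e x = phi x * pd psi (F' x e) (F x) + pd phi e x * psi (F x)" if "x : A"
  by (rule pd_eqI[OF deriv[OF that]])
qed

end

locale bounded_diffeo = diffeo A B F G F' G' for A B :: "'a::euclidean_space set" and F G F' G' +
 fixes J :: "'a => real" and C :: real
 assumes C_nonneg: "0 <= C" and F'_bound: "!!x e. x : A ==> norm (F' x e) <= C * norm e"
  and J_lower_bound: "!!x. x : A ==> 1 <= C * J x" and L1_J_comp: "!!h. L1_on B h ==> L1_on A (%x. J x * h (F x))"
  and int_J_comp: "!!h. L1_on B h ==> ip A J (%x. h (F x)) = int_on B h"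
begin

lemma L1_on_comp:
 assumes h: "L1_on B h" "!!y. 0 <= h y"
 shows "L1_on A (%x. h (F x))" "int_on A (%x. h (F x)) <= C * int_on B h"
proof -
 have le: "h (F x) <= C * (J x * h (F x))" if "x : A" for x
  using mult_right_mono[OF J_lower_bound[OF that] h(2)] by (simp add: mult.assoc)
 have int: "L1_on A (%x. C * (J x * h (F x)))" using L1_J_comp[OF h(1)] by simp
 have ae: "AE x in leb A. norm (h (F x)) <= norm (C * (J x * h (F x)))"
  using order_trans[OF le abs_ge_self] h(2) by (simp add: AE_on_iff[OF lebesgue_A])
 show comp: "L1_on A (%x. h (F x))" by (rule integrable_bound[OF int measurable_comp[OF borel_measurable_integrable[OF h(1)]] ae])
 have "int_on A (%x. h (F x)) <= ip A (%x. C) (%x. J x * h (F x))" using le by (intro integral_mono comp int) auto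
 thus "int_on A (%x. h (F x)) <= C * int_on B h" by (simp add: int_J_comp[OF h(1)])
qed

lemma L2_on_comp: "L2_on B f ==> L2_on A (%x. f (F x))"
 using L1_on_comp(1)[of "%y. (f y)^2"] measurable_comp by (simp add: sq_integrable_def)

lemma AE_F'_bound: "AE x in leb A. abs (F' x e <.> b) <= C * norm e * norm b"
 using order_trans[OF Cauchy_Schwarz_ineq2 mult_right_mono[OF F'_bound norm_ge_zero]] by (auto simp: AE_on_iff[OF lebesgue_A])

lemma L2_on_deriv_mult_comp: "L2_on B h ==> L2_on A (%x. (F' x e <.> b) * h (F x))"
 by (rule L2_bounded_mult[OF L2_on_comp measurable_F' AE_F'_bound])

lemma L2_tendsto_comp:
 assumes S: "S : sets lebesgue" "S <= A" "F ` S : sets lebesgue"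
  and f: "!!k. L2_on B (f k)" "L2_on B g" "L2_tendsto (leb (F ` S)) f g"
 shows "L2_tendsto (leb S) (%k x. f k (F x)) (%x. g (F x))"
proof (rule L2_tendsto_le)
 fix k
 let ?q = "%y. (f k y - g y)^2"
 let ?h = "%y. indicator (F ` S) y * ?q y"
 have image: "F ` S <= B" using S(2) F_in by auto
 have notin: "F x ~: F ` S" if "x : A" "x ~: S" for x using that S(2) GF by (metis imageE subsetD)
 have "F ` S : sets (leb B)" using S(3) image by (simp add: sets_restrict_space_iff lebesgue_B)
 hence L1: "L1_on B ?h" using integrable_mult_indicator[OF _ L2_square_integrable[OF L2_diff[OF f(1,2)]]] by simp
 have "int_on S (%x. ?q (F x)) = int_on S (%x. ?h (F x))" by (intro integral_cong) auto
 also have "... = int_on A (%x. ?h (F x))" using notin by (intro int_on_superset[OF lebesgue_A S(1,2)]) auto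
 also have "... <= C * int_on B ?h" by (rule L1_on_comp(2)[OF L1]) simp
 also have "int_on B ?h = int_on (F ` S) ?h" by (intro int_on_superset[OF lebesgue_B S(3) image, symmetric]) auto
 also have "... = int_on (F ` S) ?q" by (intro integral_cong) auto
 finally show "sqnorm S (%x. f k (F x) - g (F x)) <= C * int_on (F ` S) ?q" .
next
 show "(%k. C * sqnorm (F ` S) (%y. f k y - g y)) ----> 0" using f(3) unfolding L2_tendsto_def by (rule tendsto_mult_right_zero)
qed

lemma L2_tendsto_sum_deriv_mult_comp:
 assumes S: "S : sets lebesgue" "S <= A" "F ` S : sets lebesgue"
  and f: "!!i k. i : I ==> L2_on B (f i k)" "!!i. i : I ==> L2_on B (g i)" "!!i. i : I ==> L2_tendsto (leb (F ` S)) (f i) (g i)"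
 shows "L2_tendsto (leb S) (%k x. SUM i:I. (F' x e <.> b i) * f i k (F x)) (%x. SUM i:I. (F' x e <.> b i) * g i (F x))"
proof (rule L2_tendsto_sum)
 fix i assume i: "i : I"
 note onS = L2_on_subset[OF lebesgue_A S(1,2)]
 show "L2_on S (%x. (F' x e <.> b i) * f i k (F x))" "L2_on S (%x. (F' x e <.> b i) * g i (F x))" for k
  by (intro onS L2_on_deriv_mult_comp f i)+
 have "AE x in leb S. abs (F' x e <.> b i) <= C * norm e * norm (b i)"
  using AE_F'_bound[of e "b i"] S(2) by (auto simp: AE_on_iff lebesgue_A S(1) elim: eventually_mono)
 thus "L2_tendsto (leb S) (%k x. (F' x e <.> b i) * f i k (F x)) (%x. (F' x e <.> b i) * g i (F x))"
  by (intro L2_tendsto_bounded_mult L2_tendsto_comp[OF S] onS L2_on_comp f i measurable_restrict_mono[OF measurable_F' S(2)])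
qed

lemma weak_deriv_comp_C1:
 assumes psi: "C1 psi"
 shows "weak_dir_deriv A (%x. psi (F x)) e (%x. SUM b:Basis. (F' x e <.> b) * pd psi b (F x))"
  (is "weak_dir_deriv A _ e ?D") unfolding weak_dir_deriv_iff[OF lebesgue_A]
proof (intro allI impI)
 fix phi assume phi: "test_fun A phi"
 note prod = test_fun_mult_comp[OF phi psi]
 note psi_L2 = L2_on_C1[OF psi bounded_dom(2) lebesgue_B]
 have int: "L1_on A (%x. psi (F x) * pd phi e x)" "L1_on A (%x. ?D x * phi x)"
  by (intro L2_mult L2_sum L2_on_comp L2_on_deriv_mult_comp psi_L2 Cc_L2_on lebesgue_A
   test_fun_Cc[OF phi] pd_test_fun_Cc[OF phi])+
 note zero = int_on_pd_test_fun[OF lebesgue_A prod(1)]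
 have "pd (%x. phi x * psi (F x)) e x = psi (F x) * pd phi e x + ?D x * phi x" if "x : A" for x
  by (simp add: prod(2)[OF that] pd_basis_expand[OF psi, of "F' x e"] mult.commute)
 hence "int_on A (pd (%x. phi x * psi (F x)) e) = int_on A (%x. psi (F x) * pd phi e x + ?D x * phi x)"
  by (intro integral_cong) auto
 thus "ip A (%x. psi (F x)) (pd phi e) = - ip A ?D phi" by (simp add: zero integral_add[OF int])
qed

lemma weak_deriv_chain:
 assumes u: "L2_on B u" and h: "!!b. b:Basis ==> L2_on B (h b)" and deriv: "!!b. b:Basis ==> weak_dir_deriv B u b (h b)"
 shows "weak_dir_deriv A (%x. u (F x)) e (%x. SUM b:Basis. (F' x e <.> b) * h b (F x))"
proof (rule weak_deriv_limit[OF lebesgue_A weak_deriv_comp_C1])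
 show C1: "C1 (mollify B u k)" for k by (rule C1_mollify[OF lebesgue_B L1_on_if_L2_on[OF lebesgue_B bounded_dom(2) u]])
 note W = L2_on_C1[OF C1 bounded_dom(2) lebesgue_B]
 show "L2_on A (%x. u (F x))" "L2_on A (%x. SUM b:Basis. (F' x e <.> b) * h b (F x))"
  by (intro L2_sum L2_on_comp L2_on_deriv_mult_comp u h)+
 fix K assume K: "compact K" "K <= A"
 note Km = lebesgue_compact[OF K(1)]
 show "L2_on K (%x. mollify B u k (F x))" "L2_on K (%x. SUM b:Basis. (F' x e <.> b) * pd (mollify B u k) b (F x))" for k
  by (intro L2_on_subset[OF lebesgue_A Km K(2)] L2_sum L2_on_comp L2_on_deriv_mult_comp W)+
 have image: "compact (F ` K)" "F ` K <= B"
  using K F_in continuous_on_subset[OF continuous_F K(2)] by (auto intro: compact_continuous_image)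
 note image_m = lebesgue_compact[OF image(1)]
 show "L2_tendsto (leb K) (%k x. mollify B u k (F x)) (%x. u (F x))"
  by (intro L2_tendsto_comp Km K image_m W u mollify_L2_tendsto(2)[OF lebesgue_B bounded_dom(2) image_m image(2)])
 show "L2_tendsto (leb K) (%k x. SUM b:Basis. (F' x e <.> b) * pd (mollify B u k) b (F x))
   (%x. SUM b:Basis. (F' x e <.> b) * h b (F x))" by (intro L2_tendsto_sum_deriv_mult_comp Km K image_m W h
   pd_mollify_L2_tendsto[OF open_dom(2) bounded_dom(2) u h deriv image])
qed

end

definition pull_grad :: "(real^'n => real^'n) => (real^'n => real^'n => real^'n) => (real^'n => real^'n) => real^'n => real^'n"
 where "pull_grad F F' D x = (\<chi> i. F' x (axis i 1) <.> D (F x))"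

lemma pull_grad_component: "pull_grad F F' D x $ i = (SUM j:UNIV. (F' x (axis i 1) <.> axis j 1) * D (F x) $ j)"
 by (simp add: pull_grad_def inner_axis) (simp add: inner_vec_def)

locale vec_diffeo = bounded_diffeo A B F G F' G' J C for A B :: "(real^'n) set" and F G F' G' J C
begin

lemma H1_grad_comp:
 assumes "H1_grad B u D"
 shows "H1_grad A (%x. u (F x)) (pull_grad F F' D)"
proof -
 note H = H1_gradD[OF open_dom(2) assms]
 have deriv: "L2_on B (%y. D y <.> b)" "weak_dir_deriv B u b (%y. D y <.> b)" if "b:Basis" for b
  using that H by (auto simp: Basis_vec_def inner_axis)
 have "weak_dir_deriv A (%x. u (F x)) (axis i 1) (%x. pull_grad F F' D x $ i)" for i
  using weak_deriv_chain[OF H(1) deriv, of "axis i 1"] by (simp add: pull_grad_component sum_Basis_vec inner_axis)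
 moreover have "L2_on A (%x. pull_grad F F' D x $ i)" for i
  unfolding pull_grad_component by (intro L2_sum L2_on_deriv_mult_comp H)
 ultimately show ?thesis unfolding H1_grad_def is_wgrad_iff[OF open_dom(1)] by (simp add: L2_on_comp[OF H(1)])
qed

lemma H10_grad_test_fun_comp:
 assumes phi: "test_fun B phi"
 shows "H10_grad A (%x. phi (F x)) (pull_grad F F' (cgrad phi))"
proof (rule H10_grad_cong_AE[OF open_dom(1) bounded_dom(1)])
 let ?phi = "%x. if x : A then phi (F x) else 0"
 show "H10_grad A ?phi (cgrad ?phi)" by (rule H10_grad_test_fun[OF open_dom(1) bounded_dom(1) test_fun_comp(1)[OF phi]])
 show "AE x in leb A. ?phi x = phi (F x)" by (simp add: AE_on_iff[OF lebesgue_A])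
 have "cgrad ?phi x $ i = pull_grad F F' (cgrad phi) x $ i" if "x : A" for x i
  using test_fun_comp(2)[OF phi that, of "axis i 1"] pd_basis_expand[OF test_fun_C1[OF phi], of "F' x (axis i 1)" "F x"]
  by (simp add: pull_grad_component cgrad_def sum_Basis_vec)
 thus "AE x in leb A. cgrad ?phi x = pull_grad F F' (cgrad phi) x" by (simp add: AE_on_iff[OF lebesgue_A] vec_eq_iff)
qed

lemma H10_grad_comp:
 assumes H: "H10_grad B u D"
 shows "H10_grad A (%x. u (F x)) (pull_grad F F' D)"
proof -
 note H1 = H10_grad_H1[OF H]
 obtain phi where phi: "!!k. test_fun B (phi k)" and lim: "L2_tendsto (leb B) phi u"
  "!!i. L2_tendsto (leb B) (%k x. cgrad (phi k) x $ i) (%x. D x $ i)" using H10_gradE[OF H] by metis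
 have phi1: "H1_grad B (phi k) (cgrad (phi k))" for k by (rule H1_grad_C1[OF open_dom(2) bounded_dom(2) test_fun_C1[OF phi]])
 note L2 = H1_gradD(1,2)[OF open_dom(2) phi1] H1_gradD(1,2)[OF open_dom(2) H1]
 show ?thesis
 proof (rule H10_grad_limit[OF open_dom(1) bounded_dom(1) H1_grad_comp[OF H1] H10_grad_test_fun_comp[OF phi]])
  show "L2_tendsto (leb A) (%k x. phi k (F x)) (%x. u (F x))"
   using lim(1) by (intro L2_tendsto_comp L2) (auto simp: F_image lebesgue_A lebesgue_B)
  show "L2_tendsto (leb A) (%k x. pull_grad F F' (cgrad (phi k)) x $ i) (%x. pull_grad F F' D x $ i)" for i
   unfolding pull_grad_component using lim(2)
   by (intro L2_tendsto_sum_deriv_mult_comp L2) (auto simp: F_image lebesgue_A lebesgue_B)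
 qed
qed

end

lemma C1_slice:
 assumes "C1 phi"
 shows "C1 (sect phi t)" "pd (sect phi t) e x = pd phi (0, e) (t, x)"
proof -
 have "((%x. (t, x)) has_derivative (%h. (0, h))) (at x)" for x :: 'b by (auto intro!: derivative_eq_intros)
 note deriv = has_derivative_compose[OF this C1_has_derivative[OF assms]]
 show "C1 (sect phi t)"
  by (rule C1I[OF deriv], rule continuous_on_compose2[OF C1_continuous_pd[OF assms]]) (auto intro!: continuous_intros)
 show "pd (sect phi t) e x = pd phi (0, e) (t, x)" by (rule pd_eqI[OF deriv])
qed

lemma
 assumes C: "open C" "C <= I \<times> UNIV" and I: "I : sets lebesgue" and h: "L1_on C h"
 shows Fubini_section_L1: "AE x in leb I. L1_on (Pair x -` C) (sect h x)"
  and Fubini_L1: "L1_on I (%x. int_on (Pair x -` C) (sect h x))"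
  and Fubini_int: "int_on I (%x. int_on (Pair x -` C) (sect h x)) = int_on C h"
proof -
 have int: "integrable lebesgue (%z. indicator C z * h z)" using h C(1) by (simp add: L1_indicator)
 have section_open: "open (Pair x -` C)" for x using C(1) by (intro open_vimage continuous_intros)
 have indicator: "indicator C (x, y) = (indicator I x * indicator (Pair x -` C) y :: real)" for x y
  using C(2) by (auto simp: indicator_def)
 have slices: "(LINT y. indicator C (x, y) * h (x, y)) = indicator I x * int_on (Pair x -` C) (sect h x)" for x
  by (simp add: indicator mult.assoc int_indicator section_open)
 show "AE x in leb I. L1_on (Pair x -` C) (sect h x)" unfolding AE_on_iff[OF I] using lebesgue_Fubini_section[OF int]
  by eventually_elim (auto simp: indicator L1_indicator[symmetric] section_open)
 show "L1_on I (%x. int_on (Pair x -` C) (sect h x))"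
  using lebesgue_Fubini_integrable[OF int] unfolding slices by (simp add: L1_indicator I)
 show "int_on I (%x. int_on (Pair x -` C) (sect h x)) = int_on C h"
  using lebesgue_Fubini[OF int] unfolding slices by (simp add: int_indicator C(1) I)
qed

lemma borel_conv_section:
 fixes v :: "real * (real^'n) => real" and k :: "real^'n => real"
 assumes v: "v : borel_measurable borel" and k: "continuous_on UNIV k"
 shows "(%z. LINT y|lborel. v (fst z, y) * k (y - snd z)) : borel_measurable borel"
proof -
 have "(%p :: (real * (real^'n)) \<times> (real^'n). v (fst (fst p), snd p)) : borel_measurable borel"
  by (rule measurable_compose[OF borel_measurable_continuous_onI v]) (intro continuous_intros)
 moreover have "(%p :: (real * (real^'n)) \<times> (real^'n). k (snd p - snd (fst p))) : borel_measurable borel"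
  by (intro borel_measurable_continuous_onI continuous_on_compose2[OF k]) (auto intro!: continuous_intros)
 ultimately have "(%p. v (fst (fst p), snd p) * k (snd p - snd (fst p))) : borel_measurable
   ((borel :: (real * (real^'n)) measure) \<Otimes>\<^sub>M (lborel :: (real^'n) measure))"
  by (subst measurable_cong_sets[OF sets_pair_measure_cong[OF refl sets_lborel] refl]) (simp add: borel_prod)
 thus ?thesis by (intro lborel.borel_measurable_lebesgue_integral) (simp add: case_prod_unfold)
qed

lemma pd_mollify_eq_lborel_integral:
 assumes S: "S : sets lebesgue" "L1_on S w" and v: "v : borel_measurable borel"
  and ae: "AE y in lebesgue. indicator S y * w y = v y"
 shows "pd (mollify S w k) e x = - (LINT y|lborel. v y * pd (mollifier (1 / Suc k)) e (y - x))"
proof -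
 let ?m = "mollifier (1 / Suc k) :: 'a => real"
 have "(%y. pd ?m e (y - x)) : borel_measurable borel"
  by (intro borel_measurable_continuous_onI continuous_on_compose2[OF C1_continuous_pd[OF C1_mollifier]])
   (auto intro!: continuous_intros)
 with v have "(LINT y|lborel. v y * pd ?m e (y - x)) = (LINT y. v y * pd ?m e (y - x))" by (simp add: integral_completion)
 also have "... = conv (%y. indicator S y * w y) (pd ?m e) x"
  unfolding conv_def by (intro lebesgue_cong_AE(3)) (use ae in eventually_elim, simp)
 finally show ?thesis using S by (simp add: mollify_def pd_conv L1_indicator test_fun_mollifier)
qed

lemma AE_lim_pd_mollify:
 assumes S: "open S" "bounded S" and w: "L2_on S w" "L2_on S h" and d: "weak_dir_deriv S w e h"
 shows "AE x in leb S. h x = lim (%k. pd (mollify S w k) e x)" unfolding AE_on_iff[OF lebesgue_open[OF S(1)]]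
 using AE_mollify_tendsto[OF lebesgue_open[OF S(1)] L1_on_if_L2_on[OF lebesgue_open[OF S(1)] S(2) w(2)]]
proof (eventually_elim, intro impI)
 fix x assume lim: "(%k. mollify S h k x) ----> indicator S x * h x" and x: "x : S"
 note S_L1 = L1_on_if_L2_on[OF lebesgue_open[OF S(1)] S(2) w(1)]
 have "EV k. mollify S h k x = pd (mollify S w k) e x"
  using eventually_pd_mollify[OF S(1) S_L1 d, of "{x}"] x by (auto elim: eventually_mono)
 from Lim_transform_eventually[OF lim this] show "h x = lim (%k. pd (mollify S w k) e x)" using x by (simp add: limI)
qed

locale moving_domain =
 fixes T :: real and \<Omega> :: "real => (real^'n) set"
 assumes T_pos: "0 < T" and open_cyl: "open (tdomain T \<Omega>)" and bounded_cyl: "bounded (tdomain T \<Omega>)"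
begin

abbreviation "cyl == tdomain T \<Omega>"

abbreviation "ivl == {0<..<T}"

lemma cyl_lebesgue: "cyl : sets lebesgue" using open_cyl by auto

lemma lebesgue_ivl: "ivl : sets lebesgue" by auto

lemma slice_vimage: "t : ivl ==> \<Omega> t = Pair t -` cyl" by (auto simp: tdomain_def)

lemma open_slice: "t : ivl ==> open (\<Omega> t)"
 unfolding slice_vimage using open_cyl by (intro open_vimage) (auto intro!: continuous_intros)

lemma bounded_slice: "t : ivl ==> bounded (\<Omega> t)"
proof -
 assume "t : ivl"
 hence "\<Omega> t <= snd ` cyl" by (force simp: tdomain_def)
 thus ?thesis using bounded_cyl bounded_snd bounded_subset by blast
qed

lemma lebesgue_slice: "t : ivl ==> \<Omega> t : sets lebesgue" using open_slice by auto

lemma AE_cyl_iff: "(AE z in leb cyl. P z) <-> (AE z in lebesgue. z : cyl --> P z)" by (rule AE_on_iff[OF cyl_lebesgue])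

lemma AE_ivl_iff: "(AE t in leb ivl. P t) <-> (AE t in lebesgue. t : ivl --> P t)" by (rule AE_on_iff[OF lebesgue_ivl])

lemma AE_in_ivl: "AE t in leb ivl. t : ivl" unfolding AE_ivl_iff by simp

lemma indicator_cyl: "indicator cyl (t, x) = (indicator ivl t * indicator (\<Omega> t) x :: real)"
 by (auto simp: tdomain_def indicator_def)

lemma Fubini:
 assumes h: "L1_on cyl h"
 shows "AE t in leb ivl. L1_on (\<Omega> t) (sect h t)" "L1_on ivl (%t. int_on (\<Omega> t) (sect h t))"
  "int_on ivl (%t. int_on (\<Omega> t) (sect h t)) = int_on cyl h"
proof -
 have sub: "cyl <= ivl \<times> UNIV" by (auto simp: tdomain_def)
 have slices: "AE t in leb ivl. \<Omega> t = Pair t -` cyl" by (simp add: AE_ivl_iff slice_vimage)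
 hence int: "AE t in leb ivl. int_on (\<Omega> t) (sect h t) = int_on (Pair t -` cyl) (sect h t)" by eventually_elim simp
 note sections = Fubini_section_L1[OF open_cyl sub lebesgue_ivl h] Fubini_L1[OF open_cyl sub lebesgue_ivl h]
  Fubini_int[OF open_cyl sub lebesgue_ivl h]
 show "AE t in leb ivl. L1_on (\<Omega> t) (sect h t)" using sections(1) slices by eventually_elim simp
 show "L1_on ivl (%t. int_on (\<Omega> t) (sect h t))" "int_on ivl (%t. int_on (\<Omega> t) (sect h t)) = int_on cyl h"
  using sections(2,3) by (simp_all only: L1_on_cong_AE[OF lebesgue_ivl int] int_on_cong_AE[OF lebesgue_ivl int])
qed

lemma AE_slice:
 assumes "AE z in leb cyl. P z"
 shows "AE t in leb ivl. AE x in leb (\<Omega> t). P (t, x)"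
proof -
 have "AE z in lebesgue. z : cyl --> P z" using assms by (simp add: AE_on_iff cyl_lebesgue)
 from AE_lebesgue_Pair[OF this] show ?thesis unfolding AE_ivl_iff
 proof (eventually_elim, intro impI)
  fix t assume ae: "AE x in lebesgue. (t, x) : cyl --> P (t, x)" and t: "t : ivl"
  show "AE x in leb (\<Omega> t). P (t, x)"
   unfolding AE_on_iff[OF lebesgue_slice[OF t]] using ae by eventually_elim (use t in "auto simp: tdomain_def")
 qed
qed

lemma measurable_slice:
 fixes h :: "real * (real^'n) => real"
 assumes "h : borel_measurable (leb cyl)"
 shows "AE t in leb ivl. (sect h t) : borel_measurable (leb (\<Omega> t))"
proof -
 have "(%z. indicator cyl z * h z) : borel_measurable lebesgue" using assms by (simp add: measurable_indicator_iff cyl_lebesgue)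
 from lebesgue_section_measurable[OF this] show ?thesis unfolding AE_ivl_iff
 proof eventually_elim
  case (elim t)
  thus ?case using lebesgue_slice[of t] by (auto simp: indicator_cyl measurable_indicator_iff[symmetric])
 qed
qed

lemma L1_on_cyl_if_slices:
 assumes h: "h : borel_measurable (leb cyl)" and slices: "AE t in leb ivl. L1_on (\<Omega> t) (sect h t)"
  and bound: "AE t in leb ivl. int_on (\<Omega> t) (%x. abs (h (t, x))) <= c t" and c: "L1_on ivl c"
 shows "L1_on cyl h"
proof -
 have "integrable lebesgue (%z. indicator cyl z * h z)"
 proof (rule lebesgue_Tonelli_integrable)
  show "(%z. indicator cyl z * h z) : borel_measurable lebesgue" using h by (simp add: measurable_indicator_iff cyl_lebesgue)
  show "integrable lebesgue (%t. indicator ivl t * c t)" using c by (simp add: L1_indicator)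
  show "AE t in lebesgue. integrable lebesgue (%x. indicator cyl (t, x) * h (t, x))" using slices unfolding AE_ivl_iff
  proof eventually_elim
   case (elim t)
   thus ?case using lebesgue_slice[of t] by (cases "t : ivl") (auto simp: indicator_cyl L1_indicator)
  qed
  have "(LINT x. abs (indicator cyl (t, x) * h (t, x))) = indicator ivl t * int_on (\<Omega> t) (%x. abs (h (t, x)))" for t
   using lebesgue_slice[of t] by (cases "t : ivl") (auto simp: indicator_cyl abs_mult int_indicator)
  thus "AE t in lebesgue. (LINT x. abs (indicator cyl (t, x) * h (t, x))) <= indicator ivl t * c t"
   using bound unfolding AE_ivl_iff by (auto simp: indicator_def elim: eventually_mono)
 qed
 thus ?thesis using cyl_lebesgue by (simp add: L1_indicator)
qed

lemma L2_on_slices: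
 assumes "L2_on cyl w"
 shows "AE t in leb ivl. L2_on (\<Omega> t) (sect w t)" "L1_on ivl (%t. sqnorm (\<Omega> t) (sect w t))"
  "int_on ivl (%t. sqnorm (\<Omega> t) (sect w t)) = sqnorm cyl w"
proof -
 note square = Fubini[OF L2_square_integrable[OF assms]]
 show "AE t in leb ivl. L2_on (\<Omega> t) (sect w t)" using measurable_slice[OF L2_measurable[OF assms]] square(1)
  by eventually_elim (simp add: sq_integrable_def)
 show "L1_on ivl (%t. sqnorm (\<Omega> t) (sect w t))" "int_on ivl (%t. sqnorm (\<Omega> t) (sect w t)) = sqnorm cyl w"
  by (rule square)+
qed

lemma L2_on_ivl_sqrt:
 assumes "L1_on ivl N" "!!t. 0 <= N t"
 shows "L2_on ivl (%t. sqrt (N t))"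
 using assms measurable_compose[OF borel_measurable_integrable[OF assms(1)] borel_measurable_sqrt]
 by (simp add: sq_integrable_def)

lemma L2_L2_iff: "L2_L2 T \<Omega> w <-> L2_on cyl w"
proof
 assume w: "L2_on cyl w"
 have "AE t in lebesgue. t : ivl --> L2 (\<Omega> t) (slice w t)" using L2_on_slices(1)[OF w] unfolding AE_ivl_iff
  by eventually_elim (auto simp: L2_iff[OF lebesgue_slice] slice_def)
 moreover have "AE t in leb ivl. sqrt (sqnorm (\<Omega> t) (sect w t)) = l2norm (\<Omega> t) (slice w t)"
  by (simp add: AE_ivl_iff l2norm_eq[OF lebesgue_slice] slice_def)
 from L2_on_cong_AE[OF lebesgue_ivl this]
 have "L2_on ivl (%t. l2norm (\<Omega> t) (slice w t))" using L2_on_ivl_sqrt[OF L2_on_slices(2)[OF w]] by simp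
 ultimately show "L2_L2 T \<Omega> w" using w by (simp add: L2_L2_def L2_iff[OF cyl_lebesgue] L2_iff[OF lebesgue_ivl])
qed (simp add: L2_L2_def L2_iff[OF cyl_lebesgue])

lemma tint_eq:
 assumes "AE t in leb ivl. X t = int_on (\<Omega> t) (sect h t)" "L1_on cyl h"
 shows "tint T X = int_on cyl h" unfolding tint_def int_indicator[OF lebesgue_ivl] Fubini(3)[OF assms(2), symmetric]
 by (rule int_on_cong_AE[OF lebesgue_ivl assms(1)])

lemma tint_inner:
 assumes X: "AE t in leb ivl. AE x in leb (\<Omega> t). X t x = h (t, x)" and h: "L1_on cyl h"
 shows "tint T (%t. LINT x. indicator (\<Omega> t) x * X t x) = int_on cyl h"
proof (rule tint_eq[OF _ h])
 show "AE t in leb ivl. (LINT x. indicator (\<Omega> t) x * X t x) = int_on (\<Omega> t) (sect h t)"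
  using X AE_in_ivl by eventually_elim (simp only: int_indicator[OF lebesgue_slice] int_on_cong_AE[OF lebesgue_slice])
qed

lemma tint_l2ip:
 assumes "L2_on cyl p" "L2_on cyl q" and "AE t in leb ivl. AE x in leb (\<Omega> t). r t x = p (t, x)"
   "AE t in leb ivl. AE x in leb (\<Omega> t). s t x = q (t, x)"
 shows "tint T (%t. l2ip (\<Omega> t) (r t) (s t)) = ip cyl p q" unfolding l2ip_def mult.assoc
proof (rule tint_inner[OF _ L2_mult[OF assms(1,2)]])
 show "AE t in leb ivl. AE x in leb (\<Omega> t). r t x * s t x = p (t, x) * q (t, x)" using assms(3,4)
 proof eventually_elim
  case (elim t)
  thus ?case by eventually_elim simp
 qed
qed

definition energy where "energy u w g <-> L2_on cyl u & L2_on cyl w & (ALL i. L2_on cyl (%z. g z $ i)) &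
  weak_dir_deriv cyl u (1, 0) w & (AE t in leb ivl. H10_grad (\<Omega> t) (sect u t) (sect g t))"

lemma energyD:
 assumes "energy u w g"
 shows "L2_on cyl u" "L2_on cyl w" "!!i. L2_on cyl (%z. g z $ i)" "weak_dir_deriv cyl u (1, 0) w"
  "AE t in leb ivl. H10_grad (\<Omega> t) (sect u t) (sect g t)" using assms by (auto simp: energy_def)

text \<open>The weak gradients of the slices are chosen for each time separately. The gradients of the
 mollified slices depend measurably on time as well, and so does their limit.\<close>

lemma borel_slice_gradientE:
 assumes u: "L2_on cyl u" and H: "AE t in leb ivl. H10 (\<Omega> t) (sect u t)"
 obtains g :: "real * (real^'n) => real^'n" where "!!i. (%z. g z $ i) : borel_measurable borel"
  "AE t in leb ivl. H10_grad (\<Omega> t) (sect u t) (sect g t)"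
proof -
 have "(%z. indicator cyl z * u z) : borel_measurable lebesgue"
  using u by (simp add: measurable_indicator_iff cyl_lebesgue sq_integrable_def)
 then obtain v where v: "v : borel_measurable borel" "AE z in lebesgue. indicator cyl z * u z = v z"
  by (rule lebesgue_borel_version)
 define D where "D k i z = - (LINT y|lborel. v (fst z, y) * pd (mollifier (1 / Suc k)) (axis i 1) (y - snd z))" for k i z
 have [measurable]: "D k i : borel_measurable borel" for k i
  unfolding D_def by (intro borel_measurable_uminus borel_conv_section v(1) C1_continuous_pd C1_mollifier)
 define g where "g z = (\<chi> i. lim (%k. D k i z))" for z
 have "(%z. g z $ i) : borel_measurable borel" for i unfolding g_def by simp
 moreover have version: "AE t in leb ivl. AE y in lebesgue. indicator (\<Omega> t) y * u (t, y) = v (t, y)"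
  unfolding AE_ivl_iff using AE_lebesgue_Pair[OF v(2)] by eventually_elim (auto simp: indicator_cyl elim: eventually_mono)
 have "AE t in leb ivl. H10_grad (\<Omega> t) (sect u t) (sect g t)" using H L2_on_slices(1)[OF u] AE_in_ivl version
 proof eventually_elim
  case (elim t)
  let ?u = "%x. u (t, x)"
  note S = open_slice[OF elim(3)] bounded_slice[OF elim(3)] and Sl = lebesgue_slice[OF elim(3)]
  obtain G where "is_wgrad (\<Omega> t) ?u G" using elim(1) by (auto simp: H10_def H1_def)
  hence H: "H10_grad (\<Omega> t) ?u G" using H10_iff(2)[OF S elim(1)] by blast
  note G = H1_gradD[OF S(1) H10_grad_H1[OF H]]
  have "D k i (t, x) = pd (mollify (\<Omega> t) ?u k) (axis i 1) x" for k i x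
   using pd_mollify_eq_lborel_integral[OF Sl L1_on_if_L2_on[OF Sl S(2) elim(2)] borel_section[OF v(1)] elim(4)]
   by (simp add: D_def)
  hence "AE x in leb (\<Omega> t). G x $ i = g (t, x) $ i" for i using AE_lim_pd_mollify[OF S G(1,2,3)] by (simp add: g_def)
  hence "AE x in leb (\<Omega> t). ALL i. G x $ i = g (t, x) $ i" unfolding AE_all_countable by blast
  hence "AE x in leb (\<Omega> t). G x = g (t, x)" by eventually_elim (simp add: vec_eq_iff)
  thus ?case by (intro H10_grad_cong_AE[OF S H]) auto
 qed
 ultimately show ?thesis using that by blast
qed

lemma H1norm_slice:
 assumes "AE t in leb ivl. H10_grad (\<Omega> t) (sect u t) (sect g t)"
 shows "AE t in leb ivl. (H1norm (\<Omega> t) (sect u t))^2 =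
  sqnorm (\<Omega> t) (sect u t) + (SUM i:UNIV. sqnorm (\<Omega> t) (%x. g (t, x) $ i))"
 using assms AE_in_ivl by eventually_elim (simp add: H1norm_square[OF open_slice bounded_slice H10_grad_H1])

lemma L2_H10_gradientE:
 assumes "L2_H10 T \<Omega> u"
 obtains g where "!!i. L2_on cyl (%z. g z $ i)" "AE t in leb ivl. H10_grad (\<Omega> t) (sect u t) (sect g t)"
proof -
 have u: "L2_on cyl u" and N: "L2_on ivl (%t. H1norm (\<Omega> t) (sect u t))"
  and H: "AE t in leb ivl. H10 (\<Omega> t) (sect u t)"
  using assms by (simp_all add: L2_H10_def L2_iff[OF cyl_lebesgue] L2_iff[OF lebesgue_ivl] AE_ivl_iff slice_def)
 obtain g :: "real * (real^'n) => real^'n" where g: "!!i. (%z. g z $ i) : borel_measurable borel"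
  and grad: "AE t in leb ivl. H10_grad (\<Omega> t) (sect u t) (sect g t)" using borel_slice_gradientE[OF u H] by blast
 have "L2_on cyl (%z. g z $ i)" for i
 proof -
  have meas: "(%z. g z $ i) : borel_measurable (leb cyl)" by (intro measurable_restrict_space1 lebesgue_if_borel g)
  have "L1_on cyl (%z. (g z $ i)^2)"
  proof (rule L1_on_cyl_if_slices)
   show "(%z. (g z $ i)^2) : borel_measurable (leb cyl)" using meas by (rule borel_measurable_power)
   show "L1_on ivl (%t. (H1norm (\<Omega> t) (sect u t))^2)" using N by (rule L2_square_integrable)
   show "AE t in leb ivl. L1_on (\<Omega> t) (%x. (g (t, x) $ i)^2)" using grad AE_in_ivl
    by eventually_elim (intro L2_square_integrable H1_gradD(2) open_slice H10_grad_H1)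
   show "AE t in leb ivl. int_on (\<Omega> t) (%x. abs ((g (t, x) $ i)^2)) <= (H1norm (\<Omega> t) (sect u t))^2"
    using H1norm_slice[OF grad]
   proof eventually_elim
    case (elim t)
    have "sqnorm (\<Omega> t) (%x. g (t, x) $ i) <= (SUM i:UNIV. sqnorm (\<Omega> t) (%x. g (t, x) $ i))"
     by (rule member_le_sum) auto
    thus ?case using elim by (simp add: add_increasing)
   qed
  qed
  with meas show ?thesis by (simp add: sq_integrable_def)
 qed
 with grad that show ?thesis by blast
qed

lemma energy_imp_L2_H10:
 assumes "energy u w g"
 shows "L2_H10 T \<Omega> u"
proof -
 note u = energyD[OF assms]
 let ?N = "%t. sqnorm (\<Omega> t) (sect u t) + (SUM i:UNIV. sqnorm (\<Omega> t) (%x. g (t, x) $ i))"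
 have "L1_on ivl ?N" by (intro integrable_add integrable_sum L2_on_slices(2) u)
 hence "L2_on ivl (%t. sqrt (?N t))" by (rule L2_on_ivl_sqrt) (simp add: sum_nonneg)
 moreover have "AE t in leb ivl. sqrt (?N t) = H1norm (\<Omega> t) (slice u t)"
  using H1norm_slice[OF u(5)] unfolding slice_def by eventually_elim (metis H1norm_nonneg real_sqrt_unique)
 ultimately have "L2_on ivl (%t. H1norm (\<Omega> t) (slice u t))" by (simp only: L2_on_cong_AE[OF lebesgue_ivl])
 moreover have "AE t in lebesgue. t : ivl --> H10 (\<Omega> t) (slice u t)" using u(5) unfolding AE_ivl_iff slice_def
  by eventually_elim (use H10_iff(1)[OF open_slice bounded_slice] in blast)
 ultimately show ?thesis by (simp add: L2_H10_def u(1) L2_iff[OF cyl_lebesgue] L2_iff[OF lebesgue_ivl])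
qed

lemma is_tderiv_if_energy: "energy u w g ==> is_tderiv T \<Omega> u w" by (simp add: is_tderiv_def L2_L2_iff energy_def)

lemma L2_H10_tderiv_iff: "L2_H10 T \<Omega> u & (EX w. is_tderiv T \<Omega> u w) <-> (EX w g. energy u w g)"
proof
 assume u: "L2_H10 T \<Omega> u & (EX w. is_tderiv T \<Omega> u w)"
 then obtain w where w: "is_tderiv T \<Omega> u w" by blast
 obtain g where g: "!!i. L2_on cyl (%z. g z $ i)" "AE t in leb ivl. H10_grad (\<Omega> t) (sect u t) (sect g t)"
  using L2_H10_gradientE[OF conjunct1[OF u]] by blast
 have "energy u w g" using u w g by (simp add: energy_def L2_H10_def is_tderiv_def L2_L2_iff L2_iff[OF cyl_lebesgue])
 thus "EX w g. energy u w g" by blast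
qed (blast intro: energy_imp_L2_H10 is_tderiv_if_energy)

lemma tderiv_energy:
 assumes "energy u w g"
 shows "L2_on cyl (tderiv T \<Omega> u)" "AE z in leb cyl. tderiv T \<Omega> u z = w z"
proof -
 have "is_tderiv T \<Omega> u (tderiv T \<Omega> u)"
  unfolding tderiv_def by (rule someI[of "is_tderiv T \<Omega> u", OF is_tderiv_if_energy[OF assms]])
 hence deriv: "L2_on cyl (tderiv T \<Omega> u)" "weak_dir_deriv cyl u (1, 0) (tderiv T \<Omega> u)"
  by (simp_all add: is_tderiv_def L2_L2_iff)
 thus "L2_on cyl (tderiv T \<Omega> u)" "AE z in leb cyl. tderiv T \<Omega> u z = w z"
  by (auto intro: weak_deriv_unique[OF open_cyl bounded_cyl _ _ _ energyD(4)[OF assms]] energyD(2)[OF assms])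
qed

lemma wgrad_energy:
 assumes "energy u w g"
 shows "AE t in leb ivl. AE x in leb (\<Omega> t). wgrad (\<Omega> t) (slice u t) x = g (t, x)"
 using energyD(5)[OF assms] AE_in_ivl
proof eventually_elim
 case (elim t)
 have "is_wgrad (\<Omega> t) (slice u t) (sect g t)" using H10_grad_H1[OF elim(1)] by (simp add: H1_grad_def slice_def)
 thus ?case using is_wgrad_unique[OF open_slice[OF elim(2)] bounded_slice[OF elim(2)] is_wgrad_wgrad] by blast
qed

lemma test_fun_slice:
 assumes "test_fun cyl phi" "t : ivl"
 shows "test_fun (\<Omega> t) (sect phi t)"
proof -
 obtain K where K: "compact K" "K <= cyl" "!!z. z ~: K ==> phi z = 0" using test_fun_supportE[OF assms(1)] by metis
 have "compact (snd ` (K \<inter> ({t} \<times> UNIV)))"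
  by (intro compact_continuous_image compact_Int_closed K closed_Times) (auto intro!: continuous_intros)
 moreover have "snd ` (K \<inter> ({t} \<times> UNIV)) = {x. (t, x) : K}" by force
 ultimately have "compact {x. (t, x) : K}" by simp
 thus ?thesis using K by (intro test_funI[OF C1_slice(1)[OF test_fun_C1[OF assms(1)]]]) (auto simp: tdomain_def)
qed

lemma energy_weak_space_deriv:
 assumes u: "energy u w g"
 shows "weak_dir_deriv cyl u (0, axis i 1) (%z. g z $ i)" unfolding weak_dir_deriv_iff[OF cyl_lebesgue]
proof (intro allI impI)
 fix phi assume phi: "test_fun cyl phi"
 note u = energyD[OF u]
 let ?p = "%z. u z * pd phi (0, axis i 1) z" and ?q = "%z. g z $ i * phi z"
 have int: "L1_on cyl ?p" "L1_on cyl ?q" by (intro L2_mult u Cc_L2_on cyl_lebesgue test_fun_Cc[OF phi] pd_test_fun_Cc[OF phi])+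
 have "AE t in leb ivl. int_on (\<Omega> t) (sect ?p t) = - int_on (\<Omega> t) (sect ?q t)" using u(5) AE_in_ivl
 proof eventually_elim
  case (elim t)
  have "weak_dir_deriv (\<Omega> t) (sect u t) (axis i 1) (%x. g (t, x) $ i)"
   by (rule H1_gradD(3)[OF open_slice[OF elim(2)] H10_grad_H1[OF elim(1)]])
  thus ?case using test_fun_slice[OF phi elim(2)]
   unfolding weak_dir_deriv_iff[OF lebesgue_slice[OF elim(2)]] C1_slice(2)[OF test_fun_C1[OF phi], symmetric] by blast
 qed
 from int_on_cong_AE[OF lebesgue_ivl this]
 show "int_on cyl ?p = - int_on cyl ?q" by (simp add: Fubini(3)[OF int(1)] Fubini(3)[OF int(2)])
qed

end

lemma C1_fst:
 assumes "C1 theta"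
 shows "C1 (%z :: real * 'b::euclidean_space. theta (fst z))" "pd (%z :: real * 'b. theta (fst z)) e z = pd theta (fst e) (fst z)"
proof -
 have "(fst has_derivative fst) (at z)" for z :: "real * 'b" by (auto intro!: derivative_eq_intros)
 note deriv = has_derivative_compose[OF this C1_has_derivative[OF assms]]
 show "C1 (%z :: real * 'b. theta (fst z))"
  by (rule C1I[OF deriv], rule continuous_on_compose2[OF C1_continuous_pd[OF assms]]) (auto intro!: continuous_intros)
 show "pd (%z :: real * 'b. theta (fst z)) e z = pd theta (fst e) (fst z)" by (rule pd_eqI[OF deriv])
qed

lemma C1_snd:
 assumes "C1 phi"
 shows "C1 (%z :: real * 'b::euclidean_space. phi (snd z))" "pd (%z :: real * 'b. phi (snd z)) e z = pd phi (snd e) (snd z)"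
proof -
 have "(snd has_derivative snd) (at z)" for z :: "real * 'b" by (auto intro!: derivative_eq_intros)
 note deriv = has_derivative_compose[OF this C1_has_derivative[OF assms]]
 show "C1 (%z :: real * 'b. phi (snd z))"
  by (rule C1I[OF deriv], rule continuous_on_compose2[OF C1_continuous_pd[OF assms]]) (auto intro!: continuous_intros)
 show "pd (%z :: real * 'b. phi (snd z)) e z = pd phi (snd e) (snd z)" by (rule pd_eqI[OF deriv])
qed

lemma pd_0: "C1 phi ==> pd phi 0 x = 0" using pd_scale_dir[of phi 0 0 x] by simp

lemma L2_on_continuous_mult:
 assumes f: "continuous_on UNIV f" and S: "S : sets lebesgue" "bounded S" and v: "L2_on S v"
 shows "L2_on S (%x. f x * v x)"
proof -
 have "compact (f ` closure S)" using S by (intro compact_continuous_image) (auto intro: continuous_on_subset[OF f])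
 then obtain C where "!!x. x : closure S ==> abs (f x) <= C" using compact_imp_bounded bounded_real by (metis imageI)
 hence "AE x in leb S. abs (f x) <= C" using closure_subset[of S] by (auto simp: AE_on_iff S(1))
 moreover have "f : borel_measurable (leb S)"
  by (intro measurable_restrict_space1 lebesgue_if_borel borel_measurable_continuous_onI f)
 ultimately show ?thesis by (intro L2_bounded_mult[OF v])
qed

lemma test_fun_L2_dense:
 assumes S: "open S" "bounded S" and g: "L2_on S g"
 obtains kappa where "!!j. test_fun S (kappa j)" "L2_tendsto (leb S) kappa g"
proof -
 note Sm = lebesgue_open[OF S(1)]
 have "EX kappa. test_fun S kappa & sqnorm S (%x. kappa x - g x) < eps" if eps: "eps > 0" for eps
 proof -
  obtain C :: "nat => 'a set" where C: "!!n. compact (C n)" "!!n. C n <= S"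
   and exhaust: "!!K. compact K ==> K <= S ==> EX N. ALL n>=N. K <= C n" using open_Union_compact_subsets[OF S(1)] by metis
  have cut: "L2_on S (%x. indicator (C n) x * g x)" for n using lebesgue_compact[OF C(1)]
   by (intro L2_bounded_mult[OF g, of _ 1] measurable_restrict_space1) (auto simp: indicator_def)
  have "(%n. sqnorm S (%x. indicator (C n) x * g x - g x)) ----> int_on S (%_. 0)"
  proof (rule integral_dominated_convergence[where w = "%x. (g x)^2"])
   have zero: "EV n. (indicator (C n) x * g x - g x)^2 = 0" if "x : S" for x
    using exhaust[of "{x}"] that by (auto simp: eventually_sequentially indicator_def)
   show "AE x in leb S. (%n. (indicator (C n) x * g x - g x)^2) ----> 0"
    unfolding AE_on_iff[OF Sm] by (intro AE_I2 impI tendsto_eventually zero)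
  qed (use L2_square_integrable[OF L2_diff[OF cut g]] L2_square_integrable[OF g] in "auto simp: indicator_def")
  hence "EV n. sqnorm S (%x. indicator (C n) x * g x - g x) < eps / 4"
   using eps by (intro order_tendstoD(2)) auto
  then obtain n where n: "sqnorm S (%x. indicator (C n) x * g x - g x) < eps / 4"
   using eventually_happens'[OF sequentially_bot] by blast
  let ?W = "mollify S (%x. indicator (C n) x * g x)"
  obtain K' where "EV k. test_fun S (?W k) & (ALL x. x ~: K' --> (ALL e. pd (?W k) e x = 0))"
   by (rule mollify_compact_support[OF S cut[of n] C(1)[of n] C(2)[of n]]) auto
  hence "EV k. test_fun S (?W k)" by eventually_elim simp
  moreover have "EV k. sqnorm S (%x. ?W k x - indicator (C n) x * g x) < eps / 4"
   using mollify_L2_tendsto(2)[OF Sm S(2) Sm order_refl cut[of n]] eps unfolding L2_tendsto_def by (intro order_tendstoD(2)) auto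
  ultimately have "EV k. test_fun S (?W k) & sqnorm S (%x. ?W k x - indicator (C n) x * g x) < eps / 4"
   by (rule eventually_conj)
  then obtain k where k: "test_fun S (?W k)" "sqnorm S (%x. ?W k x - indicator (C n) x * g x) < eps / 4"
   using eventually_happens'[OF sequentially_bot] by blast
  have "sqnorm S (%x. ?W k x - g x) < eps"
   using integral_square_add_le[OF L2_diff[OF test_fun_L2_on[OF k(1) Sm] cut[of n]] L2_diff[OF cut[of n] g]]
    k(2) n by simp
  with k(1) show ?thesis by blast
 qed
 hence "ALL j. EX kappa. test_fun S kappa & sqnorm S (%x. kappa x - g x) < 1 / Suc j" by simp
 then obtain kappa where kappa: "!!j. test_fun S (kappa j)" "!!j. sqnorm S (%x. kappa j x - g x) < 1 / Suc j" by metis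
 have "L2_tendsto (leb S) kappa g" by (rule L2_tendsto_le[OF less_imp_le[OF kappa(2)] one_over_Suc_tendsto_0])
 with kappa(1) that show ?thesis by blast
qed

lemma L2_weak_tendsto_if_test_fun:
 assumes S: "open S" "bounded S" and f0: "L2_on S f0" and g: "L2_on S g"
  and f: "eventually (%t. L2_on S (f t) & sqnorm S (f t) <= C) F"
  and test: "!!phi. test_fun S phi ==> ((%t. ip S (f t) phi) ---> ip S f0 phi) F"
 shows "((%t. ip S (f t) g) ---> ip S f0 g) F"
proof (rule tendstoI)
 fix eps :: real assume eps: "eps > 0"
 note Sm = lebesgue_open[OF S(1)]
 define D where "D = sqrt (2 * C + 2 * sqnorm S f0)"
 obtain kappa where kappa: "!!j. test_fun S (kappa j)" "L2_tendsto (leb S) kappa g" using test_fun_L2_dense[OF S g] by blast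
 have "(%j. D * sqrt (sqnorm S (%x. kappa j x - g x))) ----> 0"
  using tendsto_mult_right_zero[OF tendsto_real_sqrt[OF kappa(2)[unfolded L2_tendsto_def], simplified]] .
 then obtain j where j: "D * sqrt (sqnorm S (%x. kappa j x - g x)) < eps / 2"
  using order_tendstoD(2)[of _ 0 sequentially "eps / 2"] eps eventually_happens'[OF sequentially_bot] by fastforce
 note kappa_L2 = Cc_L2_on[OF test_fun_Cc[OF kappa(1)[of j]] Sm]
 have "eventually (%t. dist (ip S (f t) (kappa j)) (ip S f0 (kappa j)) < eps / 2) F"
  using eps by (intro tendstoD[OF test[OF kappa(1)]]) simp
 with f show "eventually (%t. dist (ip S (f t) g) (ip S f0 g) < eps) F"
 proof eventually_elim
  case (elim t)
  hence ft: "L2_on S (f t)" by simp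
  have pair: "ip S (%x. f t x - f0 x) p = ip S (f t) p - ip S f0 p" if "L2_on S p" for p
   using L2_mult[OF ft that] L2_mult[OF f0 that] by (simp add: left_diff_distrib)
  have "abs (ip S (%x. f t x - f0 x) (%x. kappa j x - g x)) <=
    sqrt (sqnorm S (%x. f t x - f0 x)) * sqrt (sqnorm S (%x. kappa j x - g x))"
   by (intro Cauchy_Schwarz_integral_sqrt L2_diff ft f0 kappa_L2 g)
  also have "... <= D * sqrt (sqnorm S (%x. kappa j x - g x))"
   using integral_square_add_le[OF ft L2_minus[OF f0]] elim unfolding D_def by (intro mult_right_mono real_sqrt_le_mono) auto
  finally have "abs (ip S (%x. f t x - f0 x) (%x. kappa j x - g x)) < eps / 2" using j by simp
  moreover have "ip S (%x. f t x - f0 x) (%x. kappa j x - g x) = ip S (%x. f t x - f0 x) (kappa j) - ip S (%x. f t x - f0 x) g"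
   using L2_mult[OF L2_diff[OF ft f0] kappa_L2] L2_mult[OF L2_diff[OF ft f0] g] by (simp add: right_diff_distrib)
  ultimately show ?case using elim(2) pair[OF kappa_L2] pair[OF g] unfolding dist_real_def by linarith
 qed
qed

definition weak_jet :: "(real^'n => real) => (real^'n => real^'n) => 'n option => real^'n => real" where
 "weak_jet w G k = (case k of None => w | Some i => (%x. G x $ i))"

abbreviation "jet phi == weak_jet phi (cgrad phi)"

lemma weak_jet_simps [simp]: "weak_jet w G None = w" "weak_jet w G (Some i) = (%x. G x $ i)" by (simp_all add: weak_jet_def)

lemma cgrad_component: "(%x. cgrad phi x $ i) = pd phi (axis i 1)" by (simp add: cgrad_def)

lemma jet_Cc: "test_fun S phi ==> Cc (jet phi k)" by (cases k) (auto simp: cgrad_component intro: test_fun_Cc pd_test_fun_Cc)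

lemma sum_option: "(SUM k:UNIV. f k) = f None + (SUM i:UNIV. f (Some (i :: 'n::finite)))"
 by (simp add: UNIV_option_conv sum.reindex)

definition space_jet :: "(real * (real^'n) => real) => 'n option => real * (real^'n) => real" where
 "space_jet psi k = (case k of None => psi | Some i => pd psi (0, axis i 1))"

lemma space_jet_simps [simp]: "space_jet psi None = psi" "space_jet psi (Some i) = pd psi (0, axis i 1)"
 by (simp_all add: space_jet_def)

lemma space_jet_Cc: "test_fun A psi ==> Cc (space_jet psi k)" by (cases k) (auto intro: test_fun_Cc pd_test_fun_Cc)

lemma H1_grad_weak_jet: "open S ==> H1_grad S w G ==> L2_on S (weak_jet w G k)" by (cases k) (auto intro: H1_gradD)

lemma weak_jet_le_H1norm:
 assumes S: "open S" "bounded S" and H: "H1_grad S w G"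
 shows "sqrt (sqnorm S (weak_jet w G k)) <= H1norm S w"
proof -
 have "sqnorm S (weak_jet w G k) <= (SUM k:UNIV. sqnorm S (weak_jet w G k))" by (rule member_le_sum) auto
 also have "... = (H1norm S w)^2" by (simp add: H1norm_square[OF S H] sum_option)
 finally show ?thesis by (intro real_le_lsqrt H1norm_nonneg) auto
qed

lemma pairing_H10:
 assumes S: "open S" "bounded S" and w: "L2_on S w" and R: "!!k. L2_on S (R k)"
  and pairing: "!!phi. test_fun S phi ==> ip S w phi = (SUM k:UNIV. ip S (R k) (jet phi k))" and H: "H10_grad S n G"
 shows "ip S w n = (SUM k:UNIV. ip S (R k) (weak_jet n G k))"
proof -
 obtain phi where phi: "!!j. test_fun S (phi j)" and lim: "L2_tendsto (leb S) phi n"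
  "!!i. L2_tendsto (leb S) (%j x. cgrad (phi j) x $ i) (%x. G x $ i)" using H10_gradE[OF H] by metis
 note L2 = H1_grad_weak_jet[OF S(1) H1_grad_C1[OF S test_fun_C1[OF phi]]] H1_grad_weak_jet[OF S(1) H10_grad_H1[OF H]]
 have "L2_tendsto (leb S) (%j. jet (phi j) k) (weak_jet n G k)" for k using lim by (cases k) auto
 hence conv: "(%j. ip S (jet (phi j) k) p) ----> ip S (weak_jet n G k) p" if "L2_on S p" for k p
  by (intro L2_tendsto_integral_mult L2 that)
 have "(%j. ip S w (phi j)) ----> ip S w n" using conv[OF w, of None] by (simp add: mult.commute)
 moreover have "(%j. ip S w (phi j)) ----> (SUM k:UNIV. ip S (R k) (weak_jet n G k))"
  using conv[OF R] unfolding pairing[OF phi] by (intro tendsto_sum) (simp add: mult.commute)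
 ultimately show ?thesis by (rule LIMSEQ_unique)
qed

lemma weak_jet_weak_tendsto:
 assumes S: "open S" "bounded S" and n0: "H1_grad S n0 G0"
  and n: "eventually (%t. H1_grad S (n t) (G t) & (ALL k. sqnorm S (weak_jet (n t) (G t) k) <= C)) F"
  and lim: "((%t. sqnorm S (%x. n t x - n0 x)) ---> 0) F" and g: "L2_on S g"
 shows "((%t. ip S (weak_jet (n t) (G t) k) g) ---> ip S (weak_jet n0 G0 k) g) F"
proof (rule L2_weak_tendsto_if_test_fun[OF S H1_grad_weak_jet[OF S(1) n0] g])
 show "eventually (%t. L2_on S (weak_jet (n t) (G t) k) & sqnorm S (weak_jet (n t) (G t) k) <= C) F"
  using n by eventually_elim (simp add: H1_grad_weak_jet[OF S(1)])
 fix phi assume phi: "test_fun S phi"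
 note Sm = lebesgue_open[OF S(1)]
 have n_L2: "eventually (%t. L2_on S (n t)) F" using n by eventually_elim (auto simp: H1_grad_def)
 note weak = L2_strong_imp_weak_tendsto[OF n_L2 H1_gradD(1)[OF S(1) n0] lim]
 show "((%t. ip S (weak_jet (n t) (G t) k) phi) ---> ip S (weak_jet n0 G0 k) phi) F"
 proof (cases k)
  case None
  thus ?thesis using weak[OF test_fun_L2_on[OF phi Sm]] by simp
 next
  case (Some i)
  have parts: "ip S (%x. G x $ i) phi = - ip S w (pd phi (axis i 1))" if "H1_grad S w G" for w G
   using H1_gradD(3)[OF S(1) that, of i] phi by (simp add: weak_dir_deriv_iff[OF Sm])
  have "((%t. - ip S (n t) (pd phi (axis i 1))) ---> ip S (%x. G0 x $ i) phi) F"
   unfolding parts[OF n0] by (intro tendsto_minus weak pd_test_fun_L2_on[OF phi Sm])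
  moreover have "eventually (%t. - ip S (n t) (pd phi (axis i 1)) = ip S (%x. G t x $ i) phi) F" using n
  proof eventually_elim
   case (elim t)
   thus ?case using parts[of "n t" "G t"] by simp
  qed
  ultimately show ?thesis using Some by (simp add: Lim_transform_eventually)
 qed
qed

lemma pairing_tendsto:
 assumes S: "open S" "bounded S" and R0: "!!k. L2_on S (R0 k)"
  and w: "eventually (%t. L2_on S (w t) & (ALL k. L2_on S (R t k)) &
   (ALL phi. test_fun S phi --> ip S (w t) phi = (SUM k:UNIV. ip S (R t k) (jet phi k)))) F"
  and R: "!!k. ((%t. sqnorm S (%x. R t k x - R0 k x)) ---> 0) F"
  and n: "eventually (%t. H10_grad S (n t) (G t) & (ALL k. sqnorm S (weak_jet (n t) (G t) k) <= C)) F"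
  and n0: "H1_grad S n0 G0" and lim: "((%t. sqnorm S (%x. n t x - n0 x)) ---> 0) F"
 shows "((%t. ip S (w t) (n t)) ---> (SUM k:UNIV. ip S (R0 k) (weak_jet n0 G0 k))) F"
proof -
 let ?d = "%t k. ip S (%x. R t k x - R0 k x) (weak_jet (n t) (G t) k)"
 let ?r = "%t k. ip S (weak_jet (n t) (G t) k) (R0 k)"
 have "((%t. ?d t k) ---> 0) F" for k
 proof (rule Lim_null_comparison)
  show "eventually (%t. norm (?d t k) <= sqrt (sqnorm S (%x. R t k x - R0 k x)) * sqrt C) F" using w n
  proof eventually_elim
   case (elim t)
   hence "abs (?d t k) <= sqrt (sqnorm S (%x. R t k x - R0 k x)) * sqrt (sqnorm S (weak_jet (n t) (G t) k))"
    by (intro Cauchy_Schwarz_integral_sqrt L2_diff R0 H1_grad_weak_jet[OF S(1)] H10_grad_H1) auto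
   also have "... <= sqrt (sqnorm S (%x. R t k x - R0 k x)) * sqrt C" using elim by (intro mult_left_mono real_sqrt_le_mono) auto
   finally show ?case by simp
  qed
  show "((%t. sqrt (sqnorm S (%x. R t k x - R0 k x)) * sqrt C) ---> 0) F"
   using tendsto_mult_left_zero[OF tendsto_real_sqrt[OF R, simplified]] .
 qed
 moreover have "((%t. ?r t k) ---> ip S (weak_jet n0 G0 k) (R0 k)) F" for k
  by (rule weak_jet_weak_tendsto[OF S n0 _ lim R0]) (use n in eventually_elim, auto dest: H10_grad_H1)
 ultimately have "((%t. SUM k:UNIV. ?d t k + ?r t k) ---> (SUM k:UNIV. 0 + ip S (weak_jet n0 G0 k) (R0 k))) F"
  by (intro tendsto_sum tendsto_add)
 moreover have "eventually (%t. (SUM k:UNIV. ?d t k + ?r t k) = ip S (w t) (n t)) F" using w n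
 proof eventually_elim
  case (elim t)
  note jet_L2 = H1_grad_weak_jet[OF S(1) H10_grad_H1[OF conjunct1[OF elim(2)]]]
  have "?d t k + ?r t k = ip S (R t k) (weak_jet (n t) (G t) k)" for k
   using L2_mult[OF L2_diff[OF _ R0] jet_L2, of "R t k" k k] L2_mult[OF jet_L2 R0, of k k] elim(1)
   by (subst integral_add[symmetric]) (auto simp: algebra_simps)
  thus ?case using pairing_H10[OF S, of "w t" "R t" "n t" "G t"] elim by simp
 qed
 ultimately show ?thesis by (simp add: mult.commute Lim_transform_eventually)
qed

lemma lborel_distr_swap: "distr lborel borel (prod.swap :: 'a::euclidean_space \<times> 'b::euclidean_space => 'b * 'a) = lborel"
proof -
 have "lborel = distr lborel lborel (%(x :: 'a, y :: 'b). (y, x))"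
  using lborel_pair.distr_pair_swap[where 'a = 'b and 'b = 'a] unfolding lborel_prod .
 also have "... = distr lborel borel prod.swap" by (rule distr_cong) auto
 finally show ?thesis ..
qed

lemma L1_on_swap:
 assumes AB: "open A" "open B" and h: "L1_on (A \<times> B) h"
 shows "L1_on (B \<times> A) (%z. h (prod.swap z))" "int_on (B \<times> A) (%z. h (prod.swap z)) = int_on (A \<times> B) h"
proof -
 have "(prod.swap :: 'b * 'a => _) : borel_measurable borel"
  unfolding prod.swap_def by (intro borel_measurable_continuous_onI continuous_intros)
 note swap = this lborel_distr_swap
 have "indicator (A \<times> B) (prod.swap z) = (indicator (B \<times> A) z :: real)" for z
  by (cases z) (auto simp: indicator_def)
 thus "L1_on (B \<times> A) (%z. h (prod.swap z))" "int_on (B \<times> A) (%z. h (prod.swap z)) = int_on (A \<times> B) h"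
  using integrable_lebesgue_comp[OF swap, of "%z. indicator (A \<times> B) z * h z"]
   integral_lebesgue_comp[OF swap, of "%z. indicator (A \<times> B) z * h z"] h AB
  by (simp_all add: L1_indicator int_indicator open_Times)
qed

lemma Fubini_Times:
 assumes AB: "open A" "open B" and h: "L1_on (A \<times> B) h"
 shows "AE x in leb A. L1_on B (sect h x)" "L1_on A (%x. int_on B (sect h x))"
  "int_on A (%x. int_on B (sect h x)) = int_on (A \<times> B) h"
proof -
 note A = lebesgue_open[OF AB(1)] and sub = Sigma_mono[OF order_refl subset_UNIV, of A "%_. B"]
 have slices: "AE x in leb A. B = Pair x -` (A \<times> B)" by (auto simp: AE_on_iff[OF A])
 hence int: "AE x in leb A. int_on B (sect h x) = int_on (Pair x -` (A \<times> B)) (sect h x)" by eventually_elim simp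
 note sections = Fubini_section_L1[OF open_Times[OF AB] sub A h] Fubini_L1[OF open_Times[OF AB] sub A h]
  Fubini_int[OF open_Times[OF AB] sub A h]
 show "AE x in leb A. L1_on B (sect h x)" using sections(1) slices by eventually_elim simp
 show "L1_on A (%x. int_on B (sect h x))" "int_on A (%x. int_on B (sect h x)) = int_on (A \<times> B) h"
  using sections(2,3) by (simp_all only: L1_on_cong_AE[OF A int] int_on_cong_AE[OF A int])
qed

lemma int_on_interval_split:
 assumes "a <= b" "b <= c" and f: "L1_on {a<..<c :: real} f"
 shows "int_on {a<..<c} f = int_on {a<..<b} f + int_on {b<..<c} f"
proof -
 have L1: "L1_on {a<..<b} f" "L1_on {b<..<c} f" using assms by (auto intro: L1_on_subset[OF _ _ _ f])
 have "AE r in lebesgue. r ~= b"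
  using AE_iff_null_sets[of "{b}" lebesgue] negligible_sing[of b] by (simp add: negligible_iff_null_sets)
 hence "AE r in lebesgue. indicator {a<..<c} r * f r = indicator {a<..<b} r * f r + indicator {b<..<c} r * f r"
  by eventually_elim (use assms(1,2) in "auto simp: indicator_def")
 from lebesgue_cong_AE(3)[OF this] L1 show ?thesis by (simp add: int_indicator[symmetric] L1_indicator[symmetric])
qed

lemma AE_interval_ex:
 assumes ae: "AE t in leb {a<..<b}. P t" and "a < (b :: real)"
 obtains t where "t : {a<..<b}" "P t"
proof -
 have "{a<..<b} ~: null_sets lebesgue" using open_not_negligible[of "{a<..<b}"] assms(2) by (auto simp: negligible_iff_null_sets)
 moreover have "{a<..<b} : null_sets lebesgue" if "!!t. t : {a<..<b} ==> ~ P t"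
  using ae that by (subst AE_iff_null_sets) (auto simp: AE_on_iff elim!: eventually_mono)
 ultimately show ?thesis using that by blast
qed

locale cylinder =
 fixes T :: real and S :: "(real^'n) set"
 assumes T_pos: "0 < T" and open_S: "open S" and bounded_S: "bounded S"

lemma tdomain_cylinder: "tdomain T (%_. S) = {0<..<T} \<times> S" by (auto simp: tdomain_def)

sublocale cylinder \<subseteq> moving_domain T "%_. S" using T_pos open_S bounded_S
 by unfold_locales (auto simp: tdomain_cylinder intro!: open_Times bounded_Times)

context cylinder
begin

lemma lebesgue_S: "S : sets lebesgue" using open_S by auto

definition time_integral :: "(real * (real^'n) => real) => real => real^'n => real" where
 "time_integral g t x = int_on {0<..<t} (%r. g (r, x))"

lemma
 assumes g: "L2_on cyl g" and st: "0 <= s" "s <= t" "t <= T"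
 shows L2_on_section_integral: "L2_on S (%x. int_on {s<..<t} (%r. g (r, x)))"
  and section_integral_square_le: "sqnorm S (%x. int_on {s<..<t} (%r. g (r, x))) <= (t - s) * sqnorm cyl g"
  and section_integral_pairing: "continuous_on UNIV phi ==>
   ip S (%x. int_on {s<..<t} (%r. g (r, x))) phi = ip ({s<..<t} \<times> S) g (%z. phi (snd z))"
proof -
 let ?I = "{s<..<t}"
 let ?A = "%x. int_on ?I (%r. g (r, x))"
 note I = open_greaterThanLessThan[of s t]
 note SI = L1_on_swap[OF I open_S] and FS = Fubini_Times[OF open_S I]
 have D: "?I \<times> S : sets lebesgue" "?I \<times> S <= cyl" "bounded (?I \<times> S)"
  using st by (auto simp: tdomain_cylinder intro!: open_Times open_S bounded_Times bounded_S)
 note gD = L2_on_subset[OF cyl_lebesgue D(1,2) g]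
 note square = L2_square_integrable[OF gD] and gD1 = L1_on_if_L2_on[OF D(1,3) gD]
 have bound: "AE x in leb S. (?A x)^2 <= (t - s) * sqnorm ?I (%r. g (r, x))"
  using FS(1)[OF SI(1)[OF gD1]] FS(1)[OF SI(1)[OF square]]
 proof eventually_elim
  case (elim x)
  hence "L2_on ?I (%r. g (r, x))" by (simp add: sq_integrable_def)
  moreover have "L2_on ?I (%_. 1)" by (intro finite_measure.L2_const finite_measure_lebesgue_on_bounded) auto
  ultimately have "(ip ?I (%r. g (r, x)) (%r. 1))^2 <= sqnorm ?I (%r. g (r, x)) * int_on ?I (%_. 1^2)"
   by (rule Cauchy_Schwarz_integral)
  moreover have "int_on ?I (%_. 1 :: real) = t - s" using st by (simp add: measure_restrict_space measure_completion)
  ultimately show ?case by (simp add: mult.commute)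
 qed
 have A_meas: "?A : borel_measurable (leb S)" using FS(2)[OF SI(1)[OF gD1]] by simp
 have square_int: "L1_on S (%x. (t - s) * sqnorm ?I (%r. g (r, x)))" using FS(2)[OF SI(1)[OF square]] by simp
 have A_square: "L1_on S (%x. (?A x)^2)" by (rule integrable_bound[OF square_int borel_measurable_power[OF A_meas]])
   (use bound in eventually_elim, use st in simp)
 with A_meas show "L2_on S ?A" by (simp add: sq_integrable_def)
 have "sqnorm S ?A <= (t - s) * sqnorm (?I \<times> S) g"
  using integral_mono_AE[OF A_square square_int bound] FS(3)[OF SI(1)[OF square]] SI(2)[OF square] by simp
 also have "... <= (t - s) * sqnorm cyl g"
  using st by (intro mult_left_mono int_on_mono_set cyl_lebesgue D L2_square_integrable[OF g]) auto
 finally show "sqnorm S ?A <= (t - s) * sqnorm cyl g" .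
 assume phi: "continuous_on UNIV phi"
 have "continuous_on UNIV (%z :: real * (real^'n). phi (snd z))"
  by (intro continuous_on_compose2[OF phi]) (auto intro!: continuous_intros)
 from L1_on_if_L2_on[OF D(1,3) L2_on_continuous_mult[OF this D(1,3) gD]]
 have "L1_on (?I \<times> S) (%z. g z * phi (snd z))" by (simp add: mult.commute)
 from FS(3)[OF SI(1)[OF this]] SI(2)[OF this]
 show "ip S ?A phi = ip (?I \<times> S) g (%z. phi (snd z))" by simp
qed

lemma L2_on_time_integral: "L2_on cyl g ==> t : {0..T} ==> L2_on S (time_integral g t)"
 unfolding time_integral_def[abs_def] by (rule L2_on_section_integral) auto

lemma AE_time_integral_diff:
 assumes g: "L2_on cyl g" and st: "0 <= s" "s <= t" "t <= T"
 shows "AE x in leb S. time_integral g t x - time_integral g s x = int_on {s<..<t} (%r. g (r, x))"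
proof -
 have "L1_on ({0<..<T} \<times> S) g" using L1_on_if_L2_on[OF cyl_lebesgue bounded_cyl g] by (simp add: tdomain_cylinder)
 from Fubini_Times(1)[OF open_S open_greaterThanLessThan L1_on_swap(1)[OF open_greaterThanLessThan open_S this]]
 show ?thesis
 proof eventually_elim
  case (elim x)
  hence "L1_on {0<..<t} (%r. g (r, x))" using st by (intro L1_on_subset[OF _ _ _ elim, simplified]) auto
  from int_on_interval_split[OF st(1,2) this] show ?case by (simp add: time_integral_def)
 qed
qed

lemma time_integral_dist_le:
 assumes g: "L2_on cyl g" and st: "s : {0..T}" "t : {0..T}"
 shows "sqnorm S (%x. time_integral g t x - time_integral g s x) <= abs (t - s) * sqnorm cyl g"
proof -
 have "sqnorm S (%x. time_integral g t x - time_integral g s x) <= (t - s) * sqnorm cyl g" if "0 <= s" "s <= t" "t <= T" for s t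
 proof -
  have "AE x in leb S. (time_integral g t x - time_integral g s x)^2 = (int_on {s<..<t} (%r. g (r, x)))^2"
   using AE_time_integral_diff[OF g that] by eventually_elim simp
  from int_on_cong_AE[OF lebesgue_S this] section_integral_square_le[OF g that] show ?thesis by simp
 qed
 from this[of s t] this[of t s] st show ?thesis by (cases "s <= t") (auto simp: power2_commute)
qed

text \<open>\<open>\<partial>\<^sub>t w = r\<^sub>0 - (\<partial>\<^sub>1 r\<^sub>1 + ... + \<partial>\<^sub>n r\<^sub>n)\<close> in the sense of distributions.\<close>

definition weak_time_eq :: "(real * (real^'n) => real) => ('n option => real * (real^'n) => real) => bool" where
 "weak_time_eq w r <-> (ALL psi. test_fun cyl psi -->
  ip cyl w (pd psi (1, 0)) = - (SUM k:UNIV. ip cyl (r k) (space_jet psi k)))"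

lemma pd_time_mollify:
 assumes w: "L2_on cyl w" and r: "!!k. L2_on cyl (r k)" and eq: "weak_time_eq w r"
  and cube: "cbox z (z + (1 / Suc k) *R One) <= cyl"
 shows "pd (mollify cyl w k) (1, 0) z =
  mollify cyl (r None) k z - (SUM i:UNIV. pd (mollify cyl (r (Some i)) k) (0, axis i 1) z)"
proof -
 have "test_fun cyl (%y. mollifier (1 / Suc k) (y - z))" by (rule test_fun_shifted_mollifier[OF _ cube]) simp
 thus ?thesis using eq
  by (simp add: weak_time_eq_def pd_mollify_eq mollify_eq cyl_lebesgue L1_on_if_L2_on bounded_cyl w r sum_option sum_negf)
qed

lemma int_on_time_derivative:
 fixes W :: "real * (real^'n) => real"
 assumes "C1 W" "s < t"
 shows "int_on {s<..<t} (%u. pd W (1, 0) (u, x)) = W (t, x) - W (s, x)"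
proof -
 have "((%u. (u, x)) has_derivative (%h. (h, 0))) (at u within {s..t})" for u by (auto intro!: derivative_eq_intros)
 note deriv = has_derivative_compose[OF this C1_has_derivative[OF assms(1)]]
 have scale: "(%h. pd W (h, 0) z) = (%h. h *R pd W (1, 0) z)" for z
 proof
  fix h show "pd W (h, 0) z = h *R pd W (1, 0) z" using pd_scale_dir[OF assms(1), of h "(1, 0)" z] by simp
 qed
 have "((%u. W (u, x)) has_vector_derivative pd W (1, 0) (u, x)) (at u within {s..t})" for u
  using deriv[of u] unfolding has_vector_derivative_def scale .
 hence "((%u. pd W (1, 0) (u, x)) has_integral (W (t, x) - W (s, x))) {s..t}"
  using assms(2) by (intro fundamental_theorem_of_calculus) auto
 moreover have "L2_on {s<..<t} (%u. pd W (1, 0) (u, x))"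
  by (intro L2_on_continuous continuous_on_compose2[OF C1_continuous_pd[OF assms(1)]]) (auto intro!: continuous_intros)
 ultimately show ?thesis
  by (metis L1_on_if_L2_on bounded_box box_real(1) integral_open_interval_real integral_unique lebesgue_integral_eq_integral
   lebesgue_open open_greaterThanLessThan)
qed

lemma mollified_pairing_increment:
 assumes w: "L2_on cyl w" and r: "!!k. L2_on cyl (r k)" and eq: "weak_time_eq w r" and phi: "test_fun S phi"
  and st: "0 <= s" "s < t" "t <= T" and K: "!!x. x ~: K ==> phi x = 0"
  and cube: "!!z. z : {s<..<t} \<times> K ==> cbox z (z + (1 / Suc k) *R One) <= cyl"
 shows "ip S (%x. mollify cyl w k (t, x)) phi - ip S (%x. mollify cyl w k (s, x)) phi =
  (SUM j:UNIV. ip ({s<..<t} \<times> S) (mollify cyl (r j) k) (%z. jet phi j (snd z)))"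
proof -
 let ?W = "mollify cyl w k" and ?R = "%j. mollify cyl (r j) k" and ?I = "{s<..<t}" and ?D = "{s<..<t} \<times> S"
 note L1 = L1_on_if_L2_on[OF cyl_lebesgue bounded_cyl]
 note C = test_fun_C1[OF phi]
 have CW: "C1 ?W" and CR: "C1 (?R j)" for j by (intro C1_mollify cyl_lebesgue L1 w r)+
 have D: "?D : sets lebesgue" "bounded ?D" by (auto intro!: open_Times open_S bounded_Times bounded_S)
 have phi_L2: "L2_on ?D (%z. phi (snd z))" "L2_on ?D (%z. pd phi e (snd z))" for e
  using L2_on_C1(1)[OF C1_snd(1)[OF C] D(2,1)] L2_on_C1(2)[OF C1_snd(1)[OF C] D(2,1), of "(0, e)"]
  by (simp_all add: C1_snd(2)[OF C, abs_def])
 have slice_int: "L1_on S (%x. ?W (u, x) * phi x)" for u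
  by (intro L2_mult L2_on_C1(1)[OF C1_slice(1)[OF CW]] test_fun_L2_on[OF phi] bounded_S lebesgue_S)
 have int: "L1_on ?D (%z. ?R j z * phi (snd z))" "L1_on ?D (%z. ?R j z * pd phi e (snd z))"
  "L1_on ?D (%z. pd (?R j) e' z * phi (snd z))" for j e e'
  by (intro L2_mult L2_on_C1[OF CR D(2,1)] phi_L2)+
 have parts: "ip ?D (pd (?R j) (0, axis i 1)) (%z. phi (snd z)) = - ip ?D (?R j) (%z. pd phi (axis i 1) (snd z))" for i j
 proof -
  have "ip S (%x. pd (?R j) (0, axis i 1) (u, x)) phi = - ip S (%x. ?R j (u, x)) (pd phi (axis i 1))" for u
   using C1_weak_deriv[OF lebesgue_S C1_slice(1)[OF CR]] phi
   by (simp add: weak_dir_deriv_iff[OF lebesgue_S] C1_slice(2)[OF CR])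
  thus ?thesis
   using Fubini_Times(3)[OF open_greaterThanLessThan open_S int(2)[of j "axis i 1"]]
    Fubini_Times(3)[OF open_greaterThanLessThan open_S int(3)[of j "(0, axis i 1)"]] by simp
 qed
 have "ip S (sect ?W t) phi - ip S (sect ?W s) phi =
   ip S (%x. int_on ?I (%u. pd ?W (1, 0) (u, x))) phi"
  using slice_int by (simp add: int_on_time_derivative[OF CW st(2)] left_diff_distrib)
 also have "... = ip ?D (pd ?W (1, 0)) (%z. phi (snd z))"
  using st by (intro section_integral_pairing L2_on_C1(2)[OF CW] bounded_cyl cyl_lebesgue C1_continuous[OF C]) auto
 also have "... = int_on ?D (%z. ?R None z * phi (snd z) - (SUM i:UNIV. pd (?R (Some i)) (0, axis i 1) z * phi (snd z)))"
 proof (intro integral_cong refl)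
  fix z assume "z : space (leb ?D)"
  hence z: "z : ?D" by simp
  show "pd ?W (1, 0) z * phi (snd z) = ?R None z * phi (snd z) - (SUM i:UNIV. pd (?R (Some i)) (0, axis i 1) z * phi (snd z))"
  proof (cases "snd z : K")
   case True
   hence "z : ?I \<times> K" using z by (cases z) simp
   from pd_time_mollify[OF w r eq cube[OF this]] show ?thesis by (simp add: left_diff_distrib sum_distrib_right)
  qed (simp add: K)
 qed
 also have "... = ip ?D (?R None) (%z. phi (snd z)) - (SUM i:UNIV. ip ?D (pd (?R (Some i)) (0, axis i 1)) (%z. phi (snd z)))"
  using int by simp
 finally show ?thesis by (simp add: parts sum_negf sum_option cgrad_component)
qed

lemma mollify_slices_subseqE:
 assumes w: "L2_on cyl w"
 obtains sigma where "strict_mono sigma"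
  "AE t in leb ivl. L2_tendsto (leb S) (%k x. mollify cyl w (sigma k) (t, x)) (sect w t)"
proof -
 note moll = mollify_L2_tendsto[OF cyl_lebesgue bounded_cyl cyl_lebesgue order_refl w]
 note diff = L2_on_slices[OF L2_diff[OF moll(1) w]]
 have "(%k. LINT t|leb ivl. norm (sqnorm S (%x. mollify cyl w k (t, x) - w (t, x)))) ----> 0"
  using moll(2) diff(3) by (simp add: L2_tendsto_def)
 from tendsto_L1_AE_subseq[OF diff(2) this] show ?thesis using that unfolding L2_tendsto_def by blast
qed

text \<open>The null set of times on which the equation for the increments fails is independent of the test function.\<close>

lemma pairing_incrementE:
 assumes w: "L2_on cyl w" and r: "!!k. L2_on cyl (r k)" and eq: "weak_time_eq w r"
 obtains E where "AE t in leb ivl. t : E" "!!t. t : E ==> t : ivl & L2_on S (sect w t)"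
  "!!s t phi. s : E ==> t : E ==> s < t ==> test_fun S phi ==>
   ip S (sect w t) phi - ip S (sect w s) phi =
   (SUM k:UNIV. ip S (%x. time_integral (r k) t x - time_integral (r k) s x) (jet phi k))"
proof -
 obtain sigma where sigma: "strict_mono sigma"
  "AE t in leb ivl. L2_tendsto (leb S) (%k x. mollify cyl w (sigma k) (t, x)) (sect w t)"
  by (rule mollify_slices_subseqE[OF w])
 define E where "E = {t : ivl. L2_on S (sect w t) &
  L2_tendsto (leb S) (%k x. mollify cyl w (sigma k) (t, x)) (sect w t)}"
 have "ip S (sect w t) phi - ip S (sect w s) phi =
   (SUM k:UNIV. ip S (%x. time_integral (r k) t x - time_integral (r k) s x) (jet phi k))"
  if E: "s : E" "t : E" "s < t" and phi: "test_fun S phi" for s t phi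
 proof -
  have st: "0 <= s" "s <= t" "t <= T" using E by (auto simp: E_def)
  let ?D = "{s<..<t} \<times> S"
  have D: "?D : sets lebesgue" "?D <= cyl" "bounded ?D"
   using st by (auto simp: tdomain_cylinder intro!: open_Times open_S bounded_Times bounded_S)
  obtain K where K: "compact K" "K <= S" "!!x. x ~: K ==> phi x = 0" by (rule test_fun_supportE[OF phi]) blast
  have "{s..t} \<times> K <= cyl" using E K(2) by (auto simp: E_def tdomain_cylinder)
  from compact_cube_margin[OF compact_Times[OF compact_Icc K(1)] this open_cyl]
  have "EV k. ip S (%x. mollify cyl w k (t, x)) phi - ip S (%x. mollify cyl w k (s, x)) phi =
    (SUM j:UNIV. ip ?D (mollify cyl (r j) k) (%z. jet phi j (snd z)))"
   by eventually_elim (rule mollified_pairing_increment[OF w r eq phi st(1) E(3) st(3) K(3)], assumption, erule bspec, auto)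
  note increments = eventually_subseq[OF sigma(1) this]
  have "(%k. ip S (%x. mollify cyl w (sigma k) (u, x)) phi) ----> ip S (sect w u) phi" if "u : E" for u
   using that L1_on_if_L2_on[OF cyl_lebesgue bounded_cyl w]
   by (intro L2_tendsto_integral_mult L2_on_C1(1)[OF C1_slice(1)[OF C1_mollify]] test_fun_L2_on[OF phi]
    cyl_lebesgue lebesgue_S bounded_S) (auto simp: E_def)
  note tendsto_diff[OF this[OF E(2)] this[OF E(1)]]
  moreover have "(%k. ip ?D (mollify cyl (r j) k) (%z. jet phi j (snd z))) ----> ip ?D (r j) (%z. jet phi j (snd z))" for j
  proof (intro L2_tendsto_integral_mult mollify_L2_tendsto[OF cyl_lebesgue bounded_cyl D(1,2) r] L2_on_subset[OF cyl_lebesgue D(1,2) r])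
   have "continuous_on UNIV (jet phi j)" using jet_Cc[OF phi] by (simp add: Cc_def)
   thus "L2_on ?D (%z. jet phi j (snd z))"
    by (intro L2_on_continuous D continuous_on_compose2[of UNIV "jet phi j" _ snd]) (auto intro!: continuous_intros)
  qed
  hence "(%k. SUM j:UNIV. ip ?D (mollify cyl (r j) k) (%z. jet phi j (snd z))) ----> (SUM j:UNIV. ip ?D (r j) (%z. jet phi j (snd z)))"
   by (intro tendsto_sum)
  note LIMSEQ_subseq_LIMSEQ[OF this sigma(1), unfolded o_def]
  ultimately have "ip S (sect w t) phi - ip S (sect w s) phi = (SUM j:UNIV. ip ?D (r j) (%z. jet phi j (snd z)))"
   using Lim_transform_eventually[OF _ increments] LIMSEQ_unique by blast
  moreover have "ip ?D (r j) (%z. jet phi j (snd z)) =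
    ip S (%x. time_integral (r j) t x - time_integral (r j) s x) (jet phi j)" for j
  proof -
   have "AE x in leb S. (time_integral (r j) t x - time_integral (r j) s x) * jet phi j x =
     int_on {s<..<t} (%u. r j (u, x)) * jet phi j x"
    using AE_time_integral_diff[OF r[of j] st] by eventually_elim simp
   from int_on_cong_AE[OF lebesgue_S this] section_integral_pairing[OF r[of j] st, of "jet phi j"] jet_Cc[OF phi, of j]
   show ?thesis by (simp add: Cc_def)
  qed
  ultimately show ?thesis by simp
 qed
 moreover have "AE t in leb ivl. t : E"
  using sigma(2) L2_on_slices(1)[OF w] AE_in_ivl by eventually_elim (simp add: E_def)
 moreover have "t : ivl & L2_on S (sect w t)" if "t : E" for t using that by (simp add: E_def)
 ultimately show ?thesis using that by blast
qed

definition time_rep ::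
 "(real * (real^'n) => real) => ('n option => real * (real^'n) => real) => real => real => 'n option => real^'n => real"
 where "time_rep w r s t k x =
  time_integral (r k) t x - time_integral (r k) s x + (if k = None then w (s, x) else 0)"

text \<open>For a weak solution of \<open>\<partial>\<^sub>t w = r\<^sub>0 - div r\<close>, almost every slice is a functional with densities
 \<open>time_rep w r s t\<close> in \<open>L\<^sup>2\<close>. These depend continuously on \<open>t\<close>.\<close>

theorem time_repE:
 assumes w: "L2_on cyl w" and r: "!!k. L2_on cyl (r k)" and eq: "weak_time_eq w r"
 obtains s where "s : ivl" "L2_on S (sect w s)" "AE t in leb ivl. ALL phi. test_fun S phi -->
   ip S (sect w t) phi = (SUM k:UNIV. ip S (time_rep w r s t k) (jet phi k))"
proof -
 obtain E where E: "AE t in leb ivl. t : E" "!!t. t : E ==> t : ivl & L2_on S (sect w t)"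
  and incr: "!!s t phi. s : E ==> t : E ==> s < t ==> test_fun S phi ==> ip S (sect w t) phi - ip S (sect w s) phi =
   (SUM k:UNIV. ip S (%x. time_integral (r k) t x - time_integral (r k) s x) (jet phi k))"
  using pairing_incrementE[OF w r eq] by blast
 obtain s where s: "s : E" by (rule AE_interval_ex[OF E(1) T_pos])
 have "ip S (sect w t) phi = (SUM k:UNIV. ip S (time_rep w r s t k) (jet phi k))"
  if t: "t : E" and phi: "test_fun S phi" for t phi
 proof -
  let ?d = "%s t. SUM k:UNIV. ip S (%x. time_integral (r k) t x - time_integral (r k) s x) (jet phi k)"
  have "?d t s = - ?d s t" by (simp add: sum_negf[symmetric] flip: integral_minus) (simp add: algebra_simps)
  hence "ip S (sect w t) phi = ip S (sect w s) phi + ?d s t"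
   using incr[OF s t _ phi] incr[OF t s _ phi] by (cases s t rule: linorder_cases) auto
  moreover have ivl: "s : {0..T}" "t : {0..T}" and w_L2: "L2_on S (sect w s)" using E(2)[OF s] E(2)[OF t] by auto
  note phi_L2 = test_fun_L2_on[OF phi lebesgue_S]
  have "ip S (time_rep w r s t None) phi =
    ip S (%x. time_integral (r None) t x - time_integral (r None) s x) phi + ip S (sect w s) phi"
   using L2_mult[OF L2_diff[OF L2_on_time_integral[OF r ivl(2)] L2_on_time_integral[OF r ivl(1)]] phi_L2, of None]
    L2_mult[OF w_L2 phi_L2] by (simp add: time_rep_def distrib_right)
  ultimately show ?thesis by (simp add: sum_option time_rep_def)
 qed
 with E(1) have "AE t in leb ivl. ALL phi. test_fun S phi -->
   ip S (sect w t) phi = (SUM k:UNIV. ip S (time_rep w r s t k) (jet phi k))" by (auto elim: eventually_mono)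
 with E(2)[OF s] that show ?thesis by blast
qed

lemma L2_on_time_rep:
 assumes "!!k. L2_on cyl (r k)" "s : ivl" "L2_on S (sect w s)" "t : {0..T}"
 shows "L2_on S (time_rep w r s t k)"
 unfolding time_rep_def[abs_def] using assms by (cases "k = None") (auto intro!: L2_add L2_diff L2_on_time_integral)

lemma time_rep_dist_le:
 assumes "L2_on cyl (r k)" "t : {0..T}" "t' : {0..T}"
 shows "sqnorm S (%x. time_rep w r s t k x - time_rep w r s t' k x) <= abs (t - t') * sqnorm cyl (r k)"
 using time_integral_dist_le[OF assms(1,3,2)] by (simp add: time_rep_def)

end

definition ess_at_0 :: "real filter" where
 "ess_at_0 = inf (at_right 0) (ae_filter lebesgue)"

lemma eventually_ess_at_0: "eventually P ess_at_0 <-> (EX d>0. AE t in leb {0<..<d}. P t)"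
proof
 assume "eventually P ess_at_0"
 then obtain A B where A: "eventually A (at_right 0)" and B: "AE t in lebesgue. B t" and P: "!!t. A t ==> B t ==> P t"
  unfolding ess_at_0_def eventually_inf by blast
 obtain d where d: "d > 0" "!!t. 0 < t ==> t < d ==> A t" using A unfolding eventually_at_right_field by blast
 have "AE t in leb {0<..<d}. P t"
  using B by (auto simp: AE_on_iff d(2) P elim: eventually_mono)
 thus "EX d>0. AE t in leb {0<..<d}. P t" using d(1) by blast
next
 assume "EX d>0. AE t in leb {0<..<d}. P t"
 then obtain d where d: "d > 0" "AE t in lebesgue. t : {0<..<d} --> P t" by (auto simp: AE_on_iff)
 have "eventually (%t. t : {0<..<d}) (at_right 0)" using d(1) eventually_at_right_field by auto
 with d(2) show "eventually P ess_at_0" unfolding ess_at_0_def eventually_inf by blast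
qed

lemma eventually_ess_at_0_if_AE: "0 < d ==> AE t in leb {0<..<d}. P t ==> eventually P ess_at_0"
 unfolding eventually_ess_at_0 by blast

lemma ess_at_0_neq_bot [simp]: "ess_at_0 ~= bot"
proof -
 have "~ eventually (%_. False) ess_at_0"
  unfolding eventually_ess_at_0 using AE_interval_ex by blast
 thus ?thesis by (metis eventually_bot)
qed

lemma tendsto_0_if_le_abs_diff:
 fixes X :: "real => real"
 assumes "!!t. t : A ==> 0 <= X t" "!!t. t : A ==> X t <= abs (t - a) * C"
 shows "(X ---> 0) (at a within A)"
proof (rule tendsto_sandwich[OF _ _ tendsto_const])
 show "((%t. abs (t - a) * C) ---> 0) (at a within A)" by (auto intro!: tendsto_eq_intros)
qed (use assms in "auto simp: eventually_at_filter intro!: always_eventually")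

lemma tendsto_ess_at_0: "0 < d ==> (f ---> l) (at 0 within {0..d}) ==> (f ---> l) ess_at_0"
 unfolding ess_at_0_def by (metis at_within_Icc_at_right tendsto_mono inf_le1)

context cylinder
begin

lemma time_rep_tendsto:
 assumes "L2_on cyl (r k)"
 shows "((%t. sqnorm S (%x. time_rep w r s t k x - time_rep w r s 0 k x)) ---> 0) ess_at_0"
 by (rule tendsto_ess_at_0[OF T_pos], rule tendsto_0_if_le_abs_diff)
  (use T_pos time_rep_dist_le[where r = r and k = k, OF assms, of _ 0] in auto)

lemma abs_pairing_le:
 assumes "!!k. L2_on S (f k)" "test_fun S phi"
 shows "abs (SUM k:UNIV. ip S (f k) (jet phi k)) <= (SUM k:UNIV. sqrt (sqnorm S (f k))) * H1norm S phi"
proof -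
 have H1: "H1_grad S phi (cgrad phi)" by (rule H1_grad_C1[OF open_S bounded_S test_fun_C1[OF assms(2)]])
 have "abs (ip S (f k) (jet phi k)) <= sqrt (sqnorm S (f k)) * H1norm S phi" for k
 proof -
  have "abs (ip S (f k) (jet phi k)) <= sqrt (sqnorm S (f k)) * sqrt (sqnorm S (jet phi k))"
   by (intro Cauchy_Schwarz_integral_sqrt assms(1) H1_grad_weak_jet[OF open_S H1])
  also have "... <= sqrt (sqnorm S (f k)) * H1norm S phi"
   by (intro mult_left_mono weak_jet_le_H1norm[OF open_S bounded_S H1]) simp
  finally show ?thesis .
 qed
 thus ?thesis unfolding sum_distrib_right by (intro order_trans[OF sum_abs] sum_mono)
qed

lemma AE_closed_ivl_iff: "(AE t in lebesgue. t : {0..T} --> P t) <-> (AE t in leb ivl. P t)"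
proof
 have neq: "AE t in lebesgue. t ~= c" for c :: real
  using AE_iff_null_sets[of "{c}" lebesgue] negligible_sing[of c] by (simp add: negligible_iff_null_sets)
 assume "AE t in leb ivl. P t"
 thus "AE t in lebesgue. t : {0..T} --> P t" using neq[of 0] neq[of T] unfolding AE_ivl_iff by eventually_elim auto
qed (auto simp: AE_ivl_iff elim!: eventually_mono)

lemma Hm1_cont_imp_pairing_tendsto:
 assumes cont: "Hm1_cont T S w w1" and phi: "test_fun S phi"
 shows "((%t. ip S (sect w t) phi) ---> ip S w1 phi) ess_at_0"
proof -
 obtain lf :: "real => (real^'n => real) => real" where
  lf_cont: "!!t eps. t : {0..T} ==> eps > 0 ==> EX d>0. ALL s:{0..T}. abs (s - t) < d -->
    (ALL phi. test_fun S phi --> abs (lf s phi - lf t phi) <= eps * H1norm S phi)"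
  and lf_ae: "AE t in leb ivl. ALL phi. test_fun S phi --> lf t phi = l2ip S (slice w t) phi"
  and lf_0: "!!phi. test_fun S phi ==> lf 0 phi = l2ip S w1 phi"
  using cont unfolding Hm1_cont_def AE_closed_ivl_iff by blast
 have "((%t. lf t phi) ---> lf 0 phi) (at 0 within {0..T})" unfolding tendsto_iff
 proof (intro allI impI)
  fix e :: real assume e: "e > 0"
  have H: "0 < H1norm S phi + 1" using H1norm_nonneg[of S phi] by simp
  obtain d where d: "d > 0" "!!s. s : {0..T} ==> abs s < d ==> abs (lf s phi - lf 0 phi) <= e / (H1norm S phi + 1) * H1norm S phi"
   using lf_cont[of 0 "e / (H1norm S phi + 1)"] e H T_pos phi by auto
  have "e / (H1norm S phi + 1) * H1norm S phi < e" using e H by (simp add: field_simps)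
  thus "\<forall>\<^sub>F t in at 0 within {0..T}. dist (lf t phi) (lf 0 phi) < e"
   unfolding eventually_at using d by (fastforce simp: dist_real_def)
 qed
 from tendsto_ess_at_0[OF T_pos this]
 have lim: "((%t. lf t phi) ---> ip S w1 phi) ess_at_0" using lf_0[OF phi] by (simp add: l2ip_eq[OF lebesgue_S])
 have "AE t in leb ivl. lf t phi = ip S (sect w t) phi"
  using lf_ae by eventually_elim (use phi in "simp add: l2ip_eq[OF lebesgue_S] slice_def")
 with lim show ?thesis by (rule Lim_transform_eventually[OF _ eventually_ess_at_0_if_AE[OF T_pos]])
qed

lemma time_rep_pairing_diff_le:
 assumes r: "!!k. L2_on cyl (r k)" and s: "s : ivl" "L2_on S (sect w s)"
  and t: "t : {0..T}" "t' : {0..T}" and phi: "test_fun S phi"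
 shows "abs ((SUM k:UNIV. ip S (time_rep w r s t' k) (jet phi k)) - (SUM k:UNIV. ip S (time_rep w r s t k) (jet phi k))) <=
  sqrt (abs (t' - t)) * (SUM k:UNIV. sqrt (sqnorm cyl (r k))) * H1norm S phi" (is "abs ?diff <= ?rate * ?C * _")
proof -
 let ?R = "time_rep w r s"
 note R_L2 = L2_on_time_rep[OF r s] and jet_L2 = Cc_L2_on[OF jet_Cc[OF phi] lebesgue_S]
 have diff: "?diff = (SUM k:UNIV. ip S (%x. ?R t' k x - ?R t k x) (jet phi k))"
  using L2_mult[OF R_L2[OF t(2)] jet_L2] L2_mult[OF R_L2[OF t(1)] jet_L2]
  by (simp add: left_diff_distrib flip: sum_subtractf)
 have "abs ?diff <= (SUM k:UNIV. sqrt (sqnorm S (%x. ?R t' k x - ?R t k x))) * H1norm S phi"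
  unfolding diff by (intro abs_pairing_le L2_diff R_L2 t phi)
 moreover have "sqrt (sqnorm S (%x. ?R t' k x - ?R t k x)) <= ?rate * sqrt (sqnorm cyl (r k))" for k
  unfolding real_sqrt_mult[symmetric] by (intro real_sqrt_le_mono time_rep_dist_le r t)
 hence "(SUM k:UNIV. sqrt (sqnorm S (%x. ?R t' k x - ?R t k x))) <= ?rate * ?C" by (simp add: sum_distrib_left sum_mono)
 ultimately show ?thesis using mult_right_mono[OF _ H1norm_nonneg] by (meson order_trans)
qed

theorem Hm1_cont_iff_pairing_tendsto:
 assumes w: "L2_on cyl w" and r: "!!k. L2_on cyl (r k)" and eq: "weak_time_eq w r"
 shows "Hm1_cont T S w w1 <-> (ALL phi. test_fun S phi --> ((%t. ip S (sect w t) phi) ---> ip S w1 phi) ess_at_0)"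
proof
 assume lim: "ALL phi. test_fun S phi --> ((%t. ip S (sect w t) phi) ---> ip S w1 phi) ess_at_0"
 obtain s where s: "s : ivl" "L2_on S (sect w s)" and rep: "AE t in leb ivl. ALL phi. test_fun S phi -->
   ip S (sect w t) phi = (SUM k:UNIV. ip S (time_rep w r s t k) (jet phi k))" using time_repE[OF w r eq] by blast
 let ?R = "time_rep w r s"
 define lf where "lf t phi = (SUM k:UNIV. ip S (?R t k) (jet phi k))" for t phi
 note R_L2 = L2_on_time_rep[OF r s]
 define C where "C = (SUM k:UNIV. sqrt (sqnorm cyl (r k)))"
 have C: "C >= 0" by (simp add: C_def sum_nonneg)
 have lf_diff: "abs (lf t' phi - lf t phi) <= sqrt (abs (t' - t)) * C * H1norm S phi"
  if "t : {0..T}" "t' : {0..T}" "test_fun S phi" for t t' phi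
  unfolding lf_def C_def by (rule time_rep_pairing_diff_le[OF r s that])
 have "lf 0 phi = l2ip S w1 phi" if phi: "test_fun S phi" for phi
 proof -
  have lim_0: "((%t. sqrt (abs (t - 0)) * C * H1norm S phi) ---> 0) (at 0 within {0..T})"
   by (auto intro!: tendsto_eq_intros)
  have "\<forall>\<^sub>F t in at 0 within {0..T}. norm (lf t phi - lf 0 phi) <= sqrt (abs (t - 0)) * C * H1norm S phi"
   using T_pos lf_diff[OF _ _ phi, of 0] by (auto simp: eventually_at_filter intro!: always_eventually)
  hence "((%t. lf t phi) ---> lf 0 phi) (at 0 within {0..T})" by (rule LIM_zero_cancel[OF Lim_null_comparison[OF _ lim_0]])
  moreover have "AE t in leb ivl. lf t phi = ip S (sect w t) phi"
   using rep by eventually_elim (use phi in "simp add: lf_def")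
  ultimately have "((%t. ip S (sect w t) phi) ---> lf 0 phi) ess_at_0"
   by (intro Lim_transform_eventually[OF tendsto_ess_at_0[OF T_pos] eventually_ess_at_0_if_AE[OF T_pos]])
  from tendsto_unique[OF ess_at_0_neq_bot this] lim phi show ?thesis by (simp add: l2ip_eq[OF lebesgue_S])
 qed
 moreover have "EX d>0. ALL t':{0..T}. abs (t' - t) < d --> (ALL phi. test_fun S phi -->
   abs (lf t' phi - lf t phi) <= eps * H1norm S phi)" if t: "t : {0..T}" and eps: "eps > 0" for t eps
 proof (intro exI[of _ "(eps / (C + 1))^2"] conjI ballI impI allI)
  show "0 < (eps / (C + 1))^2" using eps C by simp
  fix t' phi assume t': "t' : {0..T}" "abs (t' - t) < (eps / (C + 1))^2" and phi: "test_fun S phi"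
  have "sqrt (abs (t' - t)) <= eps / (C + 1)" using t'(2) eps C by (intro real_le_lsqrt less_imp_le) auto
  hence "sqrt (abs (t' - t)) * C <= eps / (C + 1) * (C + 1)" using C eps by (intro mult_mono) auto
  also have "... = eps" using C by simp
  finally show "abs (lf t' phi - lf t phi) <= eps * H1norm S phi"
   using order_trans[OF lf_diff[OF t t'(1) phi] mult_right_mono[OF _ H1norm_nonneg]] by blast
 qed
 moreover have "EX B. ALL phi. test_fun S phi --> abs (lf t phi) <= B * H1norm S phi" if "t : {0..T}" for t
 proof -
  have "L2_on S (?R t k)" for k by (rule R_L2[OF that])
  from abs_pairing_le[of "?R t", OF this] show ?thesis unfolding lf_def by blast
 qed
 moreover have "AE t in lebesgue. t : {0..T} --> (ALL phi. test_fun S phi --> lf t phi = l2ip S (slice w t) phi)"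
  unfolding AE_closed_ivl_iff using rep by eventually_elim (simp add: lf_def l2ip_eq[OF lebesgue_S] slice_def)
 ultimately show "Hm1_cont T S w w1" unfolding Hm1_cont_def by blast
qed (blast intro: Hm1_cont_imp_pairing_tendsto)

definition scalar_flux :: "(real * (real^'n) => real) => 'n option => real * (real^'n) => real" where
 "scalar_flux w k = (case k of None => w | Some _ => (%_. 0))"

lemma scalar_flux_simps [simp]: "scalar_flux w None = w" "scalar_flux w (Some i) = (%_. 0)"
 by (simp_all add: scalar_flux_def)

lemma L2_time_repE:
 assumes w: "L2_on cyl w" and w': "L2_on cyl w'" and eq: "weak_time_eq w (scalar_flux w')"
 obtains U where "!!t. t : {0..T} ==> L2_on S (U t)"
  "!!s t. s : {0..T} ==> t : {0..T} ==> sqnorm S (%x. U t x - U s x) <= abs (t - s) * sqnorm cyl w'"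
  "AE t in leb ivl. AE x in leb S. U t x = w (t, x)"
proof -
 let ?r = "scalar_flux w'"
 have r: "L2_on cyl (?r k)" for k by (cases k) (simp_all add: w')
 obtain s where s: "s : ivl" "L2_on S (sect w s)" and rep: "AE t in leb ivl. ALL phi. test_fun S phi -->
   ip S (sect w t) phi = (SUM k:UNIV. ip S (time_rep w ?r s t k) (jet phi k))" using time_repE[OF w r eq] by blast
 let ?U = "%t. time_rep w ?r s t None"
 note U_L2 = L2_on_time_rep[OF r s]
 have zero: "time_rep w ?r s t (Some i) x = 0" for t i x by (simp add: time_rep_def time_integral_def)
 have "AE t in leb ivl. AE x in leb S. ?U t x = w (t, x)" using rep L2_on_slices(1)[OF w] AE_in_ivl
 proof eventually_elim
  case (elim t)
  show ?case by (rule AE_eq_if_pairing_eq[OF open_S bounded_S]) (use elim U_L2 in "auto simp: sum_option zero")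
 qed
 with that[of ?U] U_L2 time_rep_dist_le[where r = ?r and k = None, OF r] show ?thesis by auto
qed

lemma pairing_tendsto_if_L2_tendsto:
 assumes U: "!!t. t : {0..T} ==> L2_on S (U t)" and phi: "L2_on S phi"
  and lim: "((%t. sqnorm S (%x. U t x - U 0 x)) ---> 0) (at 0 within {0..T})"
  and ae: "AE t in leb ivl. AE x in leb S. U t x = w (t, x)"
 shows "((%t. ip S (sect w t) phi) ---> ip S (U 0) phi) ess_at_0"
proof (rule Lim_transform_eventually)
 show "((%t. ip S (U t) phi) ---> ip S (U 0) phi) ess_at_0"
 proof (rule tendsto_ess_at_0[OF T_pos], rule L2_strong_imp_weak_tendsto[OF _ _ lim phi])
  show "\<forall>\<^sub>F t in at 0 within {0..T}. L2_on S (U t)"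
   using U by (auto simp: eventually_at_filter intro!: always_eventually)
 qed (use U T_pos in simp)
 have "AE t in leb ivl. ip S (U t) phi = ip S (sect w t) phi" using ae
 proof eventually_elim
  case (elim t)
  show ?case by (rule int_on_cong_AE[OF lebesgue_S]) (use elim in eventually_elim, simp)
 qed
 thus "eventually (%t. ip S (U t) phi = ip S (sect w t) phi) ess_at_0" by (rule eventually_ess_at_0_if_AE[OF T_pos])
qed

lemma L2_cont_imp_pairing_tendsto:
 assumes cont: "L2_cont T S w w0" and phi: "L2_on S phi"
 shows "((%t. ip S (sect w t) phi) ---> ip S w0 phi) ess_at_0"
proof -
 obtain U where "ALL t:{0..T}. L2 S (U t)" "ALL t:{0..T}. ((%s. l2norm S (%x. U s x - U t x)) ---> 0) (at t within {0..T})"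
  and ae: "AE t in leb ivl. AE x in leb S. U t x = w (t, x)" "AE x in leb S. U 0 x = w0 x"
  using cont unfolding L2_cont_def AE_closed_ivl_iff AE_on_iff[OF lebesgue_S] by blast
 hence U: "!!t. t : {0..T} ==> L2_on S (U t)" "((%t. l2norm S (%x. U t x - U 0 x)) ---> 0) (at 0 within {0..T})"
  using T_pos by (auto simp: L2_iff[OF lebesgue_S])
 have lim: "((%t. sqnorm S (%x. U t x - U 0 x)) ---> 0) (at 0 within {0..T})"
  using tendsto_power[OF U(2), of 2] by (simp add: l2norm_eq[OF lebesgue_S])
 have "ip S (U 0) phi = ip S w0 phi" by (rule int_on_cong_AE[OF lebesgue_S]) (use ae(2) in eventually_elim, simp)
 with pairing_tendsto_if_L2_tendsto[OF U(1) phi lim ae(1)] show ?thesis by simp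
qed

theorem L2_cont_iff_pairing_tendsto:
 assumes w: "L2_on cyl w" and w': "L2_on cyl w'" and eq: "weak_time_eq w (scalar_flux w')" and w0: "L2_on S w0"
 shows "L2_cont T S w w0 <-> (ALL phi. test_fun S phi --> ((%t. ip S (sect w t) phi) ---> ip S w0 phi) ess_at_0)"
proof
 assume "L2_cont T S w w0"
 thus "ALL phi. test_fun S phi --> ((%t. ip S (sect w t) phi) ---> ip S w0 phi) ess_at_0"
  using L2_cont_imp_pairing_tendsto Cc_L2_on[OF test_fun_Cc lebesgue_S] by blast
next
 assume pairing: "ALL phi. test_fun S phi --> ((%t. ip S (sect w t) phi) ---> ip S w0 phi) ess_at_0"
 obtain U where U: "!!t. t : {0..T} ==> L2_on S (U t)"
  "!!s t. s : {0..T} ==> t : {0..T} ==> sqnorm S (%x. U t x - U s x) <= abs (t - s) * sqnorm cyl w'"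
  "AE t in leb ivl. AE x in leb S. U t x = w (t, x)" using L2_time_repE[OF w w' eq] by blast
 have lim: "((%s. sqnorm S (%x. U s x - U t x)) ---> 0) (at t within {0..T})" if "t : {0..T}" for t
  by (rule tendsto_0_if_le_abs_diff) (use U(2)[OF that] in auto)
 have zero: "0 : {0..T}" using T_pos by simp
 have "ip S (U 0) phi = ip S w0 phi" if phi: "test_fun S phi" for phi
  using pairing phi pairing_tendsto_if_L2_tendsto[OF U(1) test_fun_L2_on[OF phi lebesgue_S] lim[OF zero] U(3)]
  by (intro tendsto_unique[OF ess_at_0_neq_bot]) auto
 from AE_eq_if_pairing_eq[OF open_S bounded_S U(1)[OF zero] w0 this] U(3) have "AE x in leb S. U 0 x = w0 x" by simp
 moreover have "((%s. l2norm S (%x. U s x - U t x)) ---> 0) (at t within {0..T})" if "t : {0..T}" for t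
  using tendsto_real_sqrt[OF lim[OF that]] by (simp add: l2norm_eq[OF lebesgue_S])
 ultimately show "L2_cont T S w w0" unfolding L2_cont_def AE_closed_ivl_iff using U(1,3)
  by (auto simp: AE_on_iff[OF lebesgue_S] L2_iff[OF lebesgue_S] intro!: exI[of _ U])
qed

end

lemma lipschitz_slice:
 assumes "lipschitz_fun m L"
 shows "lipschitz_fun (sect m t) L"
proof
 fix x y
 show "abs (m (t, x) - m (t, y)) <= L * norm (x - y)"
  using lipschitz_fun.lip[OF assms, of "(t, x)" "(t, y)"] by (simp add: norm_Pair)
qed

lemma AE_cgrad_slice:
 assumes "lipschitz_fun m L"
 shows "AE t in lebesgue. AE x in lebesgue. cgrad (sect m t) x = (\<chi> i. pd m (0, axis i 1) (t, x))"
proof -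
 have slice: "pd (sect m t) e x = pd m (0, e) (t, x)" if "m differentiable (at (t, x))" for t x e
 proof (rule pd_eqI)
  have "((%x. (t, x)) has_derivative (%h. (0, h))) (at x)" by (auto intro!: derivative_eq_intros)
  from has_derivative_compose[OF this that[unfolded frechet_derivative_works]]
  show "((sect m t) has_derivative (%e. pd m (0, e) (t, x))) (at x)" by (simp add: pd_def)
 qed
 from AE_lebesgue_Pair[OF lipschitz_fun.AE_differentiable[OF assms]] show ?thesis
 proof eventually_elim
  case (elim t)
  thus ?case by eventually_elim (simp add: cgrad_def slice)
 qed
qed

context moving_domain
begin

lemma energy_cong_AE:
 assumes u: "energy u w g" and ae: "AE z in leb cyl. u z = u' z" "AE z in leb cyl. w z = w' z" "AE z in leb cyl. g z = g' z"
 shows "energy u' w' g'"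
proof -
 note u = energyD[OF u]
 have "AE z in leb cyl. g z $ i = g' z $ i" for i using ae(3) by eventually_elim simp
 from L2_on_cong_AE[OF cyl_lebesgue this] have "L2_on cyl (%z. g' z $ i)" for i using u(3) by simp
 moreover have "L2_on cyl u'" "L2_on cyl w'"
  using u(1,2) L2_on_cong_AE[OF cyl_lebesgue ae(1)] L2_on_cong_AE[OF cyl_lebesgue ae(2)] by simp_all
 moreover have "AE t in leb ivl. H10_grad (\<Omega> t) (sect u' t) (sect g' t)"
  using u(5) AE_slice[OF ae(1)] AE_slice[OF ae(3)] AE_in_ivl
  by eventually_elim (rule H10_grad_cong_AE[OF open_slice bounded_slice])
 moreover have "weak_dir_deriv cyl u' (1, 0) w'" by (rule weak_deriv_cong_AE[OF cyl_lebesgue u(4) ae(1,2)])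
 ultimately show ?thesis by (simp add: energy_def)
qed

lemma energy_C1:
 assumes psi: "C1 psi" and test: "!!t. t : ivl ==> test_fun (\<Omega> t) (sect psi t)"
 shows "energy psi (pd psi (1, 0)) (%z. \<chi> i. pd psi (0, axis i 1) z)"
proof -
 have "AE t in leb ivl. H10_grad (\<Omega> t) (sect psi t) (%x. \<chi> i. pd psi (0, axis i 1) (t, x))" using AE_in_ivl
 proof eventually_elim
  case (elim t)
  show ?case using H10_grad_test_fun[OF open_slice[OF elim] bounded_slice[OF elim] test[OF elim]]
   by (simp add: cgrad_def[abs_def] C1_slice(2)[OF psi])
 qed
 thus ?thesis using L2_on_C1[OF psi bounded_cyl cyl_lebesgue] by (simp add: energy_def C1_weak_deriv[OF cyl_lebesgue psi])
qed

lemma energy_lipschitz_mult: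
 assumes m: "lipschitz_fun m L" and v: "energy v w g"
 shows "energy (%z. m z * v z) (%z. m z * w z + pd m (1, 0) z * v z) (%z. m z *R g z + v z *R (\<chi> i. pd m (0, axis i 1) z))"
proof -
 note v = energyD[OF v]
 note mult = lipschitz_fun.L2_on_mult[OF m cyl_lebesgue bounded_cyl]
 have "AE t in leb ivl. AE x in lebesgue. cgrad (sect m t) x = (\<chi> i. pd m (0, axis i 1) (t, x))"
  unfolding AE_ivl_iff using AE_cgrad_slice[OF m] by eventually_elim simp
 hence "AE t in leb ivl. H10_grad (\<Omega> t) (%x. m (t, x) * v (t, x))
   (%x. m (t, x) *R g (t, x) + v (t, x) *R (\<chi> i. pd m (0, axis i 1) (t, x)))" using v(5) AE_in_ivl
 proof eventually_elim
  case (elim t)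
  note S = open_slice[OF elim(3)] bounded_slice[OF elim(3)]
  have "AE x in leb (\<Omega> t). m (t, x) *R g (t, x) + v (t, x) *R cgrad (sect m t) x =
    m (t, x) *R g (t, x) + v (t, x) *R (\<chi> i. pd m (0, axis i 1) (t, x))"
   unfolding AE_on_iff[OF lebesgue_slice[OF elim(3)]] using elim(1) by eventually_elim simp
  thus ?case by (intro H10_grad_cong_AE[OF S H10_grad_lipschitz_mult[OF S lipschitz_slice[OF m] elim(2)]]) auto
 qed
 moreover have "L2_on cyl (%z. (m z *R g z + v z *R (\<chi> i. pd m (0, axis i 1) z)) $ i)" for i
  using L2_add[OF mult(1)[OF v(3)] mult(2)[OF v(1)], of i "(0, axis i 1)"] by (simp add: mult.commute)
 moreover have "weak_dir_deriv cyl (%z. m z * v z) (1, 0) (%z. m z * w z + pd m (1, 0) z * v z)"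
  by (rule weak_deriv_lipschitz_mult[OF open_cyl bounded_cyl m v(1,2,4)])
 moreover have "L2_on cyl (%z. m z * v z)" "L2_on cyl (%z. m z * w z + pd m (1, 0) z * v z)" by (intro L2_add mult v)+
 ultimately show ?thesis by (simp add: energy_def)
qed

lemma test_fun_time_marginE:
 assumes "test_fun cyl psi"
 obtains r where "r > 0" "!!z. fst z <= r | T - r <= fst z ==> psi z = 0" "!!z e. fst z <= r | T - r <= fst z ==> pd psi e z = 0"
proof -
 obtain K where K: "compact K" "K <= cyl" "!!z. z ~: K ==> psi z = 0" "!!z e. z ~: K ==> pd psi e z = 0"
  using test_fun_supportE[OF assms] by metis
 hence "compact (fst ` K)" "fst ` K <= ivl" by (auto simp: tdomain_def intro!: compact_continuous_image continuous_intros)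
 then obtain r where r: "r > 0" "!!s t. s : fst ` K ==> dist s t < r ==> t : ivl"
  using compact_in_open_margin[OF _ _ open_greaterThanLessThan] by metis
 have "z ~: K" if "fst z <= r / 2 | T - r / 2 <= fst z" for z
 proof
  assume z: "z : K"
  hence "fst z : ivl" using K(2) by (auto simp: tdomain_def)
  thus False using r(2)[of "fst z" 0] r(2)[of "fst z" T] z that r(1) by (auto simp: dist_real_def)
 qed
 with K that[of "r / 2"] r(1) show ?thesis by simp
qed

end

context cylinder
begin

lemma energy_time_parts:
 assumes v: "energy v w g" and psi: "C1 psi" and K: "compact K" "K <= ivl" "!!z. fst z ~: K ==> psi z = 0"
 shows "ip cyl v (pd psi (1, 0)) = - ip cyl w psi"
proof -
 note v = energyD[OF v]
 note mult = L2_on_continuous_mult[OF _ cyl_lebesgue bounded_cyl]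
 have "L2_on S (%_. 1)" by (intro finite_measure.L2_const finite_measure_lebesgue_on_bounded lebesgue_S bounded_S)
 then obtain kappa where kappa: "!!j. test_fun S (kappa j)" "L2_tendsto (leb S) kappa (%_. 1)"
  using test_fun_L2_dense[OF open_S bounded_S] by blast
 note C = C1_snd[OF test_fun_C1[OF kappa(1)]]
 have one: "L2_on cyl (%z. 1)" and kappa_L2: "L2_on cyl (%z. kappa j (snd z))" for j
  by (intro L2_on_C1(1)[OF C1_const] L2_on_C1(1)[OF C(1)] bounded_cyl cyl_lebesgue)+
 have "sqnorm cyl (%z. kappa j (snd z) - 1) = T * sqnorm S (%x. kappa j x - 1)" for j
  using L2_on_slices(3)[OF L2_diff[OF kappa_L2 one], of j] T_pos by (simp add: measure_restrict_space measure_completion)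
 hence lim: "L2_tendsto (leb cyl) (%j z. kappa j (snd z)) (%_. 1)"
  using tendsto_mult_right_zero[OF kappa(2)[unfolded L2_tendsto_def], of T] by (simp add: L2_tendsto_def)
 have parts: "ip cyl (%z. kappa j (snd z)) (%z. pd psi (1, 0) z * v z) = - ip cyl (%z. kappa j (snd z)) (%z. psi z * w z)" for j
 proof -
  obtain K' where K': "compact K'" "K' <= S" "!!x. x ~: K' ==> kappa j x = 0" using test_fun_supportE[OF kappa(1)[of j]] by metis
  have "test_fun cyl (%z. kappa j (snd z) * psi z)" by (rule test_funI[OF C1_mult[OF C(1) psi] compact_Times[OF K(1) K'(1)]])
    (use K(2,3) K'(2,3) in "auto simp: tdomain_cylinder mem_Times_iff")
  moreover have "pd (%z. kappa j (snd z) * psi z) (1, 0) z = kappa j (snd z) * pd psi (1, 0) z" for z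
   by (simp add: pd_mult[OF C(1) psi] C(2) pd_0[OF test_fun_C1[OF kappa(1)]])
  moreover note v(4)[unfolded weak_dir_deriv_iff[OF cyl_lebesgue], rule_format, OF calculation(1)]
  ultimately show ?thesis by (simp add: mult_ac)
 qed
 have "(%j. ip cyl (%z. kappa j (snd z)) (%z. pd psi (1, 0) z * v z)) ----> ip cyl (%z. 1) (%z. pd psi (1, 0) z * v z)"
  by (rule L2_tendsto_integral_mult[OF kappa_L2 one mult[OF C1_continuous_pd[OF psi] v(1)] lim])
 moreover have "(%j. - ip cyl (%z. kappa j (snd z)) (%z. psi z * w z)) ----> - ip cyl (%z. 1) (%z. psi z * w z)"
  by (rule tendsto_minus[OF L2_tendsto_integral_mult[OF kappa_L2 one mult[OF C1_continuous[OF psi] v(2)] lim]])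
 ultimately show ?thesis unfolding parts by (simp add: LIMSEQ_unique mult.commute)
qed

lemma energy_weak_time_eq: "energy v w g ==> weak_time_eq v (scalar_flux w)"
 using energyD(4) by (simp add: weak_time_eq_def weak_dir_deriv_iff[OF cyl_lebesgue] sum_option)

lemma energy_space_parts:
 assumes v: "energy v w g" and psi: "AE t in leb ivl. H1_grad S (sect psi t) (sect D t)"
  "L2_on cyl psi" "!!i. L2_on cyl (%z. D z $ i)"
 shows "ip cyl v (%z. D z $ i) = - ip cyl (%z. g z $ i) psi"
proof -
 note v = energyD[OF v]
 have int: "L1_on cyl (%z. v z * D z $ i)" "L1_on cyl (%z. g z $ i * psi z)" by (intro L2_mult v psi)+
 have "AE t in leb ivl. ip S (sect v t) (%x. D (t, x) $ i) = - ip S (%x. g (t, x) $ i) (sect psi t)"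
  using v(5) psi(1) by eventually_elim (rule H10_integration_by_parts[OF open_S bounded_S])
 from int_on_cong_AE[OF lebesgue_ivl this] show ?thesis by (simp add: Fubini(3)[OF int(1)] Fubini(3)[OF int(2)])
qed

lemma energy_space_parts_C1:
 assumes v: "energy v w g" and psi: "C1 psi"
 shows "ip cyl v (pd psi (0, axis i 1)) = - ip cyl (%z. g z $ i) psi"
proof -
 let ?D = "%z. \<chi> i. pd psi (0, axis i 1) z"
 have "H1_grad S (sect psi t) (sect ?D t)" for t
  using H1_grad_C1[OF open_S bounded_S C1_slice(1)[OF psi]] by (simp add: cgrad_def[abs_def] C1_slice(2)[OF psi])
 hence "ip cyl v (%z. ?D z $ i) = - ip cyl (%z. g z $ i) psi"
  using L2_on_C1[OF psi bounded_cyl cyl_lebesgue] by (intro energy_space_parts[OF v]) auto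
 thus ?thesis by simp
qed

lemma pd_mollify_energy:
 assumes v: "energy v w g" and x: "fst x : ivl" "fst x + 1 / Suc k < T"
 shows "pd (mollify cyl v k) (1, 0) x = mollify cyl w k x" "pd (mollify cyl v k) (0, axis i 1) x = mollify cyl (%z. g z $ i) k x"
proof -
 let ?m = "mollifier (1 / Suc k) :: real * (real^'n) => real"
 have C: "C1 (%y. ?m (y - x))" by (rule C1_shifted[OF C1_mollifier])
 note pd = pd_mollify_eq[OF cyl_lebesgue L1_on_if_L2_on[OF cyl_lebesgue bounded_cyl energyD(1)[OF v]]]
  and moll = mollify_eq[OF cyl_lebesgue]
 have zero: "?m (y - x) = 0" if "fst y ~: {fst x..fst x + 1 / Suc k}" for y
 proof (rule mollifier_outside)
  have time: "(1, 0) : (Basis :: (real * (real^'n)) set)" by (simp add: Basis_prod_def)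
  have "0 <= fst y - fst x & fst y - fst x <= 1 / Suc k" if "y - x : cbox 0 ((1 / Suc k) *R One)"
   using bspec[OF that[unfolded mem_box] time] inner_sum_left_Basis[OF time, of "%_. 1"] by (simp add: inner_prod_def)
  thus "y - x ~: cbox 0 ((1 / Suc k) *R One)" using that by auto
 qed simp
 have "ip cyl v (%y. pd (%y. ?m (y - x)) (1, 0) y) = - ip cyl w (%y. ?m (y - x))"
  by (rule energy_time_parts[OF v C, of "{fst x..fst x + 1 / Suc k}"]) (use x zero in auto)
 thus "pd (mollify cyl v k) (1, 0) x = mollify cyl w k x" by (simp add: pd moll)
 show "pd (mollify cyl v k) (0, axis i 1) x = mollify cyl (%z. g z $ i) k x"
  by (simp only: pd moll energy_space_parts_C1[OF v C] minus_minus)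
qed

lemma pd_pd_mollify_commute:
 assumes v: "L2_on cyl v"
 shows "C1 (pd (mollify cyl v k) e)" "pd (pd (mollify cyl v k) e) e' x = pd (pd (mollify cyl v k) e') e x"
proof -
 let ?m = "mollifier (1 / Suc k) :: real * (real^'n) => real" and ?v = "%y. indicator cyl y * v y"
 have L1: "integrable lebesgue ?v" using L1_on_if_L2_on[OF cyl_lebesgue bounded_cyl v] cyl_lebesgue by (simp add: L1_indicator)
 have pd: "pd (mollify cyl v k) e = (%x. 0 - conv ?v (pd ?m e) x)" for e
  using L1 by (simp add: mollify_def pd_conv test_fun_mollifier fun_eq_iff)
 note C = C1_conv[OF L1 test_fun_pd_mollifier[of "1 / Suc k"]]
 show "C1 (pd (mollify cyl v k) e)" unfolding pd by (intro C1_diff C1_const C) simp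
 have pd_pd: "pd (pd (mollify cyl v k) e) e' x = conv ?v (pd (pd ?m e) e') x" for e e'
 proof -
  have "pd (pd (mollify cyl v k) e) e' x = pd (%_. 0) e' x - pd (conv ?v (pd ?m e)) e' x"
   unfolding pd by (rule pd_diff[OF C1_const C]) simp
  also have "... = conv ?v (pd (pd ?m e) e') x"
   using pd_conv[OF L1 test_fun_pd_mollifier[of "1 / Suc k"]] by (simp add: pd_eqI[OF has_derivative_const])
  finally show ?thesis .
 qed
 have "pd (pd ?m e) e' = pd (pd ?m e') e" by (rule ext) (rule pd_mollifier_commute)
 thus "pd (pd (mollify cyl v k) e) e' x = pd (pd (mollify cyl v k) e') e x" by (simp only: pd_pd)
qed

text \<open>Formally \<open>\<partial>\<^sub>i\<partial>\<^sub>t v = \<partial>\<^sub>t\<partial>\<^sub>i v\<close>. It is justified by mollifying the extension of \<open>v\<close> by zero.\<close>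

lemma mollified_commutator_cutoff:
 assumes v: "energy v w g" and z: "energy z y h" and rho: "C1 rho"
  and K: "compact K" "K <= ivl" "!!t. t ~: K ==> rho t = 0" "!!t. t ~: K ==> pd rho 1 t = 0"
  and k: "!!t. t : K ==> t + 1 / Suc k < T"
 shows "ip cyl (%x. mollify cyl (%x. g x $ i) k x) (%x. rho (fst x) * y x) -
   ip cyl (mollify cyl w k) (%x. rho (fst x) * h x $ i) =
  - ip cyl (%x. mollify cyl (%x. g x $ i) k x) (%x. pd rho 1 (fst x) * z x)"
proof -
 note v_L2 = energyD(1)[OF v]
 let ?p = "pd (mollify cyl v k) (0, axis i 1)" and ?q = "pd (mollify cyl v k) (1, 0)"
 note Cp = pd_pd_mollify_commute(1)[OF v_L2, of k "(0, axis i 1)"]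
  and Cq = pd_pd_mollify_commute(1)[OF v_L2, of k "(1, 0)"]
 note C = C1_fst[OF rho]
 have pq: "?p x = mollify cyl (%x. g x $ i) k x" "?q x = mollify cyl w k x" if "fst x : K" for x
  using pd_mollify_energy[OF v, of x k] K(2) k that by auto
 have eq: "rho (fst x) * ?p x = rho (fst x) * mollify cyl (%x. g x $ i) k x"
  "rho (fst x) * ?q x = rho (fst x) * mollify cyl w k x"
  "pd rho 1 (fst x) * ?p x = pd rho 1 (fst x) * mollify cyl (%x. g x $ i) k x" for x
  using pq[of x] K(3,4)[of "fst x"] by (cases "fst x : K"; simp)+
 have "ip cyl z (%x. pd (%x. rho (fst x) * ?p x) (1, 0) x) = - ip cyl y (%x. rho (fst x) * ?p x)"
  by (rule energy_time_parts[OF z C1_mult[OF C(1) Cp] K(1,2)]) (simp add: K(3))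
 moreover have "ip cyl z (%x. pd (%x. rho (fst x) * ?q x) (0, axis i 1) x) = - ip cyl (%x. h x $ i) (%x. rho (fst x) * ?q x)"
  by (rule energy_space_parts_C1[OF z C1_mult[OF C(1) Cq]])
 moreover have "pd (%x. rho (fst x) * ?p x) (1, 0) x = pd (%x. rho (fst x) * ?q x) (0, axis i 1) x + pd rho 1 (fst x) * ?p x" for x
  using pd_pd_mollify_commute(2)[OF v_L2, of k "(0, axis i 1)" "(1, 0)"]
  by (simp add: pd_mult[OF C(1) Cp] pd_mult[OF C(1) Cq] C(2) pd_0[OF rho])
 moreover have "L1_on cyl (%x. z x * pd (%x. rho (fst x) * ?q x) (0, axis i 1) x)"
  by (intro L2_mult energyD(1)[OF z] L2_on_C1(2)[OF C1_mult[OF C(1) Cq]] bounded_cyl cyl_lebesgue)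
 moreover have "L1_on cyl (%x. z x * (pd rho 1 (fst x) * ?p x))"
  by (intro L2_mult energyD(1)[OF z] L2_on_continuous continuous_on_mult bounded_cyl cyl_lebesgue
   continuous_on_subset[OF C1_continuous[OF Cp]] continuous_on_compose2[OF C1_continuous_pd[OF rho]])
   (auto intro!: continuous_intros)
 ultimately have "ip cyl y (%x. rho (fst x) * ?p x) - ip cyl (%x. h x $ i) (%x. rho (fst x) * ?q x) =
   - ip cyl z (%x. pd rho 1 (fst x) * ?p x)"
  by (simp add: distrib_left)
 thus ?thesis by (simp add: eq mult_ac)
qed

lemma energy_commutator_cutoff:
 assumes v: "energy v w g" and z: "energy z y h" and rho: "test_fun ivl rho"
 shows "ip cyl (%x. rho (fst x)) (%x. g x $ i * y x - w x * h x $ i) =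
  - ip cyl (%x. pd rho 1 (fst x)) (%x. g x $ i * z x)"
proof -
 note C = test_fun_C1[OF rho]
 note v' = energyD[OF v] and z' = energyD[OF z]
 let ?a = "%x. rho (fst x) * y x" and ?b = "%x. rho (fst x) * h x $ i" and ?c = "%x. pd rho 1 (fst x) * z x"
 obtain K where K: "compact K" "K <= ivl" "!!t. t ~: K ==> rho t = 0" "!!t. t ~: K ==> pd rho 1 t = 0"
  using test_fun_supportE[OF rho] by metis
 obtain r where r: "r > 0" "!!s t. s : K ==> dist s t < r ==> t : ivl"
  using compact_in_open_margin[OF K(1,2) open_greaterThanLessThan] by blast
 have L2: "L2_on cyl ?a" "L2_on cyl ?b" "L2_on cyl ?c"
  by (intro L2_on_continuous_mult cyl_lebesgue bounded_cyl z' continuous_on_compose2[OF C1_continuous[OF C]]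
   continuous_on_compose2[OF C1_continuous_pd[OF C]]; auto intro!: continuous_intros)+
 let ?G = "mollify cyl (%x. g x $ i)" and ?W = "mollify cyl w"
 have "EV k. ip cyl (?G k) ?a - ip cyl (?W k) ?b = - ip cyl (?G k) ?c"
  using eventually_one_over_Suc_less[OF r(1), of 1]
 proof eventually_elim
  case (elim k)
  have margin: "t + 1 / Suc k < T" if "t : K" for t
   using r(2)[OF that, of "t + 1 / Suc k"] elim by (simp add: dist_real_def)
  show ?case by (rule mollified_commutator_cutoff[OF v z C K margin])
 qed
 note eq = Lim_transform_eventually[OF _ this]
 note moll = mollify_L2_tendsto[OF cyl_lebesgue bounded_cyl cyl_lebesgue order_refl]
 have lhs: "(%k. ip cyl (?G k) ?a - ip cyl (?W k) ?b) ---->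
   ip cyl (%x. g x $ i) ?a - ip cyl w ?b"
  by (intro tendsto_diff L2_tendsto_integral_mult moll v' L2)
 have rhs: "(%k. - ip cyl (?G k) ?c) ----> - ip cyl (%x. g x $ i) ?c"
  by (intro tendsto_minus L2_tendsto_integral_mult moll v' L2)
 have "ip cyl (%x. g x $ i) ?a - ip cyl w ?b = - ip cyl (%x. g x $ i) ?c"
  by (rule LIMSEQ_unique[OF eq[OF lhs] rhs])
 thus ?thesis
  using L2_mult[OF v'(3)[of i] L2(1)] L2_mult[OF v'(2) L2(2)]
  by (simp add: right_diff_distrib mult.left_commute[of "rho _"] mult.left_commute[of "pd rho _ _"])
qed

lemma vanish_ends_imp_square_le:
 assumes z: "energy z y h" and vanish: "vanish_ends T (%_. S) z"
 shows "AE t in leb ivl. sqnorm S (sect z t) <= min t (T - t) * sqnorm cyl y"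
proof -
 let ?c = "sqnorm cyl y"
 obtain U where U: "!!t. t : {0..T} ==> L2_on S (U t)"
  "!!s t. s : {0..T} ==> t : {0..T} ==> sqnorm S (%x. U t x - U s x) <= abs (t - s) * ?c"
  "AE t in leb ivl. AE x in leb S. U t x = z (t, x)"
  using L2_time_repE[OF energyD(1,2)[OF z] energy_weak_time_eq[OF z]] by blast
 have Uz: "AE t in leb ivl. sqnorm S (U t) = sqnorm S (sect z t)"
  using U(3)
 proof eventually_elim
  case (elim t)
  show ?case by (rule int_on_cong_AE[OF lebesgue_S]) (use elim in eventually_elim, simp)
 qed
 have c: "0 <= ?c" by simp
 have end_zero: "sqnorm S (U e) = 0" if e: "e = 0 | e = T" for e
 proof (rule antisym[OF field_le_epsilon])
  fix eps :: real assume eps: "eps > 0"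
  hence "sqrt (eps / 4) > 0" by simp
  then obtain d where d: "d > 0"
   "AE t in lebesgue. t : {0<..<d} \<union> {T - d<..<T} --> l2norm S (slice z t) < sqrt (eps / 4)"
   using vanish unfolding vanish_ends_def by blast
  define r where "r = min (min d T) (eps / (4 * (?c + 1)))"
  have r: "0 < r" "r <= d" "r <= T" "r * ?c <= eps / 4"
  proof -
   have "r * ?c <= (eps / 4 / (?c + 1)) * (?c + 1)" unfolding r_def divide_divide_eq_left using eps c by (intro mult_mono) auto
   also have "... = eps / 4" using c by (intro nonzero_eq_divide_eq[THEN iffD1, OF _ refl]) linarith
   finally show "r * ?c <= eps / 4" .
  qed (use d(1) T_pos eps c in "auto simp: r_def add_nonneg_pos")
  define a where "a = (if e = 0 then 0 else T - r)"
  have a: "{a<..<a + r} <= ivl" "{a<..<a + r} <= {0<..<d} \<union> {T - d<..<T}"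
   "!!s. s : {a<..<a + r} ==> abs (e - s) <= r" using e r T_pos by (auto simp: a_def split: if_splits)
  have "AE s in leb {a<..<a + r}. sqnorm S (U s) < eps / 4"
   using Uz d(2) unfolding AE_ivl_iff AE_on_iff[OF lebesgue_open[OF open_greaterThanLessThan]]
   by eventually_elim (use a(1,2) in "auto simp: l2norm_eq[OF lebesgue_S] slice_def")
  then obtain s where s: "s : {a<..<a + r}" "sqnorm S (U s) < eps / 4" by (rule AE_interval_ex) (use r(1) in simp)
  have in_T: "s : {0..T}" "e : {0..T}" using s(1) a(1) e T_pos by auto
  have "sqnorm S (%x. U e x - U s x + U s x) <= 2 * sqnorm S (%x. U e x - U s x) + 2 * sqnorm S (U s)"
   by (intro integral_square_add_le L2_diff U in_T)
  moreover have "sqnorm S (%x. U e x - U s x) <= r * ?c"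
   using order_trans[OF U(2)[OF in_T] mult_right_mono[OF a(3)[OF s(1)]]] by simp
  ultimately show "sqnorm S (U e) <= 0 + eps" using s(2) r(4) by simp
 qed simp
 have le: "sqnorm S (U t) <= abs (t - e) * ?c" if t: "t : {0..T}" and e: "e = 0 | e = T" for t e
 proof -
  have "e : {0..T}" using e T_pos by auto
  note U' = U(1)[OF this] U(2)[OF this t]
  have "AE x in leb S. (U e x)^2 = 0"
   using end_zero[OF e] integral_nonneg_eq_0_iff_AE[OF L2_square_integrable[OF U'(1)]] by simp
  hence "AE x in leb S. (U t x)^2 = (U t x - U e x)^2" by eventually_elim simp
  from int_on_cong_AE[OF lebesgue_S this] U'(2) show ?thesis by simp
 qed
 show ?thesis using Uz AE_in_ivl
 proof eventually_elim
  case (elim t)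
  thus ?case using le[of t 0] le[of t T] by (cases "t <= T - t") (auto simp: min_def)
 qed
qed

end

definition smooth_step :: "real => real" where "smooth_step s = (max 0 s)^2 / ((max 0 s)^2 + (max 0 (1 - s))^2)"

lemma smooth_step_denominator: "1 / 2 <= (max 0 s)^2 + (max 0 (1 - s :: real))^2"
proof -
 have "(1 :: real)^2 <= (max 0 s + max 0 (1 - s))^2" by (intro power_mono) auto
 also have "... <= 2 * ((max 0 s)^2 + (max 0 (1 - s))^2)"
  using zero_le_power2[of "max 0 s - max 0 (1 - s)"] by (simp add: power2_sum power2_diff)
 finally show ?thesis by simp
qed

lemma smooth_step_eq: "s <= 0 ==> smooth_step s = 0" "1 <= s ==> smooth_step s = 1" "0 <= smooth_step s" "smooth_step s <= 1"
 using smooth_step_denominator[of s] by (auto simp: smooth_step_def divide_simps)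

lemma smooth_step_deriv:
 defines "D == %s :: real. 2 * max 0 s * max 0 (1 - s) * (max 0 s + max 0 (1 - s)) / ((max 0 s)^2 + (max 0 (1 - s))^2)^2"
 shows "(smooth_step has_real_derivative D s) (at s)" "abs (D s) <= 2" "s ~: {0..1} ==> D s = 0"
proof -
 have p: "((%s. (max 0 s)^2) has_real_derivative 2 * max 0 s) (at s)" for s :: real
  using pos_part_power_deriv[of 0 s] by (simp add: numeral_2_eq_2)
 have "((%s. (max 0 (1 - s))^2) has_real_derivative 2 * max 0 (1 - s) * - 1) (at s)"
  by (rule DERIV_chain2[OF p]) (auto intro!: derivative_eq_intros)
 note quotient = DERIV_divide[OF p DERIV_add[OF p this]]
 have den: "(max 0 s)^2 + (max 0 (1 - s))^2 ~= 0" using smooth_step_denominator[of s] by auto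
 show "(smooth_step has_real_derivative D s) (at s)" unfolding smooth_step_def[abs_def] D_def
  by (rule DERIV_cong[OF quotient[OF den]]) (simp add: power2_eq_square algebra_simps)
 show "abs (D s) <= 2"
 proof (cases "s : {0..1}")
  case True
  have "1 / 4 <= (s^2 + (1 - s)^2)^2"
   using power_mono[OF smooth_step_denominator[of s], of 2] True by (simp add: max_def power2_eq_square)
  moreover have "s * (1 - s) <= 1 / 4" using zero_le_power2[of "s - 1/2"] by (simp add: power2_eq_square algebra_simps)
  ultimately show ?thesis using True by (simp add: D_def max_def divide_simps abs_mult)
 qed (auto simp: D_def max_def)
qed (auto simp: D_def max_def)

lemma C1_real:
 assumes deriv: "!!x. (f has_real_derivative f' x) (at x)" and cont: "continuous_on UNIV f'"
 shows "C1 f" "pd f 1 x = f' x"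
proof -
 have deriv': "(f has_derivative (%h. f' x * h)) (at x)" for x using deriv[of x] by (simp add: has_field_derivative_def)
 show "C1 f" by (rule C1I[OF deriv']) (intro continuous_intros cont)
 show "pd f 1 x = f' x" using pd_eqI[OF deriv', of 1 x] by simp
qed

definition time_cutoff :: "real => nat => real => real" where
 "time_cutoff T k t = smooth_step (real (Suc k) * t - 1) * smooth_step (real (Suc k) * (T - t) - 1)"

lemma abs_time_cutoff_le: "abs (time_cutoff T k t) <= 1" by (simp add: time_cutoff_def abs_mult smooth_step_eq mult_le_one)

lemma time_cutoff_eq_1: "2 / Suc k < t ==> t < T - 2 / Suc k ==> time_cutoff T k t = 1"
 by (simp add: time_cutoff_def smooth_step_eq field_simps)

lemma time_cutoff_tendsto:
 assumes "0 < t" "t < T"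
 shows "(%k. time_cutoff T k t) ----> 1"
proof (rule tendsto_eventually)
 have "min t (T - t) > 0" using assms by simp
 from eventually_one_over_Suc_less[OF this, of 2] show "EV k. time_cutoff T k t = 1"
  by eventually_elim (rule time_cutoff_eq_1, auto)
qed

lemma time_cutoff:
 shows test_fun_time_cutoff: "test_fun {0<..<T} (time_cutoff T k)"
  and abs_pd_time_cutoff_le: "abs (pd (time_cutoff T k) 1 t) <= 4 * Suc k"
  and pd_time_cutoff_zero: "2 / Suc k < t ==> t < T - 2 / Suc k ==> pd (time_cutoff T k) 1 t = 0"
proof -
 let ?n = "real (Suc k)"
 define D :: "real => real" where
  "D s = 2 * max 0 s * max 0 (1 - s) * (max 0 s + max 0 (1 - s)) / ((max 0 s)^2 + (max 0 (1 - s))^2)^2" for s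
 note step = smooth_step_deriv[folded D_def]
 define E where "E t = ?n * D (?n * t - 1) * smooth_step (?n * (T - t) - 1) -
  smooth_step (?n * t - 1) * (?n * D (?n * (T - t) - 1))" for t
 have deriv: "(time_cutoff T k has_real_derivative E t) (at t)" for t unfolding time_cutoff_def[abs_def] E_def
  by (auto intro!: derivative_eq_intros DERIV_chain2[OF step(1)] simp: algebra_simps)
 have step_cont: "continuous_on UNIV smooth_step" using step(1) by (meson DERIV_isCont continuous_at_imp_continuous_on)
 have "(max 0 s)^2 + (max 0 (1 - s))^2 ~= 0" for s :: real using smooth_step_denominator[of s] by auto
 hence "continuous_on UNIV E" unfolding E_def D_def by (intro continuous_intros continuous_on_compose2[OF step_cont]) auto
 note C = C1_real[OF deriv this]
 show "test_fun {0<..<T} (time_cutoff T k)"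
 proof (rule test_funI[OF C(1) compact_Icc])
  have "0 < 1 / ?n" by simp
  thus "{1 / ?n..T - 1 / ?n} <= {0<..<T}" unfolding subset_iff atLeastAtMost_iff greaterThanLessThan_iff by linarith
  fix t assume "t ~: {1 / ?n..T - 1 / ?n}"
  hence "?n * t - 1 <= 0 | ?n * (T - t) - 1 <= 0" by (auto simp: field_simps)
  thus "time_cutoff T k t = 0" by (auto simp: time_cutoff_def smooth_step_eq)
 qed
 have "abs (?n * D a * smooth_step b) <= 2 * ?n" for a b
  using mult_left_mono[OF mult_mono[OF step(2) smooth_step_eq(4)[of b], of a], of ?n]
  by (simp add: abs_mult smooth_step_eq(3) mult.assoc mult.commute[of 2])
 from this[of "?n * t - 1" "?n * (T - t) - 1"] this[of "?n * (T - t) - 1" "?n * t - 1"]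
 show "abs (pd (time_cutoff T k) 1 t) <= 4 * Suc k" by (simp add: C(2) E_def mult_ac)
 assume "2 / Suc k < t" "t < T - 2 / Suc k"
 hence "?n * t - 1 ~: {0..1}" "?n * (T - t) - 1 ~: {0..1}" by (auto simp: field_simps)
 thus "pd (time_cutoff T k) 1 t = 0" by (simp add: C(2) E_def step(3))
qed

context cylinder
begin

lemma time_measurable:
 assumes "continuous_on UNIV f"
 shows "(%x. f (fst x)) : borel_measurable (leb cyl)"
proof -
 have "continuous_on UNIV (%x :: real * (real^'n). f (fst x))"
  by (rule continuous_on_compose2[OF assms]) (auto intro!: continuous_intros)
 thus ?thesis by (intro measurable_restrict_space1 lebesgue_if_borel borel_measurable_continuous_onI)
qed

lemma time_cutoff_integral_tendsto:
 assumes f: "L1_on cyl f"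
 shows "(%k. ip cyl (%x. time_cutoff T k (fst x)) f) ----> int_on cyl f"
proof (rule integral_dominated_convergence[where w = "%x. abs (f x)"])
 show "(%x. time_cutoff T k (fst x) * f x) : borel_measurable (leb cyl)" for k
  using f by (intro borel_measurable_times time_measurable C1_continuous test_fun_C1[OF test_fun_time_cutoff]) simp
 have lim: "(%k. time_cutoff T k (fst x) * f x) ----> f x" if "x : cyl" for x
  using tendsto_mult[OF time_cutoff_tendsto tendsto_const, of "fst x" T "f x"] that by (auto simp: tdomain_def)
 show "AE x in leb cyl. (%k. time_cutoff T k (fst x) * f x) ----> f x"
  unfolding AE_cyl_iff by (intro AE_I2 impI lim)
 show "AE x in leb cyl. norm (time_cutoff T k (fst x) * f x) <= abs (f x)" for k
  by (intro AE_I2) (simp add: abs_mult mult_left_le_one_le abs_time_cutoff_le)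
qed (use f in auto)

text \<open>The cutoffs vary on time intervals of length \<open>2 / n\<close> with slope of order \<open>n\<close>, while the square
 norm of \<open>z\<close> is at most of order \<open>1 / n\<close> there.\<close>

lemma pd_time_cutoff_mult_le:
 assumes z: "energy z y h" and vanish: "vanish_ends T (%_. S) z"
 shows "sqnorm cyl (%x. pd (time_cutoff T k) 1 (fst x) * z x) <= 128 * sqnorm cyl y"
proof -
 let ?c = "sqnorm cyl y" and ?rho = "pd (time_cutoff T k) 1"
 define n where "n = real (Suc k)"
 have n: "n > 0" by (simp add: n_def)
 have "L2_on cyl (%x. ?rho (fst x) * z x)" by (intro L2_on_continuous_mult cyl_lebesgue bounded_cyl energyD(1)[OF z]
   continuous_on_compose2[OF C1_continuous_pd[OF test_fun_C1[OF test_fun_time_cutoff]]]) (auto intro!: continuous_intros)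
 note slices = L2_on_slices[OF this]
 define b where "b t = 32 * n * ?c * (indicator {0..2 / n} t + indicator {T - 2 / n..T} t)" for t :: real
 have b_int: "integrable lebesgue b" unfolding b_def[abs_def]
  by (intro integrable_mult_right integrable_add integrable_real_indicator) (auto simp: emeasure_lborel_Icc_eq)
 have b_nonneg: "0 <= b t" for t using n by (simp add: b_def)
 have "AE t in leb ivl. sqnorm S (%x. ?rho t * z (t, x)) <= b t" using vanish_ends_imp_square_le[OF z vanish] AE_in_ivl
 proof eventually_elim
  case (elim t)
  show ?case
  proof (cases "2 / n < t & t < T - 2 / n")
   case True
   thus ?thesis using pd_time_cutoff_zero[of k t T] b_nonneg[of t] by (simp add: n_def)
  next
   case False
   hence near: "min t (T - t) <= 2 / n" "1 <= indicator {0..2 / n} t + (indicator {T - 2 / n..T} t :: real)"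
    using elim(2) by (auto simp: indicator_def)
   have "(?rho t)^2 <= (4 * n)^2"
    using abs_pd_time_cutoff_le[of T k t] n by (intro power2_le_iff_abs_le[THEN iffD2]) (auto simp: n_def)
   moreover have "sqnorm S (sect z t) <= 2 / n * ?c" using order_trans[OF elim(1) mult_right_mono[OF near(1)]] by simp
   ultimately have "(?rho t)^2 * sqnorm S (sect z t) <= (4 * n)^2 * (2 / n * ?c)" by (intro mult_mono) auto
   also have "... = 32 * n * ?c * 1" using n by (simp add: power2_eq_square)
   also have "... <= b t" unfolding b_def using n by (intro mult_left_mono near(2)) auto
   finally show ?thesis by (simp add: power_mult_distrib)
  qed
 qed
 hence "sqnorm cyl (%x. ?rho (fst x) * z x) <= int_on ivl b"
  using slices(2,3) L1_on_if_integrable[OF b_int lebesgue_ivl] by (simp flip: slices(3)) (rule integral_mono_AE)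
 also have "... <= (LINT t. b t)" using int_on_mono_set[of UNIV ivl b] b_int b_nonneg by (simp add: lebesgue_on_UNIV_eq)
 also have "... = 128 * ?c" unfolding b_def using n by (simp add: measure_completion)
 finally show ?thesis .
qed

theorem energy_commutator:
 assumes v: "energy v w g" and z: "energy z y h" and vanish: "vanish_ends T (%_. S) z"
 shows "int_on cyl (%x. g x $ i * y x - w x * h x $ i) = 0"
proof -
 note v' = energyD[OF v] and z' = energyD[OF z]
 let ?f = "%x. g x $ i * y x - w x * h x $ i" and ?rho = "%k. pd (time_cutoff T k) 1"
 have rho_z: "L2_on cyl (%x. ?rho k (fst x) * z x)" for k by (intro L2_on_continuous_mult cyl_lebesgue bounded_cyl z'
   continuous_on_compose2[OF C1_continuous_pd[OF test_fun_C1[OF test_fun_time_cutoff]]]) (auto intro!: continuous_intros)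
 have "(%k. ip cyl (%x. ?rho k (fst x) * z x) (%x. g x $ i)) ----> ip cyl (%x. 0) (%x. g x $ i)"
 proof (rule L2_weak_tendsto_if_test_fun[OF open_cyl bounded_cyl L2_zero v'(3)])
  show "EV k. L2_on cyl (%x. ?rho k (fst x) * z x) &
    sqnorm cyl (%x. ?rho k (fst x) * z x) <= 128 * sqnorm cyl y" using rho_z pd_time_cutoff_mult_le[OF z vanish] by simp
  fix phi assume "test_fun cyl phi"
  then obtain r where r: "r > 0" "!!z. fst z <= r | T - r <= fst z ==> phi z = 0" by (rule test_fun_time_marginE) blast
  from eventually_one_over_Suc_less[OF r(1), of 2]
  have "EV k. ip cyl (%x. ?rho k (fst x) * z x) phi = ip cyl (%x. 0) phi"
  proof eventually_elim
   case (elim k)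
   have "?rho k (fst x) * phi x = 0" for x using pd_time_cutoff_zero[of k "fst x" T] r(2)[of x] elim by fastforce
   hence "?rho k (fst x) * z x * phi x = 0 * phi x" for x by (metis mult.assoc mult.commute mult_zero_right)
   thus ?case by (simp only:)
  qed
  thus "(%k. ip cyl (%x. ?rho k (fst x) * z x) phi) ----> ip cyl (%x. 0) phi" by (rule tendsto_eventually)
 qed
 hence "(%k. - ip cyl (%x. ?rho k (fst x)) (%x. g x $ i * z x)) ----> 0" using tendsto_minus by (fastforce simp: mult_ac)
 hence "(%k. ip cyl (%x. time_cutoff T k (fst x)) ?f) ----> 0" unfolding energy_commutator_cutoff[OF v z test_fun_time_cutoff] .
 moreover have "L1_on cyl ?f" by (intro integrable_diff L2_mult v' z')
 note time_cutoff_integral_tendsto[OF this]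
 ultimately show ?thesis by (rule LIMSEQ_unique[rotated])
qed

end

lemma abs_det_le:
 fixes A :: "real^'n^'n"
 assumes "!!i j. abs (A $ i $ j) <= C"
 shows "abs (det A) <= real (card {p. p permutes (UNIV :: 'n set)}) * C ^ CARD('n)"
proof -
 let ?P = "{p. p permutes (UNIV :: 'n set)}"
 have "abs (of_int (sign p) * (PROD i:UNIV. A $ i $ p i)) <= C ^ CARD('n)" for p :: "'n => 'n"
  using prod_mono[of UNIV "%i. abs (A $ i $ p i)" "%_. C"] assms by (simp add: abs_mult abs_prod sign_def)
 hence "(SUM p:?P. abs (of_int (sign p) * (PROD i:UNIV. A $ i $ p i))) <= (SUM p:?P. C ^ CARD('n))" by (intro sum_mono)
 thus ?thesis unfolding det_def by (intro order_trans[OF sum_abs]) simp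
qed

lemma continuous_on_det:
 fixes f :: "'a::topological_space => real^'n^'n"
 assumes "!!i j. continuous_on S (%x. f x $ i $ j)"
 shows "continuous_on S (%x. det (f x))" unfolding det_def by (intro continuous_intros assms)

lemma sum_Basis_space_time: "(SUM b:(Basis :: (real * (real^'n)) set). f b) = f (1, 0) + (SUM j:UNIV. f (0, axis j 1))"
proof -
 have "(SUM b:(%v :: real^'n. (0 :: real, v)) ` Basis. f b) = (SUM b:Basis. f (0, b))"
  by (subst sum.reindex) (auto simp: inj_on_def)
 moreover have "(SUM b:(Basis :: (real * (real^'n)) set). f b) =
   (SUM b:(%u. (u, 0)) ` Basis. f b) + (SUM b:(%v. (0, v)) ` Basis. f b)"
  unfolding Basis_prod_def by (rule sum.union_disjoint) auto
 ultimately show ?thesis by (simp add: sum_Basis_vec)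
qed

lemma (in diffeo) inj_on_F: "inj_on F A" using GF by (metis inj_onI)

lemma diffeo_change_of_variables:
 assumes "diffeo A B F G F' G'" "L1_on B h"
 shows "L1_on A (%x. abs (det (matrix (F' x))) * h (F x))" "ip A (%x. abs (det (matrix (F' x)))) (%x. h (F x)) = int_on B h"
proof -
 interpret diffeo A B F G F' G' by (rule assms)
 show "L1_on A (%x. abs (det (matrix (F' x))) * h (F x))" "ip A (%x. abs (det (matrix (F' x)))) (%x. h (F x)) = int_on B h"
  using change_of_variables[OF open_dom(1) F_deriv inj_on_F] assms(2) by (simp_all add: F_image)
qed

locale space_time_flow =
 fixes T :: real and A B :: "real => (real^'n) set" and \<Phi> \<Psi> :: "real * (real^'n) => real^'n"
  and \<Phi>' \<Psi>' :: "real * (real^'n) => real * (real^'n) => real^'n" and C :: real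
 assumes domain_A: "moving_domain T A" and domain_B: "moving_domain T B"
  and flow_in: "!!z. z : tdomain T A ==> (fst z, \<Phi> z) : tdomain T B"
   "!!z. z : tdomain T B ==> (fst z, \<Psi> z) : tdomain T A"
  and flow_inverse: "!!z. z : tdomain T A ==> \<Psi> (fst z, \<Phi> z) = snd z"
   "!!z. z : tdomain T B ==> \<Phi> (fst z, \<Psi> z) = snd z"
  and flow_deriv: "!!z. z : tdomain T A ==> (\<Phi> has_derivative \<Phi>' z) (at z)"
   "!!z. z : tdomain T B ==> (\<Psi> has_derivative \<Psi>' z) (at z)"
  and flow_deriv_cont: "!!e. continuous_on (tdomain T A) (%z. \<Phi>' z e)" "!!e. continuous_on (tdomain T B) (%z. \<Psi>' z e)"
  and flow_deriv_bound: "!!z e. z : tdomain T A ==> norm (\<Phi>' z e) <= C * norm e"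
   "!!z e. z : tdomain T B ==> norm (\<Psi>' z e) <= C * norm e"
begin

sublocale a: moving_domain T A by (rule domain_A)

sublocale b: moving_domain T B by (rule domain_B)

abbreviation "F z == (fst z, \<Phi> z)"

abbreviation "G z == (fst z, \<Psi> z)"

abbreviation "F' z h == (fst h, \<Phi>' z h)"

abbreviation "G' z h == (fst h, \<Psi>' z h)"

abbreviation "D\<Phi> z == matrix (%h. \<Phi>' z (0, h))"

abbreviation "D\<Psi> z == matrix (%h. \<Psi>' z (0, h))"

sublocale st: diffeo "tdomain T A" "tdomain T B" F G F' G'
proof
 show "z : tdomain T A ==> (F has_derivative F' z) (at z)" "w : tdomain T B ==> (G has_derivative G' w) (at w)" for z w
  by (intro has_derivative_Pair flow_deriv has_derivative_fst[OF has_derivative_ident]; assumption)+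
 show "continuous_on (tdomain T A) (%z. F' z e)" for e by (intro continuous_intros flow_deriv_cont)
qed (use flow_inverse in "auto simp: prod_eq_iff intro: flow_in a.open_cyl b.open_cyl a.bounded_cyl b.bounded_cyl")

lemma chain_inverse:
 assumes "z : tdomain T A"
 shows "\<Psi>' (F z) (F' z h) = snd h"
proof -
 have "((%z. \<Psi> (F z)) has_derivative (%h. \<Psi>' (F z) (F' z h))) (at z)"
  by (rule has_derivative_compose[OF st.F_deriv[OF assms] flow_deriv(2)[OF flow_in(1)[OF assms]]])
 hence "(snd has_derivative (%h. \<Psi>' (F z) (F' z h))) (at z)"
  by (rule has_derivative_transform_within_open[OF _ a.open_cyl assms]) (rule flow_inverse)
 from fun_cong[OF has_derivative_unique[OF this has_derivative_snd[OF has_derivative_ident]]] show ?thesis .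
qed

lemma linear_space_deriv: "z : tdomain T A ==> linear (%h. \<Phi>' z (0, h))" "w : tdomain T B ==> linear (%h. \<Psi>' w (0, h))"
proof -
 have "linear (%h :: real^'n. f (0 :: real, h))" if "linear f" for f :: "real * (real^'n) => real^'n"
  using linear_compose[of "%h. (0, h)" f] that by (simp add: o_def linear_iff)
 thus "z : tdomain T A ==> linear (%h. \<Phi>' z (0, h))" "w : tdomain T B ==> linear (%h. \<Psi>' w (0, h))"
  using has_derivative_linear[OF flow_deriv(1)] has_derivative_linear[OF flow_deriv(2)] by blast+
qed

lemma det_inverse:
 assumes "z : tdomain T A"
 shows "det (D\<Psi> (F z)) * det (D\<Phi> z) = 1"
proof -
 have "D\<Psi> (F z) ** D\<Phi> z = matrix ((%h. \<Psi>' (F z) (0, h)) \<circ> (%h. \<Phi>' z (0, h)))"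
  by (rule matrix_compose[OF linear_space_deriv(1)[OF assms] linear_space_deriv(2)[OF flow_in(1)[OF assms]], symmetric])
 also have "(%h. \<Psi>' (F z) (0, h)) \<circ> (%h. \<Phi>' z (0, h)) = id"
  using chain_inverse[OF assms, of "(0, _)"] by (auto simp: fun_eq_iff)
 finally have "D\<Psi> (F z) ** D\<Phi> z = mat 1" by (simp only: matrix_id_mat_1)
 thus ?thesis using det_mul[of "D\<Psi> (F z)" "D\<Phi> z"] by simp
qed

definition "det_bound = real (card {p. p permutes (UNIV :: 'n set)}) * C ^ CARD('n)"

lemma det_D\<Psi>_le: "z : tdomain T B ==> abs (det (D\<Psi> z)) <= det_bound" unfolding det_bound_def
proof (rule abs_det_le)
 fix i j assume "z : tdomain T B"
 thus "abs (D\<Psi> z $ i $ j) <= C"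
  using flow_deriv_bound(2)[of z "(0, axis j 1)"] component_le_norm_cart[of "\<Psi>' z (0, axis j 1)" i]
  by (auto simp: matrix_def norm_Pair)
qed

lemma det_lower_bound:
 assumes "z : tdomain T A"
 shows "1 <= det_bound * abs (det (D\<Phi> z))"
proof -
 have "1 = abs (det (D\<Psi> (F z))) * abs (det (D\<Phi> z))" using det_inverse[OF assms] by (simp flip: abs_mult)
 also have "... <= det_bound * abs (det (D\<Phi> z))" by (intro mult_right_mono det_D\<Psi>_le flow_in assms) simp
 finally show ?thesis .
qed

lemma measurable_det_D\<Phi>: "(%z. det (D\<Phi> z)) : borel_measurable (leb (tdomain T A))"
proof (intro continuous_imp_measurable_on_sets_lebesgue a.cyl_lebesgue continuous_on_det)
 show "continuous_on (tdomain T A) (%z. D\<Phi> z $ i $ j)" for i j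
  using continuous_on_component[OF flow_deriv_cont(1)] by (simp add: matrix_def)
qed

definition "bound = max (1 + abs C) det_bound"

lemma bound_nonneg: "0 <= bound" by (simp add: bound_def le_max_iff_disj)

lemma det_lower_bound':
 assumes "z : tdomain T A"
 shows "1 <= bound * abs (det (D\<Phi> z))"
 by (rule order_trans[OF det_lower_bound[OF assms] mult_right_mono]) (auto simp: bound_def)

lemma slice_in: "t : {0<..<T} ==> y : A t ==> (t, y) : tdomain T A" "t : {0<..<T} ==> x : B t ==> (t, x) : tdomain T B"
 by (simp_all add: tdomain_def)

lemma slice_diffeo:
 assumes t: "t : {0<..<T}"
 shows "diffeo (A t) (B t) (sect \<Phi> t) (sect \<Psi> t) (%y h. \<Phi>' (t, y) (0, h)) (%x h. \<Psi>' (t, x) (0, h))"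
proof
 note slice_in = slice_in[OF t]
 have slice_deriv: "((sect f t) has_derivative (%h. f' (0, h))) (at y)"
  if "(f has_derivative f') (at (t, y))" for f :: "real * (real^'n) => real^'n" and f' y
 proof -
  have "((%y. (t, y)) has_derivative (%h. (0, h))) (at y)" by (auto intro!: derivative_eq_intros)
  from has_derivative_compose[OF this that] show ?thesis .
 qed
 show "((sect \<Phi> t) has_derivative (%h. \<Phi>' (t, y) (0, h))) (at y)" if "y : A t" for y
  by (rule slice_deriv[OF flow_deriv(1)[OF slice_in(1)[OF that]]])
 show "((sect \<Psi> t) has_derivative (%h. \<Psi>' (t, x) (0, h))) (at x)" if "x : B t" for x
  by (rule slice_deriv[OF flow_deriv(2)[OF slice_in(2)[OF that]]])
 show "open (A t)" "open (B t)" "bounded (A t)" "bounded (B t)"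
  using t by (simp_all add: a.open_slice b.open_slice a.bounded_slice b.bounded_slice)
 show "y : A t ==> \<Phi> (t, y) : B t" "x : B t ==> \<Psi> (t, x) : A t"
  "y : A t ==> \<Psi> (t, \<Phi> (t, y)) = y" "x : B t ==> \<Phi> (t, \<Psi> (t, x)) = x" for x y
  using flow_in(1)[OF slice_in(1)] flow_in(2)[OF slice_in(2)]
   flow_inverse(1)[OF slice_in(1)] flow_inverse(2)[OF slice_in(2)] by (auto simp: tdomain_def)
 show "continuous_on (A t) (%y. \<Phi>' (t, y) (0, e))" for e
  by (rule continuous_on_compose2[OF flow_deriv_cont(1)]) (auto intro!: continuous_intros slice_in)
qed

lemma slice_vec_diffeo:
 assumes t: "t : {0<..<T}"
 shows "vec_diffeo (A t) (B t) (sect \<Phi> t) (sect \<Psi> t) (%y h. \<Phi>' (t, y) (0, h)) (%x h. \<Psi>' (t, x) (0, h))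
  (%y. abs (det (D\<Phi> (t, y)))) bound"
proof (intro vec_diffeo.intro bounded_diffeo.intro bounded_diffeo_axioms.intro slice_diffeo[OF t] bound_nonneg)
 show "norm (\<Phi>' (t, y) (0, e)) <= bound * norm e" if "y : A t" for y e
 proof -
  have "norm (\<Phi>' (t, y) (0, e)) <= C * norm e"
   using flow_deriv_bound(1)[OF slice_in(1)[OF t that], of "(0, e)"] by (simp add: norm_Pair)
  also have "... <= bound * norm e" by (intro mult_right_mono) (auto simp: bound_def)
  finally show ?thesis .
 qed
 show "1 <= bound * abs (det (D\<Phi> (t, y)))" if "y : A t" for y by (rule det_lower_bound'[OF slice_in(1)[OF t that]])
qed (use diffeo_change_of_variables[OF slice_diffeo[OF t]] in auto)

lemma change_of_variables_cyl:
 assumes h: "L1_on (tdomain T B) h"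
 shows "L1_on (tdomain T A) (%z. abs (det (D\<Phi> z)) * h (F z))"
  "ip (tdomain T A) (%z. abs (det (D\<Phi> z))) (%z. h (F z)) = int_on (tdomain T B) h"
proof -
 let ?Jh = "%z. abs (det (D\<Phi> z)) * h (F z)"
 note slice = diffeo_change_of_variables[OF slice_diffeo]
 note h_slices = b.Fubini[OF h] and abs_slices = b.Fubini[OF integrable_abs[OF h]]
 show int: "L1_on (tdomain T A) ?Jh"
 proof (rule a.L1_on_cyl_if_slices[OF _ _ _ abs_slices(2)])
  show "?Jh : borel_measurable (leb (tdomain T A))"
   by (intro borel_measurable_times borel_measurable_abs measurable_det_D\<Phi> st.measurable_comp
    borel_measurable_integrable[OF h])
  show "AE t in leb {0<..<T}. L1_on (A t) (sect ?Jh t)" using h_slices(1) a.AE_in_ivl by eventually_elim (use slice(1) in simp)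
  show "AE t in leb {0<..<T}. int_on (A t) (%x. abs (?Jh (t, x))) <= int_on (B t) (%x. abs (h (t, x)))"
   using abs_slices(1) a.AE_in_ivl
  proof eventually_elim
   case (elim t)
   show ?case using slice(2)[OF elim(2,1)] by (simp add: abs_mult)
  qed
 qed
 have "AE t in leb {0<..<T}. int_on (A t) (sect ?Jh t) = int_on (B t) (sect h t)"
  using h_slices(1) a.AE_in_ivl by eventually_elim (use slice(2) in simp)
 from int_on_cong_AE[OF a.lebesgue_ivl this] show "int_on (tdomain T A) ?Jh = int_on (tdomain T B) h"
  using a.Fubini(3)[OF int] h_slices(3) by simp
qed

sublocale st: bounded_diffeo "tdomain T A" "tdomain T B" F G F' G' "%z. abs (det (D\<Phi> z))" bound
proof
 show "norm (F' z e) <= bound * norm e" if "z : tdomain T A" for z e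
 proof -
  have "norm (F' z e) <= norm e + C * norm e"
   using norm_Pair_le[of "fst e" "\<Phi>' z e"] flow_deriv_bound(1)[OF that, of e] norm_fst_le[of "fst e" "snd e"] by simp
  also have "... <= (1 + abs C) * norm e" using mult_right_mono[OF abs_ge_self[of C], of "norm e"] by (simp add: distrib_right)
  also have "... <= bound * norm e" by (intro mult_right_mono) (auto simp: bound_def)
  finally show ?thesis .
 qed
qed (auto intro: bound_nonneg det_lower_bound' change_of_variables_cyl)

lemma energy_comp:
 assumes u: "b.energy u w g"
 shows "a.energy (%z. u (F z)) (%z. w (F z) + \<Phi>' z (1, 0) <.> g (F z)) (%z. \<chi> i. \<Phi>' z (0, axis i 1) <.> g (F z))"
proof -
 note u' = b.energyD[OF u]
 define h where "h e z = fst e * w z + (SUM j:UNIV. snd e $ j * g z $ j)" for e :: "real * (real^'n)" and z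
 have h_Basis: "h (1, 0) = w" "h (0, axis j 1) = (%z. g z $ j)" for j
  by (auto simp: h_def axis_def if_distrib[of "%x. x * _"] cong: if_cong)
 have h: "L2_on (tdomain T B) (h e)" for e unfolding h_def by (intro L2_add L2_cmult L2_sum u')
 have "weak_dir_deriv (tdomain T B) u e (h e)" if "e:Basis" for e
  using that u'(4) b.energy_weak_space_deriv[OF u] h_Basis by (auto simp: Basis_prod_def Basis_vec_def)
 note chain = st.weak_deriv_chain[OF u'(1) h this]
 have sum: "(SUM b:Basis. (F' z e <.> b) * h b (F z)) = fst e * w (F z) + \<Phi>' z e <.> g (F z)" for z e
  unfolding sum_Basis_space_time h_Basis by (simp add: inner_vec_def[of "\<Phi>' z e"] inner_axis)
 have "L2_on (tdomain T A) (%z. SUM j:UNIV. (F' z e <.> (0, axis j 1)) * g (F z) $ j)" for e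
  using st.L2_on_deriv_mult_comp[OF u'(3)] by (intro L2_sum)
 hence grad: "L2_on (tdomain T A) (%z. \<Phi>' z e <.> g (F z))" for e by (simp add: inner_vec_def[of "\<Phi>' _ e"] inner_axis)
 have "AE t in leb {0<..<T}. H10_grad (A t) (%x. u (F (t, x)))
   (%x. \<chi> i. \<Phi>' (t, x) (0, axis i 1) <.> g (F (t, x)))" using u'(5) a.AE_in_ivl
 proof eventually_elim
  case (elim t)
  show ?case using vec_diffeo.H10_grad_comp[OF slice_vec_diffeo[OF elim(2)] elim(1)] by (simp add: pull_grad_def[abs_def])
 qed
 thus ?thesis using chain[of "(1, 0)"] grad L2_add[OF st.L2_on_comp[OF u'(2)] grad] st.L2_on_comp[OF u'(1)]
  unfolding a.energy_def sum by simp
qed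

end

definition C11_bound :: "(real * (real^'n)) set => (real * (real^'n) => real^'n) => real => bool" where
 "C11_bound S F L <-> 0 <= L & (ALL z:S. ALL h. norm (frechet_derivative F (at z within S) h) <= L * norm h) &
  (ALL z:S. ALL z':S. ALL h. norm (frechet_derivative F (at z within S) h - frechet_derivative F (at z' within S) h)
   <= L * norm (z - z') * norm h)"

lemma C11_boundD:
 assumes "C11_bound S F L"
 shows "0 <= L" "z : S ==> norm (frechet_derivative F (at z within S) h) <= L * norm h"
  "z : S ==> z' : S ==> norm (frechet_derivative F (at z within S) h - frechet_derivative F (at z' within S) h)
   <= L * norm (z - z') * norm h" using assms unfolding C11_bound_def by blast+

lemma C11_bound_mono:
 assumes "C11_bound S F L" "L <= M"
 shows "C11_bound S F M"
proof -
 have "L * norm h <= M * norm h" "L * norm z * norm h <= M * norm z * norm h" for z h :: "real * (real^'n)"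
  using assms(2) by (auto intro!: mult_right_mono)
 thus ?thesis using assms unfolding C11_bound_def by (meson order_trans)
qed

lemma C11_boundE:
 assumes C11: "C11_on S F" and S: "bounded S"
 obtains L where "C11_bound S F L"
proof (cases "S = {}")
 case False
 let ?D = "%z. frechet_derivative F (at z within S)"
 have D: "bounded_linear (?D z)" if "z : S" for z
  using C11 that unfolding C11_on_def frechet_derivative_works by (blast intro: has_derivative_bounded_linear)
 obtain L0 where L0: "!!z z'. z : S ==> z' : S ==> onorm (%h. ?D z h - ?D z' h) <= L0 * dist z z'"
  using C11 unfolding C11_on_def by blast
 have lip: "norm (?D z h - ?D z' h) <= abs L0 * norm (z - z') * norm h" if "z : S" "z' : S" for z z' h
 proof -
  have "norm (?D z h - ?D z' h) <= onorm (%h. ?D z h - ?D z' h) * norm h"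
   by (rule onorm[OF bounded_linear_sub[OF D[OF that(1)] D[OF that(2)]]])
  also have "... <= (abs L0 * norm (z - z')) * norm h"
   using L0[OF that] mult_right_mono[OF abs_ge_self[of L0], of "norm (z - z')"] by (intro mult_right_mono) (auto simp: dist_norm)
  finally show ?thesis .
 qed
 obtain z0 where z0: "z0 : S" using False by blast
 obtain M where M: "!!z. z : S ==> norm z <= M" using S by (auto simp: bounded_iff)
 have nonneg: "0 <= M" "0 <= onorm (?D z0)" using order_trans[OF norm_ge_zero M[OF z0]] onorm_pos_le[OF D[OF z0]] by auto
 have "norm (?D z h) <= (onorm (?D z0) + abs L0 * (2 * M)) * norm h" if z: "z : S" for z h
 proof -
  have "abs L0 * norm (z - z0) * norm h <= abs L0 * (2 * M) * norm h"
   using M[OF z] M[OF z0] norm_triangle_ineq4[of z z0] by (intro mult_right_mono mult_left_mono) auto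
  with lip[OF z z0, of h] onorm[OF D[OF z0], of h] norm_triangle_sub[of "?D z h" "?D z0 h"]
  show ?thesis by (simp add: distrib_right)
 qed
 moreover define L where "L = abs L0 + (onorm (?D z0) + abs L0 * (2 * M))"
 have "abs L0 * norm (z - z') * norm h <= L * norm (z - z') * norm h"
  "(onorm (?D z0) + abs L0 * (2 * M)) * norm h <= L * norm h" for z z' h :: "real * (real^'n)"
  using nonneg by (auto simp: L_def intro!: mult_right_mono)
 moreover have "0 <= L" using nonneg by (simp add: L_def)
 ultimately have "C11_bound S F L" unfolding C11_bound_def using lip by (meson order_trans)
 thus ?thesis by (rule that)
qed (auto simp: C11_bound_def intro: that[of 0])

definition bdd_lipschitz :: "'a::euclidean_space set => ('a => real) => bool" where
 "bdd_lipschitz S f <-> bounded (f ` S) & (EX L. L-lipschitz_on S f)"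

lemma bdd_lipschitzI:
 assumes "!!z. z : S ==> abs (f z) <= B" "0 <= L" "!!z z'. z : S ==> z' : S ==> abs (f z - f z') <= L * norm (z - z')"
 shows "bdd_lipschitz S f"
proof -
 have "bounded (f ` S)" using assms(1) by (auto simp: bounded_iff)
 moreover have "L-lipschitz_on S f" using assms(2,3) by (auto simp: dist_norm intro!: lipschitz_onI)
 ultimately show ?thesis by (auto simp: bdd_lipschitz_def)
qed

lemma bdd_lipschitzE:
 assumes "bdd_lipschitz S f"
 obtains L B where "0 <= L" "0 <= B" "!!z. z : S ==> abs (f z) <= B"
  "!!z z'. z : S ==> z' : S ==> abs (f z - f z') <= L * norm (z - z')"
proof -
 obtain L B where "L-lipschitz_on S f" "0 < B" "!!z. z : S ==> abs (f z) <= B"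
  using assms by (auto simp: bdd_lipschitz_def bounded_pos)
 thus ?thesis using that[of L B] by (auto simp: lipschitz_on_def dist_norm)
qed

lemma bdd_lipschitz_const: "bdd_lipschitz S (%_. c)" by (rule bdd_lipschitzI[of _ _ "abs c" 0]) auto

lemma bdd_lipschitz_subset: "bdd_lipschitz S f ==> S' <= S ==> bdd_lipschitz S' f"
 unfolding bdd_lipschitz_def by (meson bounded_subset image_mono lipschitz_on_subset)

lemma bdd_lipschitz_add: "bdd_lipschitz S f ==> bdd_lipschitz S g ==> bdd_lipschitz S (%z. f z + g z)"
 unfolding bdd_lipschitz_def by (auto intro!: bounded_plus_comp exI intro: lipschitz_on_add)

lemma bdd_lipschitz_mult:
 assumes "bdd_lipschitz S f" "bdd_lipschitz S g"
 shows "bdd_lipschitz S (%z. f z * g z)"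
proof -
 obtain L B where f: "0 <= L" "0 <= B" "!!z. z : S ==> abs (f z) <= B"
  "!!z z'. z : S ==> z' : S ==> abs (f z - f z') <= L * norm (z - z')" by (rule bdd_lipschitzE[OF assms(1)]) blast
 obtain L' B' where g: "0 <= L'" "0 <= B'" "!!z. z : S ==> abs (g z) <= B'"
  "!!z z'. z : S ==> z' : S ==> abs (g z - g z') <= L' * norm (z - z')" by (rule bdd_lipschitzE[OF assms(2)]) blast
 show ?thesis
 proof (rule bdd_lipschitzI[of _ _ "B * B'" "B * L' + L * B'"])
  fix z z' assume z: "z : S" "z' : S"
  have "f z * g z - f z' * g z' = f z * (g z - g z') + (f z - f z') * g z'" by (simp add: algebra_simps)
  hence "abs (f z * g z - f z' * g z') <= abs (f z) * abs (g z - g z') + abs (f z - f z') * abs (g z')"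
   by (metis abs_mult abs_triangle_ineq)
  also have "... <= B * (L' * norm (z - z')) + (L * norm (z - z')) * B'" using f(1,2) by (intro add_mono mult_mono f g z) auto
  finally show "abs (f z * g z - f z' * g z') <= (B * L' + L * B') * norm (z - z')" by (simp add: algebra_simps)
 next
  show "abs (f z * g z) <= B * B'" if "z : S" for z unfolding abs_mult using f(2) that by (intro mult_mono f g) auto
 qed (use f g in simp)
qed

lemma bdd_lipschitz_sum: "(!!i. i : I ==> bdd_lipschitz S (f i)) ==> bdd_lipschitz S (%z. SUM i:I. f i z)"
 by (induction I rule: infinite_finite_induct) (auto intro: bdd_lipschitz_const bdd_lipschitz_add)

lemma bdd_lipschitz_prod: "(!!i. i : I ==> bdd_lipschitz S (f i)) ==> bdd_lipschitz S (%z. PROD i:I. f i z)"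
 by (induction I rule: infinite_finite_induct) (auto intro: bdd_lipschitz_const bdd_lipschitz_mult)

lemma bdd_lipschitz_det: "(!!i j. bdd_lipschitz S (%z. f z $ i $ j)) ==> bdd_lipschitz S (%z. det (f z :: real^'n^'n))"
 unfolding det_def by (intro bdd_lipschitz_sum bdd_lipschitz_mult bdd_lipschitz_const bdd_lipschitz_prod)

lemma bdd_lipschitz_inverse:
 assumes g: "bdd_lipschitz S g" and c: "0 < c" "!!z. z : S ==> c <= abs (g z)"
 shows "bdd_lipschitz S (%z. 1 / g z)"
proof -
 obtain L B where L: "0 <= L" "!!z z'. z : S ==> z' : S ==> abs (g z - g z') <= L * norm (z - z')"
  by (rule bdd_lipschitzE[OF g]) blast
 show ?thesis
 proof (rule bdd_lipschitzI[of _ _ "1 / c" "L / (c * c)"])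
  fix z z' assume z: "z : S" "z' : S"
  have "g z ~= 0" "g z' ~= 0" using c(1) c(2)[OF z(1)] c(2)[OF z(2)] by auto
  hence "abs (1 / g z - 1 / g z') = abs (g z - g z') / (abs (g z) * abs (g z'))"
   by (simp add: diff_frac_eq abs_divide abs_mult abs_minus_commute)
  also have "... <= (L * norm (z - z')) / (c * c)" using L z c mult_mono[OF c(2) c(2), of z z'] by (intro frac_le) auto
  finally show "abs (1 / g z - 1 / g z') <= L / (c * c) * norm (z - z')" by simp
 qed (use c L in "auto simp: abs_divide frac_le")
qed

text \<open>McShane's extension.\<close>

lemma bdd_lipschitz_extendE:
 assumes "bdd_lipschitz S f"
 obtains m L where "lipschitz_fun m L" "!!z. z : S ==> m z = f z"
proof (cases "S = {}")
 case True
 have "lipschitz_fun (%_ :: 'a. 0) 0" by standard simp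
 thus ?thesis using that True by blast
next
 case False
 obtain L B where f: "0 <= L" "0 <= B" "!!z. z : S ==> abs (f z) <= B"
  "!!z z'. z : S ==> z' : S ==> abs (f z - f z') <= L * norm (z - z')"
  by (rule bdd_lipschitzE[OF assms]) blast
 define m where "m x = (INF y\<in>S. f y + L * norm (x - y))" for x
 have bdd: "bdd_below ((%y. f y + L * norm (x - y)) ` S)" for x
  by (rule bdd_belowI2[of _ "- B"]) (use f(3) mult_nonneg_nonneg[OF f(1) norm_ge_zero] in "force simp: abs_le_iff intro: add_increasing2")
 have le: "m x <= m x' + L * norm (x - x')" for x x'
 proof -
  have "m x - L * norm (x - x') <= m x'" unfolding m_def[of x']
  proof (rule cINF_greatest[OF False])
   fix y assume y: "y : S"
   have "m x <= f y + L * norm (x - y)" unfolding m_def by (rule cINF_lower[OF bdd y])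
   moreover have "L * norm (x - y) <= L * norm (x - x') + L * norm (x' - y)"
    using mult_left_mono[OF norm_triangle_ineq[of "x - x'" "x' - y"] f(1)] by (simp add: distrib_left)
   ultimately show "m x - L * norm (x - x') <= f y + L * norm (x' - y)" by linarith
  qed
  thus ?thesis by linarith
 qed
 have "lipschitz_fun m L"
 proof
  show "abs (m x - m y) <= L * norm (x - y)" for x y
   using le[of x y] le[of y x] by (simp add: norm_minus_commute abs_le_iff)
 qed
 moreover have "m z = f z" if z: "z : S" for z
 proof (rule antisym)
  show "m z <= f z" unfolding m_def using cINF_lower[OF bdd z, of z] by simp
  show "f z <= m z" unfolding m_def
  proof (rule cINF_greatest[OF False])
   fix y assume "y : S"
   thus "f z <= f y + L * norm (z - y)" using f(4)[OF z, of y] by linarith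
  qed
 qed
 ultimately show ?thesis by (rule that)
qed

definition lipschitz_extension :: "'a::euclidean_space set => ('a => real) => 'a => real" where
 "lipschitz_extension S f = (SOME m. (EX L. lipschitz_fun m L) & (ALL z:S. m z = f z))"

lemma lipschitz_extension:
 assumes "bdd_lipschitz S f"
 shows "EX L. lipschitz_fun (lipschitz_extension S f) L" "z : S ==> lipschitz_extension S f z = f z"
proof -
 have "EX m. (EX L. lipschitz_fun m L) & (ALL z:S. m z = f z)" using bdd_lipschitz_extendE[OF assms] by metis
 from someI_ex[OF this, folded lipschitz_extension_def]
 show "EX L. lipschitz_fun (lipschitz_extension S f) L" "z : S ==> lipschitz_extension S f z = f z" by auto
qed

locale flow =
 fixes T :: real and \<Omega> :: "real => (real^'n) set" and \<Phi> \<Psi> :: "real * (real^'n) => real^'n"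
 assumes T_pos: "T > 0"
  and dom: "ALL t:{0..T}. \<Omega> t ~= {} & open (\<Omega> t) & bounded (\<Omega> t) & lipschitz_boundary (\<Omega> t)"
  and Phi_C11: "C11_on (domPhi T \<Omega>) \<Phi>" and Psi_C11: "C11_on (domPsi T \<Omega>) \<Psi>"
  and Phi_into: "ALL t:{0..T}. (sect \<Phi> t) ` \<Omega> 0 = \<Omega> t"
  and Psi_into: "ALL t:{0..T}. (sect \<Psi> t) ` \<Omega> t = \<Omega> 0"
  and Psi_range: "ALL z:domPsi T \<Omega>. \<Psi> z : closure (\<Omega> 0)"
  and Phi_Psi: "ALL z:domPsi T \<Omega>. \<Phi> (fst z, \<Psi> z) = snd z"
  and Psi_Phi: "ALL z:domPhi T \<Omega>. \<Psi> (fst z, \<Phi> z) = snd z"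
  and Phi_0: "ALL y:closure (\<Omega> 0). \<Phi> (0, y) = y"
begin

abbreviation "Om0 == \<Omega> 0"

abbreviation "D == domPhi T \<Omega>"

abbreviation "E == domPsi T \<Omega>"

abbreviation "Q == tdomain T (%_. Om0)"

abbreviation "CY == tdomain T \<Omega>"

abbreviation "F z == (fst z, \<Phi> z)"

abbreviation "G z == (fst z, \<Psi> z)"

abbreviation "d\<Phi> z == frechet_derivative \<Phi> (at z within D)"

abbreviation "d\<Psi> z == frechet_derivative \<Psi> (at z within E)"

lemma domain_0: "open Om0" "bounded Om0" using dom T_pos by auto

sublocale c: cylinder T "Om0" by standard (use T_pos domain_0 in auto)

lemma Q_subset_D: "Q <= D" using closure_subset[of "Om0"] by (auto simp: tdomain_cylinder domPhi_def)

lemma CY_subset_E: "CY <= E" unfolding domPsi_def by (rule closure_subset)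

lemma compact_D: "compact D" unfolding domPhi_def using domain_0 by (intro compact_Times) auto

lemma Phi_has_derivative: "z : D ==> (\<Phi> has_derivative d\<Phi> z) (at z within D)"
 using Phi_C11 unfolding C11_on_def frechet_derivative_works by blast

lemma Psi_has_derivative: "z : E ==> (\<Psi> has_derivative d\<Psi> z) (at z within E)"
 using Psi_C11 unfolding C11_on_def frechet_derivative_works by blast

lemma continuous_Phi: "continuous_on D \<Phi>"
 using Phi_has_derivative by (meson has_derivative_continuous continuous_on_eq_continuous_within)

lemma F_in_CY: "z : Q ==> F z : CY" using Phi_into by (force simp: tdomain_def)

lemma G_in_Q: "z : CY ==> G z : Q" using Psi_into by (force simp: tdomain_def)

lemma G_F: "z : Q ==> G (F z) = z" using Psi_Phi Q_subset_D by (auto simp: prod_eq_iff)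

lemma F_G: "z : CY ==> F (G z) = z" using Phi_Psi CY_subset_E by (auto simp: prod_eq_iff)

lemma F_image_Q: "F ` Q = CY"
proof
 show "F ` Q <= CY" using F_in_CY by blast
 show "CY <= F ` Q"
 proof
  fix z assume z: "z : CY"
  show "z : F ` Q" using imageI[OF G_in_Q[OF z], of F] unfolding F_G[OF z] .
 qed
qed

lemma moving_domain_Om: "moving_domain T \<Omega>"
proof
 show "0 < T" by (rule T_pos)
 have "open (F ` Q)"
 proof (rule invariance_of_domain[OF _ c.open_cyl])
  show "continuous_on Q F" by (intro continuous_intros continuous_on_subset[OF continuous_Phi Q_subset_D])
  show "inj_on F Q" by (rule inj_on_inverseI[of _ G]) (rule G_F)
 qed
 thus "open CY" by (simp only: F_image_Q)
 have "bounded (\<Phi> ` D)" by (intro compact_imp_bounded compact_continuous_image continuous_Phi compact_D)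
 hence "bounded ({0..T} \<times> \<Phi> ` D)" by (intro bounded_Times) auto
 thus "bounded CY"
  unfolding F_image_Q[symmetric] by (rule bounded_subset) (use Q_subset_D in "auto simp: tdomain_cylinder")
qed

sublocale u: moving_domain T \<Omega> by (rule moving_domain_Om)

definition "flow_bound = (SOME L. C11_bound D \<Phi> L & C11_bound E \<Psi> L)"

lemma flow_bound: "C11_bound D \<Phi> flow_bound" "C11_bound E \<Psi> flow_bound"
proof -
 have "bounded E" unfolding domPsi_def by (rule bounded_closure[OF u.bounded_cyl])
 then obtain L L' where "C11_bound D \<Phi> L" "C11_bound E \<Psi> L'"
  using C11_boundE[OF Phi_C11 compact_imp_bounded[OF compact_D]] C11_boundE[OF Psi_C11] by metis
 hence "EX L. C11_bound D \<Phi> L & C11_bound E \<Psi> L" by (intro exI[of _ "max L L'"]) (auto intro: C11_bound_mono)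
 from someI_ex[OF this, folded flow_bound_def] show "C11_bound D \<Phi> flow_bound" "C11_bound E \<Psi> flow_bound" by auto
qed

lemma continuous_frechet_derivative:
 assumes "C11_bound S f L"
 shows "continuous_on S (%z. frechet_derivative f (at z within S) e)"
proof (rule lipschitz_on_continuous_on[of "L * norm e"])
 show "(L * norm e)-lipschitz_on S (%z. frechet_derivative f (at z within S) e)"
  using C11_boundD(1,3)[OF assms] by (intro lipschitz_onI) (auto simp: dist_norm mult_ac)
qed

sublocale fl: space_time_flow T "%_. Om0" \<Omega> \<Phi> \<Psi> d\<Phi> d\<Psi> flow_bound
proof (rule space_time_flow.intro)
 show "\<Psi> (fst z, \<Phi> z) = snd z" if "z : Q" for z using Psi_Phi Q_subset_D that by blast
 show "\<Phi> (fst z, \<Psi> z) = snd z" if "z : CY" for z using Phi_Psi CY_subset_E that by blast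
 show "(\<Phi> has_derivative d\<Phi> z) (at z)" if "z : Q" for z
  using Phi_has_derivative[of z] Q_subset_D that at_within_open_subset[OF that c.open_cyl Q_subset_D] by auto
 show "(\<Psi> has_derivative d\<Psi> z) (at z)" if "z : CY" for z
  using Psi_has_derivative[of z] CY_subset_E that at_within_open_subset[OF that u.open_cyl CY_subset_E] by auto
 show "continuous_on Q (%z. d\<Phi> z e)" "continuous_on CY (%z. d\<Psi> z e)" for e
  using continuous_on_subset[OF continuous_frechet_derivative[OF flow_bound(1)] Q_subset_D]
   continuous_on_subset[OF continuous_frechet_derivative[OF flow_bound(2)] CY_subset_E] by auto
 show "norm (d\<Phi> z e) <= flow_bound * norm e" if "z : Q" for z e
  using C11_boundD(2)[OF flow_bound(1)] Q_subset_D that by blast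
 show "norm (d\<Psi> z e) <= flow_bound * norm e" if "z : CY" for z e
  using C11_boundD(2)[OF flow_bound(2)] CY_subset_E that by blast
qed (rule c.moving_domain_axioms moving_domain_Om F_in_CY G_in_Q; assumption?)+

sublocale rf: space_time_flow T \<Omega> "%_. Om0" \<Psi> \<Phi> d\<Psi> d\<Phi> flow_bound
 by (rule space_time_flow.intro; (rule fl.domain_A fl.domain_B fl.flow_in fl.flow_inverse fl.flow_deriv
  fl.flow_deriv_cont fl.flow_deriv_bound; (assumption)?))

abbreviation "J z == det (matrix (%h. d\<Phi> z (0, h)))"

abbreviation "b z == coefb T \<Omega> \<Phi> \<Psi> z"

definition "D0 = {0..<T} \<times> Om0"

text \<open>Cramer's rule for \<open>J * b\<close>, which avoids the derivative of \<open>\<Psi>\<close>.\<close>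

definition "cramer_b k z = det ((\<chi> i j. if j = k then d\<Phi> z (1, 0) $ i
 else matrix (%h. d\<Phi> z (0, h)) $ i $ j) :: real^'n^'n)"

lemma D0_subset_D: "D0 <= D" and Q_subset_D0: "Q <= D0"
 using closure_subset[of "Om0"] by (auto simp: D0_def domPhi_def tdomain_cylinder)

lemma detDPhi_eq_J: "detDPhi T \<Omega> \<Phi> z = J z" by (simp add: detDPhi_def Dx_def)

lemma bdd_lipschitz_dPhi: "bdd_lipschitz D (%z. d\<Phi> z e $ i)"
proof (rule bdd_lipschitzI)
 note bound = C11_boundD[OF flow_bound(1)]
 show "0 <= flow_bound * norm e" using bound(1) by simp
 show "abs (d\<Phi> z e $ i) <= flow_bound * norm e" if "z : D" for z
  by (rule order_trans[OF component_le_norm_cart bound(2)[OF that]])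
 show "abs (d\<Phi> z e $ i - d\<Phi> z' e $ i) <= (flow_bound * norm e) * norm (z - z')" if "z : D" "z' : D" for z z'
 proof -
  have "abs (d\<Phi> z e $ i - d\<Phi> z' e $ i) <= norm (d\<Phi> z e - d\<Phi> z' e)"
   using component_le_norm_cart[of "d\<Phi> z e - d\<Phi> z' e" i] by simp
  also have "... <= flow_bound * norm (z - z') * norm e" by (rule bound(3)[OF that])
  finally show ?thesis by (simp add: mult_ac)
 qed
qed

lemma bdd_lipschitz_J: "bdd_lipschitz D J"
 by (rule bdd_lipschitz_det) (simp add: matrix_def bdd_lipschitz_dPhi)

lemma bdd_lipschitz_cramer_b: "bdd_lipschitz D (cramer_b k)"
 unfolding cramer_b_def[abs_def]
proof (rule bdd_lipschitz_det)
 show "bdd_lipschitz D (%z. (\<chi> i j. if j = k then d\<Phi> z (1, 0) $ i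
   else matrix (%h. d\<Phi> z (0, h)) $ i $ j) $ i $ j)" for i j
  by (cases "j = k") (simp_all add: matrix_def bdd_lipschitz_dPhi)
qed

lemma dPhi_at_0:
 assumes y: "y : Om0"
 shows "d\<Phi> (0, y) (0, h) = h"
proof -
 have D: "(0, y) : D" "(%y. (0, y)) ` Om0 <= D"
  using y T_pos closure_subset[of "Om0"] by (auto simp: domPhi_def)
 have "((%y. (0 :: real, y)) has_derivative (%h. (0, h))) (at y within Om0)"
  by (auto intro!: derivative_eq_intros)
 from has_derivative_in_compose[OF this has_derivative_subset[OF Phi_has_derivative[OF D(1)] D(2)]]
 have "((sect \<Phi> 0) has_derivative (%h. d\<Phi> (0, y) (0, h))) (at y)"
  using at_within_open[OF y domain_0(1)] by simp
 hence "((%y. y) has_derivative (%h. d\<Phi> (0, y) (0, h))) (at y)"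
  by (rule has_derivative_transform_within_open[OF _ domain_0(1) y]) (use Phi_0 closure_subset in blast)
 from fun_cong[OF has_derivative_unique[OF this has_derivative_ident]] show ?thesis .
qed

lemma J_at_0: "y : Om0 ==> J (0, y) = 1"
 by (simp add: dPhi_at_0 matrix_id_mat_1[unfolded id_def])

lemma J_nonzero: "z : Q ==> J z ~= 0"
 using fl.det_inverse[of z] by auto

lemma J_pos:
 assumes "z : D0"
 shows "J z > 0"
proof (rule ccontr)
 assume neg: "~ J z > 0"
 obtain t y where z: "z = (t, y)" "0 <= t" "t < T" "y : Om0" using assms by (auto simp: D0_def)
 have "continuous_on D J"
  by (rule continuous_on_det)
   (simp add: matrix_def continuous_on_component continuous_frechet_derivative[OF flow_bound(1)])
 hence "continuous_on {0..t} (%s. J (s, y))"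
  by (rule continuous_on_compose2)
   (use z closure_subset[of "Om0"] in "auto intro!: continuous_intros simp: domPhi_def")
 then obtain s where s: "0 <= s" "s <= t" "J (s, y) = 0" using IVT2'[of "%s. J (s, y)" t 0 0] neg z J_at_0[OF z(4)] by auto
 hence "s ~= 0" using J_at_0[OF z(4)] by auto
 hence "(s, y) : Q" using s z by (auto simp: tdomain_cylinder)
 thus False using J_nonzero s(3) by blast
qed

lemma abs_J: "z : Q ==> abs (J z) = J z" using J_pos[of z] Q_subset_D0 by auto

lemma b_eq: "b z = - d\<Psi> (F z) (1, 0)" by (simp add: coefb_def tdot_def)

lemma dPhi_b:
 assumes z: "z : Q"
 shows "d\<Phi> z (0, b z) = d\<Phi> z (1, 0)"
proof -
 have "d\<Phi> z (1, d\<Psi> (F z) (1, 0)) = 0" using rf.chain_inverse[OF F_in_CY[OF z], of "(1, 0)"] G_F[OF z] by simp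
 hence "d\<Phi> z ((1, 0) - (0, b z)) = 0" by (simp add: b_eq)
 thus ?thesis unfolding linear_diff[OF has_derivative_linear[OF fl.flow_deriv(1)[OF z]]] by simp
qed

lemma J_b:
 assumes z: "z : Q"
 shows "J z * b z $ k = cramer_b k z"
proof -
 have "matrix (%h. d\<Phi> z (0, h)) *v b z = d\<Phi> z (1, 0)"
  using fun_cong[OF matrix_vector_mul(2)[OF fl.linear_space_deriv(1)[OF z]], of "b z"] dPhi_b[OF z] by simp
 hence "b z = (\<chi> k. cramer_b k z / J z)" using cramer[OF J_nonzero[OF z]] unfolding cramer_b_def by blast
 thus ?thesis using J_nonzero[OF z] by simp
qed

definition "J_ext = lipschitz_extension D0 J"

definition "Jinv_ext = lipschitz_extension Q (%z. 1 / J z)"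

definition "Jb_ext k = lipschitz_extension D0 (cramer_b k)"

lemma J_ext: "EX L. lipschitz_fun J_ext L" "z : D0 ==> J_ext z = J z"
 unfolding J_ext_def by (rule lipschitz_extension bdd_lipschitz_subset[OF bdd_lipschitz_J D0_subset_D]; assumption?)+

lemma Jb_ext: "EX L. lipschitz_fun (Jb_ext k) L" "z : D0 ==> Jb_ext k z = cramer_b k z" unfolding Jb_ext_def
 by (rule lipschitz_extension bdd_lipschitz_subset[OF bdd_lipschitz_cramer_b D0_subset_D]; assumption?)+

lemma Jinv_ext: "EX L. lipschitz_fun Jinv_ext L" "z : Q ==> Jinv_ext z = 1 / J z"
proof -
 have "bdd_lipschitz Q (%z. 1 / J z)"
 proof (rule bdd_lipschitz_inverse[OF bdd_lipschitz_subset[OF bdd_lipschitz_J Q_subset_D], of "1 / (fl.bound + 1)"])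
  show "1 / (fl.bound + 1) > 0" using fl.bound_nonneg by simp
  fix z assume z: "z : Q"
  have "1 <= (fl.bound + 1) * abs (J z)" using fl.det_lower_bound'[OF z] by (simp add: distrib_right add_increasing2)
  thus "1 / (fl.bound + 1) <= abs (J z)" using fl.bound_nonneg by (simp add: divide_le_eq mult.commute)
 qed
 from lipschitz_extension[OF this, folded Jinv_ext_def]
 show "EX L. lipschitz_fun Jinv_ext L" "z : Q ==> Jinv_ext z = 1 / J z" by auto
qed

lemma J_ext_eq: "z : Q ==> J_ext z = J z" and Jb_ext_eq: "z : Q ==> Jb_ext k z = J z * b z $ k"
 using J_ext(2)[of z] Jb_ext(2)[of z k] J_b[of z k] Q_subset_D0 by auto

lemma change_of_variables_cyl:
 assumes "L1_on CY h"
 shows "L1_on Q (%z. J z * h (F z))" "ip Q J (%z. h (F z)) = int_on CY h"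
proof -
 have ae: "AE z in leb Q. abs (J z) * h (F z) = J z * h (F z)" by (simp add: c.AE_cyl_iff abs_J)
 show "L1_on Q (%z. J z * h (F z))" "ip Q J (%z. h (F z)) = int_on CY h" using fl.change_of_variables_cyl[OF assms]
  by (simp_all add: L1_on_cong_AE[OF c.cyl_lebesgue ae] int_on_cong_AE[OF c.cyl_lebesgue ae])
qed

lemma L2_on_lipschitz_mult:
 assumes "EX L. lipschitz_fun m L" "L2_on Q w"
 shows "L2_on Q (%z. m z * w z)" "L2_on Q (%z. pd m e z * w z)"
 using lipschitz_fun.L2_on_mult[OF _ c.cyl_lebesgue c.bounded_cyl assms(2)] assms(1) by blast+

lemma lipschitz_integration_by_parts:
 assumes m: "EX L. lipschitz_fun m L" and phi: "test_fun Q phi"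
 shows "ip Q (pd m e) phi = - ip Q m (pd phi e)"
proof -
 obtain K where K: "K <= Q" "!!x. x ~: K ==> phi x = 0" "!!x e. x ~: K ==> pd phi e x = 0"
  using test_fun_supportE[OF phi] by metis
 have "int_on Q h = integral\<^sup>L lebesgue h" if "!!x. x ~: K ==> h x = 0" for h :: "real * (real^'n) => real"
  using int_on_superset[of UNIV Q h] c.cyl_lebesgue K(1) that by (auto simp: lebesgue_on_UNIV_eq subset_iff)
 moreover obtain L where "lipschitz_fun m L" using m by blast
 note lipschitz_fun.pd_weak[OF this test_fun_mono[OF phi], of e]
 ultimately show ?thesis using K(2,3) by simp
qed

lemma J_pd_push_test_fun:
 assumes phi: "test_fun Q phi" and z: "z : Q"
 shows "J z * pd (%x. if x : CY then phi (G x) else 0) (1, 0) (F z) =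
  J_ext z * pd phi (1, 0) z - (SUM i:UNIV. Jb_ext i z * pd phi (0, axis i 1) z)"
proof -
 have "pd (%x. if x : CY then phi (G x) else 0) (1, 0) (F z) = pd phi (1, - b z) z"
  using rf.st.test_fun_comp(2)[OF phi F_in_CY[OF z], of "(1, 0)"] G_F[OF z] by (simp add: b_eq)
 also have "... = pd phi (1, 0) z - (SUM j:UNIV. b z $ j * pd phi (0, axis j 1) z)"
  unfolding pd_basis_expand[OF test_fun_C1[OF phi], of "(1, - b z)"] sum_Basis_space_time
  by (simp add: inner_axis sum_negf)
 finally show ?thesis by (simp add: J_ext_eq[OF z] Jb_ext_eq[OF z] right_diff_distrib sum_distrib_left mult.assoc)
qed

text \<open>Euler's identity for the Jacobian. Only first derivatives of the flow are available, so it
 is obtained in weak form, from the change of variables applied to a time derivative.\<close>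

theorem Euler_identity: "AE z in leb Q. pd J_ext (1, 0) z = (SUM i:UNIV. pd (Jb_ext i) (0, axis i 1) z)"
proof -
 let ?w = "%z. pd J_ext (1, 0) z - (SUM i:UNIV. pd (Jb_ext i) (0, axis i 1) z)"
 have one: "L2_on Q (%_. 1)" by (rule L2_on_C1(1)[OF C1_const c.bounded_cyl c.cyl_lebesgue])
 have pd_L2: "L2_on Q (pd J_ext e)" "L2_on Q (pd (Jb_ext k) e)" and ext_L2: "L2_on Q J_ext" "L2_on Q (Jb_ext k)" for k e
  using L2_on_lipschitz_mult[OF J_ext(1) one] L2_on_lipschitz_mult[OF Jb_ext(1) one] by simp_all
 have "L2_on Q ?w" by (intro L2_diff L2_sum pd_L2)
 hence "AE z in leb Q. ?w z = 0"
 proof (rule AE_zero_if_orthogonal_test_fun[OF c.open_cyl L1_on_if_L2_on[OF c.cyl_lebesgue c.bounded_cyl]])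
  fix phi assume phi: "test_fun Q phi"
  note phi_L2 = test_fun_L2_on[OF phi c.cyl_lebesgue] pd_test_fun_L2_on[OF phi c.cyl_lebesgue]
  let ?psi = "%x. if x : CY then phi (G x) else 0"
  have psi: "test_fun CY ?psi" by (rule rf.st.test_fun_comp(1)[OF phi])
  note psi_L1 = L1_on_if_L2_on[OF u.cyl_lebesgue u.bounded_cyl pd_test_fun_L2_on[OF psi u.cyl_lebesgue]]
  have "ip Q ?w phi = ip Q (pd J_ext (1, 0)) phi - (SUM i:UNIV. ip Q (pd (Jb_ext i) (0, axis i 1)) phi)"
   using L2_mult[OF pd_L2(1) phi_L2(1)] L2_mult[OF pd_L2(2) phi_L2(1)] by (simp add: left_diff_distrib sum_distrib_right)
  also have "... = - int_on Q (%z. J_ext z * pd phi (1, 0) z - (SUM i:UNIV. Jb_ext i z * pd phi (0, axis i 1) z))"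
   using L2_mult[OF ext_L2(1) phi_L2(2)] L2_mult[OF ext_L2(2) phi_L2(2)]
   by (simp add: lipschitz_integration_by_parts[OF J_ext(1) phi] lipschitz_integration_by_parts[OF Jb_ext(1) phi] sum_negf)
  also have "... = - ip Q J (%z. pd ?psi (1, 0) (F z))"
   using J_pd_push_test_fun[OF phi] by (intro arg_cong[of _ _ uminus] integral_cong) auto
  also have "... = 0" by (simp only: change_of_variables_cyl(2)[OF psi_L1] int_on_pd_test_fun[OF u.cyl_lebesgue psi] minus_zero)
  finally show "ip Q ?w phi = 0" .
 qed
 thus ?thesis by eventually_elim simp
qed

end

lemma wdiv_eq_AE:
 assumes S: "open S" "bounded S" and h: "L2_on S h"
  and div: "!!phi. test_fun S phi ==> int_on S (%x. F x <.> cgrad phi x) = - ip S h phi"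
 shows "AE x in leb S. wdiv S F x = h x"
proof -
 note Sl = lebesgue_open[OF S(1)]
 let ?is_wdiv = "%h. L2 S h & (ALL phi. test_fun S phi -->
  (LINT x. indicator S x * (F x <.> cgrad phi x)) = - (LINT x. indicator S x * h x * phi x))"
 have is_wdiv_iff: "?is_wdiv h <-> L2_on S h & (ALL phi. test_fun S phi -->
   int_on S (%x. F x <.> cgrad phi x) = - ip S h phi)" for h unfolding L2_iff[OF Sl] mult.assoc int_indicator[OF Sl] ..
 have "?is_wdiv h" unfolding is_wdiv_iff using h div by blast
 from someI[of ?is_wdiv, OF this] have "?is_wdiv (wdiv S F)" unfolding wdiv_def .
 hence wdiv: "L2_on S (wdiv S F)" "!!phi. test_fun S phi ==>
   int_on S (%x. F x <.> cgrad phi x) = - ip S (wdiv S F) phi" unfolding is_wdiv_iff by blast+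
 show ?thesis by (rule AE_eq_if_pairing_eq[OF S wdiv(1) h]) (use div wdiv(2) in force)
qed

lemma gram_quadratic_form:
 fixes M :: "real^'n^'n"
 shows "((M ** transpose M) *v x) <.> y = (transpose M *v x) <.> (transpose M *v y)"
proof -
 have "((M ** transpose M) *v x) <.> y = y <.> (M *v (transpose M *v x))" by (simp only: matrix_vector_mul_assoc inner_commute)
 also have "... = (transpose M *v y) <.> (transpose M *v x)" by (simp add: dot_lmul_matrix[symmetric])
 finally show ?thesis by (simp only: inner_commute)
qed

lemma outer_quadratic_form: "(outer p q *v x) <.> y = (q <.> x) * (p <.> y)"
proof -
 have "outer p q *v x = (q <.> x) *R p"
  by (simp add: vec_eq_iff outer_def matrix_vector_mult_def inner_vec_def sum_distrib_left mult_ac)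
 thus ?thesis by simp
qed

lemma vanish_ends_dominated:
 assumes T: "T > 0" and vanish: "vanish_ends T A eta"
  and le: "AE t in leb {0<..<T}. l2norm (B t) (slice w t) <= M * l2norm (A t) (slice eta t)"
 shows "vanish_ends T B w" unfolding vanish_ends_def
proof (intro allI impI)
 fix eps :: real assume eps: "eps > 0"
 hence "eps / (abs M + 1) > 0" by simp
 then obtain d where d: "d > 0"
  "AE t in lebesgue. t : {0<..<d} \<union> {T - d<..<T} --> l2norm (A t) (slice eta t) < eps / (abs M + 1)"
  using vanish unfolding vanish_ends_def by blast
 have "AE t in lebesgue. t : {0<..<T} --> l2norm (B t) (slice w t) <= M * l2norm (A t) (slice eta t)"
  using le by (simp add: AE_on_iff)
 with d(2) have "AE t in lebesgue. t : {0<..<min d T} \<union> {T - min d T<..<T} --> l2norm (B t) (slice w t) < eps"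
 proof eventually_elim
  case (elim t)
  show ?case
  proof
   assume t: "t : {0<..<min d T} \<union> {T - min d T<..<T}"
   let ?n = "l2norm (A t) (slice eta t)"
   have "0 <= ?n" by (simp add: l2norm_def)
   have "l2norm (B t) (slice w t) <= M * ?n" using elim(2) t by auto
   also have "... <= (abs M + 1) * ?n" using \<open>0 <= ?n\<close> by (intro mult_right_mono) auto
   also have "... < eps" using elim(1) t by (auto simp: pos_less_divide_eq mult.commute)
   finally show "l2norm (B t) (slice w t) < eps" .
  qed
 qed
 thus "EX d > 0. AE t in lebesgue. t : {0<..<d} \<union> {T - d<..<T} --> l2norm (B t) (slice w t) < eps"
  using d(1) T by (intro exI[of _ "min d T"]) simp
qed

lemma (in moving_domain) admissible_iff: "admissible T \<Omega> eta <-> (EX w g. energy eta w g) & vanish_ends T \<Omega> eta"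
 unfolding admissible_def L2_H10_tderiv_iff[symmetric] by blast

lemma (in space_time_flow) vanish_ends_comp:
 assumes eta: "L2_on (tdomain T B) eta" and vanish: "vanish_ends T B eta"
 shows "vanish_ends T A (%z. eta (F z))"
proof (rule vanish_ends_dominated[OF a.T_pos vanish])
 show "AE t in leb {0<..<T}. l2norm (A t) (slice (%z. eta (F z)) t) <= sqrt bound * l2norm (B t) (slice eta t)"
  using b.L2_on_slices(1)[OF eta] b.AE_in_ivl
 proof eventually_elim
  case (elim t)
  interpret slice: vec_diffeo "A t" "B t" "%y. \<Phi> (t, y)" "%x. \<Psi> (t, x)" "%y h. \<Phi>' (t, y) (0, h)"
   "%x h. \<Psi>' (t, x) (0, h)" "%y. abs (det (D\<Phi> (t, y)))" bound by (rule slice_vec_diffeo[OF elim(2)])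
  from real_sqrt_le_mono[OF slice.L1_on_comp(2)[OF L2_square_integrable[OF elim(1)]]] show ?case
   by (simp add: l2norm_eq a.lebesgue_slice[OF elim(2)] b.lebesgue_slice[OF elim(2)] slice_def real_sqrt_mult)
 qed
qed

lemma (in cylinder) vanish_ends_lipschitz_mult:
 assumes m: "lipschitz_fun m L" and w: "L2_on cyl w" and vanish: "vanish_ends T (%_. S) w"
 shows "vanish_ends T (%_. S) (%z. m z * w z)"
proof -
 obtain C where C: "C > 0" "!!z. z : cyl ==> abs (m z) <= C" using lipschitz_fun.bounded_on[OF m bounded_cyl] by blast
 have "AE t in leb ivl. l2norm S (slice (%z. m z * w z) t) <= C * l2norm S (slice w t)"
  using L2_on_slices(1)[OF w] L2_on_slices(1)[OF lipschitz_fun.L2_on_mult(1)[OF m cyl_lebesgue bounded_cyl w]] AE_in_ivl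
 proof eventually_elim
  case (elim t)
  have "(m (t, x) * w (t, x))^2 <= C^2 * (w (t, x))^2" if "x : S" for x using C(2)[of "(t, x)"] that elim(3)
   by (auto simp: power_mult_distrib tdomain_def abs_le_square_iff[symmetric] intro!: mult_right_mono)
  hence "sqnorm S (%x. m (t, x) * w (t, x)) <= int_on S (%x. C^2 * (w (t, x))^2)"
   using elim(1,2) by (intro integral_mono) (auto simp: sq_integrable_def)
  from real_sqrt_le_mono[OF this] show ?case using C(1) by (simp add: l2norm_eq[OF lebesgue_S] slice_def real_sqrt_mult)
 qed
 thus ?thesis by (rule vanish_ends_dominated[OF T_pos vanish])
qed

context flow
begin

definition "push_dt v_t v_g x = v_t (G x) + d\<Psi> x (1, 0) <.> (v_g (G x) :: real^'n)"

definition "push_grad v_g x = (\<chi> i. d\<Psi> x (0, axis i 1) <.> (v_g (G x) :: real^'n))"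

abbreviation "B z == coefB T \<Omega> \<Phi> \<Psi> z"

abbreviation "a z == coefa T \<Omega> \<Phi> \<Psi> z"

abbreviation "grad_J z == \<chi> i. pd J_ext (0, axis i 1) z"

lemma push_energy: "c.energy v v_t v_g ==> u.energy (%x. v (G x)) (push_dt v_t v_g) (push_grad v_g)"
 using rf.energy_comp[of v v_t v_g] unfolding push_dt_def[abs_def] push_grad_def[abs_def] .

lemma push_at_F:
 assumes "z : Q"
 shows "push_dt v_t v_g (F z) = v_t z - b z <.> v_g z" "push_grad v_g (F z) $ i = d\<Psi> (F z) (0, axis i 1) <.> v_g z"
 using G_F[OF assms] by (simp_all add: push_dt_def push_grad_def b_eq)

lemma B_quadratic_form: "(B z *v x) <.> y =
  (SUM i:UNIV. (d\<Psi> (F z) (0, axis i 1) <.> x) * (d\<Psi> (F z) (0, axis i 1) <.> y)) - (b z <.> x) * (b z <.> y)"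
proof -
 let ?M = "matrix (%h. d\<Psi> (F z) (0, h))"
 have component: "(transpose ?M *v x) $ i = d\<Psi> (F z) (0, axis i 1) <.> x" for x i
  by (simp add: matrix_vector_mult_def transpose_def matrix_def inner_vec_def)
 have "(transpose ?M *v x) <.> (transpose ?M *v y) =
   (SUM i:UNIV. (d\<Psi> (F z) (0, axis i 1) <.> x) * (d\<Psi> (F z) (0, axis i 1) <.> y))"
  by (simp add: inner_vec_def[of "transpose ?M *v x"] component del: transpose_matrix_vector)
 thus ?thesis by (simp add: coefB_def Let_def Dx_def tdot_def b_eq matrix_vector_mult_diff_rdistrib inner_diff_left
   gram_quadratic_form outer_quadratic_form del: transpose_matrix_vector)
qed

lemma det_DPsi: "z : Q ==> det (Dx E \<Psi> (F z)) = 1 / J z" using fl.det_inverse[of z] by (auto simp: Dx_def eq_divide_eq)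

lemma frechet_derivative_detDPhi:
 assumes "z : Q" "J_ext differentiable (at z)"
 shows "frechet_derivative (detDPhi T \<Omega> \<Phi>) (at z) = frechet_derivative J_ext (at z)"
proof (rule frechet_derivative_at[symmetric])
 show "(detDPhi T \<Omega> \<Phi> has_derivative frechet_derivative J_ext (at z)) (at z)"
  using assms(2) unfolding frechet_derivative_works
  by (rule has_derivative_transform_within_open[OF _ c.open_cyl assms(1)]) (simp add: detDPhi_eq_J J_ext_eq)
qed

lemma frechet_derivative_detDPhi_b:
 assumes "z : Q" "!!i. Jb_ext i differentiable (at z)"
 shows "frechet_derivative (%w. detDPhi T \<Omega> \<Phi> w *R b w) (at z) e = (\<chi> i. pd (Jb_ext i) e z)"
proof -
 have "((%w. \<chi> i. Jb_ext i w) has_derivative (%e. \<chi> i. pd (Jb_ext i) e z)) (at z)"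
  using assms(2) by (subst has_derivative_componentwise_within)
   (auto simp: Basis_vec_def inner_axis pd_def frechet_derivative_works)
 hence "((%w. detDPhi T \<Omega> \<Phi> w *R b w) has_derivative (%e. \<chi> i. pd (Jb_ext i) e z)) (at z)"
  by (rule has_derivative_transform_within_open[OF _ c.open_cyl assms(1)]) (simp add: vec_eq_iff detDPhi_eq_J Jb_ext_eq)
 from fun_cong[OF frechet_derivative_at[OF this]] show ?thesis by simp
qed

lemma AE_J_a_inner: "AE z in leb Q. ALL w.
  J z * (a z <.> w) = - (grad_J z <.> (B z *v w)) - (SUM i:UNIV. pd (Jb_ext i) (1, 0) z * w $ i)"
proof -
 have "AE z in lebesgue. J_ext differentiable (at z)" "AE z in lebesgue. ALL k. Jb_ext k differentiable (at z)"
  unfolding AE_all_countable using lipschitz_fun.AE_differentiable J_ext(1) Jb_ext(1) by blast+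
 thus ?thesis unfolding c.AE_cyl_iff
 proof eventually_elim
  case (elim z)
  show ?case
  proof (intro impI allI)
   fix w assume z: "z : Q"
   have "a z = (1 / J z) *R (- (transpose (B z) *v grad_J z + (\<chi> i. pd (Jb_ext i) (1, 0) z)))"
    using frechet_derivative_detDPhi[OF z] frechet_derivative_detDPhi_b[OF z] elim by (simp add: coefa_def det_DPsi[OF z] pd_def)
   hence "J z * (a z <.> w) = - ((transpose (B z) *v grad_J z) <.> w) - (\<chi> i. pd (Jb_ext i) (1, 0) z) <.> w"
    using J_nonzero[OF z] by (simp add: inner_add_left inner_diff_left)
   also have "(transpose (B z) *v grad_J z) <.> w = grad_J z <.> (B z *v w)" by (simp add: dot_lmul_matrix)
   finally show "J z * (a z <.> w) = - (grad_J z <.> (B z *v w)) - (SUM i:UNIV. pd (Jb_ext i) (1, 0) z * w $ i)"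
    by (simp add: inner_vec_def[of "\<chi> i. pd (Jb_ext i) (1, 0) z"])
  qed
 qed
qed

lemma L2_on_dPsi_mult:
 assumes "L2_on Q h"
 shows "L2_on Q (%z. d\<Psi> (F z) e $ i * h z)"
proof (rule L2_bounded_mult[OF assms, of _ "flow_bound * norm e"])
 have "continuous_on Q (%z. d\<Psi> (F z) e)"
  by (rule continuous_on_compose2[OF fl.flow_deriv_cont(2) fl.st.continuous_F]) (use F_in_CY in auto)
 thus "(%z. d\<Psi> (F z) e $ i) : borel_measurable (leb Q)"
  by (intro continuous_imp_measurable_on_sets_lebesgue[OF _ c.cyl_lebesgue] continuous_on_component)
 show "AE z in leb Q. abs (d\<Psi> (F z) e $ i) <= flow_bound * norm e"
  using order_trans[OF component_le_norm_cart fl.flow_deriv_bound(2)[OF F_in_CY]] by (auto simp: c.AE_cyl_iff)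
qed

lemma L2_on_dPsi_inner:
 assumes "!!j. L2_on Q (%z. g z $ j)"
 shows "L2_on Q (%z. d\<Psi> (F z) e <.> g z)" unfolding inner_vec_def inner_real_def by (intro L2_sum L2_on_dPsi_mult assms)

lemma L2_on_b_mult: "L2_on Q h ==> L2_on Q (%z. b z $ i * h z)"
 using L2_minus[OF L2_on_dPsi_mult[of h "(1, 0)" i]] by (simp add: b_eq)

lemma L2_on_B_mult:
 assumes "!!j. L2_on Q (%z. g z $ j)"
 shows "L2_on Q (%z. (B z *v g z) $ i)"
proof -
 have "(B z *v g z) $ i = (SUM k:UNIV. d\<Psi> (F z) (0, axis k 1) $ i * (d\<Psi> (F z) (0, axis k 1) <.> g z)) -
   b z $ i * - (d\<Psi> (F z) (1, 0) <.> g z)" for z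
  using B_quadratic_form[of z "g z" "axis i 1"] by (simp add: inner_axis mult.commute b_eq)
 thus ?thesis using assms by (simp only:) (intro L2_diff L2_minus L2_sum L2_on_dPsi_mult L2_on_b_mult L2_on_dPsi_inner)
qed

lemma L1_on_B_form:
 assumes "!!j. L2_on Q (%z. g z $ j)" "!!j. L2_on Q (%z. h z $ j)"
 shows "L1_on Q (%z. (B z *v g z) <.> h z)" unfolding inner_vec_def[of "B _ *v g _"] inner_real_def
 by (intro integrable_sum L2_mult L2_on_B_mult assms)

lemma energy_lipschitz_mult:
 assumes "EX L. lipschitz_fun m L" "c.energy v w g"
 shows "c.energy (%z. m z * v z) (%z. m z * w z + pd m (1, 0) z * v z) (%z. m z *R g z + v z *R (\<chi> i. pd m (0, axis i 1) z))"
 using c.energy_lipschitz_mult[OF _ assms(2)] assms(1) by blast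

definition "J_dt w w_t z = J_ext z * w_t z + pd J_ext (1, 0) z * w z"

definition "J_grad w w_g z = J_ext z *R w_g z + w z *R grad_J z"

definition "Jb_dt i w w_t z = Jb_ext i z * w_t z + pd (Jb_ext i) (1, 0) z * w z"

definition "Jb_grad i w w_g z = Jb_ext i z *R w_g z + w z *R (\<chi> j. pd (Jb_ext i) (0, axis j 1) z)"

definition "div_Jb w w_g z = (SUM i:UNIV. Jb_grad i w w_g z $ i)"

lemma energy_J_mult: "c.energy w w_t w_g ==> c.energy (%z. J_ext z * w z) (J_dt w w_t) (J_grad w w_g)"
 unfolding J_dt_def[abs_def] J_grad_def[abs_def] by (rule energy_lipschitz_mult[OF J_ext(1)])

lemma energy_Jb_mult: "c.energy w w_t w_g ==> c.energy (%z. Jb_ext i z * w z) (Jb_dt i w w_t) (Jb_grad i w w_g)"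
 unfolding Jb_dt_def[abs_def] Jb_grad_def[abs_def] by (rule energy_lipschitz_mult[OF Jb_ext(1)])

definition "integrand_u f v_t v_g w w_t w_g x =
 - (push_dt v_t v_g x * push_dt w_t w_g x) + push_grad v_g x <.> push_grad w_g x - f x * w (G x)"

definition "integrand_v f v_t v_g w w_t w_g z =
 - (v_t z * J_dt w w_t z) + (B z *v v_g z) <.> J_grad w w_g z + (a z <.> v_g z) * (J_ext z * w z)
  + 2 * (v_t z * div_Jb w w_g z) - f (F z) * (J_ext z * w z)"

definition "weak_form_u f v_t v_g w w_t w_g = int_on CY (integrand_u f v_t v_g w w_t w_g)"

definition "weak_form_v f v_t v_g w w_t w_g = int_on Q (integrand_v f v_t v_g w w_t w_g)"

lemma L2_on_div_Jb: "c.energy w w_t w_g ==> L2_on Q (div_Jb w w_g)"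
 unfolding div_Jb_def[abs_def] by (intro L2_sum c.energyD(3)[OF energy_Jb_mult])

lemma L2_on_a_inner:
 assumes g: "!!j. L2_on Q (%z. g z $ j)"
 shows "L2_on Q (%z. a z <.> g z)"
proof -
 let ?h = "%z. Jinv_ext z * (- (SUM i:UNIV. pd J_ext (0, axis i 1) z * (B z *v g z) $ i) - (SUM i:UNIV. pd (Jb_ext i) (1, 0) z * g z $ i))"
 have "AE z in leb Q. z : Q" by (simp add: c.AE_cyl_iff)
 with AE_J_a_inner have "AE z in leb Q. a z <.> g z = ?h z"
 proof eventually_elim
  case (elim z)
  have "a z <.> g z = Jinv_ext z * (J z * (a z <.> g z))" by (simp add: Jinv_ext(2) J_nonzero elim(2))
  thus ?case unfolding elim(1)[rule_format] by (simp add: inner_vec_def[of "grad_J z"])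
 qed
 moreover have "L2_on Q ?h" by (intro L2_diff L2_minus L2_sum L2_on_B_mult L2_on_lipschitz_mult J_ext(1) Jb_ext(1) Jinv_ext(1) g)
 ultimately show ?thesis by (simp only: L2_on_cong_AE[OF c.cyl_lebesgue])
qed

lemma weak_form_v_integrable:
 assumes v: "c.energy v v_t v_g" and w: "c.energy w w_t w_g" and f: "L2_on CY f"
 shows "L1_on Q (%z. v_t z * J_dt w w_t z)" "L1_on Q (%z. (B z *v v_g z) <.> J_grad w w_g z)"
  "L1_on Q (%z. (a z <.> v_g z) * (J_ext z * w z))" "L1_on Q (%z. v_t z * div_Jb w w_g z)"
  "L1_on Q (%z. f (F z) * (J_ext z * w z))"
 by (intro L2_mult L1_on_B_form L2_on_a_inner c.energyD[OF v] c.energyD[OF energy_J_mult[OF w]]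
  L2_on_div_Jb[OF w] fl.st.L2_on_comp[OF f])+

lemma integrand_v_integrable:
 assumes "c.energy v v_t v_g" "c.energy w w_t w_g" "L2_on CY f"
 shows "L1_on Q (integrand_v f v_t v_g w w_t w_g)"
 unfolding integrand_v_def[abs_def] using weak_form_v_integrable[OF assms] by (intro integrable_diff integrable_add
  integrable_minus integrable_mult_right)

lemma integrand_u_integrable:
 assumes v: "c.energy v v_t v_g" and w: "c.energy w w_t w_g" and f: "L2_on CY f"
 shows "L1_on CY (integrand_u f v_t v_g w w_t w_g)"
 unfolding integrand_u_def[abs_def] inner_vec_def[of "push_grad v_g _"] inner_real_def
 by (intro integrable_diff integrable_add integrable_minus
  integrable_sum L2_mult u.energyD[OF push_energy[OF v]] u.energyD[OF push_energy[OF w]] f)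

lemma integrand_u_at_F:
 assumes "z : Q"
 shows "integrand_u f v_t v_g w w_t w_g (F z) = - (v_t z * w_t z) + v_t z * (b z <.> w_g z) + (b z <.> v_g z) * w_t z
   + (B z *v v_g z) <.> w_g z - f (F z) * w z"
 unfolding integrand_u_def inner_vec_def[of "push_grad v_g _"] push_at_F[OF assms] B_quadratic_form
 using G_F[OF assms] by (simp add: algebra_simps)

lemma div_Jb_eq:
 assumes "z : Q" "pd J_ext (1, 0) z = (SUM i:UNIV. pd (Jb_ext i) (0, axis i 1) z)"
 shows "div_Jb w w_g z = J z * (b z <.> w_g z) + pd J_ext (1, 0) z * w z"
 by (simp add: div_Jb_def Jb_grad_def Jb_ext_eq[OF assms(1)] assms(2) sum.distrib inner_vec_def sum_distrib_left mult_ac)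

lemma sum_Jb_dt:
 assumes "z : Q"
 shows "(SUM i:UNIV. v_g z $ i * Jb_dt i w w_t z) =
  J z * (b z <.> v_g z) * w_t z + w z * (SUM i:UNIV. pd (Jb_ext i) (1, 0) z * v_g z $ i)"
 by (simp add: Jb_dt_def Jb_ext_eq[OF assms] inner_vec_def distrib_left sum.distrib sum_distrib_left sum_distrib_right mult_ac)

lemma integrand_difference:
 assumes z: "z : Q" and Euler: "pd J_ext (1, 0) z = (SUM i:UNIV. pd (Jb_ext i) (0, axis i 1) z)" and J_a: "J z * (a z <.> v_g z) =
   - (grad_J z <.> (B z *v v_g z)) - (SUM i:UNIV. pd (Jb_ext i) (1, 0) z * v_g z $ i)"
 shows "J z * integrand_u f v_t v_g w w_t w_g (F z) - integrand_v f v_t v_g w w_t w_g z =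
  (SUM i:UNIV. v_g z $ i * Jb_dt i w w_t z - v_t z * Jb_grad i w w_g z $ i)"
proof -
 let ?s = "SUM i:UNIV. pd (Jb_ext i) (1, 0) z * v_g z $ i"
 have "(a z <.> v_g z) * (J_ext z * w z) = (- (grad_J z <.> (B z *v v_g z)) - ?s) * w z"
  unfolding J_ext_eq[OF z] J_a[symmetric] by simp
 moreover have "(B z *v v_g z) <.> J_grad w w_g z = J z * ((B z *v v_g z) <.> w_g z) + w z * (grad_J z <.> (B z *v v_g z))"
  by (simp add: J_grad_def J_ext_eq[OF z] inner_add_right inner_commute[of "grad_J z"])
 moreover have "(SUM i:UNIV. v_g z $ i * Jb_dt i w w_t z - v_t z * Jb_grad i w w_g z $ i) =
   J z * (b z <.> v_g z) * w_t z + w z * ?s - v_t z * div_Jb w w_g z"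
  by (simp add: sum_subtractf sum_Jb_dt[OF z] div_Jb_def sum_distrib_left)
 ultimately show ?thesis unfolding integrand_u_at_F[OF z] integrand_v_def div_Jb_eq[OF z Euler] J_dt_def J_ext_eq[OF z]
  by (simp add: algebra_simps)
qed

theorem weak_form_difference:
 assumes v: "c.energy v v_t v_g" and w: "c.energy w w_t w_g" and f: "L2_on CY f"
 shows "weak_form_u f v_t v_g w w_t w_g - weak_form_v f v_t v_g w w_t w_g =
  (SUM i:UNIV. int_on Q (%z. v_g z $ i * Jb_dt i w w_t z - v_t z * Jb_grad i w w_g z $ i))"
proof -
 note int_u = change_of_variables_cyl[OF integrand_u_integrable[OF v w f]] and int_v = integrand_v_integrable[OF v w f]
 have "AE z in leb Q. z : Q" by (simp add: c.AE_cyl_iff)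
 with Euler_identity AE_J_a_inner
 have ae: "AE z in leb Q. J z * integrand_u f v_t v_g w w_t w_g (F z) - integrand_v f v_t v_g w w_t w_g z =
   (SUM i:UNIV. v_g z $ i * Jb_dt i w w_t z - v_t z * Jb_grad i w w_g z $ i)" by eventually_elim (rule integrand_difference, auto)
 have "weak_form_u f v_t v_g w w_t w_g - weak_form_v f v_t v_g w w_t w_g = int_on Q
   (%z. J z * integrand_u f v_t v_g w w_t w_g (F z) - integrand_v f v_t v_g w w_t w_g z)"
  unfolding weak_form_u_def weak_form_v_def by (simp only: integral_diff[OF int_u(1) int_v] int_u(2))
 also have "... = int_on Q (%z. SUM i:UNIV. v_g z $ i * Jb_dt i w w_t z - v_t z * Jb_grad i w w_g z $ i)"
  by (rule int_on_cong_AE[OF c.cyl_lebesgue ae])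
 also have "... = (SUM i:UNIV. int_on Q (%z. v_g z $ i * Jb_dt i w w_t z - v_t z * Jb_grad i w w_g z $ i))"
  by (intro integral_sum integrable_diff L2_mult c.energyD[OF v] c.energyD[OF energy_Jb_mult[OF w]])
 finally show ?thesis .
qed

lemma weak_forms_eq:
 assumes v: "c.energy v v_t v_g" and w: "c.energy w w_t w_g" and f: "L2_on CY f" and vanish: "vanish_ends T (%_. Om0) w"
 shows "weak_form_u f v_t v_g w w_t w_g = weak_form_v f v_t v_g w w_t w_g"
proof -
 have "vanish_ends T (%_. Om0) (%z. Jb_ext i z * w z)" for i
  using Jb_ext(1) c.vanish_ends_lipschitz_mult[OF _ c.energyD(1)[OF w] vanish] by blast
 from c.energy_commutator[OF v energy_Jb_mult[OF w] this] show ?thesis using weak_form_difference[OF v w f] by simp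
qed

lemma wdiv_b_eq:
 assumes w: "c.energy w w_t w_g" and xi: "!!z. z : Q ==> xi z = J_ext z * w z"
 shows "AE t in leb {0<..<T}. AE y in leb Om0. wdiv Om0 (%y. xi (t, y) *R b (t, y)) y = div_Jb w w_g (t, y)"
proof -
 have "AE t in leb {0<..<T}. ALL i. H10_grad Om0 (%y. Jb_ext i (t, y) * w (t, y)) (%y. Jb_grad i w w_g (t, y))"
  unfolding AE_all_countable using c.energyD(5)[OF energy_Jb_mult[OF w]] by blast
 thus ?thesis using c.AE_in_ivl
 proof eventually_elim
  case (elim t)
  note H = H1_gradD[OF domain_0(1) H10_grad_H1[OF elim(1)[rule_format]]]
  show ?case
  proof (rule wdiv_eq_AE[OF domain_0])
   show "L2_on Om0 (%y. div_Jb w w_g (t, y))" unfolding div_Jb_def by (intro L2_sum H)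
   fix phi assume phi: "test_fun Om0 phi"
   note phi_L2 = test_fun_L2_on[OF phi c.lebesgue_S] pd_test_fun_L2_on[OF phi c.lebesgue_S]
   have "(xi (t, x) *R b (t, x)) <.> cgrad phi x = (SUM i:UNIV. (Jb_ext i (t, x) * w (t, x)) * pd phi (axis i 1) x)"
    if "x : Om0" for x
   proof -
    have "(t, x) : Q" using that elim(2) by (simp add: tdomain_def)
    thus ?thesis by (simp add: xi J_ext_eq Jb_ext_eq inner_vec_def cgrad_def sum_distrib_left mult_ac)
   qed
   hence "int_on Om0 (%x. (xi (t, x) *R b (t, x)) <.> cgrad phi x) =
     int_on Om0 (%x. SUM i:UNIV. (Jb_ext i (t, x) * w (t, x)) * pd phi (axis i 1) x)" by (intro integral_cong) auto
   also have "... = (SUM i:UNIV. ip Om0 (%x. Jb_ext i (t, x) * w (t, x)) (pd phi (axis i 1)))"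
    by (intro integral_sum L2_mult H phi_L2)
   also have "... = (SUM i:UNIV. - ip Om0 (%x. Jb_grad i w w_g (t, x) $ i) phi)"
    using H(3) phi unfolding weak_dir_deriv_iff[OF c.lebesgue_S] by (intro sum.cong) auto
   also have "... = - ip Om0 (%x. div_Jb w w_g (t, x)) phi"
    unfolding div_Jb_def sum_distrib_right using L2_mult[OF H(2) phi_L2(1)] by (simp add: sum_negf)
   finally show "int_on Om0 (%x. (xi (t, x) *R b (t, x)) <.> cgrad phi x) = - ip Om0 (%x. div_Jb w w_g (t, x)) phi" .
  qed
 qed
qed

definition "weak_eq_u f w eta <->
 - tint T (%t. l2ip (\<Omega> t) (slice (tderiv T \<Omega> w) t) (slice (tderiv T \<Omega> eta) t))
 + tint T (%t. LINT x. indicator (\<Omega> t) x * (wgrad (\<Omega> t) (slice w t) x <.> wgrad (\<Omega> t) (slice eta t) x))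
 = tint T (%t. l2ip (\<Omega> t) (slice f t) (slice eta t))"

definition "weak_eq_v f v xi <-> - tint T (%t. l2ip Om0 (slice (tderiv T (%_. Om0) v) t) (slice (tderiv T (%_. Om0) xi) t))
 + tint T (%t. LINT y. indicator Om0 y * ((B (t, y) *v wgrad Om0 (slice v t) y) <.> wgrad Om0 (slice xi t) y))
 + tint T (%t. LINT y. indicator Om0 y * ((a (t, y) <.> wgrad Om0 (slice v t) y) * xi (t, y)))
 + 2 * tint T (%t. l2ip Om0 (slice (tderiv T (%_. Om0) v) t) (wdiv Om0 (%y. xi (t, y) *R b (t, y))))
 = tint T (%t. l2ip Om0 (slice (%z. f (F z)) t) (slice xi t))"

lemma weak_eq_u_iff_integral:
 assumes w: "u.energy w w_t w_g" and eta: "u.energy eta eta_t eta_g" and f: "L2_on CY f"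
 shows "weak_eq_u f w eta <-> int_on CY (%x. - (w_t x * eta_t x) + w_g x <.> eta_g x - f x * eta x) = 0"
proof -
 note w' = u.energyD[OF w] and eta' = u.energyD[OF eta]
 have grad: "L1_on CY (%x. w_g x <.> eta_g x)" unfolding inner_vec_def inner_real_def by (intro integrable_sum L2_mult w' eta')
 have "tint T (%t. l2ip (\<Omega> t) (slice (tderiv T \<Omega> w) t) (slice (tderiv T \<Omega> eta) t)) = ip CY w_t eta_t"
  using u.AE_slice[OF u.tderiv_energy(2)[OF w]] u.AE_slice[OF u.tderiv_energy(2)[OF eta]]
  by (intro u.tint_l2ip w' eta') (auto simp: slice_def)
 moreover have "AE t in leb {0<..<T}. AE x in leb (\<Omega> t).
   wgrad (\<Omega> t) (slice w t) x <.> wgrad (\<Omega> t) (slice eta t) x = w_g (t, x) <.> eta_g (t, x)"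
  using u.wgrad_energy[OF w] u.wgrad_energy[OF eta]
 proof eventually_elim
  case (elim t)
  thus ?case by eventually_elim simp
 qed
 note u.tint_inner[OF this grad]
 moreover have "tint T (%t. l2ip (\<Omega> t) (slice f t) (slice eta t)) = ip CY f eta"
  by (intro u.tint_l2ip f eta') (auto simp: slice_def)
 ultimately show ?thesis unfolding weak_eq_u_def using L2_mult[OF w'(2) eta'(2)] grad L2_mult[OF f eta'(1)] by auto
qed

lemma push_energy_cong:
 assumes "c.energy v v_t v_g" "!!z. z : Q ==> v z = w (F z)"
 shows "u.energy w (push_dt v_t v_g) (push_grad v_g)"
proof (rule u.energy_cong_AE[OF push_energy[OF assms(1)]])
 show "AE x in leb CY. v (G x) = w x" using assms(2)[OF G_in_Q] F_G by (simp add: u.AE_cyl_iff)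
qed auto

lemma weak_eq_u_iff:
 assumes v: "c.energy v v_t v_g" "!!z. z : Q ==> v z = w (F z)"
  and zeta: "c.energy zeta zeta_t zeta_g" "!!z. z : Q ==> zeta z = eta (F z)" and f: "L2_on CY f"
 shows "weak_eq_u f w eta <-> weak_form_u f v_t v_g zeta zeta_t zeta_g = 0"
proof -
 have "weak_form_u f v_t v_g zeta zeta_t zeta_g = int_on CY
   (%x. - (push_dt v_t v_g x * push_dt zeta_t zeta_g x) + push_grad v_g x <.> push_grad zeta_g x - f x * eta x)"
  unfolding weak_form_u_def integrand_u_def[abs_def] using zeta(2)[OF G_in_Q] F_G by (intro integral_cong) auto
 thus ?thesis
  using weak_eq_u_iff_integral[OF push_energy_cong[where w = w, OF v] push_energy_cong[where w = eta, OF zeta] f] by simp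
qed

lemma weak_eq_v_iff:
 assumes v: "c.energy v v_t v_g" and w: "c.energy w w_t w_g" and f: "L2_on CY f" and xi: "!!z. z : Q ==> xi z = J_ext z * w z"
 shows "weak_eq_v f v xi <-> weak_form_v f v_t v_g w w_t w_g = 0"
proof -
 note v' = c.energyD[OF v] and int = weak_form_v_integrable[OF v w f] and J_zeta = energy_J_mult[OF w]
 have xi_ae: "AE z in leb Q. J_ext z * w z = xi z" using xi by (simp add: c.AE_cyl_iff)
 have xi_energy: "c.energy xi (J_dt w w_t) (J_grad w w_g)" by (rule c.energy_cong_AE[OF J_zeta xi_ae]) auto
 have xi_slice: "AE t in leb {0<..<T}. AE y in leb Om0. xi (t, y) = J_ext (t, y) * w (t, y)"
  by (rule c.AE_slice) (use xi_ae in "auto elim: eventually_mono")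
 note v_grad = c.wgrad_energy[OF v] and xi_grad = c.wgrad_energy[OF xi_energy]
  and v_dt = c.AE_slice[OF c.tderiv_energy(2)[OF v]] and xi_dt = c.AE_slice[OF c.tderiv_energy(2)[OF xi_energy]]
 have "AE t in leb {0<..<T}. AE y in leb Om0. (B (t, y) *v wgrad Om0 (slice v t) y) <.> wgrad Om0 (slice xi t) y =
   (B (t, y) *v v_g (t, y)) <.> J_grad w w_g (t, y)" using v_grad xi_grad
 proof eventually_elim
  case (elim t)
  thus ?case by eventually_elim simp
 qed
 note B_term = c.tint_inner[OF this int(2)]
 have "AE t in leb {0<..<T}. AE y in leb Om0. (a (t, y) <.> wgrad Om0 (slice v t) y) * xi (t, y) =
   (a (t, y) <.> v_g (t, y)) * (J_ext (t, y) * w (t, y))" using v_grad xi_slice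
 proof eventually_elim
  case (elim t)
  thus ?case by eventually_elim simp
 qed
 note a_term = c.tint_inner[OF this int(3)]
 have "tint T (%t. l2ip Om0 (slice (tderiv T (%_. Om0) v) t) (slice (tderiv T (%_. Om0) xi) t)) =
   ip Q v_t (J_dt w w_t)" using v_dt xi_dt by (intro c.tint_l2ip v' c.energyD[OF J_zeta]) (auto simp: slice_def)
 moreover have "tint T (%t. l2ip Om0 (slice (tderiv T (%_. Om0) v) t) (wdiv Om0 (%y. xi (t, y) *R b (t, y)))) =
   ip Q v_t (div_Jb w w_g)" using v_dt wdiv_b_eq[OF w xi] by (intro c.tint_l2ip v' L2_on_div_Jb[OF w]) (auto simp: slice_def)
 moreover have "tint T (%t. l2ip Om0 (slice (%z. f (F z)) t) (slice xi t)) = ip Q (%z. f (F z)) (%z. J_ext z * w z)"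
  using xi_slice by (intro c.tint_l2ip fl.st.L2_on_comp[OF f] c.energyD[OF J_zeta]) (auto simp: slice_def)
 ultimately show ?thesis unfolding weak_eq_v_def B_term a_term weak_form_v_def integrand_v_def[abs_def] using int by auto
qed

theorem weak_equations_iff:
 assumes v: "c.energy v v_t v_g" "!!z. z : Q ==> v z = w (F z)" and f: "L2_on CY f"
 shows "(ALL eta. admissible T \<Omega> eta --> weak_eq_u f w eta) <-> (ALL xi. admissible T (%_. Om0) xi --> weak_eq_v f v xi)"
proof (intro iffI allI impI)
 fix xi assume eq: "ALL eta. admissible T \<Omega> eta --> weak_eq_u f w eta" and adm: "admissible T (%_. Om0) xi"
 obtain xi_t xi_g where xi: "c.energy xi xi_t xi_g" "vanish_ends T (%_. Om0) xi" using adm unfolding c.admissible_iff by blast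
 let ?zeta = "%z. Jinv_ext z * xi z"
 note zeta = energy_lipschitz_mult[OF Jinv_ext(1) xi(1)]
 have vanish: "vanish_ends T (%_. Om0) ?zeta"
  using Jinv_ext(1) c.vanish_ends_lipschitz_mult[OF _ c.energyD(1)[OF xi(1)] xi(2)] by blast
 have "weak_eq_u f w (%x. ?zeta (G x))"
  using eq push_energy[OF zeta] rf.vanish_ends_comp[OF c.energyD(1)[OF zeta] vanish] unfolding u.admissible_iff by blast
 hence "weak_form_v f v_t v_g ?zeta (%z. Jinv_ext z * xi_t z + pd Jinv_ext (1, 0) z * xi z)
   (%z. Jinv_ext z *R xi_g z + xi z *R (\<chi> i. pd Jinv_ext (0, axis i 1) z)) = 0"
  using weak_eq_u_iff[where w = w, OF v zeta _ f, of "%x. ?zeta (G x)"] weak_forms_eq[OF v(1) zeta f vanish]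
  by (simp add: fl.flow_inverse(1))
 thus "weak_eq_v f v xi" by (subst weak_eq_v_iff[OF v(1) zeta f]) (simp_all add: J_ext_eq Jinv_ext(2) J_nonzero)
next
 fix eta assume eq: "ALL xi. admissible T (%_. Om0) xi --> weak_eq_v f v xi" and adm: "admissible T \<Omega> eta"
 obtain eta_t eta_g where eta: "u.energy eta eta_t eta_g" "vanish_ends T \<Omega> eta"
  using adm unfolding u.admissible_iff by blast
 note zeta = fl.energy_comp[OF eta(1)]
 note vanish = fl.vanish_ends_comp[OF u.energyD(1)[OF eta(1)] eta(2)]
 have "vanish_ends T (%_. Om0) (%z. J_ext z * eta (F z))"
  using J_ext(1) c.vanish_ends_lipschitz_mult[OF _ c.energyD(1)[OF zeta] vanish] by blast
 hence "weak_eq_v f v (%z. J_ext z * eta (F z))" using eq energy_J_mult[OF zeta] unfolding c.admissible_iff by blast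
 thus "weak_eq_u f w eta"
  using weak_eq_v_iff[OF v(1) zeta f] weak_forms_eq[OF v(1) zeta f vanish] weak_eq_u_iff[where w = w, OF v zeta _ f, of eta]
  by simp
qed

lemma energy_iff:
 assumes "!!z. z : Q ==> v z = w (F z)"
 shows "(EX w_t w_g. u.energy w w_t w_g) <-> (EX v_t v_g. c.energy v v_t v_g)"
proof
 assume "EX w_t w_g. u.energy w w_t w_g"
 then obtain w_t w_g where w: "u.energy w w_t w_g" by blast
 have "AE z in leb Q. w (F z) = v z" using assms by (simp add: c.AE_cyl_iff)
 from c.energy_cong_AE[OF fl.energy_comp[OF w] this AE_I2[OF refl] AE_I2[OF refl]] show "EX v_t v_g. c.energy v v_t v_g" by blast
next
 assume "EX v_t v_g. c.energy v v_t v_g"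
 thus "EX w_t w_g. u.energy w w_t w_g" using push_energy_cong[where w = w] assms by blast
qed

end

lemma negligible_graph:
 fixes gam :: "real^'n => real"
 assumes lip: "!!x y. abs (gam x - gam y) <= L * norm (x - y)"
  and indep: "!!x. gam x = gam (\<chi> i. if i = k then 0 else x $ i)"
 shows "negligible {w. w $ k = gam w}"
proof -
 define g where "g w = w + gam w *R axis k 1" for w :: "real^'n"
 have "norm (g y - g x) <= (1 + L) * norm (y - x)" for x y
 proof -
  have "norm (g y - g x) = norm ((y - x) + (gam y - gam x) *R axis k 1)" by (simp add: g_def algebra_simps)
  also have "... <= norm (y - x) + abs (gam y - gam x)" using norm_triangle_ineq[of "y - x" "(gam y - gam x) *R axis k 1"] by simp
  finally show ?thesis using lip[of y x] by (simp add: distrib_right)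
 qed
 hence "negligible (g ` {w. w $ k = 0})"
  by (intro negligible_locally_Lipschitz_image negligible_standard_hyperplane_cart) (auto intro!: exI[of _ UNIV])
 moreover have "{w. w $ k = gam w} <= g ` {w. w $ k = 0}"
 proof
  fix w assume w: "w : {w. w $ k = gam w}"
  let ?w = "\<chi> i. if i = k then 0 else w $ i"
  have "w = g ?w" using indep[of w] w by (simp add: g_def vec_eq_iff axis_def)
  thus "w : g ` {w. w $ k = 0}" by (intro image_eqI[of _ _ ?w]) auto
 qed
 ultimately show ?thesis by (rule negligible_subset)
qed

lemma negligible_lipschitz_frontier:
 assumes "lipschitz_boundary S"
 shows "negligible (frontier S)" unfolding locally_negligible_alt[of "frontier S"]
proof
 fix p assume p: "p : frontier S"
 obtain r R k gam L where r: "r > 0" and R: "orthogonal_matrix R" and lip: "!!x y. abs (gam x - gam y) <= L * norm (x - y)"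
  and indep: "!!x. gam x = gam (\<chi> i. if i = k then 0 else x $ i)"
  and S: "!!x. x : ball p r ==> x : S <-> (R *v x) $ k < (gam (R *v x) :: real)"
  using assms[unfolded lipschitz_boundary_def, rule_format, OF p] by blast
 interpret lipschitz_fun gam L by unfold_locales (rule lip)
 have "continuous_on UNIV (%x. R *v x)" by (intro linear_continuous_on matrix_vector_mul_bounded_linear)
 hence cont: "continuous_on UNIV (%x. gam (R *v x))" "continuous_on UNIV (%x. (R *v x) $ k)"
  by (auto intro: continuous_on_compose2[OF continuous] continuous_on_component)
 note open_sides = open_Collect_less[OF cont(2,1)] open_Collect_less[OF cont]
 have "(R *v x) $ k = gam (R *v x)" if x: "x : frontier S" "x : ball p r" for x
 proof (rule linorder_cases)
  assume below: "(R *v x) $ k < gam (R *v x)"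
  have "x : interior S"
   by (rule interiorI[of "{x. (R *v x) $ k < gam (R *v x)} \<inter> ball p r"]) (use open_sides below x S in auto)
  thus ?thesis using x by (simp add: frontier_def)
 next
  assume above: "gam (R *v x) < (R *v x) $ k"
  have "{x. gam (R *v x) < (R *v x) $ k} \<inter> ball p r \<inter> S = {}" using S by fastforce
  hence "{x. gam (R *v x) < (R *v x) $ k} \<inter> ball p r \<inter> closure S = {}"
   using open_Int_closure_eq_empty[OF open_Int[OF open_sides(2) open_ball]] by blast
  thus ?thesis using x above by (auto simp: frontier_def)
 qed
 moreover have inverse: "transpose R *v (R *v x) = x" for x using R by (simp add: matrix_vector_mul_assoc orthogonal_matrix_def)
 ultimately have "frontier S \<inter> ball p r <= (%w. transpose R *v w) ` {w. w $ k = gam w}"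
  by (intro subsetI, subst inverse[symmetric]) (rule imageI, auto)
 moreover have "negligible ((%w. transpose R *v w) ` {w. w $ k = gam w})"
  by (intro negligible_differentiable_image_negligible negligible_graph[OF lip indep]
   bounded_linear_imp_differentiable_on matrix_vector_mul_bounded_linear) simp
 ultimately have "negligible (frontier S \<inter> ball p r)" using negligible_subset by blast
 thus "EX U. openin (top_of_set (frontier S)) U & p : U & negligible U"
  using p r by (intro exI[of _ "frontier S \<inter> ball p r"]) (auto intro: openin_open_Int)
qed

lemma negligible_UNIV_Times:
 assumes "closed N" "negligible N"
 shows "negligible ((UNIV :: 'a::euclidean_space set) \<times> N)"
proof -
 have "N : null_sets lborel" using assms by (simp add: negligible_iff_null_sets null_sets_completion_iff borel_closed)
 hence "UNIV \<times> N : null_sets (lborel \<Otimes>\<^sub>M lborel :: ('a * 'b) measure)"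
  by (intro lborel.times_in_null_sets2) auto
 thus ?thesis by (simp add: negligible_iff_null_sets lborel_prod null_sets_completionI)
qed

lemma int_on_test_fun_superset:
 assumes "test_fun S phi" "S : sets lebesgue" "S' : sets lebesgue" "S <= S'"
 shows "ip S h phi = ip S' h phi"
proof -
 obtain K where "K <= S" "!!x. x ~: K ==> phi x = 0" by (rule test_fun_supportE[OF assms(1)]) blast
 thus ?thesis using assms by (intro int_on_superset) auto
qed

context moving_domain
begin

lemma energy_test_fun: "test_fun cyl psi ==> energy psi (pd psi (1, 0)) (%z. \<chi> i. pd psi (0, axis i 1) z)"
 by (rule energy_C1[OF test_fun_C1 test_fun_slice])

lemma vanish_ends_test_fun:
 assumes "test_fun cyl psi"
 shows "vanish_ends T \<Omega> psi"
proof -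
 obtain r where "r > 0" "!!z. fst z <= r | T - r <= fst z ==> psi z = 0" by (rule test_fun_time_marginE[OF assms]) blast
 thus ?thesis unfolding vanish_ends_def by (intro allI impI exI[of _ r]) (auto simp: l2norm_def slice_def)
qed

lemma admissible_test_fun: "test_fun cyl psi ==> admissible T \<Omega> psi"
 unfolding admissible_iff using energy_test_fun vanish_ends_test_fun by blast

lemma energy_unique:
 assumes "energy u w g" "energy u' w' g'" "AE z in leb cyl. u z = u' z"
 shows "AE z in leb cyl. w z = w' z" "AE z in leb cyl. g z = g' z"
proof -
 have u: "energy u' w g" by (rule energy_cong_AE[OF assms(1,3)]) auto
 note unique = weak_deriv_unique[OF open_cyl bounded_cyl]
 show "AE z in leb cyl. w z = w' z"
  by (rule unique[OF energyD(2)[OF u] energyD(2)[OF assms(2)] energyD(4)[OF u] energyD(4)[OF assms(2)]])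
 have "AE z in leb cyl. g z $ i = g' z $ i" for i
  by (rule unique[OF energyD(3)[OF u] energyD(3)[OF assms(2)] energy_weak_space_deriv[OF u] energy_weak_space_deriv[OF assms(2)]])
 hence "AE z in leb cyl. ALL i. g z $ i = g' z $ i" unfolding AE_all_countable by blast
 thus "AE z in leb cyl. g z = g' z" by eventually_elim (simp add: vec_eq_iff)
qed

end

context cylinder
begin

lemma gradient_weak_time_eq:
 assumes v: "energy v v_t v_g"
 shows "weak_time_eq (%z. v_g z $ i) (%k z. if k = Some i then - v_t z else 0)" unfolding weak_time_eq_def
proof (intro allI impI)
 fix psi assume psi: "test_fun cyl psi"
 note psi_energy = energy_test_fun[OF psi]
 have "L1_on cyl (%z. v_g z $ i * pd psi (1, 0) z)" "L1_on cyl (%z. v_t z * pd psi (0, axis i 1) z)"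
  using L2_mult[OF energyD(3)[OF v] energyD(2)[OF psi_energy]] L2_mult[OF energyD(2)[OF v] energyD(3)[OF psi_energy]] by simp_all
 hence "ip cyl (%z. v_g z $ i) (pd psi (1, 0)) = ip cyl v_t (space_jet psi (Some i))"
  using energy_commutator[OF v psi_energy vanish_ends_test_fun[OF psi], of i] by simp
 also have "... = - (SUM k:UNIV. if k = Some i then - ip cyl v_t (space_jet psi k) else 0)" by (simp add: sum.delta)
 also have "... = - (SUM k:UNIV. ip cyl (%z. if k = Some i then - v_t z else 0) (space_jet psi k))"
  by (intro arg_cong[of _ _ uminus] sum.cong) simp_all
 finally show "ip cyl (%z. v_g z $ i) (pd psi (1, 0)) =
  - (SUM k:UNIV. ip cyl (%z. if k = Some i then - v_t z else 0) (space_jet psi k))" .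
qed

lemma gradient_pairing_tendsto:
 assumes v: "energy v v_t v_g" and cont: "L2_cont T S v u0" and u0: "H10_grad S u0 G0" and n: "H1_grad S n N"
 shows "((%t. ip S (%x. v_g (t, x) $ i) n) ---> ip S (%x. G0 x $ i) n) ess_at_0"
proof -
 have "AE t in leb ivl. - ip S (sect v t) (%x. N x $ i) = ip S (%x. v_g (t, x) $ i) n"
  using energyD(5)[OF v] by eventually_elim (simp add: H10_integration_by_parts[OF open_S bounded_S _ n])
 note eventually_ess_at_0_if_AE[OF T_pos this]
 moreover note tendsto_minus[OF L2_cont_imp_pairing_tendsto[OF cont H1_gradD(2)[OF open_S n]], of i]
 ultimately have "((%t. ip S (%x. v_g (t, x) $ i) n) ---> - ip S u0 (%x. N x $ i)) ess_at_0"
  by (rule Lim_transform_eventually[rotated])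
 thus ?thesis by (simp add: H10_integration_by_parts[OF open_S bounded_S u0 n])
qed

lemma pairing_tendsto_iff:
 assumes w: "L2_on cyl w" "!!k. L2_on cyl (r k)" "weak_time_eq w r"
  and n: "eventually (%t. H10_grad S (n t) (G t) & (ALL k. sqnorm S (weak_jet (n t) (G t) k) <= C)) ess_at_0"
  and n0: "H10_grad S n0 G0" and lim: "((%t. sqnorm S (%x. n t x - n0 x)) ---> 0) ess_at_0"
 shows "((%t. ip S (sect w t) (n t)) ---> l) ess_at_0 <-> ((%t. ip S (sect w t) n0) ---> l) ess_at_0"
proof -
 obtain s where s: "s : ivl" "L2_on S (sect w s)" and rep: "AE t in leb ivl. ALL phi. test_fun S phi -->
   ip S (sect w t) phi = (SUM k:UNIV. ip S (time_rep w r s t k) (jet phi k))" using time_repE[OF w] by blast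
 note rep_L2 = L2_on_time_rep[OF w(2) s]
 have "AE t in leb ivl. L2_on S (sect w t) & (ALL k. L2_on S (time_rep w r s t k)) & (ALL phi. test_fun S phi -->
   ip S (sect w t) phi = (SUM k:UNIV. ip S (time_rep w r s t k) (jet phi k)))"
  using rep L2_on_slices(1)[OF w(1)] AE_in_ivl by eventually_elim (simp add: rep_L2)
 note pairing = pairing_tendsto[OF open_S bounded_S rep_L2 eventually_ess_at_0_if_AE[OF T_pos this] time_rep_tendsto[OF w(2)]]
 let ?l = "SUM k:UNIV. ip S (time_rep w r s 0 k) (weak_jet n0 G0 k)"
 have "sqnorm S (weak_jet n0 G0 k) <= (SUM k:UNIV. sqnorm S (weak_jet n0 G0 k))" for k by (rule member_le_sum) auto
 hence "eventually (%t. H10_grad S n0 G0 & (ALL k. sqnorm S (weak_jet n0 G0 k) <=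
   (SUM k:UNIV. sqnorm S (weak_jet n0 G0 k)))) ess_at_0" using n0 by simp
 hence const: "((%t. ip S (sect w t) n0) ---> ?l) ess_at_0"
  using T_pos by (intro pairing[where n = "%_. n0" and G = "%_. G0", OF _ _ H10_grad_H1[OF n0]]) auto
 have "((%t. ip S (sect w t) (n t)) ---> ?l) ess_at_0" using T_pos by (intro pairing[OF _ n H10_grad_H1[OF n0] lim]) auto
 note unique = tendsto_unique[OF ess_at_0_neq_bot this] tendsto_unique[OF ess_at_0_neq_bot const]
 show ?thesis using const \<open>((%t. ip S (sect w t) (n t)) ---> ?l) ess_at_0\<close> unique by fast
qed

end

context flow
begin

lemma Phi_displacement:
 assumes z: "z : D"
 shows "norm (\<Phi> z - snd z) <= flow_bound * fst z"
proof -
 obtain t y where ty: "z = (t, y)" "0 <= t" "t <= T" "y : closure Om0" using z by (auto simp: domPhi_def)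
 let ?X = "{0..T} \<times> {y}"
 have X: "?X <= D" using ty by (auto simp: domPhi_def)
 have "norm (\<Phi> (t, y) - \<Phi> (0, y)) <= flow_bound * norm ((t, y) - (0, y))"
 proof (rule differentiable_bound[of ?X \<Phi> d\<Phi>])
  show "convex ?X" by (intro convex_Times) auto
  show "(\<Phi> has_derivative d\<Phi> x) (at x within ?X)" "onorm (d\<Phi> x) <= flow_bound" if "x : ?X" for x
   using has_derivative_subset[OF Phi_has_derivative X] onorm_bound[OF C11_boundD(1,2)[OF flow_bound(1)]] that X by auto
 qed (use ty T_pos in auto)
 thus ?thesis using Phi_0 ty by (simp add: norm_Pair)
qed

text \<open>By Brouwer's theorem, a point well inside \<open>Om0\<close> stays in \<open>\<Omega> t\<close> for small \<open>t\<close>.\<close>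

lemma in_domain_if_cball_subset:
 assumes t: "0 <= t" "t <= T" and r: "0 < r" "flow_bound * t <= r" and ball: "cball x r <= Om0"
 shows "x : \<Omega> t"
proof -
 let ?f = "%y. x - (\<Phi> (t, y) - y)"
 have D: "(t, y) : D" if "y : cball x r" for y
  using ball that t closure_subset[of "Om0"] by (auto simp: domPhi_def)
 have "continuous_on (cball x r) (sect \<Phi> t)"
  by (rule continuous_on_compose2[OF continuous_Phi]) (use D in "auto intro!: continuous_intros")
 hence "continuous_on (cball x r) ?f" by (intro continuous_intros)
 moreover have "?f : cball x r \<rightarrow> cball x r" using Phi_displacement[OF D] r(2) by (fastforce simp: dist_norm)
 ultimately obtain y where y: "y : cball x r" "?f y = y" by (rule brouwer_ball[OF r(1)])
 hence "x = \<Phi> (t, y)" by (simp add: algebra_simps)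
 thus ?thesis using Phi_into t ball y(1) by fastforce
qed

lemma stays_in_domain:
 assumes K: "compact K" "K <= Om0"
 obtains d S where "0 < d" "d <= T" "open S" "K <= S" "S <= Om0" "{0..d} \<times> S <= tdomain_cl T \<Omega>"
proof -
 obtain r where r: "r > 0" "!!x y. x : K ==> dist x y < r ==> y : Om0"
  using compact_in_open_margin[OF K domain_0(1)] by blast
 define S where "S = (UN x:K. ball x (r / 2))"
 define d where "d = min T (r / 3 / (flow_bound + 1))"
 note bound_nonneg = C11_boundD(1)[OF flow_bound(1)]
 have "0 < d" "d <= T" using T_pos r(1) bound_nonneg by (auto simp: d_def)
 have ball: "cball x (r / 3) <= Om0" if x: "x : S" for x
 proof
  fix y assume y: "y : cball x (r / 3)"
  obtain k where k: "k : K" "dist k x < r / 2" using x by (auto simp: S_def)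
  thus "y : Om0" using dist_triangle[of k y x] y r(1) by (intro r(2)[OF k(1)]) auto
 qed
 have "flow_bound * t <= r / 3" if "0 <= t" "t <= d" for t
 proof -
  have "flow_bound * t <= (flow_bound + 1) * (r / 3 / (flow_bound + 1))"
   using that bound_nonneg by (intro mult_mono) (auto simp: d_def)
  also have "... = r / 3" using bound_nonneg by (intro times_divide_eq_right[THEN trans] nonzero_mult_div_cancel_left) auto
  finally show ?thesis .
 qed
 hence "x : \<Omega> t" if "0 <= t" "t <= d" "x : S" for t x
  using in_domain_if_cball_subset[OF that(1) _ _ _ ball[OF that(3)]] that r(1) \<open>d <= T\<close> by simp
 hence "{0..d} \<times> S <= tdomain_cl T \<Omega>" using \<open>d <= T\<close> by (auto simp: tdomain_cl_def)
 moreover have "S <= Om0" using ball r(1) by force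
 moreover have "open S" "K <= S" using r(1) by (auto simp: S_def)
 ultimately show ?thesis using that \<open>0 < d\<close> \<open>d <= T\<close> by blast
qed

lemma J_ext_at_0: "y : Om0 ==> J_ext (0, y) = 1" using J_ext(2)[of "(0, y)"] J_at_0[of y] T_pos by (simp add: D0_def)

lemma Jb_ext_at_0:
 assumes y: "y : Om0"
 shows "Jb_ext i (0, y) = tdot D \<Phi> (0, y) $ i"
proof -
 have D0: "(0, y) : D0" using y T_pos by (simp add: D0_def)
 have id: "matrix (%h. d\<Phi> (0, y) (0, h)) = mat 1" using dPhi_at_0[OF y] matrix_id_mat_1 by (simp add: id_def)
 have "Jb_ext i (0, y) = det ((\<chi> k j. if j = i then d\<Phi> (0, y) (1, 0) $ k else (mat 1 :: real^'n^'n) $ k $ j) :: real^'n^'n)"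
  unfolding Jb_ext(2)[OF D0] cramer_b_def id ..
 also have "... = d\<Phi> (0, y) (1, 0) $ i" using cramer_lemma[of i "mat 1 :: real^'n^'n" "d\<Phi> (0, y) (1, 0)"]
  unfolding matrix_vector_mul_lid det_I mult_1_right .
 finally show ?thesis by (simp add: tdot_def)
qed

lemma AE_in_CY_if_in_E: "AE z in leb Q. z : E --> z : CY"
proof -
 let ?N = "D \<inter> UNIV \<times> frontier Om0"
 have "negligible (frontier Om0)" by (rule negligible_lipschitz_frontier) (use dom T_pos in auto)
 hence "negligible ?N" by (intro negligible_subset[OF negligible_UNIV_Times]) auto
 moreover have "F differentiable_on ?N" using Phi_has_derivative unfolding differentiable_on_def differentiable_def
  by (blast intro: has_derivative_subset has_derivative_Pair has_derivative_fst[OF has_derivative_ident])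
 ultimately have "negligible (F ` ?N)" by (intro negligible_differentiable_image_negligible) auto
 moreover have "{z. ~ (z : Q --> z : E --> z : CY)} <= F ` ?N"
 proof
  fix z assume "z : {z. ~ (z : Q --> z : E --> z : CY)}"
  hence z: "z : Q" "z : E" "z ~: CY" by auto
  have t: "fst z : {0<..<T}" using z(1) by (auto simp: tdomain_def)
  have "\<Psi> z ~: Om0"
  proof
   assume "\<Psi> z : Om0"
   hence "F (G z) : CY" using t by (intro F_in_CY) (simp add: tdomain_def)
   thus False using Phi_Psi z(2,3) by simp
  qed
  hence "G z : ?N" using Psi_range z(2) t domain_0 by (auto simp: domPhi_def frontier_def interior_open)
  moreover have "z = F (G z)" using Phi_Psi z(2) by (simp add: prod_eq_iff)
  ultimately show "z : F ` ?N" by (rule rev_image_eqI)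
 qed
 ultimately show ?thesis unfolding c.AE_cyl_iff eventually_ae_filter_negligible using negligible_subset by blast
qed

lemma energy_time_parts:
 assumes u: "u.energy u u_t u_g" and theta: "test_fun {0<..<T} theta"
 shows "int_on CY (%x. u x * pd theta 1 (fst x) + u_t x * theta (fst x)) = 0"
proof -
 note C = C1_fst[OF test_fun_C1[OF theta]]
 obtain K where K: "compact K" "K <= {0<..<T}" "!!t. t ~: K ==> theta t = 0" using test_fun_supportE[OF theta] by metis
 let ?v = "%z. u (F z)" and ?v_t = "%z. u_t (F z) + d\<Phi> z (1, 0) <.> u_g (F z)"
  and ?v_g = "%z. \<chi> i. d\<Phi> z (0, axis i 1) <.> u_g (F z)"
 note v = fl.energy_comp[OF u]
 note Jv = energy_J_mult[OF v] and Jbv = energy_Jb_mult[OF v]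
 have theta_L2: "L2_on X (%z. theta (fst z))" "L2_on X (%z. pd theta 1 (fst z))"
  if "bounded X" "X : sets lebesgue" for X :: "(real * (real^'n)) set"
  using L2_on_C1(1)[OF C(1) that] L2_on_C1(2)[OF C(1) that, of "(1, 0)"] by (simp_all add: C(2)[abs_def])
 note theta_Q = theta_L2[OF c.bounded_cyl c.cyl_lebesgue] and theta_CY = theta_L2[OF u.bounded_cyl u.cyl_lebesgue]
 have int: "L1_on CY (%x. u x * pd theta 1 (fst x))" "L1_on CY (%x. u_t x * theta (fst x))"
  by (intro L2_mult u.energyD[OF u] theta_CY)+
 have int_J: "L1_on Q (%z. J_ext z * ?v z * pd theta 1 (fst z))" "L1_on Q (%z. J_dt ?v ?v_t z * theta (fst z))"
  and int_Jb: "!!i. L1_on Q (%z. Jb_grad i ?v ?v_g z $ i * theta (fst z))"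
  by (intro L2_mult c.energyD[OF Jv] c.energyD(3)[OF Jbv] theta_Q)+
 have dPhi_inner: "d\<Phi> z (1, 0) <.> w = b z <.> (\<chi> i. d\<Phi> z (0, axis i 1) <.> w)" if "z : Q" for z w
 proof -
  note lin = fl.linear_space_deriv(1)[OF that]
  have "d\<Phi> z (0, b z) = matrix (%h. d\<Phi> z (0, h)) *v b z"
   using fun_cong[OF matrix_vector_mul(2)[OF lin]] by simp
  also have "... = (SUM i:UNIV. b z $ i *R d\<Phi> z (0, axis i 1))"
   by (simp add: vec_eq_iff matrix_vector_mult_def matrix_def mult.commute)
  finally show ?thesis by (simp add: dPhi_b[OF that] inner_sum_left inner_vec_def[of "b z"])
 qed
 have "AE z in leb Q. J z * (u (F z) * pd theta 1 (fst (F z)) + u_t (F z) * theta (fst (F z))) =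
   (J_ext z * ?v z * pd theta 1 (fst z) + J_dt ?v ?v_t z * theta (fst z)) - (SUM i:UNIV. Jb_grad i ?v ?v_g z $ i * theta (fst z))"
  using Euler_identity unfolding c.AE_cyl_iff
 proof eventually_elim
  case (elim z)
  show ?case
  proof
   assume z: "z : Q"
   show "J z * (u (F z) * pd theta 1 (fst (F z)) + u_t (F z) * theta (fst (F z))) =
     (J_ext z * ?v z * pd theta 1 (fst z) + J_dt ?v ?v_t z * theta (fst z)) - (SUM i:UNIV. Jb_grad i ?v ?v_g z $ i * theta (fst z))"
    unfolding sum_distrib_right[symmetric] div_Jb_def[symmetric] div_Jb_eq[OF z mp[OF elim z]] J_dt_def J_ext_eq[OF z]
     dPhi_inner[OF z] by (simp add: algebra_simps)
  qed
 qed
 note pointwise = int_on_cong_AE[OF c.cyl_lebesgue this]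
 have "ip Q (%z. Jb_grad i ?v ?v_g z $ i) (%z. theta (fst z)) = 0" for i
  using c.energy_space_parts_C1[OF Jbv C(1), of i i] by (simp add: C(2) pd_0[OF test_fun_C1[OF theta]])
 moreover have "ip Q (%z. J_ext z * ?v z) (%z. pd theta 1 (fst z)) = - ip Q (J_dt ?v ?v_t) (%z. theta (fst z))"
  using c.energy_time_parts[OF Jv C(1) K(1,2)] K(3) by (simp add: C(2))
 ultimately show ?thesis using change_of_variables_cyl(2)[OF integrable_add[OF int]] int_J int_Jb
  by (simp only: pointwise) simp
qed

lemma int_energy_time_deriv:
 assumes u: "u.energy u u_t u_g" and psi: "test_fun Q psi"
 shows "int_on CY (%z. psi z * u_t z + pd psi (1, 0) z * u z) = 0"
proof -
 obtain L where L: "lipschitz_fun psi L" by (rule test_fun_lipschitzE[OF psi])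
 obtain r where r: "r > 0" "!!z. fst z <= r | T - r <= fst z ==> psi z = 0"
  "!!z e. fst z <= r | T - r <= fst z ==> pd psi e z = 0" by (rule c.test_fun_time_marginE[OF psi]) blast
 obtain k where "1 / real (Suc k) * 2 < r"
  using eventually_happens[OF eventually_one_over_Suc_less[OF r(1)]] by auto
 hence k: "2 / Suc k < r" by simp
 have "psi z * u z * pd (time_cutoff T k) 1 (fst z) + (psi z * u_t z + pd psi (1, 0) z * u z) * time_cutoff T k (fst z) =
   psi z * u_t z + pd psi (1, 0) z * u z" for z
  using r(2,3)[of z] pd_time_cutoff_zero[of k "fst z" T] time_cutoff_eq_1[of k "fst z" T] k
  by (cases "fst z <= r | T - r <= fst z") auto
 thus ?thesis using energy_time_parts[OF u.energy_lipschitz_mult[OF L u] test_fun_time_cutoff, of k] by simp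
qed

lemma position_weak_time_eq:
 assumes u: "u.energy u u_t u_g" and zero: "!!z. z ~: E ==> u z = 0"
 shows "L2_on Q u" "L2_on Q (%z. indicator CY z * u_t z)" "c.weak_time_eq u (c.scalar_flux (%z. indicator CY z * u_t z))"
proof -
 have ext_L2: "L2_on Q (%z. indicator CY z * h z)" if "L2_on CY h" for h :: "real * (real^'n) => real"
  using that[folded L2_iff[OF u.cyl_lebesgue]] by (intro L2_on_subset[OF _ c.cyl_lebesgue subset_UNIV])
   (simp_all add: lebesgue_on_UNIV_eq sq_integrable_def L2_def)
 have ext: "AE z in leb Q. indicator CY z * u z = u z"
  using AE_in_CY_if_in_E by eventually_elim (use zero in "auto simp: indicator_def")
 show "L2_on Q u" using ext_L2[OF u.energyD(1)[OF u]] by (simp only: L2_on_cong_AE[OF c.cyl_lebesgue ext])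
 show "L2_on Q (%z. indicator CY z * u_t z)" by (rule ext_L2[OF u.energyD(2)[OF u]])
 show "c.weak_time_eq u (c.scalar_flux (%z. indicator CY z * u_t z))" unfolding c.weak_time_eq_def
 proof (intro allI impI)
  fix psi assume psi: "test_fun Q psi"
  obtain K where K: "K <= Q" "!!z. z ~: K ==> psi z = 0" "!!z e. z ~: K ==> pd psi e z = 0"
   by (rule test_fun_supportE[OF psi]) blast
  have swap: "ip Q (%z. indicator CY z * h z) g = ip CY g h" if "!!z. z ~: K ==> g z = 0" for h g
  proof -
   have "indicator Q z * (indicator CY z * h z * g z) = indicator CY z * (g z * h z)" for z
    using that[of z] K(1) by (cases "z : K") (auto simp: indicator_def)
   thus ?thesis by (simp only: int_indicator[OF c.cyl_lebesgue, symmetric] int_indicator[OF u.cyl_lebesgue, symmetric])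
  qed
  obtain L where "lipschitz_fun psi L" by (rule test_fun_lipschitzE[OF psi])
  note L2 = lipschitz_fun.L2_on_mult[OF this u.cyl_lebesgue u.bounded_cyl]
  have "ip Q u (pd psi (1, 0)) = ip Q (%z. indicator CY z * u z) (pd psi (1, 0))"
   by (rule int_on_cong_AE[OF c.cyl_lebesgue]) (use ext in eventually_elim, simp)
  also have "... = ip CY (pd psi (1, 0)) u" by (rule swap[OF K(3)])
  also have "... = - ip CY psi u_t"
   using int_energy_time_deriv[OF u psi] L1_on_if_L2_on[OF u.cyl_lebesgue u.bounded_cyl L2(1)[OF u.energyD(2)[OF u]]]
    L1_on_if_L2_on[OF u.cyl_lebesgue u.bounded_cyl L2(2)[OF u.energyD(1)[OF u]]] by simp
  finally show "ip Q u (pd psi (1, 0)) =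
    - (SUM k:UNIV. ip Q (%z. c.scalar_flux (%z. indicator CY z * u_t z) k z) (space_jet psi k))"
   by (simp add: sum_option swap[OF K(2)])
 qed
qed

definition "div_b z = (SUM i:UNIV. Jb_ext i z * pd Jinv_ext (0, axis i 1) z + Jinv_ext z * pd (Jb_ext i) (0, axis i 1) z)"

definition "flux_v f v_t v_g k z = (case k of None => f (F z) - a z <.> v_g z - 2 * (div_b z * v_t z)
 | Some i => - (B z *v v_g z) $ i - 2 * (b z $ i * v_t z))"

definition "flux_u f u_g k z = (case k of None => f z | Some i => - u_g z $ i)"

lemma L2_on_flux_v:
 assumes v: "c.energy v v_t v_g" and f: "L2_on CY f"
 shows "L2_on Q (flux_v f v_t v_g k)"
proof (cases k)
 case None
 show ?thesis unfolding flux_v_def None option.case div_b_def sum_distrib_right distrib_right mult.assoc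
  by (intro L2_diff L2_cmult L2_sum L2_add L2_on_lipschitz_mult Jinv_ext(1) Jb_ext(1) L2_on_a_inner
   fl.st.L2_on_comp[OF f] c.energyD[OF v])
next
 case (Some i)
 show ?thesis
  unfolding flux_v_def Some option.case by (intro L2_diff L2_minus L2_cmult L2_on_B_mult L2_on_b_mult c.energyD[OF v])
qed

lemma L2_on_flux_u: "u.energy u u_t u_g ==> L2_on CY f ==> L2_on CY (flux_u f u_g k)"
 unfolding flux_u_def[abs_def] by (cases k) (auto intro: L2_minus u.energyD)

lemma div_Jb_Jinv:
 assumes "z : Q"
 shows "div_Jb (%z. Jinv_ext z * psi z) (%z. Jinv_ext z *R g z + psi z *R (\<chi> i. pd Jinv_ext (0, axis i 1) z)) z =
  b z <.> g z + div_b z * psi z"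
proof -
 have b: "b z $ i = Jb_ext i z * Jinv_ext z" for i by (simp add: Jb_ext_eq Jinv_ext(2) J_nonzero assms)
 show ?thesis unfolding div_Jb_def Jb_grad_def div_b_def inner_vec_def[of "b z"] b sum_distrib_right sum.distrib[symmetric]
  by (intro sum.cong) (simp_all add: algebra_simps)
qed

lemma sum_flux_v: "(SUM k:UNIV. flux_v f v_t v_g k z * space_jet psi k z) =
  (f (F z) - a z <.> v_g z - 2 * (div_b z * v_t z)) * psi z - (B z *v v_g z) <.> (\<chi> i. pd psi (0, axis i 1) z)
   - 2 * (v_t z * (b z <.> (\<chi> i. pd psi (0, axis i 1) z)))"
 by (simp add: sum_option flux_v_def inner_vec_def sum_subtractf sum_negf sum_distrib_left algebra_simps)

lemma velocity_v_weak_time_eq: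
 assumes v: "c.energy v v_t v_g" and f: "L2_on CY f" and eq: "ALL xi. admissible T (%_. Om0) xi --> weak_eq_v f v xi"
 shows "c.weak_time_eq v_t (flux_v f v_t v_g)" unfolding c.weak_time_eq_def
proof (intro allI impI)
 fix psi assume psi: "test_fun Q psi"
 let ?g = "%z. \<chi> i. pd psi (0, axis i 1) z"
 note psi_energy = c.energy_test_fun[OF psi]
 note w = energy_lipschitz_mult[OF Jinv_ext(1) psi_energy]
 let ?w = "%z. Jinv_ext z * psi z" and ?w_t = "%z. Jinv_ext z * pd psi (1, 0) z + pd Jinv_ext (1, 0) z * psi z"
  and ?w_g = "%z. Jinv_ext z *R ?g z + psi z *R (\<chi> i. pd Jinv_ext (0, axis i 1) z)"
 have J_zeta: "J_ext z * ?w z = psi z" if "z : Q" for z by (simp add: J_ext_eq Jinv_ext(2) J_nonzero that)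
 hence "weak_form_v f v_t v_g ?w ?w_t ?w_g = 0"
  using eq c.admissible_test_fun[OF psi] weak_eq_v_iff[OF v w f, of psi] by simp
 moreover have "AE z in leb Q. J_ext z * ?w z = psi z" using J_zeta by (simp add: c.AE_cyl_iff)
 note c.energy_unique[OF energy_J_mult[OF w] psi_energy this]
 hence "AE z in leb Q. integrand_v f v_t v_g ?w ?w_t ?w_g z =
   - (v_t z * pd psi (1, 0) z + (SUM k:UNIV. flux_v f v_t v_g k z * space_jet psi k z))"
  unfolding c.AE_cyl_iff
 proof eventually_elim
  case (elim z)
  show ?case
  proof
   assume z: "z : Q"
   show "integrand_v f v_t v_g ?w ?w_t ?w_g z =
     - (v_t z * pd psi (1, 0) z + (SUM k:UNIV. flux_v f v_t v_g k z * space_jet psi k z))"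
    unfolding integrand_v_def sum_flux_v J_zeta[OF z] div_Jb_Jinv[OF z] mp[OF elim(1) z] mp[OF elim(2) z]
    by (simp add: algebra_simps)
  qed
 qed
 note integral = int_on_cong_AE[OF c.cyl_lebesgue this]
 have "L1_on Q (%z. v_t z * pd psi (1, 0) z)" "L1_on Q (%z. flux_v f v_t v_g k z * space_jet psi k z)" for k
  by (intro L2_mult c.energyD[OF v] L2_on_flux_v[OF v f] pd_test_fun_L2_on[OF psi] Cc_L2_on[OF space_jet_Cc[OF psi]]
   c.cyl_lebesgue)+
 ultimately show "ip Q v_t (pd psi (1, 0)) = - (SUM k:UNIV. ip Q (flux_v f v_t v_g k) (space_jet psi k))"
  by (simp add: weak_form_v_def integral)
qed

end

locale fixed_region = flow T \<Omega> \<Phi> \<Psi> for T and \<Omega> :: "real => (real^'n) set" and \<Phi> \<Psi> +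
 fixes d :: real and S :: "(real^'n) set"
 assumes d: "0 < d" "d <= T" and open_S: "open S" and S_subset: "S <= Om0" "!!t. t : {0<..<d} ==> S <= \<Omega> t"
begin

sublocale r: cylinder d S using d open_S S_subset(1) domain_0(2) by unfold_locales (auto intro: bounded_subset)

lemma region_subset_CY: "r.cyl <= CY" using S_subset(2) d by (force simp: tdomain_def)

lemma pairing_transport:
 assumes h: "L2_on CY h" and phi: "test_fun S phi"
 shows "AE t in leb {0<..<d}. ip S (sect h t) phi =
  ip Om0 (%y. h (F (t, y))) (%y. J_ext (t, y) * phi (\<Phi> (t, y)))"
proof -
 have "AE t in leb {0<..<d}. L2_on (\<Omega> t) (sect h t)"
  using u.L2_on_slices(1)[OF h] d(2) by (auto simp: AE_on_iff elim!: eventually_mono)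
 thus ?thesis using r.AE_in_ivl
 proof eventually_elim
  case (elim t)
  hence t: "t : {0<..<T}" using d(2) by auto
  have phi_L2: "L2_on (\<Omega> t) phi" by (rule test_fun_L2_on[OF phi u.lebesgue_slice[OF t]])
  have "ip S (sect h t) phi = ip (\<Omega> t) (sect h t) phi"
   by (rule int_on_test_fun_superset[OF phi r.lebesgue_S u.lebesgue_slice[OF t] S_subset(2)[OF elim(2)]])
  also have "... = ip Om0 (%y. abs (J (t, y))) (%y. h (t, \<Phi> (t, y)) * phi (\<Phi> (t, y)))"
   by (rule diffeo_change_of_variables(2)[OF fl.slice_diffeo[OF t] L2_mult[OF elim(1) phi_L2], symmetric])
  also have "... = ip Om0 (%y. h (F (t, y))) (%y. J_ext (t, y) * phi (\<Phi> (t, y)))"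
   using fl.slice_in(1)[OF t] by (intro integral_cong) (auto simp: abs_J J_ext_eq)
  finally show ?case .
 qed
qed

definition "transported_grad m phi t y =
 m (t, y) *R pull_grad (sect \<Phi> t) (%y h. d\<Phi> (t, y) (0, h)) (cgrad phi) y + phi (\<Phi> (t, y)) *R cgrad (sect m t) y"

abbreviation "transported m phi t == %y. m (t, y) * phi (\<Phi> (t, y))"

abbreviation "transported_jet m phi t == weak_jet (transported m phi t) (transported_grad m phi t)"

lemma H10_grad_transported:
 assumes m: "lipschitz_fun m L" and phi: "test_fun S phi" and t: "t : {0<..<d}"
 shows "H10_grad Om0 (transported m phi t) (transported_grad m phi t)"
proof -
 have t': "t : {0<..<T}" using t d(2) by auto
 have "H10_grad (\<Omega> t) phi (cgrad phi)"
  by (rule H10_grad_test_fun[OF u.open_slice[OF t'] u.bounded_slice[OF t'] test_fun_mono[OF phi S_subset(2)[OF t]]])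
 from H10_grad_lipschitz_mult[OF domain_0 lipschitz_slice[OF m] vec_diffeo.H10_grad_comp[OF fl.slice_vec_diffeo[OF t'] this]]
 show ?thesis unfolding transported_grad_def[abs_def] .
qed

lemma test_fun_jet_boundE:
 assumes "test_fun S phi"
 obtains H where "0 <= H" "!!x. abs (phi x) <= H" "!!x. norm (cgrad phi x) <= H"
proof -
 have "EX C > 0. ALL x. abs (jet phi k x) <= C" for k using Cc_boundE[OF jet_Cc[OF assms]] by metis
 then obtain C where C: "!!k. C k > 0" "!!k x. abs (jet phi k x) <= C k" by metis
 have nonneg: "0 <= (SUM i:UNIV. C (Some i))" using C(1) by (intro sum_nonneg less_imp_le)
 have "norm (cgrad phi x) <= C None + (SUM i:UNIV. C (Some i))" for x
  using norm_le_l1_cart[of "cgrad phi x"] sum_mono[of UNIV "%i. abs (cgrad phi x $ i)" "%i. C (Some i)"] C(1)[of None] C(2)[of "Some _" x]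
  by fastforce
 moreover have "abs (phi x) <= C None + (SUM i:UNIV. C (Some i))" for x
  using C(2)[of None x] nonneg by (simp add: add_increasing2)
 ultimately show ?thesis using that nonneg C(1)[of None] by (meson add_nonneg_nonneg less_imp_le)
qed

lemma transported_jet_le:
 assumes m: "lipschitz_fun m L" and phi: "test_fun S phi"
 obtains C where "!!t k. t : {0<..<d} ==> AE y in leb Om0. abs (transported_jet m phi t k y) <= C"
proof -
 obtain A where A: "A > 0" "!!z. z : Q ==> abs (m z) <= A" using lipschitz_fun.bounded_on[OF m c.bounded_cyl] by blast
 obtain H where H: "0 <= H" "!!x. abs (phi x) <= H" "!!x. norm (cgrad phi x) <= H" by (rule test_fun_jet_boundE[OF phi]) blast
 note L = lipschitz_fun.const_nonneg[OF m] and bound_nonneg = C11_boundD(1)[OF flow_bound(1)]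
 let ?C = "A * H + (A * (flow_bound * H) + H * L)"
 have "AE y in leb Om0. abs (transported_jet m phi t k y) <= ?C" if t: "t : {0<..<d}" for t k
 proof -
  have "AE y in leb Om0. ALL i. abs (pd (sect m t) (axis i 1) y) <= L"
   unfolding AE_all_countable using lipschitz_fun.AE_on_pd_bound[OF lipschitz_slice[OF m] c.lebesgue_S, of t "axis _ 1"] by simp
  thus ?thesis unfolding AE_on_iff[OF c.lebesgue_S]
  proof (eventually_elim, intro impI)
   fix y assume pd: "y : Om0 --> (ALL i. abs (pd (sect m t) (axis i 1) y) <= L)" and y: "y : Om0"
   have z: "(t, y) : Q" using t y d(2) by (simp add: tdomain_def)
   have "abs (m (t, y) * phi (\<Phi> (t, y))) <= A * H"
    unfolding abs_mult using A(2)[OF z] A(1) H by (intro mult_mono) auto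
   moreover have "abs (d\<Phi> (t, y) (0, axis i 1) <.> cgrad phi (\<Phi> (t, y))) <= flow_bound * H" for i
    using fl.flow_deriv_bound(1)[OF z, of "(0, axis i 1)"] H bound_nonneg
    by (intro order_trans[OF Cauchy_Schwarz_ineq2 mult_mono]) (auto simp: norm_Pair)
   hence "abs (m (t, y) * (d\<Phi> (t, y) (0, axis i 1) <.> cgrad phi (\<Phi> (t, y)))) <= A * (flow_bound * H)"
    "abs (phi (\<Phi> (t, y)) * pd (sect m t) (axis i 1) y) <= H * L" for i
    unfolding abs_mult using A(2)[OF z] A(1) H L mp[OF pd y] by (intro mult_mono; simp)+
   hence "abs (m (t, y) * (d\<Phi> (t, y) (0, axis i 1) <.> cgrad phi (\<Phi> (t, y))) +
     phi (\<Phi> (t, y)) * pd (sect m t) (axis i 1) y) <= A * (flow_bound * H) + H * L" for i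
    by (intro order_trans[OF abs_triangle_ineq] add_mono)
   moreover have "0 <= A * H" "0 <= A * (flow_bound * H) + H * L" using A(1) H(1) L bound_nonneg by auto
   ultimately show "abs (transported_jet m phi t k y) <= ?C"
    by (cases k) (auto simp: transported_grad_def pull_grad_def cgrad_def[of "%y. m (t, y)"] add_increasing add_increasing2)
  qed
 qed
 thus ?thesis using that by blast
qed

lemma transport_displacementE:
 assumes m: "lipschitz_fun m L" and phi: "test_fun S phi"
 obtains C where "!!z. z : Q ==> abs (m z * phi (\<Phi> z) - m (0, snd z) * phi (snd z)) <= C * fst z"
proof -
 obtain A where A: "A > 0" "!!z. z : Q ==> abs (m z) <= A" using lipschitz_fun.bounded_on[OF m c.bounded_cyl] by blast
 obtain K where K: "lipschitz_fun phi K" using test_fun_lipschitzE[OF phi] .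
 obtain H where H: "H > 0" "!!x. abs (phi x) <= H" using Cc_boundE[OF test_fun_Cc[OF phi]] by blast
 have "abs (m z * phi (\<Phi> z) - m (0, snd z) * phi (snd z)) <= (A * (K * flow_bound) + L * H) * fst z" if z: "z : Q" for z
 proof -
  have "abs (phi (\<Phi> z) - phi (snd z)) <= K * (flow_bound * fst z)" using Phi_displacement[of z] Q_subset_D z
   by (intro order_trans[OF lipschitz_fun.lip[OF K] mult_left_mono] lipschitz_fun.const_nonneg[OF K]) auto
  moreover have "abs (m z - m (0, snd z)) <= L * fst z"
   using lipschitz_fun.lip[OF m, of z "(0, snd z)"] z by (cases z) (auto simp: norm_Pair tdomain_def)
  ultimately have "abs (m z) * abs (phi (\<Phi> z) - phi (snd z)) + abs (m z - m (0, snd z)) * abs (phi (snd z)) <=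
    A * (K * (flow_bound * fst z)) + (L * fst z) * H" using A(1) A(2)[OF z] H by (intro add_mono mult_mono) auto
  moreover have "m z * phi (\<Phi> z) - m (0, snd z) * phi (snd z) =
    m z * (phi (\<Phi> z) - phi (snd z)) + (m z - m (0, snd z)) * phi (snd z)" by (simp add: algebra_simps)
  hence "abs (m z * phi (\<Phi> z) - m (0, snd z) * phi (snd z)) <=
    abs (m z) * abs (phi (\<Phi> z) - phi (snd z)) + abs (m z - m (0, snd z)) * abs (phi (snd z))"
   by (simp only: abs_mult[symmetric] abs_triangle_ineq)
  ultimately show ?thesis by (simp add: algebra_simps)
 qed
 thus ?thesis by (rule that)
qed

lemma H10_grad_initial_test:
 assumes m: "lipschitz_fun m L" and phi: "test_fun S phi"
 obtains N where "H10_grad Om0 (%y. m (0, y) * phi y) N"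
 using that[OF H10_grad_lipschitz_mult[OF domain_0 lipschitz_slice[OF m] H10_grad_test_fun[OF domain_0 test_fun_mono[OF phi S_subset(1)]]]] .

lemma pairing_transport_tendsto_iff:
 assumes w: "L2_on Q w" "!!k. L2_on Q (q k)" "c.weak_time_eq w q" and m: "lipschitz_fun m L" and phi: "test_fun S phi"
 shows "((%t. ip Om0 (sect w t) (%y. m (t, y) * phi (\<Phi> (t, y)))) ---> l) ess_at_0 <->
  ((%t. ip Om0 (sect w t) (%y. m (0, y) * phi y)) ---> l) ess_at_0"
proof -
 obtain N where N: "H10_grad Om0 (%y. m (0, y) * phi y) N" by (rule H10_grad_initial_test[OF m phi])
 note const_L2 = L2_on_C1(1)[OF C1_const domain_0(2) c.lebesgue_S]
 obtain C where C: "!!t k. t : {0<..<d} ==> AE y in leb Om0. abs (transported_jet m phi t k y) <= C"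
  using transported_jet_le[OF m phi] by blast
 have jet_int: "sqnorm Om0 (transported_jet m phi t k) <= int_on Om0 (%_. C^2)"
  if t: "t : {0<..<d}" for t k
 proof (rule integral_mono_AE[OF L2_square_integrable[OF H1_grad_weak_jet] L2_square_integrable[OF const_L2]])
  show "H1_grad Om0 (transported m phi t) (transported_grad m phi t)"
   by (rule H10_grad_H1[OF H10_grad_transported[OF m phi t]])
  show "AE y in leb Om0. (transported_jet m phi t k y)^2 <= C^2"
   using C[OF t, of k] by eventually_elim (auto intro: abs_le_square_iff[THEN iffD1])
 qed (rule domain_0)
 have n: "eventually (%t. H10_grad Om0 (transported m phi t) (transported_grad m phi t) &
   (ALL k. sqnorm Om0 (transported_jet m phi t k) <= int_on Om0 (%_. C^2))) ess_at_0"
  by (rule eventually_ess_at_0_if_AE[OF d(1)])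
   (use r.AE_in_ivl in eventually_elim, intro conjI allI H10_grad_transported[OF m phi] jet_int)
 obtain c where c: "!!z. z : Q ==> abs (m z * phi (\<Phi> z) - m (0, snd z) * phi (snd z)) <= c * fst z"
  using transport_displacementE[OF m phi] by blast
 have "AE t in leb {0<..<d}. norm (sqnorm Om0 (%y. m (t, y) * phi (\<Phi> (t, y)) - m (0, y) * phi y)) <=
   (c * t)^2 * int_on Om0 (%_. 1)" using r.AE_in_ivl
 proof eventually_elim
  case (elim t)
  note L2 = L2_diff[OF H1_gradD(1)[OF domain_0(1) H10_grad_H1[OF H10_grad_transported[OF m phi elim]]]
   H1_gradD(1)[OF domain_0(1) H10_grad_H1[OF N]]]
  have "(m (t, y) * phi (\<Phi> (t, y)) - m (0, y) * phi y)^2 <= (c * t)^2" if "y : Om0" for y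
   using c[of "(t, y)"] that elim d(2) by (intro abs_le_square_iff[THEN iffD1]) (auto simp: tdomain_def)
  hence "sqnorm Om0 (%y. m (t, y) * phi (\<Phi> (t, y)) - m (0, y) * phi y) <= int_on Om0 (%_. (c * t)^2)"
   by (intro integral_mono L2_square_integrable[OF L2] L2_square_integrable[OF const_L2]) auto
  thus ?case by (simp add: mult.commute)
 qed
 note bound = eventually_ess_at_0_if_AE[OF d(1) this]
 have "((%t. (c * t)^2 * int_on Om0 (%_. 1)) ---> 0) ess_at_0"
  by (rule tendsto_ess_at_0[OF d(1)]) (auto intro!: tendsto_eq_intros)
 from c.pairing_tendsto_iff[OF w n N Lim_null_comparison[OF bound this]] show ?thesis .
qed

lemma int_on_J_ext_at_0: "ip Om0 w (%y. J_ext (0, y) * phi y) = ip Om0 w phi"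
 by (intro integral_cong) (simp_all add: J_ext_at_0)

lemma position_pairing_iff:
 assumes v: "c.energy v v_t v_g" "!!z. z : Q ==> v z = u (F z)" and u: "L2_on CY u" and phi: "test_fun S phi"
 shows "((%t. ip Om0 (sect u t) phi) ---> l) ess_at_0 <-> ((%t. ip Om0 (sect v t) phi) ---> l) ess_at_0"
proof -
 have flux: "L2_on Q (c.scalar_flux v_t k)" for k using c.energyD[OF v(1)] by (cases k) simp_all
 obtain L where L: "lipschitz_fun J_ext L" using J_ext(1) by blast
 have "AE t in leb {0<..<d}. ip Om0 (sect u t) phi =
   ip Om0 (sect v t) (%y. J_ext (t, y) * phi (\<Phi> (t, y)))" using pairing_transport[OF u phi] r.AE_in_ivl
 proof eventually_elim
  case (elim t)
  have "v (t, y) = u (F (t, y))" if "y : Om0" for y using that elim(2) d(2) by (intro v(2)) (auto simp: tdomain_def)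
  hence "ip Om0 (sect v t) (%y. J_ext (t, y) * phi (\<Phi> (t, y))) =
    ip Om0 (%y. u (F (t, y))) (%y. J_ext (t, y) * phi (\<Phi> (t, y)))" by (intro integral_cong) auto
  thus ?case using elim(1) int_on_test_fun_superset[OF phi r.lebesgue_S c.lebesgue_S S_subset(1)] by simp
 qed
 note tendsto_cong[OF eventually_ess_at_0_if_AE[OF d(1) this]]
 thus ?thesis using pairing_transport_tendsto_iff[OF c.energyD(1)[OF v(1)] flux c.energy_weak_time_eq[OF v(1)] L phi]
  by (simp add: int_on_J_ext_at_0)
qed

lemma velocity_u_weak_time_eq:
 assumes u: "u.energy u u_t u_g" and f: "L2_on CY f" and eq: "ALL eta. admissible T \<Omega> eta --> weak_eq_u f u eta"
 shows "r.weak_time_eq u_t (flux_u f u_g)" unfolding r.weak_time_eq_def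
proof (intro allI impI)
 fix psi assume psi: "test_fun r.cyl psi"
 note psi_CY = test_fun_mono[OF psi region_subset_CY]
 obtain K where K: "K <= r.cyl" "!!z. z ~: K ==> psi z = 0" "!!z e. z ~: K ==> pd psi e z = 0"
  by (rule test_fun_supportE[OF psi]) blast
 let ?h = "%z. - (u_t z * pd psi (1, 0) z) + u_g z <.> (\<chi> i. pd psi (0, axis i 1) z) - f z * psi z"
 have "?h z = 0" if "z ~: K" for z by (simp add: inner_vec_def K(2,3)[OF that])
 hence "int_on r.cyl ?h = int_on CY ?h"
  using K(1) region_subset_CY by (intro int_on_superset u.cyl_lebesgue r.cyl_lebesgue) blast+
 also have "... = 0"
  using weak_eq_u_iff_integral[OF u u.energy_test_fun[OF psi_CY] f] eq u.admissible_test_fun[OF psi_CY] by blast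
 also have "?h = (%z. - (u_t z * pd psi (1, 0) z + (SUM k:UNIV. flux_u f u_g k z * space_jet psi k z)))"
  by (simp add: sum_option flux_u_def inner_vec_def sum_negf algebra_simps)
 finally have zero: "int_on r.cyl (%z. - (u_t z * pd psi (1, 0) z + (SUM k:UNIV. flux_u f u_g k z * space_jet psi k z))) = 0" .
 note restrict = L2_on_subset[OF u.cyl_lebesgue r.cyl_lebesgue region_subset_CY]
 have "L1_on r.cyl (%z. u_t z * pd psi (1, 0) z)" "L1_on r.cyl (%z. flux_u f u_g k z * space_jet psi k z)" for k
  by (intro L2_mult restrict u.energyD[OF u] L2_on_flux_u[OF u f] pd_test_fun_L2_on[OF psi]
   Cc_L2_on[OF space_jet_Cc[OF psi]] r.cyl_lebesgue)+
 with zero show "ip r.cyl u_t (pd psi (1, 0)) = - (SUM k:UNIV. ip r.cyl (flux_u f u_g k) (space_jet psi k))" by simp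
qed

lemma velocity_transport:
 assumes v: "c.energy v v_t v_g" and ae: "AE z in leb CY. u_t z = push_dt v_t v_g z" and phi: "test_fun S phi"
 shows "AE t in leb {0<..<d}. ip S (sect u_t t) phi =
  ip Om0 (sect v_t t) (%y. J_ext (t, y) * phi (\<Phi> (t, y))) -
  (SUM i:UNIV. ip Om0 (%y. v_g (t, y) $ i) (%y. Jb_ext i (t, y) * phi (\<Phi> (t, y))))"
proof -
 obtain L L' where L: "lipschitz_fun J_ext L" "!!i. lipschitz_fun (Jb_ext i) (L' i)" using J_ext(1) Jb_ext(1) by metis
 have "AE z in leb r.cyl. u_t z = push_dt v_t v_g z"
  using ae region_subset_CY by (auto simp: AE_on_iff u.cyl_lebesgue r.cyl_lebesgue elim!: eventually_mono)
 note slices = r.AE_slice[OF this]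
 have grad: "AE t in leb {0<..<T}. ALL i. L2_on Om0 (%y. v_g (t, y) $ i)"
  unfolding AE_all_countable using c.L2_on_slices(1)[OF c.energyD(3)[OF v]] by blast
 have "AE t in leb {0<..<d}. L2_on Om0 (sect v_t t) & (ALL i. L2_on Om0 (%y. v_g (t, y) $ i))"
  using c.L2_on_slices(1)[OF c.energyD(2)[OF v]] grad unfolding c.AE_ivl_iff r.AE_ivl_iff by eventually_elim (use d(2) in auto)
 with slices pairing_transport[OF u.energyD(2)[OF push_energy[OF v]] phi] r.AE_in_ivl show ?thesis
 proof eventually_elim
  case (elim t)
  note transported_L2 = H1_gradD(1)[OF domain_0(1) H10_grad_H1[OF H10_grad_transported[OF _ phi elim(3)]]]
  have "ip S (sect u_t t) phi = ip S (%x. push_dt v_t v_g (t, x)) phi"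
   by (rule int_on_cong_AE[OF r.lebesgue_S]) (use elim(1) in eventually_elim, simp)
  also have "... = ip Om0 (%y. push_dt v_t v_g (F (t, y))) (%y. J_ext (t, y) * phi (\<Phi> (t, y)))" by (rule elim(2))
  also have "... = int_on Om0 (%y. v_t (t, y) * (J_ext (t, y) * phi (\<Phi> (t, y))) -
    (SUM i:UNIV. v_g (t, y) $ i * (Jb_ext i (t, y) * phi (\<Phi> (t, y)))))"
  proof (intro integral_cong refl)
   fix y assume "y : space (leb Om0)"
   hence "(t, y) : Q" using elim(3) d(2) by (simp add: tdomain_def)
   note J_b = push_at_F(1)[OF this] J_ext_eq[OF this] Jb_ext_eq[OF this]
   show "push_dt v_t v_g (F (t, y)) * (J_ext (t, y) * phi (\<Phi> (t, y))) = v_t (t, y) * (J_ext (t, y) * phi (\<Phi> (t, y))) -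
     (SUM i:UNIV. v_g (t, y) $ i * (Jb_ext i (t, y) * phi (\<Phi> (t, y))))"
    unfolding J_b left_diff_distrib by (simp add: inner_vec_def sum_distrib_left mult_ac)
  qed
  also have "... = ip Om0 (sect v_t t) (%y. J_ext (t, y) * phi (\<Phi> (t, y))) -
    (SUM i:UNIV. ip Om0 (%y. v_g (t, y) $ i) (%y. Jb_ext i (t, y) * phi (\<Phi> (t, y))))"
   using L2_mult[OF conjunct1[OF elim(4)] transported_L2[OF L(1)]] L2_mult[OF spec[OF conjunct2[OF elim(4)]] transported_L2[OF L(2)]]
   by simp
  finally show ?case .
 qed
qed

lemma velocity_pairing_iff:
 assumes v: "c.energy v v_t v_g" and f: "L2_on CY f" and eq: "c.weak_time_eq v_t (flux_v f v_t v_g)"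
  and cont: "L2_cont T Om0 v u0" and u0: "H10_grad Om0 u0 G0"
  and ae: "AE z in leb CY. u_t z = push_dt v_t v_g z" and phi: "test_fun S phi"
 shows "((%t. ip S (sect u_t t) phi) ---> l) ess_at_0 <-> ((%t. ip Om0 (sect v_t t) phi) --->
   l + (SUM i:UNIV. ip Om0 (%y. G0 y $ i) (%y. Jb_ext i (0, y) * phi y))) ess_at_0"
proof -
 obtain L L' where L: "lipschitz_fun J_ext L" "!!i. lipschitz_fun (Jb_ext i) (L' i)" using J_ext(1) Jb_ext(1) by metis
 let ?V = "%t. ip Om0 (sect v_t t) (%y. J_ext (t, y) * phi (\<Phi> (t, y)))"
  and ?G = "%t. SUM i:UNIV. ip Om0 (%y. v_g (t, y) $ i) (%y. Jb_ext i (t, y) * phi (\<Phi> (t, y)))"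
  and ?G_lim = "SUM i:UNIV. ip Om0 (%y. G0 y $ i) (%y. Jb_ext i (0, y) * phi y)"
 have V: "((%t. ip Om0 (sect v_t t) phi) ---> l + ?G_lim) ess_at_0 <-> (?V ---> l + ?G_lim) ess_at_0"
  using pairing_transport_tendsto_iff[OF c.energyD(2)[OF v] L2_on_flux_v[OF v f] eq L(1) phi] by (simp add: int_on_J_ext_at_0)
 have "((%t. ip Om0 (%y. v_g (t, y) $ i) (%y. Jb_ext i (t, y) * phi (\<Phi> (t, y)))) --->
   ip Om0 (%y. G0 y $ i) (%y. Jb_ext i (0, y) * phi y)) ess_at_0" for i
 proof -
  obtain N where N: "H10_grad Om0 (%y. Jb_ext i (0, y) * phi y) N" by (rule H10_grad_initial_test[OF L(2) phi])
  have "L2_on Q (if k = Some i then %z. - v_t z else (%_. 0))" for k using L2_minus[OF c.energyD(2)[OF v]] by simp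
  hence "L2_on Q (%z. if k = Some i then - v_t z else 0)" for k by (cases "k = Some i") (simp_all add: if_distrib)
  from pairing_transport_tendsto_iff[OF c.energyD(3)[OF v] this c.gradient_weak_time_eq[OF v] L(2) phi]
   c.gradient_pairing_tendsto[OF v cont u0 H10_grad_H1[OF N]]
  show ?thesis by simp
 qed
 hence G: "(?G ---> ?G_lim) ess_at_0" by (rule tendsto_sum)
 have "((%t. ip S (sect u_t t) phi) ---> l) ess_at_0 <-> ((%t. ?V t - ?G t) ---> l) ess_at_0"
  by (rule tendsto_cong[OF eventually_ess_at_0_if_AE[OF d(1) velocity_transport[OF v ae phi]]])
 also have "... <-> (?V ---> l + ?G_lim) ess_at_0"
  using tendsto_add[OF _ G, of "%t. ?V t - ?G t" l] tendsto_diff[OF _ G, of ?V "l + ?G_lim"] by auto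
 finally show ?thesis unfolding V .
qed

lemma initial_velocity_iff_tendsto:
 assumes u: "u.energy u u_t u_g" and v: "c.energy v v_t v_g" and f: "L2_on CY f"
  and eq: "ALL eta. admissible T \<Omega> eta --> weak_eq_u f u eta" "c.weak_time_eq v_t (flux_v f v_t v_g)"
  and cont: "L2_cont T Om0 v u0" and u0: "H10_grad Om0 u0 G0"
  and ae: "AE z in leb CY. u_t z = push_dt v_t v_g z"
 shows "Hm1_cont d S u_t u1 <-> (ALL phi. test_fun S phi -->
  ((%t. ip Om0 (sect v_t t) phi) ---> ip Om0 u1 phi +
   (SUM i:UNIV. ip Om0 (%y. G0 y $ i) (%y. Jb_ext i (0, y) * phi y))) ess_at_0)"
proof -
 note restrict = L2_on_subset[OF u.cyl_lebesgue r.cyl_lebesgue region_subset_CY]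
 note r.Hm1_cont_iff_pairing_tendsto[OF restrict[OF u.energyD(2)[OF u]] restrict[OF L2_on_flux_u[OF u f]]
  velocity_u_weak_time_eq[OF u f eq(1)]]
 thus ?thesis
  using velocity_pairing_iff[OF v f eq(2) cont u0 ae] int_on_test_fun_superset[OF _ r.lebesgue_S c.lebesgue_S S_subset(1)] by simp
qed

end

lemma Hm1_cont_empty: "Hm1_cont d {} w w1" unfolding Hm1_cont_def
 by (intro exI[of _ "%_ _. 0"]) (auto simp: l2ip_def H1norm_nonneg intro!: exI[of _ 1])

context flow
begin

lemma fixed_region:
 assumes "0 < d" "open S" "S <= Om0" "S ~= {}" and subset: "{0..d} \<times> S <= tdomain_cl T \<Omega>"
 shows "fixed_region T \<Omega> \<Phi> \<Psi> d S"
proof (intro fixed_region.intro flow_axioms fixed_region_axioms.intro assms)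
 obtain x where "x : S" using assms(4) by blast
 hence "(d, x) : tdomain_cl T \<Omega>" using assms(1) subset by force
 thus "d <= T" by (simp add: tdomain_cl_def)
 fix t assume t: "t : {0<..<d}"
 show "S <= \<Omega> t"
 proof
  fix x assume "x : S"
  with t have "(t, x) : {0..d} \<times> S" by simp
  with subset have "(t, x) : tdomain_cl T \<Omega>" by (rule subsetD)
  thus "x : \<Omega> t" by (simp add: tdomain_cl_def)
 qed
qed

lemma test_fun_in_fixed_regionE:
 assumes "test_fun Om0 phi"
 obtains d S where "0 < d" "open S" "S <= Om0" "{0..d} \<times> S <= tdomain_cl T \<Omega>"
   "fixed_region T \<Omega> \<Phi> \<Psi> d S" "test_fun S phi"
proof -
 obtain K where K: "compact K" "K <= Om0" "!!x. x ~: K ==> phi x = 0" by (rule test_fun_supportE[OF assms]) blast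
 obtain x0 where x0: "x0 : Om0" using dom T_pos by fastforce
 obtain d S where S: "0 < d" "d <= T" "open S" "insert x0 K <= S" "S <= Om0" "{0..d} \<times> S <= tdomain_cl T \<Omega>"
  using stays_in_domain[of "insert x0 K"] K x0 by (metis compact_insert insert_subset)
 have "test_fun S phi" by (rule test_funI[OF test_fun_C1[OF assms] K(1)]) (use K(3) S(4) in auto)
 thus ?thesis using S by (intro that fixed_region) auto
qed

lemma L2_cont_iff:
 assumes v: "c.energy v v_t v_g" "!!z. z : Q ==> v z = u (F z)" and zero: "!!z. z ~: E ==> u z = 0" and w0: "L2_on Om0 w0"
 shows "L2_cont T Om0 u w0 <-> L2_cont T Om0 v w0"
proof -
 have u: "u.energy u (push_dt v_t v_g) (push_grad v_g)" by (rule push_energy_cong[OF v])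
 note c.L2_cont_iff_pairing_tendsto[OF position_weak_time_eq[OF u zero] w0]
 moreover have "((%t. ip Om0 (sect u t) phi) ---> l) ess_at_0 <->
   ((%t. ip Om0 (sect v t) phi) ---> l) ess_at_0" if "test_fun Om0 phi" for phi l
  by (rule test_fun_in_fixed_regionE[OF that]) (rule fixed_region.position_pairing_iff[OF _ v u.energyD(1)[OF u]])
 ultimately show ?thesis
  using c.L2_cont_iff_pairing_tendsto[OF c.energyD(1,2)[OF v(1)] c.energy_weak_time_eq[OF v(1)] w0] by simp
qed

lemma int_initial_velocity:
 assumes u1: "L2_on Om0 u1" and G0: "!!i. L2_on Om0 (%y. G0 y $ i)" and phi: "test_fun Om0 phi"
 shows "ip Om0 (%y. u1 y + tdot D \<Phi> (0, y) <.> G0 y) phi = ip Om0 u1 phi +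
  (SUM i:UNIV. ip Om0 (%y. G0 y $ i) (%y. Jb_ext i (0, y) * phi y))"
proof -
 note phi_L2 = test_fun_L2_on[OF phi c.lebesgue_S]
 have "L2_on Om0 (%y. Jb_ext i (0, y) * phi y)" for i
 proof -
  obtain L where "lipschitz_fun (Jb_ext i) L" using Jb_ext(1) by blast
  from lipschitz_fun.L2_on_mult(1)[OF lipschitz_slice[OF this] c.lebesgue_S domain_0(2) phi_L2] show ?thesis .
 qed
 note L1 = L2_mult[OF u1 phi_L2] L2_mult[OF G0 this]
 have "ip Om0 (%y. u1 y + tdot D \<Phi> (0, y) <.> G0 y) phi =
   int_on Om0 (%y. u1 y * phi y + (SUM i:UNIV. G0 y $ i * (Jb_ext i (0, y) * phi y)))"
  by (intro integral_cong) (simp_all add: Jb_ext_at_0 inner_vec_def sum_distrib_left algebra_simps)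
 thus ?thesis using L1 by simp
qed

lemma initial_velocity_iff:
 assumes v: "c.energy v v_t v_g" "!!z. z : Q ==> v z = u (F z)" and f: "L2_on CY f"
  and eq: "ALL xi. admissible T (%_. Om0) xi --> weak_eq_v f v xi"
  and cont: "L2_cont T Om0 v u0" and u0: "H10 Om0 u0" and u1: "L2 Om0 u1"
 shows "(ALL d \<Omega>'. d > 0 --> open \<Omega>' --> \<Omega>' <= Om0 --> {0..d} \<times> \<Omega>' <= tdomain_cl T \<Omega> -->
   Hm1_cont d \<Omega>' (tderiv T \<Omega> u) u1) <->
  Hm1_cont T Om0 (tderiv T (%_. Om0) v) (%y. u1 y + tdot D \<Phi> (0, y) <.> wgrad Om0 u0 y)"
  (is "?local <-> _")
proof -
 let ?v_t = "tderiv T (%_. Om0) v" and ?u_t = "tderiv T \<Omega> u" and ?G0 = "wgrad Om0 u0"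
 have v_tderiv: "c.energy v ?v_t v_g"
  using c.tderiv_energy(2)[OF v(1)] by (intro c.energy_cong_AE[OF v(1)]) (auto elim: eventually_mono)
 have u: "u.energy u (push_dt ?v_t v_g) (push_grad v_g)" by (rule push_energy_cong[OF v_tderiv v(2)])
 note eq_v = velocity_v_weak_time_eq[OF v_tderiv f eq] and u_t = u.tderiv_energy(2)[OF u]
 have u_tderiv: "u.energy u ?u_t (push_grad v_g)" using u_t by (intro u.energy_cong_AE[OF u]) (auto elim: eventually_mono)
 obtain G where "is_wgrad Om0 u0 G" using u0 by (auto simp: H10_def H1_def)
 note G0 = H10_iff(2)[OF domain_0 u0 is_wgrad_wgrad[OF this]]
 note v_iff = c.Hm1_cont_iff_pairing_tendsto[OF c.energyD(2)[OF v_tderiv] L2_on_flux_v[OF v_tderiv f] eq_v]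
 have eq_u: "ALL eta. admissible T \<Omega> eta --> weak_eq_u f u eta" using weak_equations_iff[OF v f] eq by blast
 note u_iff = fixed_region.initial_velocity_iff_tendsto[OF _ u_tderiv v_tderiv f eq_u eq_v cont G0 u_t]
 note v1 = int_initial_velocity[OF u1[unfolded L2_iff[OF c.lebesgue_S]] H1_gradD(2)[OF domain_0(1) H10_grad_H1[OF G0]]]
 show ?thesis
 proof
  assume local: ?local
  show "Hm1_cont T Om0 ?v_t (%y. u1 y + tdot D \<Phi> (0, y) <.> ?G0 y)" unfolding v_iff
  proof (intro allI impI)
   fix phi assume phi: "test_fun Om0 phi"
   obtain d S where "0 < d" "open S" "S <= Om0" "{0..d} \<times> S <= tdomain_cl T \<Omega>"
   "fixed_region T \<Omega> \<Phi> \<Psi> d S" "test_fun S phi"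
    by (rule test_fun_in_fixed_regionE[OF phi])
   with local u_iff show "((%t. ip Om0 (sect ?v_t t) phi) --->
     ip Om0 (%y. u1 y + tdot D \<Phi> (0, y) <.> ?G0 y) phi) ess_at_0" unfolding v1[OF phi] by blast
  qed
 next
  assume Hm1: "Hm1_cont T Om0 ?v_t (%y. u1 y + tdot D \<Phi> (0, y) <.> ?G0 y)"
  show ?local
  proof (intro allI impI)
   fix d S assume S: "d > 0" "open S" "S <= Om0" "{0..d} \<times> S <= tdomain_cl T \<Omega>"
   show "Hm1_cont d S ?u_t u1"
   proof (cases "S = {}")
    case True
    thus ?thesis by (simp add: Hm1_cont_empty)
   next
    case False
    show ?thesis unfolding u_iff[OF fixed_region[OF S(1-3) False S(4)]]
    proof (intro allI impI)
     fix phi assume "test_fun S phi"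
     note phi = test_fun_mono[OF this S(3)]
     show "((%t. ip Om0 (sect ?v_t t) phi) ---> ip Om0 u1 phi +
       (SUM i:UNIV. ip Om0 (%y. ?G0 y $ i) (%y. Jb_ext i (0, y) * phi y))) ess_at_0"
      using Hm1 phi unfolding v_iff v1[OF phi, symmetric] by blast
    qed
   qed
  qed
 qed
qed

end

theorem theorem2p9:
  fixes T :: real and \<Omega> :: "real \<Rightarrow> (real^'n) set"
    and f u :: "real \<times> (real^'n) \<Rightarrow> real" and u0 u1 :: "real^'n \<Rightarrow> real"
    and \<Phi> \<Psi> :: "real \<times> (real^'n) \<Rightarrow> real^'n"
  assumes T_pos: "T > 0"
    and dom: "\<forall>t\<in>{0..T}. \<Omega> t \<noteq> {} \<and> open (\<Omega> t) \<and> bounded (\<Omega> t) \<and> lipschitz_boundary (\<Omega> t)"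
    and f_L2: "L2 (tdomain T \<Omega>) f"
    and u0_H10: "H10 (\<Omega> 0) u0"
    and u1_L2: "L2 (\<Omega> 0) u1"
    and Phi_C11: "C11_on (domPhi T \<Omega>) \<Phi>"
    and Psi_C11: "C11_on (domPsi T \<Omega>) \<Psi>"
    and Phi_into: "\<forall>t\<in>{0..T}. (\<lambda>y. \<Phi> (t, y)) ` \<Omega> 0 = \<Omega> t"
    and Psi_into: "\<forall>t\<in>{0..T}. (\<lambda>x. \<Psi> (t, x)) ` \<Omega> t = \<Omega> 0"
    and Psi_range: "\<forall>z\<in>domPsi T \<Omega>. \<Psi> z \<in> closure (\<Omega> 0)"
    and Phi_Psi: "\<forall>z\<in>domPsi T \<Omega>. \<Phi> (fst z, \<Psi> z) = snd z"
    and Psi_Phi: "\<forall>z\<in>domPhi T \<Omega>. \<Psi> (fst z, \<Phi> z) = snd z"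
    and Phi_0: "\<forall>y\<in>closure (\<Omega> 0). \<Phi> (0, y) = y"
    and u_ext: "\<forall>z. z \<notin> domPsi T \<Omega> \<longrightarrow> u z = 0"
  shows "wsol_u T \<Omega> f u0 u1 u \<longleftrightarrow>
    wsol_v T (\<Omega> 0) (coefB T \<Omega> \<Phi> \<Psi>) (coefa T \<Omega> \<Phi> \<Psi>) (coefb T \<Omega> \<Phi> \<Psi>)
      (\<lambda>z. f (fst z, \<Phi> z)) u0
      (\<lambda>y. u1 y + tdot (domPhi T \<Omega>) \<Phi> (0, y) \<bullet> wgrad (\<Omega> 0) u0 y)
      (\<lambda>z. if z \<in> domPhi T \<Omega> then u (fst z, \<Phi> z) else 0)"
proof -
  interpret flow T \<Omega> \<Phi> \<Psi>
    by (rule flow.intro[OF T_pos dom Phi_C11 Psi_C11 Phi_into Psi_into Psi_range Phi_Psi Psi_Phi Phi_0])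
  let ?v = "%z. if z : domPhi T \<Omega> then u (fst z, \<Phi> z) else 0"
  have pull: "?v z = u (F z)" if "z : Q" for z using that Q_subset_D by auto
  have f: "L2_on CY f" using f_L2 by (simp only: L2_iff[OF u.cyl_lebesgue])
  have u0: "L2_on (\<Omega> 0) u0" using u0_H10 by (simp add: H10_def H1_def L2_iff[OF c.lebesgue_S])
  have energy_u: "L2_H10 T \<Omega> u & (EX w. is_tderiv T \<Omega> u w) <-> (EX v_t v_g. c.energy ?v v_t v_g)"
    unfolding u.L2_H10_tderiv_iff by (rule energy_iff) (rule pull)
  have iff: "(L2_cont T (\<Omega> 0) u u0 <-> L2_cont T (\<Omega> 0) ?v u0) &
      ((ALL eta. admissible T \<Omega> eta --> weak_eq_u f u eta) <-> (ALL xi. admissible T (%_. \<Omega> 0) xi --> weak_eq_v f ?v xi))"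
    if "c.energy ?v v_t v_g" for v_t v_g
    using L2_cont_iff[OF that pull _ u0] weak_equations_iff[OF that pull f] u_ext by blast
  have velocity: "(ALL \<delta> \<Omega>'. \<delta> > 0 --> open \<Omega>' --> \<Omega>' <= \<Omega> 0 --> {0..\<delta>} \<times> \<Omega>' <= tdomain_cl T \<Omega> -->
      Hm1_cont \<delta> \<Omega>' (tderiv T \<Omega> u) u1) <->
      Hm1_cont T (\<Omega> 0) (tderiv T (%_. \<Omega> 0) ?v) (%y. u1 y + tdot D \<Phi> (0, y) \<bullet> wgrad (\<Omega> 0) u0 y)"
    if "c.energy ?v v_t v_g" "ALL xi. admissible T (%_. \<Omega> 0) xi --> weak_eq_v f ?v xi" "L2_cont T (\<Omega> 0) ?v u0" for v_t v_g
    by (rule initial_velocity_iff[OF that(1) pull f that(2,3) u0_H10 u1_L2])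
  show ?thesis
    unfolding wsol_u_def wsol_v_def weak_eq_u_def[symmetric] weak_eq_v_def[symmetric]
    using energy_u c.L2_H10_tderiv_iff[of ?v] iff velocity by meson
qed

end
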